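(* Let $p\in[2,\infty)$ and $p'=p/(p-1)$. If $u\in W^{1,p,p'}_\alpha(J,V,V')$, then $\sqrt\alpha\,u\in C(\overline J,L^2(\Omega))$ (after modification on a null set of times). In addition, there exists a constant $\widetilde C_{\mathrm{emb},p}>0$ such that $$\|\sqrt\alpha\,u\|_{C(\overline J,L^2(\Omega))}\le\widetilde C_{\mathrm{emb},p}\,\|u\|_{W^{1,p,p'}_\alpha(J,V,V')}\qquad\text{for any }u\in W^{1,p,p'}_\alpha(J,V,V').$$ Moreover, for any $u,z\in W^{1,p,p'}_\alpha(J,V,V')$ and any $t_1,t_2\in\overline J$, the following integration by parts formula holds: $$\int_{t_1}^{t_2}\Big(\langle(\alpha\partial_t u)(t),z(t)\rangle+\langle(\alpha\partial_t z)(t),u(t)\rangle\Big)\,dt=\big((\sqrt\alpha u)(t_2),(\sqrt\alpha z)(t_2)\big)-\big((\sqrt\alpha u)(t_1),(\sqrt\alpha z)(t_1)\big)-\int_{t_1}^{t_2}\int_\Omega\big(uz\,\partial_t\alpha+\nabla\cdot(\alpha uz v)\big)\,dx\,dt,$$ where $(\cdot,\cdot)$ is the inner product of $L^2(\Omega)$.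
   Context: Geometric setting. $\Omega\subset\mathbb R^d$, $d\in\{1,2,3\}$, is a fixed open bounded domain with Lipschitz boundary $\partial\Omega$; $J=(0,T)$ with $0<T<\infty$. For every $t\in\overline J$, $\Omega=\Omega_1(t)\cup\Omega_2(t)\cup\Gamma(t)$, where $\Omega_1(t),\Omega_2(t)$ are nonempty disjoint open Lipschitz subdomains and $\Gamma(t)=\partial\Omega_1(t)\cap\partial\Omega_2(t)$. Put $Q=\Omega\times J$, $Q_1=\{(x,t)\in Q: x\in\Omega_1(t),\ t\in J\}$, $Q_2=Q\setminus\overline{Q_1}$. There is a sufficiently smooth map $\Phi:\overline\Omega\times\overline J\to\overline\Omega$ with $\Phi(\cdot,0)=\mathrm{Id}$ such that, for all $t\in J$, $\Phi(\cdot,t)$ is a diffeomorphism mapping $\overline{\Omega_i(0)}$ onto $\overline{\Omega_i(t)}$, $i=1,2$. The velocity is $v(x,t)=\dot\Phi\big([\Phi(\cdot,t)]^{-1}(x),t\big)$, where $\dot\Phi$ is the time derivative of $\Phi$, and it is assumed that $v\in C^1(\overline Q)^d$. Coefficient. $\alpha\ge 0$ satisfies $\alpha\in C^1(\overline{Q_1})\cap C^1(\overline{Q_2})$ (it may jump across $\Gamma(t)$). For all $t\in\overline J$, $\Sigma(t):=\operatorname{supp}(\alpha(\cdot,t))\setminus(\Gamma(t)\cup\partial\Omega)$ is nonempty, and $\alpha(x,t)\ge\alpha_0>0$ for all $x\in\Sigma(t)$ and $t\in\overline J$; thus $\Sigma(t)$ is $\Omega_1(t)$, $\Omega_2(t)$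 or $\Omega_1(t)\cup\Omega_2(t)$. The functions $\partial_t\alpha$ and $\nabla\alpha$ are understood piecewise, i.e. as the classical derivatives on $Q_1$ and $Q_2$ (elements of $L^\infty(Q)$ and $L^\infty(Q)^d$). Likewise $\nabla\cdot(\alpha u w v)$ is understood piecewise on $\Omega_1(t)$ and $\Omega_2(t)$ (no interface contribution), so it equals $uw\,v\cdot\nabla\alpha+\alpha w\,v\cdot\nabla u+\alpha u\,v\cdot\nabla w+\alpha uw\,\nabla\cdot v$ a.e. Function spaces (real-valued). $V$ is a Hilbert space continuously embedded in $H^1(\Omega)$ and such that the embedding $V\hookrightarrow L^2(\Omega)$ is dense; $V'$ is its dual, $\langle\cdot,\cdot\rangle$ the duality pairing, and $V\hookrightarrow L^2(\Omega)\hookrightarrow V'$ is a Gelfand triple. $\mathcal D(J)$ is the set of infinitely differentiable functions with compact support in $J$. For $u\in L^1(J,V)$, the distribution $\alpha\partial_t u\in\mathcal L(\mathcal D(J),V')$ is defined by $$\langle(\alpha\partial_t u)(\phi),w\rangle=-\int_0^T\int_\Omega\big(\alpha u w\,\partial_t\phi+u\phi w\,\partial_t\alpha+\phi\,\nabla\cdot(\alpha u w v)\big)\,dx\,dt,\qquad \phi\in\mathcal D(J),\ w\in V.$$ One writes $\alpha\partial_t u\in L^{q}(J,V')$ if there is $g\in L^q(J,V')$ with $\langle(\alpha\partial_t u)(\phi),w\rangle=\int_0^T\phi(t)\langle g(t),w\rangle\,dt$ for all $\phi\in\mathcal D(J)$, $w\in V$, and then $(\alpha\partial_t u)(t):=g(t)$.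 For $p\in(1,\infty)$ and $p'=p/(p-1)$, $$W^{1,p,p'}_\alpha(J,V,V')=\{u\in L^p(J,V):\alpha\partial_t u\in L^{p'}(J,V')\},$$ with norm $\|u\|_{W^{1,p,p'}_\alpha(J,V,V')}=\|u\|_{L^p(J,V)}+\|\alpha\partial_t u\|_{L^{p'}(J,V')}$. *)

theory Defs
  imports "HOL-Analysis.Analysis"
begin

section \<open>Spaces of smooth functions\<close>

text \<open>\<open>C\<^sup>1\<close> up to the boundary of an open set \<open>U\<close>: \<open>f\<close> is continuous on the closure, differentiable
  in \<open>U\<close>, and its derivative extends continuously to the closure.\<close>

definition C1_bar :: "'a::euclidean_space set \<Rightarrow> ('a \<Rightarrow> 'b::real_normed_vector) set" where
  "C1_bar U = {f. continuous_on (closure U) f \<and>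
     (\<exists>f' :: 'a \<Rightarrow> 'a \<Rightarrow>\<^sub>L 'b. continuous_on (closure U) f' \<and>
        (\<forall>x\<in>U. (f has_derivative blinfun_apply (f' x)) (at x)))}"

definition C1_bar_diffeomorphism ::
    "'a::euclidean_space set \<Rightarrow> 'b::euclidean_space set \<Rightarrow> ('a \<Rightarrow> 'b) \<Rightarrow> bool" where
  "C1_bar_diffeomorphism U V f \<longleftrightarrow>
     bij_betw f (closure U) (closure V) \<and> f \<in> C1_bar U \<and> inv_into (closure U) f \<in> C1_bar V"

primrec Ck :: "nat \<Rightarrow> ('a::euclidean_space \<Rightarrow> real) \<Rightarrow> bool" where
  "Ck 0 f \<longleftrightarrow> continuous_on UNIV f"
| "Ck (Suc k) f \<longleftrightarrow> (\<forall>x. f differentiable at x) \<and>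
     (\<forall>b\<in>Basis. Ck k (\<lambda>x. frechet_derivative f (at x) b))"

text \<open>\<open>\<D>(U)\<close>; its elements are extended by zero to the whole space.\<close>

definition test_functions :: "'a::euclidean_space set \<Rightarrow> ('a \<Rightarrow> real) set" where
  "test_functions U = {\<psi>. (\<forall>k. Ck k \<psi>) \<and>
     compact (closure {x. \<psi> x \<noteq> 0}) \<and> closure {x. \<psi> x \<noteq> 0} \<subseteq> U}"

definition grad :: "(real^'n \<Rightarrow> real) \<Rightarrow> real^'n \<Rightarrow> real^'n" where
  "grad \<psi> x = (\<chi> i. frechet_derivative \<psi> (at x) (axis i 1))"


section \<open>Lebesgue and Sobolev spaces on an open set\<close>

text \<open>Elements of \<open>L\<^sup>2(\<Omega>)\<close>, \<open>H\<^sup>1(\<Omega>)\<close> and of the Bochner spaces below are represented by functions;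
  all notions are invariant under modification on null sets.\<close>

definition L2 :: "(real^'n) set \<Rightarrow> (real^'n \<Rightarrow> real) set" where
  "L2 \<Omega> = {f \<in> borel_measurable (lebesgue_on \<Omega>). integrable (lebesgue_on \<Omega>) (\<lambda>x. (f x)\<^sup>2)}"

definition L2_inner :: "(real^'n) set \<Rightarrow> (real^'n \<Rightarrow> real) \<Rightarrow> (real^'n \<Rightarrow> real) \<Rightarrow> real" where
  "L2_inner \<Omega> f g = (LINT x|lebesgue_on \<Omega>. f x * g x)"

definition L2_norm :: "(real^'n) set \<Rightarrow> (real^'n \<Rightarrow> real) \<Rightarrow> real" where
  "L2_norm \<Omega> f = sqrt (L2_inner \<Omega> f f)"

definition is_weak_gradient ::
    "(real^'n) set \<Rightarrow> (real^'n \<Rightarrow> real) \<Rightarrow> (real^'n \<Rightarrow> real^'n) \<Rightarrow> bool" where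
  "is_weak_gradient \<Omega> f g \<longleftrightarrow> (\<forall>\<psi>\<in>test_functions \<Omega>. \<forall>i.
     (LINT x|lebesgue_on \<Omega>. f x * grad \<psi> x $ i) = - (LINT x|lebesgue_on \<Omega>. g x $ i * \<psi> x))"

definition H1 :: "(real^'n) set \<Rightarrow> (real^'n \<Rightarrow> real) set" where
  "H1 \<Omega> = {f \<in> L2 \<Omega>. \<exists>g. (\<forall>i. (\<lambda>x. g x $ i) \<in> L2 \<Omega>) \<and> is_weak_gradient \<Omega> f g}"

definition weak_gradient :: "(real^'n) set \<Rightarrow> (real^'n \<Rightarrow> real) \<Rightarrow> real^'n \<Rightarrow> real^'n" where
  "weak_gradient \<Omega> f = (SOME g. (\<forall>i. (\<lambda>x. g x $ i) \<in> L2 \<Omega>) \<and> is_weak_gradient \<Omega> f g)"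

definition H1_norm :: "(real^'n) set \<Rightarrow> (real^'n \<Rightarrow> real) \<Rightarrow> real" where
  "H1_norm \<Omega> f = sqrt ((L2_norm \<Omega> f)\<^sup>2 + (\<Sum>i\<in>UNIV. (L2_norm \<Omega> (\<lambda>x. weak_gradient \<Omega> f x $ i))\<^sup>2))"

definition is_weak_divergence ::
    "(real^'n) set \<Rightarrow> (real^'n \<Rightarrow> real^'n) \<Rightarrow> (real^'n \<Rightarrow> real) \<Rightarrow> bool" where
  "is_weak_divergence U F g \<longleftrightarrow>
     (\<forall>K. compact K \<and> K \<subseteq> U \<longrightarrow> integrable (lebesgue_on K) g) \<and>
     (\<forall>\<psi>\<in>test_functions U.
        (LINT x|lebesgue_on U. F x \<bullet> grad \<psi> x) = - (LINT x|lebesgue_on U. g x * \<psi> x))"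

definition weak_divergence :: "(real^'n) set \<Rightarrow> (real^'n \<Rightarrow> real^'n) \<Rightarrow> real^'n \<Rightarrow> real" where
  "weak_divergence U F = (SOME g. is_weak_divergence U F g)"


section \<open>Bochner spaces\<close>

text \<open>Strong measurability is stated by approximation with simple functions, so that no separability
  of the target space is needed.\<close>

definition strongly_measurable :: "'m measure \<Rightarrow> ('m \<Rightarrow> 'b::real_normed_vector) \<Rightarrow> bool" where
  "strongly_measurable M f \<longleftrightarrow>
     (\<exists>s. (\<forall>n::nat. simple_function M (s n)) \<and> (AE t in M. (\<lambda>n. s n t) \<longlonglongrightarrow> f t))"

definition Lp_space :: "real \<Rightarrow> real set \<Rightarrow> (real \<Rightarrow> 'b::real_normed_vector) set" where
  "Lp_space p J = {f. strongly_measurable (lebesgue_on J) f \<and>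
     integrable (lebesgue_on J) (\<lambda>t. norm (f t) powr p)}"

definition Lp_norm :: "real \<Rightarrow> real set \<Rightarrow> (real \<Rightarrow> 'b::real_normed_vector) \<Rightarrow> real" where
  "Lp_norm p J f = (LINT t|lebesgue_on J. norm (f t) powr p) powr (1 / p)"

definition C_L2 :: "real \<Rightarrow> (real^'n) set \<Rightarrow> (real \<Rightarrow> real^'n \<Rightarrow> real) set" where
  "C_L2 T \<Omega> = {y. \<forall>t\<in>{0..T}. y t \<in> L2 \<Omega> \<and>
     ((\<lambda>s. L2_norm \<Omega> (\<lambda>x. y s x - y t x)) \<longlongrightarrow> 0) (at t within {0..T})}"

definition C_L2_norm :: "real \<Rightarrow> (real^'n) set \<Rightarrow> (real \<Rightarrow> real^'n \<Rightarrow> real) \<Rightarrow> real" where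
  "C_L2_norm T \<Omega> y = (SUP t\<in>{0..T}. L2_norm \<Omega> (y t))"


section \<open>Geometric setting\<close>

text \<open>Near every boundary point, \<open>U\<close> is the strict epigraph, in some direction \<open>e\<close>, of a Lipschitz
  function of the component orthogonal to \<open>e\<close>.\<close>

definition lipschitz_domain :: "(real^'n) set \<Rightarrow> bool" where
  "lipschitz_domain U \<longleftrightarrow> open U \<and> connected U \<and> bounded U \<and> U \<noteq> {} \<and>
     (\<forall>z\<in>frontier U. \<exists>r>0. \<exists>e L. \<exists>\<gamma> :: real^'n \<Rightarrow> real.
        norm e = 1 \<and> L-lipschitz_on UNIV \<gamma> \<and>
        U \<inter> ball z r = {x \<in> ball z r. \<gamma> (x - (x \<bullet> e) *\<^sub>R e) < x \<bullet> e})"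

definition interface :: "(real \<Rightarrow> (real^'n) set) \<Rightarrow> (real \<Rightarrow> (real^'n) set) \<Rightarrow> real \<Rightarrow> (real^'n) set" where
  "interface \<Omega>1 \<Omega>2 t = frontier (\<Omega>1 t) \<inter> frontier (\<Omega>2 t)"

locale moving_domains =
  fixes \<Omega> :: "(real^'n) set" and T :: real
    and \<Omega>1 \<Omega>2 :: "real \<Rightarrow> (real^'n) set"
    and \<Phi> v :: "(real^'n) \<times> real \<Rightarrow> real^'n"
  assumes dimension: "CARD('n) \<in> {1, 2, 3}"
    and T_pos: "0 < T"
    and domain: "lipschitz_domain \<Omega>"
    and subdomain1: "\<And>t. t \<in> {0..T} \<Longrightarrow> lipschitz_domain (\<Omega>1 t)"
    and subdomain2: "\<And>t. t \<in> {0..T} \<Longrightarrow> lipschitz_domain (\<Omega>2 t)"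
    and disjoint: "\<And>t. t \<in> {0..T} \<Longrightarrow> \<Omega>1 t \<inter> \<Omega>2 t = {}"
    and decomposition: "\<And>t. t \<in> {0..T} \<Longrightarrow> \<Omega> = \<Omega>1 t \<union> \<Omega>2 t \<union> interface \<Omega>1 \<Omega>2 t"
    and flow_smooth: "\<Phi> \<in> C1_bar (\<Omega> \<times> {0<..<T})"
    and flow_closed: "\<And>x t. x \<in> closure \<Omega> \<Longrightarrow> t \<in> {0..T} \<Longrightarrow> \<Phi> (x, t) \<in> closure \<Omega>"
    and flow_initial: "\<And>x. x \<in> closure \<Omega> \<Longrightarrow> \<Phi> (x, 0) = x"
    and flow_diffeo: "\<And>t. t \<in> {0<..<T} \<Longrightarrow> C1_bar_diffeomorphism \<Omega> \<Omega> (\<lambda>x. \<Phi> (x, t))"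
    and flow_subdomain1: "\<And>t. t \<in> {0<..<T} \<Longrightarrow> (\<lambda>x. \<Phi> (x, t)) ` closure (\<Omega>1 0) = closure (\<Omega>1 t)"
    and flow_subdomain2: "\<And>t. t \<in> {0<..<T} \<Longrightarrow> (\<lambda>x. \<Phi> (x, t)) ` closure (\<Omega>2 0) = closure (\<Omega>2 t)"
    and velocity: "\<And>x t. x \<in> closure \<Omega> \<Longrightarrow> t \<in> {0<..<T} \<Longrightarrow>
      v (x, t) = vector_derivative
        (\<lambda>s. \<Phi> (inv_into (closure \<Omega>) (\<lambda>y. \<Phi> (y, t)) x, s)) (at t)"
    and velocity_smooth: "v \<in> C1_bar (\<Omega> \<times> {0<..<T})"
begin

definition Q1 :: "((real^'n) \<times> real) set" where
  "Q1 = {(x, t) \<in> \<Omega> \<times> {0<..<T}. x \<in> \<Omega>1 t}"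

definition Q2 :: "((real^'n) \<times> real) set" where
  "Q2 = (\<Omega> \<times> {0<..<T}) - closure Q1"

end

text \<open>\<open>\<alpha>\<close> may be two-valued on the interface. Hence \<open>\<alpha> \<in> C\<^sup>1(closure Q\<^sub>i)\<close> is expressed by a function
  \<open>\<alpha>\<^sub>i\<close> on the closure of \<open>Q\<^sub>i\<close> that agrees with \<open>\<alpha>\<close> away from the interface (times 0 and \<open>T\<close>
  included); the values of \<open>\<alpha>\<close> itself on the interface are irrelevant.\<close>

locale moving_coefficient = moving_domains \<Omega> T \<Omega>1 \<Omega>2 \<Phi> v
  for \<Omega> :: "(real^'n) set" and T :: real
    and \<Omega>1 \<Omega>2 :: "real \<Rightarrow> (real^'n) set"
    and \<Phi> v :: "(real^'n) \<times> real \<Rightarrow> real^'n" +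
  fixes \<alpha> :: "(real^'n) \<times> real \<Rightarrow> real" and \<alpha>0 :: real
  assumes nonneg: "\<And>x t. x \<in> \<Omega> \<Longrightarrow> t \<in> {0..T} \<Longrightarrow> 0 \<le> \<alpha> (x, t)"
    and smooth1: "\<exists>\<alpha>1 \<in> C1_bar Q1. \<forall>t\<in>{0..T}. \<forall>x\<in>\<Omega>1 t. \<alpha> (x, t) = \<alpha>1 (x, t)"
    and smooth2: "\<exists>\<alpha>2 \<in> C1_bar Q2. \<forall>t\<in>{0..T}. \<forall>x\<in>\<Omega>2 t. \<alpha> (x, t) = \<alpha>2 (x, t)"
    and alpha0_pos: "0 < \<alpha>0"
    and support_nonempty: "\<And>t. t \<in> {0..T} \<Longrightarrow>
      closure {x \<in> \<Omega>. \<alpha> (x, t) \<noteq> 0} - (interface \<Omega>1 \<Omega>2 t \<union> frontier \<Omega>) \<noteq> {}"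
    and lower_bound: "\<And>x t. t \<in> {0..T} \<Longrightarrow>
      x \<in> closure {x \<in> \<Omega>. \<alpha> (x, t) \<noteq> 0} - (interface \<Omega>1 \<Omega>2 t \<union> frontier \<Omega>) \<Longrightarrow>
      \<alpha>0 \<le> \<alpha> (x, t)"

text \<open>The Hilbert space \<open>V\<close> is a type; \<open>emb w\<close> is a representative of the image of \<open>w\<close> in \<open>H\<^sup>1(\<Omega>)\<close>.\<close>

locale gelfand_embedding =
  fixes \<Omega> :: "(real^'n) set" and emb :: "'v::{real_inner, complete_space} \<Rightarrow> real^'n \<Rightarrow> real"
  assumes emb_linear: "\<And>a b w w'. AE x in lebesgue_on \<Omega>.
      emb (a *\<^sub>R w + b *\<^sub>R w') x = a * emb w x + b * emb w' x"
    and emb_injective: "\<And>w. (AE x in lebesgue_on \<Omega>. emb w x = 0) \<Longrightarrow> w = 0"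
    and emb_H1: "\<And>w. emb w \<in> H1 \<Omega>"
    and emb_continuous: "\<exists>C. \<forall>w. H1_norm \<Omega> (emb w) \<le> C * norm w"
    and emb_dense: "\<And>f \<epsilon>. f \<in> L2 \<Omega> \<Longrightarrow> 0 < \<epsilon> \<Longrightarrow> \<exists>w. L2_norm \<Omega> (\<lambda>x. f x - emb w x) < \<epsilon>"


section \<open>The weighted time derivative\<close>

text \<open>On the open sets \<open>Q\<^sub>1\<close> and \<open>Q\<^sub>2\<close> this is the classical derivative; the interface is a null set.\<close>

definition dt :: "((real^'n) \<times> real \<Rightarrow> real) \<Rightarrow> real^'n \<Rightarrow> real \<Rightarrow> real" where
  "dt \<alpha> x t = deriv (\<lambda>s. \<alpha> (x, s)) t"

text \<open>\<open>\<nabla> \<cdot> (\<alpha> f g v)\<close> at time \<open>t\<close>, understood piecewise: test functions are supported away from the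
  interface.\<close>

definition flux_div ::
    "(real \<Rightarrow> (real^'n) set) \<Rightarrow> (real \<Rightarrow> (real^'n) set) \<Rightarrow> ((real^'n) \<times> real \<Rightarrow> real^'n) \<Rightarrow>
     ((real^'n) \<times> real \<Rightarrow> real) \<Rightarrow> real \<Rightarrow> (real^'n \<Rightarrow> real) \<Rightarrow> (real^'n \<Rightarrow> real) \<Rightarrow> real^'n \<Rightarrow> real" where
  "flux_div \<Omega>1 \<Omega>2 v \<alpha> t f g =
     weak_divergence (\<Omega>1 t \<union> \<Omega>2 t) (\<lambda>x. (\<alpha> (x, t) * f x * g x) *\<^sub>R v (x, t))"

definition alpha_dt_distribution where
  "alpha_dt_distribution \<Omega> T \<Omega>1 \<Omega>2 v \<alpha> emb u \<phi> w =
     - (LINT t|lebesgue_on {0<..<T}. LINT x|lebesgue_on \<Omega>.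
          \<alpha> (x, t) * emb (u t) x * emb w x * deriv \<phi> t
          + emb (u t) x * \<phi> t * emb w x * dt \<alpha> x t
          + \<phi> t * flux_div \<Omega>1 \<Omega>2 v \<alpha> t (emb (u t)) (emb w) x)"

definition is_alpha_dt ::
    "(real^'n) set \<Rightarrow> real \<Rightarrow> (real \<Rightarrow> (real^'n) set) \<Rightarrow> (real \<Rightarrow> (real^'n) set) \<Rightarrow>
     ((real^'n) \<times> real \<Rightarrow> real^'n) \<Rightarrow> ((real^'n) \<times> real \<Rightarrow> real) \<Rightarrow>
     ('v::{real_inner, complete_space} \<Rightarrow> real^'n \<Rightarrow> real) \<Rightarrow> real \<Rightarrow>
     (real \<Rightarrow> 'v) \<Rightarrow> (real \<Rightarrow> 'v \<Rightarrow>\<^sub>L real) \<Rightarrow> bool" where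
  "is_alpha_dt \<Omega> T \<Omega>1 \<Omega>2 v \<alpha> emb q u g \<longleftrightarrow> g \<in> Lp_space q {0<..<T} \<and>
     (\<forall>\<phi>\<in>test_functions {0<..<T}. \<forall>w.
        alpha_dt_distribution \<Omega> T \<Omega>1 \<Omega>2 v \<alpha> emb u \<phi> w =
        (LINT t|lebesgue_on {0<..<T}. \<phi> t * blinfun_apply (g t) w))"

definition alpha_dt where
  "alpha_dt \<Omega> T \<Omega>1 \<Omega>2 v \<alpha> emb q u = (SOME g. is_alpha_dt \<Omega> T \<Omega>1 \<Omega>2 v \<alpha> emb q u g)"

definition W_space where
  "W_space \<Omega> T \<Omega>1 \<Omega>2 v \<alpha> emb p q =
     {u \<in> Lp_space p {0<..<T}. \<exists>g. is_alpha_dt \<Omega> T \<Omega>1 \<Omega>2 v \<alpha> emb q u g}"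

definition W_norm where
  "W_norm \<Omega> T \<Omega>1 \<Omega>2 v \<alpha> emb p q u =
     Lp_norm p {0<..<T} u + Lp_norm q {0<..<T} (alpha_dt \<Omega> T \<Omega>1 \<Omega>2 v \<alpha> emb q u)"

text \<open>\<open>y\<close> is a continuous representative of \<open>\<surd>\<alpha> u\<close> in \<open>C([0,T], L\<^sup>2(\<Omega>))\<close>.\<close>

definition is_continuous_rep where
  "is_continuous_rep \<Omega> T \<alpha> emb u y \<longleftrightarrow> y \<in> C_L2 T \<Omega> \<and>
     (AE t in lebesgue_on {0<..<T}. AE x in lebesgue_on \<Omega>. y t x = sqrt (\<alpha> (x, t)) * emb (u t) x)"

end

(* For w, z in V put m(t;w,z) = (alpha(t) w, z) and a(t;w,z) = int (w z d_t alpha + div(alpha w z v)).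
   Cut-offs carried along by the flow satisfy d_t psi + v . grad psi = 0; inserting them gives the Reynolds
   formula m(t;w,z) - m(s;w,z) = int_s^t a(r;w,z) dr without an interface contribution, and alpha d_t u = g
   becomes d/dt m(t;u,w) = <g,w> + a(t;u,w) weakly, for every fixed w.  By separability this holds in integrated
   form between all times of one set G of full measure and for all w = u(r), r in G; comparing difference
   quotients in both arguments gives the product formula for m(t;u,z) on G.  Applied to u - u(r), it shows that
   sqrt(alpha) u restricted to G is Cauchy in L^2 at every time of [0,T]: the weight sqrt(alpha(t)) w is
   continuous in t because almost every point stays in one phase near a given time.  The energy bound and the
   product formula extend from G by density. *)
theory Submission
 imports Defs
begin

text \<open>The weight may vanish on a whole phase, so \<open>u\<close> itself need have no time
  derivative, and smoothing \<open>u\<close> in time does not commute with a moving weight. The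
  product formula therefore rests on an exact identity: the increment of m(.;u,z) from s to t is
  split at the mixed pair (u(s), z(t)), each equation is used with a frozen second argument, and
  what remains pairs the derivatives and the form a with increments of u and z. Averaged over all s
  with t = s + h this remainder is o(h), because functions in L^p(J,V) are close to uniformly
  continuous ones. Conjugate exponents control the pairing with the derivatives; the form a needs
  square integrability in time, which is where p >= 2 enters. The flow is only C^1, so transported
  cut-offs are C^1 while weak derivatives are tested with smooth functions; this gap, and the
  product of two H^1 functions, explain the mollification results. At the final time no
  diffeomorphism is assumed, and backward uniqueness of trajectories replaces it. The embedding
  constant bounds the energy at one time by its mean over J plus its variation, after dividing by
  the norm.\<close>

abbreviation (input) leb :: "'a::euclidean_space set \<Rightarrow> 'a measure" where "leb \<equiv> lebesgue_on"
abbreviation (input) bmeas :: "'a measure \<Rightarrow> ('a \<Rightarrow> 'b::topological_space) set" where "bmeas \<equiv> borel_measurable"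
abbreviation (input) fderiv where "fderiv \<equiv> frechet_derivative"
abbreviation (input) bapp where "bapp \<equiv> blinfun_apply"
abbreviation (input) seq_lim :: "(nat \<Rightarrow> 'a::topological_space) \<Rightarrow> 'a \<Rightarrow> bool" (infixr "---->" 60) where
 "X ----> l \<equiv> X \<longlonglongrightarrow> l"

lemmas bi_integrable_add = Bochner_Integration.integrable_add
lemmas bi_integrable_bound = Bochner_Integration.integrable_bound
lemmas bi_integrable_diff = Bochner_Integration.integrable_diff
lemmas bi_integrable_sum = Bochner_Integration.integrable_sum
lemmas bi_integral_add = Bochner_Integration.integral_add
lemmas bi_integral_cong = Bochner_Integration.integral_cong
lemmas bi_integral_diff = Bochner_Integration.integral_diff
lemmas bi_integral_mono = Bochner_Integration.integral_mono
lemmas bi_integral_nonneg = Bochner_Integration.integral_nonneg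
lemmas bi_norm_bound = Bochner_Integration.integral_norm_bound_integral
lemmas bi_integral_sum = Bochner_Integration.integral_sum
lemmas bi_integral_zero = Bochner_Integration.integral_zero

section \<open>Smooth functions and mollification\<close>

lemma derivative_outside_support:
 fixes f :: "'a::euclidean_space => real"
 assumes K: "compact K" and f: "!!x. x ~: K ==> f x = 0" and x: "x ~: K" shows "(f has_derivative (%h. 0)) (at x)" "fderiv f (at x) b = 0"
proof -
 have o: "open (- K)" "x : - K" using K x by (simp_all add: open_Compl compact_imp_closed)
 show d: "(f has_derivative (%h. 0)) (at x)" by (rule has_derivative_transform_within_open[OF has_derivative_const[of 0] o]) (simp add: f)
 from frechet_derivative_at[OF d] show "fderiv f (at x) b = 0" by (simp add: fun_eq_iff) qed

lemma Ck_SucI: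
 assumes "!!x. (f has_derivative f' x) (at x)" and "!!b. b : Basis ==> Ck k (%x. f' x b)" shows "Ck (Suc k) f"
proof -
 have "fderiv f (at x) = f' x" for x using assms(1) frechet_derivative_at by metis
 with assms show ?thesis by (auto simp: differentiable_def) qed

lemma Ck_has_derivative:
 "Ck (Suc k) f ==> (f has_derivative fderiv f (at x)) (at x)" by (simp add: frechet_derivative_works)

lemma Ck_continuous: "Ck k f ==> continuous_on UNIV f" by (cases k) (auto intro!: differentiable_imp_continuous_on simp: differentiable_on_def)

text \<open>\<open>Ck\<close> records differentiability order by order, so lowering the order is an
  induction through the partial derivatives that ends with differentiable functions being
  continuous.\<close>

lemma Ck_Suc_imp: "Ck (Suc k) f ==> Ck k f"
proof (induction k arbitrary: f)
 case 0
 thus ?case using Ck_continuous by (metis Ck.simps(1))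
next
 case (Suc k)
 show ?case
 proof (rule Ck_SucI[OF Ck_has_derivative[OF Suc.prems]])
 fix b :: 'a assume "b : Basis"
 thus "Ck k (%x. fderiv f (at x) b)" using Suc by auto qed qed

declare Ck.simps(2)[simp del]

lemma Ck_partial: "Ck (Suc k) f ==> b : Basis ==> Ck k (%x. fderiv f (at x) b)" by (simp add: Ck.simps(2))

lemma Ck_const: "Ck k (%_. c)"
proof (induction k arbitrary: c)
 case (Suc k) thus ?case by (intro Ck_SucI[where f'="%_ _. 0"]) auto qed simp

lemma Ck_inner: "Ck k (%x. x \<bullet> b)"
proof (cases k)
 case (Suc k')
 have "Ck (Suc k') (%x. x \<bullet> b)" by (rule Ck_SucI[where f'="%_ h. h \<bullet> b"]) (auto intro!: Ck_const derivative_eq_intros)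
 thus ?thesis using Suc by simp qed (auto intro!: continuous_intros)

lemma Ck_add: "Ck k f ==> Ck k g ==> Ck k (%x. f x + g x)"
proof (induction k arbitrary: f g)
 case (Suc k)
 show ?case by (rule Ck_SucI[where f'="%x h. fderiv f (at x) h + fderiv g (at x) h"])
 (use Suc in "auto intro!: has_derivative_add Ck_has_derivative Ck_partial") qed (auto intro: continuous_on_add)

lemma Ck_mult: "Ck k f ==> Ck k g ==> Ck k (%x. f x * g x)"
proof (induction k arbitrary: f g)
 case (Suc k)
 have "Ck k f" "Ck k g" using Suc.prems Ck_Suc_imp by auto
 show ?case
 proof (rule Ck_SucI)
 show "((%x. f x * g x) has_derivative
 (%h. f x * fderiv g (at x) h + fderiv f (at x) h * g x)) (at x)" for x by (rule has_derivative_mult[OF Ck_has_derivative[OF Suc.prems(1)] Ck_has_derivative[OF Suc.prems(2)]])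
 show "Ck k (%x. f x * fderiv g (at x) b + fderiv f (at x) b * g x)"
 if "b : Basis" for b by (intro Ck_add Suc.IH Ck_partial Suc.prems \<open>Ck k f\<close> \<open>Ck k g\<close> that) qed qed (auto intro: continuous_on_mult)

lemma Ck_sum: "(!!i. i : I ==> Ck k (f i)) ==> Ck k (%x. \<Sum>i\<in>I. f i x)" by (induction I rule: infinite_finite_induct) (auto intro: Ck_const Ck_add)

lemma Ck_cmult: "Ck k f ==> Ck k (%x. c * f x)" using Ck_mult[OF Ck_const] .

lemma Ck_diff: "Ck k f ==> Ck k g ==> Ck k (%x. f x - g x)" using Ck_add[of k f "%x. (-1) * g x"] Ck_cmult[of k g "-1"] by simp

section \<open>Flat functions, compact supports and mollifier kernels\<close>

definition flat_exp :: "nat => real => real" where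
 "flat_exp m t = (if t <= 0 then 0 else exp (- (1 / t)) / t ^ m)"

text \<open>Substituting s = 1/t turns the claim into the decay of s^m exp(-s). The whole family in
  m is kept because differentiation raises m.\<close>

lemma flat_exp_tendsto_0: "(flat_exp m \<longlongrightarrow> 0) (at 0)"
proof -
 have "((%s::real. s ^ m / exp s) \<longlongrightarrow> 0) at_top" by (rule tendsto_power_div_exp_0)
 hence "((%t::real. inverse t ^ m / exp (inverse t)) \<longlongrightarrow> 0) (at_right 0)" by (rule filterlim_compose[OF _ filterlim_inverse_at_top_right])
 moreover have "\<forall>\<^sub>F t::real in at_right 0. inverse t ^ m / exp (inverse t) = flat_exp m t" using eventually_at_right_less[of "0::real"]
 by eventually_elim (simp add: flat_exp_def exp_minus divide_simps)
 ultimately have "(flat_exp m \<longlongrightarrow> 0) (at_right 0)" by (rule Lim_transform_eventually)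
 moreover have "(flat_exp m \<longlongrightarrow> 0) (at_left 0)" by (rule tendsto_eventually) (auto simp: eventually_at_filter flat_exp_def)
 ultimately show ?thesis by (simp add: filterlim_at_split) qed

lemma flat_exp_deriv:
 "(flat_exp m has_field_derivative (flat_exp (m + 2) t - m * flat_exp (m + 1) t)) (at t)"
proof (cases t "0::real" rule: linorder_cases)
 case less
 have "((%_. 0) has_field_derivative 0) (at t)" by simp
 hence "(flat_exp m has_field_derivative 0) (at t)" by (rule has_field_derivative_transform_within_open[of _ _ _ "{..<0}"])
 (use less in "auto simp: flat_exp_def")
 thus ?thesis using less by (simp add: flat_exp_def)
next
 case equal
 \<comment> \<open>The difference quotient at 0 is the next member of the family, so its limit is
   already known.\<close>
 have "flat_exp m y / y = flat_exp (m + 1) y" for y by (simp add: flat_exp_def)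
 hence "(flat_exp m has_field_derivative 0) (at t)" using flat_exp_tendsto_0[of "m + 1"] equal by (simp add: has_field_derivative_iff flat_exp_def[of _ 0])
 thus ?thesis using equal by (simp add: flat_exp_def)
next
 case greater
 have d: "((%t. exp (- (1 / t))) has_field_derivative exp (- (1 / t)) * (1 / t\<^sup>2)) (at t)"
 by (rule derivative_eq_intros refl | use greater in "simp add: power2_eq_square")+
 have "((%t. exp (- (1 / t)) / t ^ m) has_field_derivative
 (exp (- (1 / t)) * (1 / t\<^sup>2) * t ^ m - exp (- (1 / t)) * (real m * t ^ (m - Suc 0))) / (t ^ m * t ^ m)) (at t)" using DERIV_divide[OF d DERIV_pow, of m] greater by simp
 also have "(exp (- (1 / t)) * (1 / t\<^sup>2) * t ^ m - exp (- (1 / t)) * (real m * t ^ (m - Suc 0))) / (t ^ m * t ^ m)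
 = flat_exp (m + 2) t - m * flat_exp (m + 1) t" using greater by (cases m) (auto simp: flat_exp_def diff_divide_distrib power2_eq_square)
 finally have *: "((%t. exp (- (1 / t)) / t ^ m) has_field_derivative
 flat_exp (m + 2) t - m * flat_exp (m + 1) t) (at t)" .
 show ?thesis by (rule has_field_derivative_transform_within_open[OF *, of "{0<..}"])
 (use greater in "auto simp: flat_exp_def") qed

text \<open>The index m has to vary in the induction: one derivative leads to the indices m + 1 and
  m + 2.\<close>

lemma Ck_flat_exp: "(!!k. Ck k q) ==> Ck k (%x. flat_exp m (q x))"
proof (induction k arbitrary: m)
 case 0
 have "continuous_on UNIV (flat_exp m)" by (rule DERIV_continuous_on[where D="%t. flat_exp (m + 2) t - m * flat_exp (m + 1) t"])
 (rule has_field_derivative_at_within[OF flat_exp_deriv])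
 moreover have "continuous_on UNIV q" using 0[of 0] by simp
 ultimately show ?case by (auto intro: continuous_on_compose2)
next
 case (Suc k)
 show ?case
 proof (rule Ck_SucI[where f'="%x h. (flat_exp (m + 2) (q x) - m * flat_exp (m + 1) (q x)) * fderiv q (at x) h"])
 show "((%x. flat_exp m (q x)) has_derivative
 (%h. (flat_exp (m + 2) (q x) - m * flat_exp (m + 1) (q x)) * fderiv q (at x) h)) (at x)" for x using has_derivative_compose[OF Ck_has_derivative[OF Suc.prems[of "Suc 0"]]
 flat_exp_deriv[unfolded has_field_derivative_def]] by simp
 show "Ck k (%x. (flat_exp (m + 2) (q x) - m * flat_exp (m + 1) (q x)) * fderiv q (at x) b)"
 if "b : Basis" for b by (intro Ck_mult Ck_diff Ck_cmult Suc.IH Suc.prems Ck_partial that) qed qed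

text \<open>Compact support, encoded by boundedness of the set where f does not vanish: no closure
  has to be carried along, and \<open>csupp_iff\<close> recovers the usual form.\<close>

definition csupp :: "('a::euclidean_space => 'b::real_normed_vector) => bool" where
 "csupp f \<longleftrightarrow> bounded {x. f x ~= 0}"

lemma csupp_iff: "csupp f \<longleftrightarrow> compact (closure {x. f x ~= 0})" unfolding csupp_def by (simp add: compact_closure)

lemma csupp_uniform:
 fixes f :: "'a::euclidean_space => 'b::real_normed_vector"
 assumes "continuous_on UNIV f" "csupp f" shows "uniformly_continuous_on UNIV f"
proof -
 obtain B where B: "!!x. f x ~= 0 ==> norm x <= B" using assms(2) unfolding csupp_def bounded_iff by auto
 have "uniformly_continuous_on (cball 0 (B + 1)) f" using assms(1) by (intro compact_uniformly_continuous) (auto intro: continuous_on_subset)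
 note u = this[unfolded uniformly_continuous_on_def, rule_format]
 show ?thesis unfolding uniformly_continuous_on_def
 proof (intro allI impI)
 fix e :: real assume "0 < e"
 then obtain d where d: "d > 0" "!!x y. x : cball 0 (B + 1) ==> y : cball 0 (B + 1) ==> dist y x < d ==> dist (f y) (f x) < e" using u by metis
 have "dist (f y) (f x) < e" if "dist y x < min d 1" for x y
 proof (cases "norm x <= B \<or> norm y <= B")
 case True
 have "norm x <= norm y + 1" "norm y <= norm x + 1" using that norm_triangle_ineq2[of x y] norm_triangle_ineq2[of y x] by (auto simp: dist_norm norm_minus_commute)
 with True have "x : cball 0 (B + 1)" "y : cball 0 (B + 1)" by auto
 thus ?thesis using d that by auto
 next
 case False
 hence "f x = 0" "f y = 0" using B by force+
 thus ?thesis using \<open>0 < e\<close> by simp qed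
 thus "EX d>0. ALL x:UNIV. ALL x':UNIV. dist x' x < d --> dist (f x') (f x) < e" using d(1) by (intro exI[of _ "min d 1"]) auto qed qed

lemma csupp_bounded:
 fixes f :: "'a::euclidean_space => 'b::real_normed_vector"
 assumes "continuous_on UNIV f" "csupp f"
 obtains B where "!!x. norm (f x) <= B" "B >= 0"
proof -
 have "compact (f ` closure {x. f x ~= 0})" using assms by (intro compact_continuous_image) (auto simp: csupp_iff intro: continuous_on_subset)
 then obtain B where B: "!!x. x : closure {x. f x ~= 0} ==> norm (f x) <= B" using compact_imp_bounded bounded_iff by (metis imageI)
 have "norm (f x) <= max B 0" for x
 proof (cases "f x = 0")
 case False
 hence "x : closure {x. f x ~= 0}" by (intro subsetD[OF closure_subset]) auto
 thus ?thesis using B by (simp add: le_max_iff_disj) qed auto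
 thus ?thesis using that by (meson max.cobounded2) qed

lemma csupp_integrable:
 fixes f :: "'a::euclidean_space => real"
 assumes "continuous_on UNIV f" "csupp f" shows "integrable lborel f" "integrable lebesgue f"
proof -
 have "integrable lborel (%x. indicator (closure {x. f x ~= 0}) x *\<^sub>R f x)"
 using assms by (intro borel_integrable_compact) (auto simp: csupp_iff intro: continuous_on_subset)
 also have "(%x. indicator (closure {x. f x ~= 0}) x *\<^sub>R f x) = f"
 proof
 fix x show "indicator (closure {x. f x ~= 0}) x *\<^sub>R f x = f x" using subsetD[OF closure_subset, of x "{x. f x ~= 0}"] by (cases "f x = 0") auto qed
 finally show "integrable lborel f" .
 thus "integrable lebesgue f" using integrable_completion[of f lborel] borel_measurable_integrable by blast qed

lemma csupp_frechet:
 assumes "csupp f" shows "csupp (%x. fderiv f (at x) b)"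
 and "{x. fderiv f (at x) b ~= 0} <= closure {x. f x ~= 0}"
proof -
 show sub: "{x. fderiv f (at x) b ~= 0} <= closure {x. f x ~= 0}"
 proof
 fix x assume "x : {x. fderiv f (at x) b ~= 0}"
 hence nz: "fderiv f (at x) b ~= 0" by simp
 show "x : closure {x. f x ~= 0}"
 proof (rule ccontr)
 assume "x ~: closure {x. f x ~= 0}"
 hence x: "x : - closure {x. f x ~= 0}" by simp
 have z: "0 = f y" if "y : - closure {x. f x ~= 0}" for y using that subsetD[OF closure_subset, of y "{x. f x ~= 0}"] by auto
 have "(f has_derivative (%_. 0)) (at x)" by (rule has_derivative_transform_within_open[OF has_derivative_const[of 0] open_Compl[OF closed_closure] x z])
 hence "fderiv f (at x) = (%_. 0)" using frechet_derivative_at by metis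
 with nz show False by simp qed qed
 show "csupp (%x. fderiv f (at x) b)" using bounded_subset[OF bounded_closure sub] assms unfolding csupp_def by simp qed

text \<open>The classical bump function: a flat function composed with e^2 - |x|^2, then
  normalised.\<close>

lemma mollifier_exists:
 fixes e :: real
 assumes "0 < e"
 obtains rho :: "'a::euclidean_space => real"
 where "!!k. Ck k rho" "!!x. 0 <= rho x" "!!x. e <= norm x ==> rho x = 0" "integral\<^sup>L lebesgue rho = 1"
proof -
 \<comment> \<open>The squared norm is spelled out as a polynomial in the coordinates, for which
   \<open>Ck\<close> has been established.\<close>
 define f :: "'a => real" where "f x = flat_exp 0 (e\<^sup>2 - (\<Sum>b\<in>Basis. (x \<bullet> b) * (x \<bullet> b)))" for x
 have f: "Ck k f" for k unfolding f_def by (intro Ck_flat_exp Ck_diff Ck_const Ck_sum Ck_mult Ck_inner)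
 have f_eq: "f x = flat_exp 0 (e\<^sup>2 - (norm x)\<^sup>2)" for x unfolding f_def by (simp add: power2_norm_eq_inner euclidean_inner[of x x])
 have f0: "0 <= f x" for x by (simp add: f_eq flat_exp_def)
 have supp: "f x = 0" if "e <= norm x" for x using that power_mono[of e "norm x" 2] assms by (simp add: f_eq flat_exp_def)
 have cs: "csupp f" unfolding csupp_def by (rule bounded_subset[OF bounded_cball[of 0 e]]) (use supp in "auto simp: not_le[symmetric] intro: ccontr")
 have cf: "continuous_on UNIV f" using f[of 0] by simp
 have int: "integrable lborel f" "integrable lebesgue f" using csupp_integrable[OF cf cs] by auto
 \<comment> \<open>f is positive on an open ball, and such a ball is not negligible; hence the
   division below is legitimate.\<close>
 have "integral\<^sup>L lborel f ~= 0"
 proof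
 assume "integral\<^sup>L lborel f = 0"
 hence "AE x in lborel. f x = 0" using integral_nonneg_eq_0_iff_AE[OF int(1)] f0 by auto
 hence "AE x in lebesgue. f x = 0" by (rule AE_completion)
 hence "negligible {x. f x ~= 0}" by (simp add: negligible_iff_null_sets completion.AE_iff_null_sets)
 moreover have "f x ~= 0" if "x : ball 0 e" for x using that assms power_strict_mono[of "norm x" e 2] by (auto simp: f_eq flat_exp_def)
 ultimately have "negligible (ball (0::'a) e)" by (auto intro: negligible_subset)
 thus False using open_not_negligible[of "ball (0::'a) e"] assms by auto qed
 hence pos: "integral\<^sup>L lebesgue f > 0" using integral_completion[OF borel_measurable_integrable[OF int(1)]] bi_integral_nonneg[of lborel f, OF f0] by simp
 show ?thesis
 proof (rule that[of "%x. (1 / integral\<^sup>L lebesgue f) * f x"])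
 show "Ck k (%x. 1 / integral\<^sup>L lebesgue f * f x)" for k by (intro Ck_cmult f) qed (use f0 supp pos int in auto) qed

text \<open>A function that vanishes off a compact subset of U is C^1 on the two open sets U and the
  complement of K, which cover the space. It serves for functions whose derivative is known in the
  domain alone, such as transported cut-offs.\<close>

lemma Ck1_extension:
 fixes f :: "'a::euclidean_space => real"
 assumes U: "open U" and K: "compact K" "K <= U" and f0: "!!x. x ~: K ==> f x = 0"
 and f': "!!x. x : U ==> (f has_derivative f' x) (at x)" "!!b. b : Basis ==> continuous_on U (%x. f' x b)" shows "Ck (Suc 0) f"
proof -
 have oK: "open (- K)" using K(1) by (simp add: open_Compl compact_imp_closed)
 have UK: "U \<union> - K = UNIV" using K(2) by blast
 have out: "(f has_derivative (%h. 0)) (at x)" if "x : - K" for x by (rule has_derivative_transform_within_open[OF has_derivative_const[of 0] oK that]) (simp add: f0)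
 have "f differentiable at x" for x using f'(1)[of x] out[of x] UK by (auto simp: differentiable_def)
 moreover have "continuous_on UNIV (%x. fderiv f (at x) b)" if b: "b : Basis" for b
 proof -
 have "continuous_on U (%x. fderiv f (at x) b)" by (rule continuous_on_eq[OF f'(2)[OF b]]) (simp add: frechet_derivative_at[OF f'(1), symmetric])
 moreover have "continuous_on (- K) (%x. fderiv f (at x) b)" by (rule continuous_on_eq[OF continuous_on_const[of _ 0]]) (simp add: frechet_derivative_at[OF out, symmetric])
 ultimately have "continuous_on (U \<union> - K) (%x. fderiv f (at x) b)" by (intro continuous_on_open_Un U oK)
 thus ?thesis by (simp only: UK) qed
 ultimately show ?thesis by (simp add: Ck.simps) qed

section \<open>Convolution and approximation by test functions\<close>

lemma measurable_lebesgueI: "f : bmeas borel ==> f : bmeas lebesgue" by (simp add: measurable_completion)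

lemma lebesgue_integral_reflect:
 fixes F :: "'a::euclidean_space => real"
 assumes [measurable]: "F : bmeas borel" shows "(LINT y|lebesgue. F (x - y)) = (LINT y|lebesgue. F y)"
proof -
 have "(LINT y|lborel. F y) = (LINT y|lborel. F (x - y))" by (subst lborel_affine[of "-1" x]) (simp_all add: density_1 integral_distr)
 thus ?thesis by (simp add: integral_completion) qed

definition conv :: "('a::euclidean_space => real) => ('a => real) => 'a => real" where
 "conv f k x = (LINT y|lebesgue. f y * k (x - y))"

lemma conv_integrable:
 fixes f k :: "'a::euclidean_space => real"
 assumes "integrable lebesgue f" "continuous_on UNIV k" "csupp k" shows "integrable lebesgue (%y. f y * k (x - y))"
proof -
 obtain B where B: "!!x. norm (k x) <= B" "B >= 0" using csupp_bounded assms by blast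
 have "(%y. k (x - y)) : bmeas lebesgue" by (intro measurable_lebesgueI borel_measurable_continuous_onI continuous_on_compose2[OF assms(2)]
 continuous_intros) auto
 hence m: "(%y. f y * k (x - y)) : bmeas lebesgue" by (rule borel_measurable_times[OF borel_measurable_integrable[OF assms(1)]])
 have "abs(f y * k (x - y)) <= abs(f y) * B" for y unfolding abs_mult using B(1)[of "x - y"] by (intro mult_left_mono) auto
 hence le: "norm (f y * k (x - y)) <= norm (f y * B)" for y using B(2) by (simp add: abs_mult)
 show ?thesis by (rule bi_integrable_bound[OF integrable_mult_left[of B] m]) (use assms(1) le in auto) qed

lemma conv_commute:
 assumes "continuous_on UNIV f" "continuous_on UNIV k" shows "conv f k x = conv k f x"
proof -
 have "(%y. f y * k (x - y)) : bmeas borel" by (intro borel_measurable_continuous_onI continuous_intros continuous_on_compose2[OF assms(2)] assms) auto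
 from lebesgue_integral_reflect[OF this, of x] show ?thesis by (simp add: conv_def mult.commute) qed

lemma conv_supp: "conv f k x ~= 0 ==> EX y. f y ~= 0 & k (x - y) ~= 0"
proof (rule ccontr)
 assume nz: "conv f k x ~= 0" and "\<not> (EX y. f y ~= 0 & k (x - y) ~= 0)"
 hence "(%y. f y * k (x - y)) = (%_. 0)" by auto
 hence "conv f k x = 0" by (simp only: conv_def bi_integral_zero)
 with nz show False .. qed

lemma csupp_conv:
 assumes "csupp f" "csupp k" shows "csupp (conv f k)"
proof -
 obtain A B where A: "!!x. f x ~= 0 ==> norm x <= A" and B: "!!x. k x ~= 0 ==> norm x <= B" using assms unfolding csupp_def bounded_iff by blast
 have "norm x <= A + B" if nz: "conv f k x ~= 0" for x
 proof -
 obtain y where y: "f y ~= 0" "k (x - y) ~= 0" using conv_supp[OF nz] by blast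
 have "norm x <= norm y + norm (x - y)" using norm_triangle_ineq[of y "x - y"] by simp
 with A[OF y(1)] B[OF y(2)] show ?thesis by simp qed
 thus ?thesis unfolding csupp_def bounded_iff by blast qed

text \<open>Compact support makes the partial derivatives uniformly continuous, and the mean value
  theorem along a segment turns this into a remainder that is uniform in the base point. This
  uniformity replaces differentiation under the integral sign.\<close>

lemma Ck1_uniformly_differentiable:
 fixes k :: "'a::euclidean_space => real"
 assumes k: "Ck (Suc 0) k" "csupp k" and "0 < e" shows "EX d>0. ALL x h. norm h < d --> abs(k (x + h) - k x - fderiv k (at x) h) <= e * norm h"
proof -
 define D where "D x = fderiv k (at x)" for x
 have der: "(k has_derivative D x) (at x)" for x unfolding D_def using k(1) by (rule Ck_has_derivative)
 \<comment> \<open>The error budget is divided by the dimension because the coordinate errors are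
   summed over a basis.\<close>
 define e' where "e' = e / DIM('a)"
 have e': "0 < e'" using \<open>0 < e\<close> by (simp add: e'_def)
 have "ALL b:Basis. EX d>0. ALL x y. dist y x < d --> dist (D y b) (D x b) < e'"
 proof
 fix b :: 'a assume b: "b : Basis"
 have "uniformly_continuous_on UNIV (%x. D x b)" unfolding D_def by (rule csupp_uniform[OF Ck_continuous[OF Ck_partial[OF k(1) b]] csupp_frechet(1)[OF k(2)]])
 thus "EX d>0. ALL x y. dist y x < d --> dist (D y b) (D x b) < e'" using e' unfolding uniformly_continuous_on_def by auto qed
 then obtain d where d: "!!b. b : Basis ==> d b > 0"
 "!!b x y. b : Basis ==> dist y x < d b ==> dist (D y b) (D x b) < e'" by metis
 define m where "m = Min (d ` Basis)"
 have m: "m > 0" "!!b. b : Basis ==> m <= d b" unfolding m_def using d(1) by (auto simp: Min_gr_iff)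
 have "abs(k (x + h) - k x - D x h) <= e * norm h" if h: "norm h < m" for x h
 proof -
 have "EX s:{0<..<1::real}. k (x + 1 *\<^sub>R h) - k (x + 0 *\<^sub>R h) = (%r. D (x + s *\<^sub>R h) (r *\<^sub>R h)) (1 - 0)"
 proof (rule mvt_simple)
 show "((%s. k (x + s *\<^sub>R h)) has_derivative (%r. D (x + s *\<^sub>R h) (r *\<^sub>R h))) (at s within {0..1})"
 if "0 <= s" "s <= 1" for s :: real by (rule has_derivative_compose[OF _ der, of "%s. x + s *\<^sub>R h"])
 (auto intro!: derivative_eq_intros) qed simp
 then obtain s where s: "0 < s" "s < 1" and eq: "k (x + h) - k x = D (x + s *\<^sub>R h) h" by auto
 have lin: "D y h = (\<Sum>b\<in>Basis. (h \<bullet> b) * D y b)" for y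
 proof -
 have "linear (D y)" using der has_derivative_linear by blast
 hence "D y (\<Sum>b\<in>Basis. (h \<bullet> b) *\<^sub>R b) = (\<Sum>b\<in>Basis. (h \<bullet> b) * D y b)" by (simp add: linear_sum linear_scale)
 thus ?thesis by (simp add: euclidean_representation) qed
 have "abs(k (x + h) - k x - D x h) = abs(\<Sum>b\<in>Basis. (h \<bullet> b) * (D (x + s *\<^sub>R h) b - D x b))"
 unfolding eq lin[of x] lin[of "x + s *\<^sub>R h"] by (simp add: sum_subtractf algebra_simps)
 also have "... <= (\<Sum>b\<in>Basis. abs((h \<bullet> b) * (D (x + s *\<^sub>R h) b - D x b)))" by (rule sum_abs)
 also have "... <= (\<Sum>b\<in>(Basis::'a set). norm h * e')"
 proof (rule sum_mono)
 fix b :: 'a assume b: "b : Basis"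
 have "dist (x + s *\<^sub>R h) x < d b" using s h m(2)[OF b] mult_left_le_one_le[of "norm h" s] by (simp add: dist_norm)
 hence "abs(D (x + s *\<^sub>R h) b - D x b) <= e'" using d(2)[OF b] by (simp add: dist_real_def less_imp_le)
 thus "abs((h \<bullet> b) * (D (x + s *\<^sub>R h) b - D x b)) <= norm h * e'" using Basis_le_norm[OF b, of h] e' by (simp add: abs_mult mult_mono) qed
 also have "... = e * norm h" by (simp add: e'_def)
 finally show ?thesis . qed
 with m(1) show ?thesis unfolding D_def by blast qed

text \<open>The remainder of k is uniform in the base point, so it may be integrated against
  |f|.\<close>

lemma conv_has_derivative:
 fixes k :: "'a::euclidean_space => real"
 assumes f: "integrable lebesgue f" and k: "Ck (Suc 0) k" "csupp k"
 shows "(conv f k has_derivative (%h. \<Sum>b\<in>Basis. (h \<bullet> b) * conv f (%x. fderiv k (at x) b) x)) (at x)"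
proof -
 define D where "D x = fderiv k (at x)" for x
 define L where "L h = (\<Sum>b\<in>Basis. (h \<bullet> b) * conv f (%x. D x b) x)" for h
 have ck: "continuous_on UNIV k" using k Ck_continuous by blast
 have intk: "integrable lebesgue (%y. f y * k (x - y))" for x using conv_integrable[OF f ck k(2)] .
 have intD: "integrable lebesgue (%y. f y * D (x - y) b)" if "b : Basis" for b x unfolding D_def
 by (rule conv_integrable[OF f Ck_continuous[OF Ck_partial[OF k(1) that]] csupp_frechet(1)[OF k(2)]])
 have linD: "D y h = (\<Sum>b\<in>Basis. (h \<bullet> b) * D y b)" for y h
 proof -
 have "linear (D y)" using Ck_has_derivative[OF k(1)] has_derivative_linear unfolding D_def by blast
 hence "D y (\<Sum>b\<in>Basis. (h \<bullet> b) *\<^sub>R b) = (\<Sum>b\<in>Basis. (h \<bullet> b) * D y b)" by (simp add: linear_sum linear_scale)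
 thus ?thesis by (simp add: euclidean_representation) qed
 have Dsum: "(%y. f y * D (x - y) h) = (%y. \<Sum>b\<in>Basis. (h \<bullet> b) * (f y * D (x - y) b))" for h by (subst linD) (simp add: sum_distrib_left mult_ac)
 have intDh: "integrable lebesgue (%y. f y * D (x - y) h)" for h unfolding Dsum[of h] by (intro bi_integrable_sum integrable_mult_right intD)
 have L: "L h = (LINT y|lebesgue. f y * D (x - y) h)" for h unfolding L_def conv_def Dsum[of h] by (subst bi_integral_sum) (auto intro!: integrable_mult_right intD)
 have "bounded_linear L" unfolding L_def[abs_def] by (rule bounded_linear_sum) (rule bounded_linear_compose[OF bounded_linear_mult_left bounded_linear_inner_left])
 moreover have "EX d>0. ALL y. norm (y - x) < d --> norm (conv f k y - conv f k x - L (y - x)) <= e * norm (y - x)"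
 if e: "0 < e" for e
 proof -
 \<comment> \<open>Adding 1 keeps N positive when f vanishes almost everywhere.\<close>
 define N where "N = (LINT y|lebesgue. abs(f y)) + 1"
 have N: "N > 0" unfolding N_def by (simp add: add_nonneg_pos)
 obtain d where d: "d > 0" "!!x h. norm h < d ==> abs(k (x + h) - k x - D x h) <= e / N * norm h"
 using Ck1_uniformly_differentiable[OF k divide_pos_pos[OF e N]] unfolding D_def by metis
 have "norm (conv f k (x + h) - conv f k x - L h) <= e * norm h" if h: "norm h < d" for h
 proof -
 have "conv f k (x + h) - conv f k x - L h
 = (LINT y|lebesgue. f y * (k ((x - y) + h) - k (x - y) - D (x - y) h))" unfolding conv_def L using intk[of "x + h"] intk[of x] intDh[of h]
 by (simp add: algebra_simps bi_integral_diff)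
 also have "norm ... <= (LINT y|lebesgue. abs(f y) * (e / N * norm h))"
 proof (rule bi_norm_bound)
 show "integrable lebesgue (%y. f y * (k ((x - y) + h) - k (x - y) - D (x - y) h))" using bi_integrable_diff[OF bi_integrable_diff[OF intk[of "x + h"] intk[of x]] intDh[of h]]
 by (simp add: algebra_simps)
 show "norm (f y * (k ((x - y) + h) - k (x - y) - D (x - y) h)) <= abs(f y) * (e / N * norm h)" for y
 using d(2)[OF h, of "x - y"] by (simp add: abs_mult mult_left_mono del: times_divide_eq_left) qed (use f in auto)
 also have "... = (N - 1) * (e / N * norm h)" unfolding N_def by simp
 also have "... <= N * (e / N * norm h)" using N \<open>0 < e\<close> by (intro mult_right_mono) auto
 also have "... = e * norm h" using N by simp
 finally show ?thesis . qed
 note this[of "_ - x"]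
 with d(1) show ?thesis by (intro exI[of _ d]) auto qed
 ultimately show ?thesis unfolding has_derivative_at_alt L_def[abs_def] D_def by blast qed

lemma conv_frechet:
 fixes k :: "'a::euclidean_space => real"
 assumes f: "integrable lebesgue f" and k: "Ck (Suc 0) k" "csupp k" and b: "b : Basis" shows "fderiv (conv f k) (at x) b = conv f (%x. fderiv k (at x) b) x"
proof -
 have "fderiv (conv f k) (at x) = (%h. \<Sum>b\<in>Basis. (h \<bullet> b) * conv f (%x. fderiv k (at x) b) x)"
 using frechet_derivative_at[OF conv_has_derivative[OF f k]] by simp
 hence "fderiv (conv f k) (at x) b = (\<Sum>c\<in>Basis. (b \<bullet> c) * conv f (%x. fderiv k (at x) c) x)" by simp
 also have "... = (\<Sum>c\<in>Basis. if c = b then conv f (%x. fderiv k (at x) c) x else 0)" by (intro sum.cong) (use b in "auto simp: inner_Basis")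
 finally show ?thesis using b by simp qed

lemma Ck_conv:
 fixes k :: "'a::euclidean_space => real"
 assumes f: "integrable lebesgue f" shows "(!!j. Ck j k) ==> csupp k ==> Ck n (conv f k)"
proof (induction n arbitrary: k)
 case 0
 have "conv f k differentiable at x" for x using conv_has_derivative[OF f 0(1,2)] differentiable_def by blast
 thus ?case by (auto intro!: differentiable_imp_continuous_on simp: differentiable_on_def)
next
 case (Suc n)
 show ?case
 proof (rule Ck_SucI[OF conv_has_derivative[OF f Suc.prems]])
 fix b :: 'a assume b: "b : Basis"
 have "Ck n (conv f (%x. fderiv k (at x) c))" if "c : Basis" for c by (intro Suc.IH Ck_partial Suc.prems csupp_frechet that)
 thus "Ck n (%x. \<Sum>c\<in>Basis. (b \<bullet> c) * conv f (%x. fderiv k (at x) c) x)" by (intro Ck_sum Ck_cmult) qed qed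

text \<open>The weight rho (x - y) is a probability density concentrated within distance d of x, so
  the average of psi differs from psi x by at most the oscillation there.\<close>

lemma conv_mollifier_close:
 fixes psi :: "'a::euclidean_space => real"
 assumes psi: "continuous_on UNIV psi" "csupp psi"
 and rho: "continuous_on UNIV rho" "csupp rho" "!!x. 0 <= rho x" "!!x. d <= norm x ==> rho x = 0" "integral\<^sup>L lebesgue rho = 1"
 and osc: "!!y. dist y x < d ==> abs(psi y - psi x) <= e" shows "abs(conv psi rho x - psi x) <= e"
proof -
 have m: "rho : bmeas borel" using rho(1) by (intro borel_measurable_continuous_onI)
 have one: "(LINT y|lebesgue. rho (x - y)) = 1" using lebesgue_integral_reflect[OF m, of x] rho(5) by simp
 have irho: "integrable lebesgue (%y. rho (x - y))" using one by (rule contrapos_pp) (simp add: not_integrable_integral_eq)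
 have i: "integrable lebesgue (%y. psi y * rho (x - y))" using conv_integrable csupp_integrable psi rho by blast
 have "conv psi rho x - psi x = (LINT y|lebesgue. (psi y - psi x) * rho (x - y))" unfolding conv_def using i irho one by (simp add: left_diff_distrib)
 also have "abs(...) <= (LINT y|lebesgue. e * rho (x - y))" unfolding real_norm_def[symmetric]
 proof (rule bi_norm_bound)
 show "integrable lebesgue (%y. (psi y - psi x) * rho (x - y))" using i irho by (simp add: left_diff_distrib)
 show "norm ((psi y - psi x) * rho (x - y)) <= e * rho (x - y)" for y
 proof (cases "dist y x < d")
 case True
 thus ?thesis using osc[OF True] rho(3)[of "x - y"] by (simp add: abs_mult mult_right_mono)
 next
 case False
 thus ?thesis using rho(4)[of "x - y"] by (simp add: dist_norm norm_minus_commute) qed qed (use irho in auto)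
 also have "... = e" using one by simp
 finally show ?thesis . qed

text \<open>Mollification at radius r / (n + 1) keeps all supports in the closed r-neighbourhood K'
  of K. The lemma upgrades identities from smooth to C^1 test functions, hence the simultaneous
  convergence of the first derivatives.\<close>

lemma test_functions_approx:
 fixes psi :: "'a::euclidean_space => real"
 assumes psi: "Ck (Suc 0) psi" and K: "compact K" "{x. psi x ~= 0} <= K" "K <= U" and U: "open U"
 obtains s K' where "compact K'" "K' <= U" "!!n::nat. s n : test_functions U" "!!n. {x. s n x ~= 0} <= K'"
 "uniform_limit UNIV s psi sequentially"
 "!!b. b : Basis ==> uniform_limit UNIV (%n x. fderiv (s n) (at x) b) (%x. fderiv psi (at x) b) sequentially"
proof -
 have cs: "csupp psi" unfolding csupp_def by (rule bounded_subset[OF compact_imp_bounded[OF K(1)] K(2)])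
 have cpsi: "continuous_on UNIV psi" using psi Ck_continuous by blast
 obtain r where r: "r > 0" "(\<Union>x\<in>K. cball x r) <= U" using compact_subset_open_imp_cball_epsilon_subset[OF K(1) U K(3)] by blast
 define K' where "K' = (\<Union>x\<in>K. cball x r)"
 have K': "compact K'" unfolding K'_def using compact_minkowski_sum_cball[OF K(1), of r] by (simp add: compact_minkowski_sum_cball)
 have "ALL n::nat. EX rho::'a => real. (ALL k. Ck k rho) & (ALL x. 0 <= rho x) & (ALL x. r / Suc n <= norm x --> rho x = 0) & integral\<^sup>L lebesgue rho = 1"
 proof
 fix n :: nat
 have "r / Suc n > 0" using r(1) by simp
 from mollifier_exists[where 'a='a, OF this]
 show "EX rho::'a => real. (ALL k. Ck k rho) & (ALL x. 0 <= rho x) & (ALL x. r / Suc n <= norm x --> rho x = 0) & integral\<^sup>L lebesgue rho = 1" by metis qed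
 then obtain rho :: "nat => 'a => real" where rho: "!!n k. Ck k (rho n)" "!!n x. 0 <= rho n x"
 "!!n x. r / Suc n <= norm x ==> rho n x = 0" "!!n. integral\<^sup>L lebesgue (rho n) = 1" by metis
 have crho: "continuous_on UNIV (rho n)" for n using rho(1) Ck_continuous by blast
 have csrho: "csupp (rho n)" for n unfolding csupp_def bounded_iff using rho(3) by (intro exI[of _ "r / Suc n"]) (metis linear mem_Collect_eq)
 have lim: "uniform_limit UNIV (%n. conv f (rho n)) f sequentially" if f: "continuous_on UNIV f" "csupp f" for f
 proof (rule uniform_limitI)
 fix e :: real assume e: "0 < e"
 obtain d where d: "d > 0" "!!x y. dist y x < d ==> dist (f y) (f x) < e / 2" using csupp_uniform[OF f] e unfolding uniformly_continuous_on_def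
 by (metis UNIV_I half_gt_zero)
 obtain N where N: "r / Suc N < d" using d(1) r(1) reals_Archimedean[of "d / r"] by (auto simp: field_simps)
 show "\<forall>\<^sub>F n in sequentially. ALL x:UNIV. dist (conv f (rho n) x) (f x) < e" unfolding eventually_sequentially
 proof (intro exI[of _ N] allI impI ballI)
 fix n x assume "N <= n"
 hence "r / Suc n <= r / Suc N" using r(1) by (intro divide_left_mono) auto
 hence "r / Suc n < d" using N by simp
 hence osc: "abs(f y - f x) <= e / 2" if "dist y x < r / Suc n" for y using d(2)[of y x] that by (simp add: dist_real_def)
 have "abs(conv f (rho n) x - f x) <= e / 2" by (rule conv_mollifier_close[OF f crho csrho rho(2) rho(3) rho(4) osc])
 thus "dist (conv f (rho n) x) (f x) < e" using e by (simp add: dist_real_def) qed qed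
 have supp: "{x. conv psi (rho n) x ~= 0} <= K'" for n
 proof
 fix x assume "x : {x. conv psi (rho n) x ~= 0}"
 then obtain y where y: "psi y ~= 0" "rho n (x - y) ~= 0" using conv_supp[of psi "rho n" x] by auto
 have "norm (x - y) < r / Suc n" using y(2) rho(3)[of n "x - y"] by force
 also have "... <= r" using r(1) by (simp add: field_simps)
 finally have "x : cball y r" by (simp add: dist_norm norm_minus_commute)
 thus "x : K'" unfolding K'_def using y(1) K(2) by blast qed
 show ?thesis
 proof (rule that[of K' "%n. conv psi (rho n)"])
 show "compact K'" "K' <= U" using K' r(2) by (auto simp: K'_def)
 show "{x. conv psi (rho n) x ~= 0} <= K'" for n by (rule supp)
 have "closure {x. conv psi (rho n) x ~= 0} <= K'" for n using supp K' compact_imp_closed closure_minimal by blast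
 thus "conv psi (rho n) : test_functions U" for n unfolding test_functions_def using r(2) csupp_conv[OF cs csrho] Ck_conv[OF csupp_integrable(2)[OF cpsi cs] rho(1) csrho]
 by (auto simp: csupp_iff K'_def)
 show "uniform_limit UNIV (%n. conv psi (rho n)) psi sequentially" by (rule lim[OF cpsi cs])
 fix b :: 'a assume b: "b : Basis"
 have cd: "continuous_on UNIV (%x. fderiv psi (at x) b)" by (intro Ck_continuous[of 0] Ck_partial psi b)
 \<comment> \<open>Smoothness comes from differentiating the kernel. Commuting the factors puts the
   first derivative on psi instead, so that it converges to the derivative of psi.\<close>
 have "conv psi (rho n) = conv (rho n) psi" for n using conv_commute[OF cpsi crho] by (intro ext)
 hence "fderiv (conv psi (rho n)) (at x) b = conv (%x. fderiv psi (at x) b) (rho n) x" for n x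
 using conv_frechet[OF csupp_integrable(2)[OF crho csrho] psi cs b] conv_commute[OF cd crho] by metis
 thus "uniform_limit UNIV (%n x. fderiv (conv psi (rho n)) (at x) b) (%x. fderiv psi (at x) b) sequentially" using lim[OF cd csupp_frechet(1)[OF cs]] by simp qed qed

lemma test_cutoff:
 fixes K :: "'a::euclidean_space set"
 assumes K: "compact K" "K <= U" and U: "open U"
 obtains c where "c : test_functions U" "!!x. 0 <= c x" "!!x. c x <= 1" "!!x. x : K ==> c x = 1"
proof -
 obtain r where r: "r > 0" "(\<Union>x\<in>K. cball x r) <= U" using compact_subset_open_imp_cball_epsilon_subset[OF K(1) U K(2)] by blast
 \<comment> \<open>The indicator of the r/2-neighbourhood is smoothed with a kernel of radius r/2:
   the result is 1 on K and vanishes off the r-neighbourhood.\<close>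
 define K1 where "K1 = (\<Union>x\<in>K. cball x (r/2))"
 define K2 where "K2 = (\<Union>x\<in>K. cball x r)"
 have K12: "compact K1" "compact K2" unfolding K1_def K2_def using compact_minkowski_sum_cball[OF K(1)] by auto
 obtain rho :: "'a => real" where rho: "!!k. Ck k rho" "!!x. 0 <= rho x" "!!x. r/2 <= norm x ==> rho x = 0" "integral\<^sup>L lebesgue rho = 1"
 using mollifier_exists[of "r/2"] r(1) by auto
 have crho: "continuous_on UNIV rho" using rho(1) Ck_continuous by blast
 have csrho: "csupp rho" unfolding csupp_def bounded_iff using rho(3) by (intro exI[of _ "r/2"]) (metis linear mem_Collect_eq)
 have m: "rho : bmeas borel" using crho by (intro borel_measurable_continuous_onI)
 define f :: "'a => real" where "f = indicator K1"
 have if': "integrable lebesgue f" unfolding f_def using lmeasurable_compact[OF K12(1)] by (simp add: lmeasurable_iff_integrable)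
 have csf: "csupp f" unfolding csupp_def f_def using K12(1) compact_imp_bounded by (auto simp: indicator_def)
 have one: "(LINT y|lebesgue. rho (x - y)) = 1" for x using lebesgue_integral_reflect[OF m, of x] rho(4) by simp
 have irho: "integrable lebesgue (%y. rho (x - y))" for x using one[of x] by (rule contrapos_pp) (simp add: not_integrable_integral_eq)
 have supp: "{x. conv f rho x ~= 0} <= K2"
 proof
 fix x assume "x : {x. conv f rho x ~= 0}"
 then obtain y where y: "f y ~= 0" "rho (x - y) ~= 0" using conv_supp[of f rho x] by auto
 have "norm (x - y) < r/2" using y(2) rho(3)[of "x - y"] by force
 moreover obtain z where z: "z : K" "dist z y <= r/2" using y(1) by (auto simp: f_def K1_def indicator_def split: if_splits)
 ultimately have "dist z x <= r" using dist_triangle[of z x y] by (simp add: dist_norm norm_minus_commute)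
 with z show "x : K2" unfolding K2_def by auto qed
 show ?thesis
 proof (rule that[of "conv f rho"])
 have "closure {x. conv f rho x ~= 0} <= K2" using supp K12 compact_imp_closed closure_minimal by blast
 thus "conv f rho : test_functions U" unfolding test_functions_def using r(2) csupp_conv[OF csf csrho] Ck_conv[OF if' rho(1) csrho] by (auto simp: csupp_iff K2_def)
 show "0 <= conv f rho x" for x unfolding conv_def using rho(2) by (intro bi_integral_nonneg) (simp add: f_def)
 have "conv f rho x <= (LINT y|lebesgue. rho (x - y))" for x unfolding conv_def using rho(2)
 by (intro bi_integral_mono conv_integrable[OF if' crho csrho] irho) (simp add: f_def indicator_def)
 thus "conv f rho x <= 1" for x using one by simp
 fix x assume x: "x : K"
 have "f y * rho (x - y) = rho (x - y)" for y
 proof (cases "y : K1")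
 case False
 hence "r/2 <= norm (x - y)" using x by (auto simp: K1_def dist_norm)
 thus ?thesis using rho(3) by simp qed (simp add: f_def)
 thus "conv f rho x = 1" by (simp only: conv_def one) qed qed

section \<open>Lebesgue and square integrable functions\<close>

lemma compact_sets_leb: "compact K ==> K : sets lebesgue" using lmeasurable_compact by blast

lemma test_functions_mono: "U <= U' ==> test_functions U <= test_functions U'" unfolding test_functions_def by blast

lemma tf_bounds:
 assumes "psi : test_functions U" shows "continuous_on UNIV psi" "csupp psi" "compact (closure {x. psi x ~= 0})" "closure {x. psi x ~= 0} <= U"
 "Ck k psi" "psi x ~= 0 ==> x : closure {x. psi x ~= 0}" using assms subsetD[OF closure_subset, of x "{x. psi x ~= 0}"] Ck_continuous[of 0 psi]
 by (auto simp: test_functions_def csupp_iff)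

lemma borel_measurable_lebesgue_onI: "f : bmeas lebesgue ==> f : bmeas (leb S)" by (rule measurable_restrict_space1)

lemma cont_measurable_leb:
 fixes f :: "'a::euclidean_space => real"
 assumes "continuous_on UNIV f" shows "f : bmeas lebesgue" "f : bmeas (leb S)"
 using measurable_lebesgueI[OF borel_measurable_continuous_onI[OF assms]] borel_measurable_lebesgue_onI by blast+

lemma integral_leb_eq:
 fixes f :: "'a::euclidean_space => real"
 assumes "S : sets lebesgue" shows "integral\<^sup>L (leb S) f = (LINT x|lebesgue. indicator S x * f x)" using assms by (simp add: integral_restrict_space)

lemma integrable_leb_eq:
 fixes f :: "'a::euclidean_space => real"
 assumes "S : sets lebesgue" shows "integrable (leb S) f \<longleftrightarrow> integrable lebesgue (%x. indicator S x * f x)"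
 using assms by (simp add: integrable_restrict_space)

text \<open>Cut-offs of shrinking neighbourhoods show that f has zero integral over every compact
  subset of U. Inner regularity then excludes a positivity set of positive measure, for f and for
  -f.\<close>

lemma fundamental_lemma:
 fixes f :: "'a::euclidean_space => real"
 assumes U: "open U"
 and int: "!!K. compact K ==> K <= U ==> integrable (leb K) f"
 and zero: "!!psi. psi : test_functions U ==> (LINT x|leb U. f x * psi x) = 0" shows "AE x in lebesgue. x : U --> f x = 0"
proof -
 have Um: "U : sets lebesgue" using U by simp
 have K0: "(LINT x|leb K. f x) = 0" if K: "compact K" "K <= U" for K
 proof -
 have Km: "K : sets lebesgue" using K compact_sets_leb by blast
 obtain r where r: "r > 0" "(\<Union>x\<in>K. cball x r) <= U" using compact_subset_open_imp_cball_epsilon_subset[OF K(1) U K(2)] by blast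
 define Kr where "Kr = (\<Union>x\<in>K. cball x r)"
 have Kr: "compact Kr" "Kr <= U" unfolding Kr_def using compact_minkowski_sum_cball[OF K(1)] r(2) by auto
 \<comment> \<open>Neighbourhoods shrinking to K, all inside the compact set \<open>Kr\<close> where
   f is integrable; their cut-offs converge pointwise to the indicator of K.\<close>
 define V where "V n = (\<Union>x\<in>K. ball x (r / Suc n))" for n :: nat
 have V: "open (V n)" "K <= V n" "V n <= Kr" for n
 proof -
 show "open (V n)" unfolding V_def by blast
 show "K <= V n" unfolding V_def using r(1) by force
 have "r / Suc n <= r" using r(1) by (simp add: field_simps)
 thus "V n <= Kr" unfolding V_def Kr_def by fastforce qed
 have "EX c. c : test_functions (V n) & (ALL x. 0 <= c x & c x <= 1) & (ALL x:K. c x = 1)" for n using test_cutoff[OF K(1) V(2,1)] by metis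
 then obtain c where c: "!!n. c n : test_functions (V n)" "!!n x. 0 <= c n x" "!!n x. c n x <= 1" "!!n x. x : K ==> c n x = 1" by metis
 have c0: "c n x = 0" if "x ~: V n" for n x using tf_bounds(4,6)[OF c(1)] that by blast
 have cU: "c n : test_functions U" for n using c(1) test_functions_mono[of "V n" U] V(3) Kr(2) by blast
 have iK: "integrable lebesgue (%x. indicator Kr x * f x)" using int[OF Kr] integrable_leb_eq compact_sets_leb[OF Kr(1)] by blast
 have m: "(%x. indicator Kr x * f x * c n x) : bmeas lebesgue" for n using borel_measurable_integrable[OF iK] cont_measurable_leb(1)[OF tf_bounds(1)[OF c(1)]]
 by (rule borel_measurable_times)
 have lim: "(%n. LINT x|lebesgue. indicator Kr x * f x * c n x) ----> (LINT x|lebesgue. indicator K x * (indicator Kr x * f x))"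
 proof (rule integral_dominated_convergence)
 show "(%x. indicator K x * (indicator Kr x * f x)) : bmeas lebesgue" using borel_measurable_times[OF borel_measurable_indicator[OF Km] borel_measurable_integrable[OF iK]] .
 show "integrable lebesgue (%x. abs(indicator Kr x * f x))" using iK by (rule integrable_abs)
 show "AE x in lebesgue. (%n. indicator Kr x * f x * c n x) ----> indicator K x * (indicator Kr x * f x)"
 proof (rule AE_I2)
 fix x
 have "(%n. c n x) ----> indicator K x"
 proof (cases "x : K")
 case False
 have "\<forall>\<^sub>F n in sequentially. c n x = 0"
 proof -
 have "EX e>0. ball x e <= - K" using open_contains_ball[of "- K"] compact_imp_closed[OF K(1)] False by (auto simp: open_Compl)
 then obtain e where e: "e > 0" "ball x e <= - K" by blast
 obtain N where N: "r / Suc N < e" using e(1) r(1) reals_Archimedean[of "e / r"] by (auto simp: field_simps)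
 have "x ~: V n" if "N <= n" for n
 proof
 assume "x : V n"
 then obtain y where y: "y : K" "dist y x < r / Suc n" unfolding V_def by auto
 have "r / Suc n <= r / Suc N" using r(1) that by (intro divide_left_mono) auto
 hence "y : ball x e" using y(2) N by (simp add: dist_commute)
 thus False using y(1) e(2) by blast qed
 thus ?thesis using c0 unfolding eventually_sequentially by blast qed
 thus ?thesis using False by (simp add: tendsto_eventually) qed (simp add: c(4))
 thus "(%n. indicator Kr x * f x * c n x) ----> indicator K x * (indicator Kr x * f x)"
 using tendsto_mult_left[of "%n. c n x" "indicator K x" sequentially "indicator Kr x * f x"] by (simp add: mult.commute) qed
 show "AE x in lebesgue. norm (indicator Kr x * f x * c n x) <= abs(indicator Kr x * f x)" for n
 proof (rule AE_I2)
 fix x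
 have "abs(indicator Kr x * f x) * abs(c n x) <= abs(indicator Kr x * f x) * 1" using c(2,3)[of n x] by (intro mult_left_mono) auto
 thus "norm (indicator Kr x * f x * c n x) <= abs(indicator Kr x * f x)" by (simp add: abs_mult) qed qed (rule m)
 have "(LINT x|lebesgue. indicator Kr x * f x * c n x) = 0" for n
 proof -
 have "indicator Kr x * f x * c n x = indicator U x * (f x * c n x)" for x using c0[of x n] V(3)[of n] Kr(2) by (cases "c n x = 0") (auto simp: indicator_def)
 hence "(LINT x|lebesgue. indicator Kr x * f x * c n x) = (LINT x|leb U. f x * c n x)" by (simp only: integral_leb_eq[OF Um])
 thus ?thesis using zero[OF cU] by simp qed
 hence "(LINT x|lebesgue. indicator K x * (indicator Kr x * f x)) = 0" using lim by (simp only: LIMSEQ_const_iff)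
 moreover have "indicator K x * (indicator Kr x * f x) = indicator K x * f x" for x using V(2,3)[of 0] by (auto simp: indicator_def)
 ultimately show ?thesis by (simp add: integral_leb_eq[OF Km]) qed
 have pos: "AE x in lebesgue. x : C --> \<not> g x > 0"
 if C: "compact C" "C <= U" and g: "!!K. compact K ==> K <= U ==> integrable (leb K) g & (LINT x|leb K. g x) = 0"
 for C and g :: "'a => real"
 proof -
 define A where "A = {x:C. g x > 0}"
 have gm: "g : bmeas (leb C)" using g[OF C] by auto
 have Cm: "C : sets lebesgue" using C compact_sets_leb by blast
 have "{x : space (leb C). g x > 0} : sets (leb C)" using gm by measurable
 hence Am: "A : sets lebesgue" using Cm by (simp add: A_def sets_restrict_space_iff space_restrict_space)
 have "A : null_sets lebesgue"
 proof (rule ccontr)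
 assume nn: "A ~: null_sets lebesgue"
 have Al: "A : lmeasurable" using Am bounded_set_imp_lmeasurable[of A] C(1) compact_imp_bounded bounded_subset[of C A] by (auto simp: A_def)
 define \<mu> where "\<mu> = measure lebesgue A"
 have \<mu>: "\<mu> > 0" using nn Al unfolding \<mu>_def by (metis negligible_iff_measure negligible_iff_null_sets measure_nonneg less_le)
 \<comment> \<open>K misses less than the full measure of A. On K the function g is positive with
   zero integral, so K is null and A - K has the full measure: a contradiction.\<close>
 obtain K where K: "closed K" "K <= A" "A - K : lmeasurable" "emeasure lebesgue (A - K) < ennreal \<mu>" using sets_lebesgue_inner_closed[OF Am, of \<mu>] \<mu> by auto
 have Kc: "compact K" using K(1,2) C(1) compact_imp_bounded bounded_subset[of C K] by (auto simp: A_def compact_eq_bounded_closed)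
 have KU: "K <= U" using K(2) C(2) by (auto simp: A_def)
 have Km: "K : sets lebesgue" using compact_sets_leb[OF Kc] .
 have gK: "integrable (leb K) g" "(LINT x|leb K. g x) = 0" using g[OF Kc KU] by auto
 have "AE x in leb K. g x = 0"
 using gK K(2) by (subst integral_nonneg_eq_0_iff_AE[OF gK(1), symmetric]) (auto simp: A_def AE_restrict_space_iff Km less_imp_le subset_eq intro!: AE_I2)
 hence "AE x in lebesgue. x ~: K" using K(2) by (auto simp: AE_restrict_space_iff Km A_def elim!: eventually_mono)
 hence "K : null_sets lebesgue" using completion.AE_iff_null_sets[of "%x. x ~: K" lborel] by simp
 hence "measure lebesgue (A - K) = \<mu>" unfolding \<mu>_def using Al by (simp add: measure_Diff_null_set fmeasurableD)
 hence "emeasure lebesgue (A - K) = ennreal \<mu>" using K(3) by (simp add: emeasure_eq_measure2)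
 thus False using K(4) by simp qed
 hence "AE x in lebesgue. x ~: A" by (rule AE_not_in)
 thus ?thesis by (auto simp: A_def elim!: eventually_mono) qed
 have "EX C :: nat => 'a set. (ALL n. compact (C n) & C n <= U) & \<Union>(range C) = U"
 proof (rule open_Union_compact_subsets[OF U])
 fix C :: "nat => 'a set" assume "!!n. compact (C n)" "!!n. C n <= U" "\<Union>(range C) = U"
 thus ?thesis by (intro exI[of _ C]) simp qed
 then obtain C :: "nat => 'a set" where C: "!!n. compact (C n)" "!!n. C n <= U" "\<Union>(range C) = U" by (elim exE conjE) metis
 have "AE x in lebesgue. x : C n --> f x = 0" for n
 proof -
 have "AE x in lebesgue. x : C n --> \<not> f x > 0" by (rule pos[OF C(1,2)]) (use int K0 in auto)
 moreover have "AE x in lebesgue. x : C n --> \<not> - f x > 0" by (rule pos[OF C(1,2)]) (use int K0 in auto)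
 ultimately show ?thesis by eventually_elim auto qed
 hence "AE x in lebesgue. ALL n. x : C n --> f x = 0" by (intro AE_all_countable[THEN iffD2] allI)
 thus ?thesis by (rule eventually_mono) (use C(3) in blast) qed

section \<open>Calculus of square integrable functions\<close>

definition nrm2 :: "'m measure => ('m => real) => real" where
 "nrm2 M f = sqrt (LINT x|M. (f x)\<^sup>2)"

definition sqint :: "'m measure => ('m => real) => bool" where
 "sqint M f \<longleftrightarrow> f : bmeas M & integrable M (%x. (f x)\<^sup>2)"

lemma nrm2_nonneg [simp]: "0 <= nrm2 M f" by (simp add: nrm2_def)

lemma nrm2_square: "(nrm2 M f)\<^sup>2 = (LINT x|M. (f x)\<^sup>2)" by (simp add: nrm2_def)

lemma sqint_mult:
 assumes "sqint M f" "sqint M g" shows "integrable M (%x. f x * g x)"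
proof (rule bi_integrable_bound)
 show "integrable M (%x. (f x)\<^sup>2 + (g x)\<^sup>2)" using assms by (simp add: sqint_def)
 show "(%x. f x * g x) : bmeas M" using assms by (simp add: sqint_def borel_measurable_times)
 have "abs(a * b) <= abs(a\<^sup>2 + b\<^sup>2)" for a b :: real
 proof -
 have "0 <= (abs(a) - abs(b))\<^sup>2" by simp
 hence "2 * (abs(a) * abs(b)) <= a\<^sup>2 + b\<^sup>2" by (simp add: power2_diff)
 moreover have "0 <= abs(a) * abs(b)" by simp
 ultimately show ?thesis unfolding abs_mult by linarith qed
 thus "AE x in M. norm (f x * g x) <= norm ((f x)\<^sup>2 + (g x)\<^sup>2)" by simp qed

lemma sqint_add:
 assumes "sqint M f" "sqint M g" shows "sqint M (%x. f x + g x)"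
 using sqint_mult[OF assms] assms by (auto simp add: sqint_def power2_sum mult.assoc intro!: borel_measurable_add)

lemma sqint_diff:
 assumes "sqint M f" "sqint M g" shows "sqint M (%x. f x - g x)"
 using sqint_mult[OF assms] assms by (auto simp add: sqint_def power2_diff mult.assoc intro!: borel_measurable_diff)

lemma sqint_bounded_mult:
 assumes "sqint M f" "c : bmeas M" "AE x in M. abs(c x) <= B" shows "sqint M (%x. c x * f x)" unfolding sqint_def
proof
 show "(%x. c x * f x) : bmeas M" using assms by (simp add: sqint_def borel_measurable_times)
 show "integrable M (%x. (c x * f x)\<^sup>2)"
 proof (rule bi_integrable_bound)
 show "integrable M (%x. B\<^sup>2 * (f x)\<^sup>2)" using assms by (simp add: sqint_def)
 show "(%x. (c x * f x)\<^sup>2) : bmeas M" using assms by (auto simp add: sqint_def intro!: borel_measurable_power borel_measurable_times)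
 show "AE x in M. norm ((c x * f x)\<^sup>2) <= norm (B\<^sup>2 * (f x)\<^sup>2)"
 using assms(3) by (rule eventually_mono) (auto simp: power_mult_distrib abs_le_square_iff[symmetric] intro!: mult_right_mono) qed qed

lemma sqint_cauchy_schwarz:
 assumes f: "sqint M f" and g: "sqint M g" shows "(LINT x|M. abs(f x * g x)) <= nrm2 M f * nrm2 M g"
proof (rule field_le_epsilon)
 fix e :: real assume e: "0 < e"
 define a b where "a = nrm2 M f" and "b = nrm2 M g"
 have ab: "0 <= a" "0 <= b" by (simp_all add: a_def b_def)
 \<comment> \<open>The optimal weight b / a in the inequality of arithmetic and geometric means is
   perturbed by d, so that vanishing norms need no separate case; the cost d (a + b) stays below
   e.\<close>
 define d where "d = e / (a + b + 1)"
 have d: "0 < d" using ab e by (simp add: d_def)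
 define t where "t = (b + d) / (a + d)"
 have t: "0 < t" using ab d by (simp add: t_def)
 have "2 * abs(f x * g x) <= t * (f x)\<^sup>2 + (g x)\<^sup>2 / t" for x
 proof -
 have "0 <= (t * abs(f x) - abs(g x))\<^sup>2 / t" using t by simp
 also have "... = t * (f x)\<^sup>2 + (g x)\<^sup>2 / t - 2 * abs(f x * g x)" using t by (simp add: power2_diff field_simps power2_eq_square abs_mult)
 finally show ?thesis by simp qed
 hence "(LINT x|M. 2 * abs(f x * g x)) <= (LINT x|M. t * (f x)\<^sup>2 + (g x)\<^sup>2 / t)" using f g sqint_mult[OF f g] by (intro bi_integral_mono) (auto simp: sqint_def)
 also have "... = t * a\<^sup>2 + b\<^sup>2 / t" using f g by (simp add: sqint_def a_def b_def nrm2_square)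
 also have "t * a\<^sup>2 <= (b + d) * a"
 proof -
 have "a\<^sup>2 <= a * (a + d)" using ab d by (simp add: power2_eq_square mult_left_mono)
 hence "t * a\<^sup>2 <= t * (a * (a + d))" using t by (simp add: mult_left_mono)
 also have "... = (b + d) * a" using ab d by (simp add: t_def add_nonneg_eq_0_iff)
 finally show ?thesis . qed
 also have "b\<^sup>2 / t <= b * (a + d)"
 proof -
 have "b\<^sup>2 / t = b * (a + d) * (b / (b + d))" using ab d by (simp add: t_def power2_eq_square)
 also have "... <= b * (a + d) * 1" using ab d by (intro mult_left_mono) auto
 finally show ?thesis by simp qed
 finally have "2 * (LINT x|M. abs(f x * g x)) <= 2 * (a * b) + d * (a + b)" by (simp add: algebra_simps)
 also have "d * (a + b) <= e"
 proof -
 have "d * (a + b) <= d * (a + b + 1)" using d by (intro mult_left_mono) auto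
 also have "... = e" using ab by (simp add: d_def add_nonneg_eq_0_iff)
 finally show ?thesis . qed
 finally show "(LINT x|M. abs(f x * g x)) <= nrm2 M f * nrm2 M g + e" using e by (simp add: a_def b_def) qed

lemma sqint_cauchy_schwarz':
 assumes f: "sqint M f" and g: "sqint M g" shows "abs(LINT x|M. f x * g x) <= nrm2 M f * nrm2 M g"
 using sqint_cauchy_schwarz[OF assms] integral_abs_bound[of M "%x. f x * g x"] by linarith

lemma nrm2_triangle:
 assumes f: "sqint M f" and g: "sqint M g" shows "nrm2 M (%x. f x + g x) <= nrm2 M f + nrm2 M g"
proof (rule power2_le_imp_le)
 have "(nrm2 M (%x. f x + g x))\<^sup>2 = (LINT x|M. (f x)\<^sup>2) + (LINT x|M. (g x)\<^sup>2) + 2 * (LINT x|M. f x * g x)"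
 using f g sqint_mult[OF f g] by (simp add: nrm2_square power2_sum sqint_def mult.assoc)
 also have "... <= (nrm2 M f + nrm2 M g)\<^sup>2" using sqint_cauchy_schwarz'[OF f g] by (simp add: power2_sum nrm2_square)
 finally show "(nrm2 M (%x. f x + g x))\<^sup>2 <= (nrm2 M f + nrm2 M g)\<^sup>2" . qed simp

lemma nrm2_triangle_diff:
 assumes "sqint M f" "sqint M g" "sqint M h" shows "nrm2 M (%x. f x - h x) <= nrm2 M (%x. f x - g x) + nrm2 M (%x. g x - h x)"
 using nrm2_triangle[OF sqint_diff[OF assms(1,2)] sqint_diff[OF assms(2,3)]] by simp

lemma nrm2_minus_commute: "nrm2 M (%x. f x - g x) = nrm2 M (%x. g x - f x)" by (simp add: nrm2_def power2_commute)

lemma nrm2_cong_AE: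
 assumes "f : bmeas M" "g : bmeas M" "AE x in M. f x = g x" shows "nrm2 M f = nrm2 M g" unfolding nrm2_def
 by (rule arg_cong[where f=sqrt], rule integral_cong_AE) (use assms in "auto elim: eventually_mono")

text \<open>Completeness of Lebesgue measure: the exceptional null set is removed and restored
  without affecting measurability.\<close>

lemma measurable_AE_limit:
 fixes f :: "nat => 'a::euclidean_space => real"
 assumes S: "S : sets lebesgue" and f: "!!n. f n : bmeas (leb S)"
 and lim: "AE x in leb S. (%n. f n x) ----> g x" shows "g : bmeas (leb S)"
proof -
 obtain N where N: "!!x. x : S - N ==> (%n. f n x) ----> g x" "N : null_sets (leb S)" using AE_E3[OF lim] by (auto simp: space_restrict_space)
 have "f n : bmeas (leb (S - N))" for n using f borel_measurable_diff_null[OF N(2) S] by blast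
 hence "g : bmeas (leb (S - N))" by (rule borel_measurable_LIMSEQ_real[rotated]) (use N(1) in "simp add: space_restrict_space")
 thus ?thesis using borel_measurable_diff_null[OF N(2) S] by blast qed

section \<open>Compositions with vector-valued measurable functions\<close>

lemma simple_comp_measurable:
 fixes H :: "'a => 'b => real"
 assumes s: "simple_function M s" and H: "!!y. (%x. H x y) : bmeas M" shows "(%x. H x (s x)) : bmeas M"
proof -
 have fin: "finite (s ` space M)" and set: "!!y. s -` {y} \<inter> space M : sets M" using simple_functionD[OF s] by auto
 have "H x (s x) = (\<Sum>y\<in>s ` space M. indicator (s -` {y} \<inter> space M) x * H x y)" if "x : space M" for x
 proof -
 have "(\<Sum>y\<in>s ` space M. indicator (s -` {y} \<inter> space M) x * H x y) = (\<Sum>y\<in>s ` space M. if y = s x then H x y else 0)"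
 by (intro sum.cong) (use that in "auto simp: indicator_def")
 also have "... = H x (s x)" using fin that by simp
 finally show ?thesis by simp qed
 moreover have "(%x. \<Sum>y\<in>s ` space M. indicator (s -` {y} \<inter> space M) x * H x y) : bmeas M"
 by (intro borel_measurable_sum borel_measurable_times H borel_measurable_indicator set)
 ultimately show ?thesis by (subst measurable_cong) auto qed

text \<open>A Caratheodory argument. Along a simple function only finitely many slices of H matter;
  continuity in the second argument carries the claim to the limit. Forms applied to V-valued
  functions become measurable in this way.\<close>

lemma strong_comp_measurable:
 fixes H :: "'a::euclidean_space => 'b::real_normed_vector => real"
 assumes S: "S : sets lebesgue" and f: "strongly_measurable (leb S) f"
 and H: "!!y. (%x. H x y) : bmeas (leb S)"
 and cont: "!!x. x : S ==> isCont (H x) (f x)" shows "(%x. H x (f x)) : bmeas (leb S)"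
proof -
 obtain s where s: "!!n::nat. simple_function (leb S) (s n)" "AE t in leb S. (%n. s n t) ----> f t" using f unfolding strongly_measurable_def by blast
 show ?thesis
 proof (rule measurable_AE_limit[OF S])
 show "(%x. H x (s n x)) : bmeas (leb S)" for n by (rule simple_comp_measurable[OF s(1) H])
 show "AE x in leb S. (%n. H x (s n x)) ----> H x (f x)" using s(2) by (rule AE_mp) (auto intro!: AE_I2 isCont_tendsto_compose[OF cont] simp: space_restrict_space) qed qed

lemma strongly_measurable_Pair:
 assumes "strongly_measurable M f" "strongly_measurable M g" shows "strongly_measurable M (%x. (f x, g x))"
proof -
 obtain s where s: "!!n::nat. simple_function M (s n)" "AE t in M. (%n. s n t) ----> f t" using assms(1) unfolding strongly_measurable_def by blast
 obtain s' where s': "!!n::nat. simple_function M (s' n)" "AE t in M. (%n. s' n t) ----> g t" using assms(2) unfolding strongly_measurable_def by blast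
 show ?thesis unfolding strongly_measurable_def
 proof (intro exI[of _ "%n x. (s n x, s' n x)"] conjI allI)
 show "AE t in M. (%n. (s n t, s' n t)) ----> (f t, g t)" using s(2) s'(2) by eventually_elim (rule tendsto_Pair) qed (use s s' in auto) qed

lemma strongly_measurable_norm:
 assumes "S : sets lebesgue" "strongly_measurable (leb S) f" shows "(%x. norm (f x)) : bmeas (leb S)"
 by (rule strong_comp_measurable[OF assms]) (auto intro!: continuous_intros)

text \<open>Inner and outer regularity enclose E between a compact K and an open V with V - K small;
  a cut-off between them differs from the indicator at most on V - K.\<close>

lemma indicator_approx:
 fixes E :: "'a::euclidean_space set"
 assumes E: "E : sets lebesgue" "bounded E" and e: "0 < e"
 obtains phi :: "'a => real" where "continuous_on UNIV phi" "csupp phi" "!!x. 0 <= phi x" "!!x. phi x <= 1"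
 "(LINT x|lebesgue. abs(indicator E x - phi x)) < e"
proof -
 obtain K where K: "closed K" "K <= E" "E - K : lmeasurable" "emeasure lebesgue (E - K) < ennreal (e / 2)" using sets_lebesgue_inner_closed[OF E(1), of "e / 2"] e by auto
 obtain V where V: "open V" "E <= V" "V - E : lmeasurable" "emeasure lebesgue (V - E) < ennreal (e / 2)" using sets_lebesgue_outer_open[OF E(1), of "e / 2"] e by auto
 have "compact K" using K(1) bounded_subset[OF E(2) K(2)] by (simp add: compact_eq_bounded_closed)
 have "K <= V" using K V by blast
 obtain phi where phi: "phi : test_functions V" "!!x. 0 <= phi x" "!!x. phi x <= 1" "!!x. x : K ==> phi x = 1"
 using test_cutoff[OF \<open>compact K\<close> \<open>K <= V\<close> V(1)] by metis
 have phi0: "phi x = 0" if "x ~: V" for x using tf_bounds(4,6)[OF phi(1)] that by blast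
 have VK: "V - K = (V - E) \<union> (E - K)" using K V by blast
 have "V - K : lmeasurable" unfolding VK using K V by (intro fmeasurable.Un)
 have le: "abs(indicator E x - phi x) <= indicator (V - K) x" for x using phi(2,3,4)[of x] phi0[of x] K(2) V(2) by (auto simp: indicator_def)
 have cs: "continuous_on UNIV phi" "csupp phi" using tf_bounds[OF phi(1)] by auto
 have El: "E : lmeasurable" using E bounded_set_imp_lmeasurable by blast
 have iE: "integrable lebesgue (indicator E :: 'a => real)" using El lmeasurable_iff_integrable by blast
 have "(LINT x|lebesgue. abs(indicator E x - phi x)) <= (LINT x|lebesgue. indicator (V - K) x)"
 proof (rule bi_integral_mono)
 show "integrable lebesgue (%x. abs(indicator E x - phi x))" using iE csupp_integrable(2)[OF cs] by (intro integrable_abs bi_integrable_diff)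
 show "integrable lebesgue (indicator (V - K) :: 'a => real)" using \<open>V - K : lmeasurable\<close> lmeasurable_iff_integrable by blast qed (rule le)
 also have "... = measure lebesgue (V - K)" by simp
 also have "... <= measure lebesgue (V - E) + measure lebesgue (E - K)" unfolding VK using K V by (intro measure_Un_le fmeasurableD)
 also have "... < e / 2 + e / 2" using K(3,4) V(3,4) by (intro add_strict_mono) (auto simp: emeasure_eq_measure2 ennreal_less_iff)
 finally have "(LINT x|lebesgue. abs(indicator E x - phi x)) < e" by simp
 thus ?thesis using that cs phi by blast qed

section \<open>Density of continuous functions in Bochner spaces\<close>

lemma powr_add_le:
 fixes a b p :: real
 assumes "0 <= a" "0 <= b" "0 <= p" shows "(a + b) powr p <= 2 powr p * (a powr p + b powr p)"
proof -
 have "(a + b) powr p <= (2 * max a b) powr p" using assms by (intro powr_mono2) auto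
 also have "... = 2 powr p * max a b powr p" using assms by (simp add: powr_mult)
 also have "max a b powr p <= a powr p + b powr p" by (simp add: max_def)
 finally show ?thesis by (simp add: mult_left_mono) qed

lemma powr_integrable_diff:
 fixes f c :: "'a::euclidean_space => 'b::real_normed_vector"
 assumes "1 <= p" "integrable M (%x. norm (f x) powr p)" "integrable M (%x. norm (c x) powr p)"
 and m: "(%x. norm (f x - c x)) : bmeas M" shows "integrable M (%x. norm (f x - c x) powr p)"
 "(LINT x|M. norm (f x - c x) powr p) <= 2 powr p * ((LINT x|M. norm (f x) powr p) + (LINT x|M. norm (c x) powr p))"
proof -
 have le: "norm (f x - c x) powr p <= 2 powr p * (norm (f x) powr p + norm (c x) powr p)" for x
 using powr_mono2[OF _ _ norm_triangle_ineq4, of p "f x" "c x"] powr_add_le[of "norm (f x)" "norm (c x)" p] assms(1) by simp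
 have i: "integrable M (%x. 2 powr p * (norm (f x) powr p + norm (c x) powr p))" using assms by simp
 have m': "(%x. norm (f x - c x) powr p) : bmeas M" using m by (intro powr_real_measurable) auto
 show i2: "integrable M (%x. norm (f x - c x) powr p)" by (rule bi_integrable_bound[OF i m']) (use le in "auto intro!: AE_I2 order_trans[OF le]")
 have "(LINT x|M. norm (f x - c x) powr p) <= (LINT x|M. 2 powr p * (norm (f x) powr p + norm (c x) powr p))" by (intro bi_integral_mono i i2 le)
 also have "... = 2 powr p * ((LINT x|M. norm (f x) powr p) + (LINT x|M. norm (c x) powr p))" using assms by simp
 finally show "(LINT x|M. norm (f x - c x) powr p) <= 2 powr p * ((LINT x|M. norm (f x) powr p) + (LINT x|M. norm (c x) powr p))" . qed

text \<open>Two stages: truncated simple functions approximate f by dominated convergence, and then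
  each of the finitely many level sets has its indicator replaced by a continuous cut-off.\<close>

lemma Lp_continuous_dense:
 fixes f :: "'a::euclidean_space => 'b::real_normed_vector"
 assumes p: "1 <= p" and f: "strongly_measurable lebesgue f" and S: "bounded S" "!!x. x ~: S ==> f x = 0"
 and int: "integrable lebesgue (%x. norm (f x) powr p)" and e: "0 < e"
 obtains c where "continuous_on UNIV c" "csupp c" "integrable lebesgue (%x. norm (f x - c x) powr p)"
 "(LINT x|lebesgue. norm (f x - c x) powr p) < e"
proof -
 have f': "strongly_measurable (leb UNIV) f" using f by (simp add: lebesgue_on_UNIV_eq)
 obtain s where s: "!!n::nat. simple_function lebesgue (s n)" "AE t in lebesgue. (%n. s n t) ----> f t" using f unfolding strongly_measurable_def by blast
 have nf: "(%x. norm (f x)) : bmeas lebesgue" using strongly_measurable_norm[OF _ f'] by (simp add: lebesgue_on_UNIV_eq)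
 \<comment> \<open>Truncation at 2 |f| gives a majorant and forces the simple functions to vanish
   where f does, so their level sets are bounded. The factor 2 ensures that the truncation is
   eventually inactive wherever f is nonzero.\<close>
 define t where "t n x = (if norm (s n x) <= 2 * norm (f x) then s n x else 0)" for n x
 have ns: "(%x. norm (s n x)) : bmeas lebesgue" for n by (rule simple_comp_measurable[OF s(1)]) simp
 have t: "simple_function lebesgue (t n)" for n unfolding t_def[abs_def]
 proof (rule simple_function_If[OF s(1)])
 show "{x : space lebesgue. norm (s n x) <= 2 * norm (f x)} : sets lebesgue" using ns nf by (intro borel_measurable_le borel_measurable_times) auto qed simp
 have t0: "t n x = 0" if "f x = 0" for n x using that by (simp add: t_def)
 have tm: "(%x. norm (f x - t n x)) : bmeas lebesgue" for n
 using strong_comp_measurable[OF _ f', of "%x y. norm (y - t n x)"] simple_comp_measurable[OF t, of "%x y'. norm (_ - y')"] by (simp add: lebesgue_on_UNIV_eq)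
 have tn: "norm (t n x) <= 2 * norm (f x)" for n x by (simp add: t_def)
 have tnp: "norm (t n x) powr p <= 2 powr p * norm (f x) powr p" for n x using powr_mono2[OF _ _ tn, of p n x] p by (simp add: powr_mult)
 have itp: "integrable lebesgue (%x. norm (t n x) powr p)" for n
 proof (rule bi_integrable_bound)
 show "integrable lebesgue (%x. 2 powr p * norm (f x) powr p)" using int by simp
 show "(%x. norm (t n x) powr p) : bmeas lebesgue" by (rule simple_comp_measurable[OF t]) simp qed (use tnp in auto)
 have "(%n. LINT x|lebesgue. norm (f x - t n x) powr p) ----> (LINT x::'a|lebesgue. 0)"
 proof (rule integral_dominated_convergence)
 show "integrable lebesgue (%x. 3 powr p * norm (f x) powr p)" using int by simp
 show "(%x. norm (f x - t n x) powr p) : bmeas lebesgue" for n using tm by (intro powr_real_measurable) auto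
 show "AE x in lebesgue. norm (norm (f x - t n x) powr p) <= 3 powr p * norm (f x) powr p" for n
 proof (rule AE_I2)
 fix x
 have "norm (f x - t n x) <= 3 * norm (f x)" using norm_triangle_ineq4[of "f x" "t n x"] tn[of n x] by linarith
 thus "norm (norm (f x - t n x) powr p) <= 3 powr p * norm (f x) powr p" using powr_mono2[of p "norm (f x - t n x)" "3 * norm (f x)"] p by (simp add: powr_mult) qed
 show "AE x in lebesgue. (%n. norm (f x - t n x) powr p) ----> 0" using s(2)
 proof (rule eventually_mono)
 fix x assume lim: "(%n. s n x) ----> f x"
 have "(%n. t n x) ----> f x"
 proof (cases "f x = 0")
 case False
 have "\<forall>\<^sub>F n in sequentially. norm (s n x) < 2 * norm (f x)" using tendsto_norm[OF lim] False by (intro order_tendstoD(2)) auto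
 hence "\<forall>\<^sub>F n in sequentially. s n x = t n x" by eventually_elim (simp add: t_def)
 thus ?thesis by (rule Lim_transform_eventually[OF lim]) qed (simp add: t0)
 hence "(%n. norm (f x - t n x)) ----> 0" using tendsto_norm_zero[OF LIM_zero[of "%n. t n x"]] by (simp add: norm_minus_commute)
 thus "(%n. norm (f x - t n x) powr p) ----> 0" using tendsto_powr'[of "%n. norm (f x - t n x)" 0 sequentially "%_. p" p] p by simp qed qed simp
 hence lim0: "(%n. LINT x|lebesgue. norm (f x - t n x) powr p) ----> 0" by simp
 \<comment> \<open>The two stages are combined by the inequality with constant 2^p, hence this share
   of e.\<close>
 define eps where "eps = e / (2 * 2 powr p)"
 have eps: "eps > 0" using e by (simp add: eps_def)
 obtain n where n: "(LINT x|lebesgue. norm (f x - t n x) powr p) < eps" using order_tendstoD(2)[OF lim0 eps] unfolding eventually_sequentially by blast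
 define Y where "Y = t n ` UNIV - {0}"
 have Y: "finite Y" unfolding Y_def using t[of n] by (simp add: simple_function_def)
 define E where "E y = t n -` {y}" for y
 have E: "E y : sets lebesgue" "bounded (E y)" if "y : Y" for y
 proof -
 show "E y : sets lebesgue" using t[of n] that by (auto simp: simple_function_def E_def Y_def)
 have "E y <= S" using that S(2) t0 by (force simp: E_def Y_def)
 thus "bounded (E y)" using S(1) bounded_subset by blast qed
 have trep: "t n x = (\<Sum>y\<in>Y. indicator (E y) x *\<^sub>R y)" for x
 proof -
 have "(\<Sum>y\<in>Y. indicator (E y) x *\<^sub>R y) = (\<Sum>y\<in>Y. if y = t n x then y else 0)" by (intro sum.cong) (auto simp: E_def indicator_def)
 also have "... = t n x" using Y by (auto simp: Y_def)
 finally show ?thesis by simp qed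
 \<comment> \<open>Dividing by B makes the weighted sum of indicator errors at most 1, where the
   p-th power is below the first power. The L^p error is thus controlled by the L^1 errors of the
   cut-offs, and delta compensates the factor B^p.\<close>
 define B where "B = 1 + (\<Sum>y\<in>Y. norm y)"
 have B: "B >= 1" unfolding B_def by (simp add: sum_nonneg)
 define \<delta> where "\<delta> = eps / (B powr p)"
 have \<delta>: "\<delta> > 0" using eps B by (simp add: \<delta>_def)
 have "ALL y:Y. EX phi. continuous_on UNIV phi & csupp phi & (ALL x. 0 <= phi x & phi x <= 1) & (LINT x|lebesgue. abs(indicator (E y) x - phi x)) < \<delta>"
 using indicator_approx[OF E \<delta>] by metis
 then obtain phi where phi: "!!y. y : Y ==> continuous_on UNIV (phi y)" "!!y. y : Y ==> csupp (phi y)"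
 "!!x y. y : Y ==> 0 <= phi y x" "!!x y. y : Y ==> phi y x <= 1"
 "!!y. y : Y ==> (LINT x|lebesgue. abs(indicator (E y) x - phi y x)) < \<delta>" by metis
 define c where "c x = (\<Sum>y\<in>Y. phi y x *\<^sub>R y)" for x
 have c: "continuous_on UNIV c" unfolding c_def[abs_def] using phi(1) by (intro continuous_on_sum continuous_on_scaleR) auto
 have csc: "csupp c"
 proof -
 have "{x. c x ~= 0} <= (\<Union>y\<in>Y. {x. phi y x ~= 0})"
 proof (rule subsetI, rule ccontr)
 fix x assume x: "x : {x. c x ~= 0}" "x ~: (\<Union>y\<in>Y. {x. phi y x ~= 0})"
 hence "c x = (\<Sum>y\<in>Y. 0)" unfolding c_def by (intro sum.cong) auto
 with x(1) show False by simp qed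
 moreover have "bounded (\<Union>y\<in>Y. {x. phi y x ~= 0})" using Y phi(2) by (auto simp: csupp_def)
 ultimately show ?thesis unfolding csupp_def using bounded_subset by blast qed
 have iE: "integrable lebesgue (%x. abs(indicator (E y) x - phi y x))" if "y : Y" for y
 proof -
 have "integrable lebesgue (indicator (E y) :: 'a => real)" by (rule lmeasurable_iff_integrable[THEN iffD1, OF bounded_set_imp_lmeasurable[OF E(2,1)[OF that]]])
 thus ?thesis by (rule integrable_abs[OF bi_integrable_diff[OF _ csupp_integrable(2)[OF phi(1)[OF that] phi(2)[OF that]]]]) qed
 have tc: "norm (t n x - c x) powr p <= B powr p * (\<Sum>y\<in>Y. abs(indicator (E y) x - phi y x) * norm y / B)" (is "_ <= _ * ?R x") for x
 proof -
 have "t n x - c x = (\<Sum>y\<in>Y. (indicator (E y) x - phi y x) *\<^sub>R y)" unfolding trep c_def by (simp add: sum_subtractf scaleR_diff_left)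
 hence "norm (t n x - c x) <= (\<Sum>y\<in>Y. abs(indicator (E y) x - phi y x) * norm y)" using norm_sum[of "%y. (indicator (E y) x - phi y x) *\<^sub>R y" Y] by simp
 also have "... = B * ?R x" using B by (simp add: sum_divide_distrib[symmetric])
 finally have 1: "norm (t n x - c x) <= B * ?R x" .
 have R0: "0 <= ?R x" using B by (intro sum_nonneg) auto
 have "(\<Sum>y\<in>Y. abs(indicator (E y) x - phi y x) * norm y) <= (\<Sum>y\<in>Y. 1 * norm y)"
 by (intro sum_mono mult_right_mono) (use phi(3,4)[of _ x] in "auto simp: indicator_def")
 also have "... <= B" by (simp add: B_def)
 finally have "?R x <= 1" using B by (simp add: sum_divide_distrib[symmetric])
 hence "?R x powr p <= ?R x" using powr_mono'[of 1 p "?R x"] R0 p by (cases "?R x = 0") auto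
 moreover have "norm (t n x - c x) powr p <= (B * ?R x) powr p" using 1 p by (intro powr_mono2) auto
 ultimately show ?thesis using B R0 by (simp add: powr_mult mult_left_mono order_trans) qed
 have iR: "integrable lebesgue (%x. B powr p * (\<Sum>y\<in>Y. abs(indicator (E y) x - phi y x) * norm y / B))"
 using iE by (intro integrable_mult_right bi_integrable_sum integrable_divide_zero integrable_mult_left) auto
 have itc: "integrable lebesgue (%x. norm (t n x - c x) powr p)"
 proof (rule bi_integrable_bound[OF iR])
 have "(%x. norm (y - c x)) : bmeas lebesgue" for y by (intro cont_measurable_leb(1) continuous_intros c)
 hence "(%x. norm (t n x - c x)) : bmeas lebesgue" using simple_comp_measurable[OF t, of "%x y. norm (y - c x)"] by simp
 thus "(%x. norm (t n x - c x) powr p) : bmeas lebesgue" by (intro powr_real_measurable) auto qed (use tc in "auto intro!: AE_I2 order_trans[OF tc]")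
 have "(LINT x|lebesgue. norm (t n x - c x) powr p) <= (LINT x|lebesgue. B powr p * (\<Sum>y\<in>Y. abs(indicator (E y) x - phi y x) * norm y / B))"
 by (intro bi_integral_mono itc iR tc)
 also have "... = B powr p * (\<Sum>y\<in>Y. (LINT x|lebesgue. abs(indicator (E y) x - phi y x)) * norm y / B)"
 proof -
 have i: "integrable lebesgue (%x. abs(indicator (E y) x - phi y x) * norm y / B)" if "y : Y" for y
 by (rule integrable_divide_zero, rule integrable_mult_left, rule iE[OF that])
 have "(LINT x|lebesgue. (\<Sum>y\<in>Y. abs(indicator (E y) x - phi y x) * norm y / B)) = (\<Sum>y\<in>Y. LINT x|lebesgue. abs(indicator (E y) x - phi y x) * norm y / B)"
 by (rule bi_integral_sum[OF i])
 also have "... = (\<Sum>y\<in>Y. (LINT x|lebesgue. abs(indicator (E y) x - phi y x)) * norm y / B)" by (simp only: integral_divide_zero integral_mult_left_zero)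
 finally show ?thesis by (simp only: integral_mult_right_zero) qed
 also have "... <= B powr p * (\<Sum>y\<in>Y. \<delta> * norm y / B)"
 using phi(5) B by (intro mult_left_mono sum_mono divide_right_mono mult_right_mono) (auto intro: less_imp_le)
 also have "... = B powr p * \<delta> * ((B - 1) / B)" by (simp add: B_def sum_divide_distrib[symmetric] sum_distrib_left[symmetric])
 also have "... <= B powr p * \<delta> * 1" using B \<delta> by (intro mult_left_mono) auto
 also have "... = eps" using B by (simp add: \<delta>_def)
 finally have tce: "(LINT x|lebesgue. norm (t n x - c x) powr p) <= eps" .
 have ift: "integrable lebesgue (%x. norm (f x - t n x) powr p)" by (rule powr_integrable_diff(1)[OF p int itp tm])
 have ict: "integrable lebesgue (%x. norm (c x - t n x) powr p)" using itc by (simp add: norm_minus_commute)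
 have mfc: "(%x. norm (f x - c x)) : bmeas lebesgue"
 proof -
 have "(%x. norm (y - c x)) : bmeas lebesgue" for y by (intro cont_measurable_leb(1) continuous_intros c)
 thus ?thesis using strong_comp_measurable[OF _ f', of "%x y. norm (y - c x)"] by (simp add: lebesgue_on_UNIV_eq) qed
 hence "(%x. norm ((f x - t n x) - (c x - t n x))) : bmeas lebesgue" by simp
 note * = powr_integrable_diff[OF p ift ict this]
 show ?thesis
 proof (rule that[OF c csc])
 show "integrable lebesgue (%x. norm (f x - c x) powr p)" using *(1) by simp
 have "(LINT x|lebesgue. norm (f x - c x) powr p) <= 2 powr p * ((LINT x|lebesgue. norm (f x - t n x) powr p) + (LINT x|lebesgue. norm (t n x - c x) powr p))"
 using *(2) by (simp add: norm_minus_commute)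
 also have "... < 2 powr p * (eps + eps)" using n tce by (intro mult_strict_left_mono) auto
 also have "... = e" by (simp add: eps_def)
 finally show "(LINT x|lebesgue. norm (f x - c x) powr p) < e" . qed qed

section \<open>Weak derivatives\<close>

lemma lborel_integral_translate:
 fixes F :: "'a::euclidean_space => real"
 assumes [measurable]: "F : bmeas borel" shows "(LINT y|lborel. F (y - z)) = (LINT y|lborel. F y)"
 and "integrable lborel (%y. F (y - z)) \<longleftrightarrow> integrable lborel F"
 and "(\<integral>\<^sup>+y. ennreal (F (y - z)) \<partial>lborel) = (\<integral>\<^sup>+y. ennreal (F y) \<partial>lborel)"
proof -
 have d: "lborel = distr lborel borel (%y. y - z)"
 proof -
 have "(%y. y - z) = (+) (- z)" by auto
 thus ?thesis using lborel_distr_plus[of "- z"] by (simp only:) qed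
 show "(LINT y|lborel. F (y - z)) = (LINT y|lborel. F y)" by (subst (2) d) (simp add: integral_distr)
 show "integrable lborel (%y. F (y - z)) \<longleftrightarrow> integrable lborel F" by (subst (2) d) (simp add: integrable_distr_eq)
 show "(\<integral>\<^sup>+y. ennreal (F (y - z)) \<partial>lborel) = (\<integral>\<^sup>+y. ennreal (F y) \<partial>lborel)" by (subst (2) d) (simp add: nn_integral_distr)
qed

lemma borel_strongly_measurable:
 fixes f :: "'a => 'b::{real_normed_vector, second_countable_topology}"
 assumes "f : bmeas M" shows "strongly_measurable M f"
proof -
 obtain F where "!!i. simple_function M (F i)" "!!x. x : space M ==> (%i. F i x) ----> f x" using borel_measurable_implies_sequence_metric[OF assms, of 0] by metis
 thus ?thesis unfolding strongly_measurable_def by (intro exI[of _ F]) auto qed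

text \<open>True for continuous functions of compact support by uniform continuity; translations are
  isometries, so the density result finishes with three errors of size e / 3.\<close>

lemma L2_translation_continuous:
 fixes f :: "'a::euclidean_space => real"
 assumes f: "f : bmeas borel" "integrable lborel (%x. (f x)\<^sup>2)"
 and S: "bounded S" "!!x. x ~: S ==> f x = 0" and e: "0 < e"
 obtains d where "0 < d" "!!z. norm z < d ==> nrm2 lborel (%x. f (x - z) - f x) <= e"
 "!!z. sqint lborel (%x. f (x - z) - f x)"
proof -
 have sf: "sqint lborel f" using f by (simp add: sqint_def)
 define e1 where "e1 = e / 3"
 have e1: "0 < e1" using e by (simp add: e1_def)
 have "strongly_measurable lebesgue f" by (intro borel_strongly_measurable measurable_lebesgueI f)
 moreover have "integrable lebesgue (%x. norm (f x) powr 2)" using f by (subst integrable_completion) auto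
 ultimately obtain c where c: "continuous_on UNIV c" "csupp c" "(LINT x|lebesgue. norm (f x - c x) powr 2) < e1\<^sup>2"
 using Lp_continuous_dense[of 2 f S "e1\<^sup>2"] S e1 by auto
 have cm[measurable]: "c : bmeas borel" using c(1) by (rule borel_measurable_continuous_onI)
 note f(1)[measurable]
 have cs2: "csupp (%x. (c x)\<^sup>2)" using c(2) by (simp add: csupp_def)
 have sc: "sqint lborel c" unfolding sqint_def using cm by (auto intro!: csupp_integrable(1)[OF _ cs2] continuous_intros c(1))
 have sfc: "sqint lborel (%x. f x - c x)" by (rule sqint_diff[OF sf sc])
 have "(nrm2 lborel (%x. f x - c x))\<^sup>2 <= e1\<^sup>2" using c(3) by (subst (asm) integral_completion) (auto simp: nrm2_square)
 hence n1: "nrm2 lborel (%x. f x - c x) <= e1" by (rule power2_le_imp_le[OF _ less_imp_le[OF e1]])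
 have sfcz: "sqint lborel (%x. f (x - z) - c (x - z))" for z using sfc lborel_integral_translate(2)[of "%x. (f x - c x)\<^sup>2" z] by (auto simp: sqint_def)
 have n2: "nrm2 lborel (%x. f (x - z) - c (x - z)) <= e1" for z using n1 lborel_integral_translate(1)[of "%x. (f x - c x)\<^sup>2" z] by (simp add: nrm2_def)
 obtain R where R: "!!x. c x ~= 0 ==> norm x <= R" using c(2) unfolding csupp_def bounded_iff by auto
 \<comment> \<open>For |z| < 1 both c and its translate vanish off this ball; eta is chosen such
   that eta^2 W equals e1^2.\<close>
 define W where "W = measure lborel (cball (0::'a) (R + 1)) + 1"
 have W: "W > 0" by (simp add: W_def add_nonneg_pos)
 define eta where "eta = e1 / sqrt W"
 have eta: "eta > 0" using e1 W by (simp add: eta_def)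
 obtain d where d: "d > 0" "!!x y. dist y x < d ==> dist (c y) (c x) < eta"
 using csupp_uniform[OF c(1,2)] eta unfolding uniformly_continuous_on_def by (metis UNIV_I)
 have scz: "sqint lborel (%x. c (x - z))" for z using sc lborel_integral_translate(2)[of "%x. (c x)\<^sup>2" z] by (auto simp: sqint_def)
 have sczc: "sqint lborel (%x. c (x - z) - c x)" for z by (rule sqint_diff[OF scz sc])
 have n3: "nrm2 lborel (%x. c (x - z) - c x) <= e1" if z: "norm z < min d 1" for z
 proof -
 have "(c (x - z) - c x)\<^sup>2 <= eta\<^sup>2 * indicator (cball 0 (R + 1)) x" for x
 proof (cases "x : cball 0 (R + 1)")
 case True
 have "abs(c (x - z) - c x) <= eta" using d(2)[of "x - z" x] z by (simp add: dist_norm)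
 thus ?thesis using True eta by (simp add: abs_le_square_iff[symmetric])
 next
 case False
 hence "\<not> norm x <= R" "\<not> norm (x - z) <= R" using z norm_triangle_ineq[of "x - z" z] by auto
 hence "c x = 0" "c (x - z) = 0" using R by blast+
 thus ?thesis by simp qed
 hence "(LINT x|lborel. (c (x - z) - c x)\<^sup>2) <= (LINT x::'a|lborel. eta\<^sup>2 * indicator (cball 0 (R + 1)) x)"
 proof (intro bi_integral_mono)
 have "integrable lborel (indicator (cball 0 (R + 1)) :: 'a => real)" using emeasure_lborel_cball_finite[of "0::'a" "R + 1"] by (auto simp: integrable_indicator_iff)
 thus "integrable lborel (%x::'a. eta\<^sup>2 * indicator (cball 0 (R + 1)) x :: real)" by simp qed (use sczc[of z] in "auto simp: sqint_def")
 also have "... = eta\<^sup>2 * (W - 1)" by (simp add: W_def)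
 also have "... <= eta\<^sup>2 * W" by (intro mult_left_mono) auto
 also have "... = e1\<^sup>2" using W by (simp add: eta_def power_divide)
 finally show ?thesis using e1 by (simp add: nrm2_def real_le_lsqrt) qed
 show ?thesis
 proof (rule that[of "min d 1"])
 have sz: "sqint lborel (%x. f (x - z))" for z using sf lborel_integral_translate(2)[of "%x. (f x)\<^sup>2" z] by (auto simp: sqint_def)
 show "sqint lborel (%x. f (x - z) - f x)" for z by (rule sqint_diff[OF sz sf])
 fix z :: 'a assume z: "norm z < min d 1"
 have "nrm2 lborel (%x. f (x - z) - f x) <= nrm2 lborel (%x. f (x - z) - c x) + nrm2 lborel (%x. c x - f x)" by (rule nrm2_triangle_diff[OF sz sc sf])
 also have "nrm2 lborel (%x. f (x - z) - c x) <= nrm2 lborel (%x. f (x - z) - c (x - z)) + nrm2 lborel (%x. c (x - z) - c x)" by (rule nrm2_triangle_diff[OF sz scz sc])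
 finally show "nrm2 lborel (%x. f (x - z) - f x) <= e" using n1 n2[of z] n3[OF z] by (simp add: nrm2_minus_commute[of _ c f] e1_def) qed (use d in auto) qed

text \<open>Mollification averages translates. Cauchy-Schwarz with respect to the density rho,
  followed by Tonelli, bounds the L^2 error by the bound for translations of length below d.\<close>

lemma conv_L2_close:
 fixes w :: "'a::euclidean_space => real"
 assumes w: "w : bmeas borel" "integrable lborel w"
 and rho: "continuous_on UNIV rho" "csupp rho" "!!x. 0 <= rho x" "!!x. d <= norm x ==> rho x = 0" "integral\<^sup>L lebesgue rho = 1"
 and e: "0 <= e" and sq: "!!z. sqint lborel (%x. w (x - z) - w x)"
 and close: "!!z. norm z < d ==> nrm2 lborel (%x. w (x - z) - w x) <= e" shows "sqint lborel (%x. conv w rho x - w x)" "nrm2 lborel (%x. conv w rho x - w x) <= e"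
proof -
 note [measurable] = w(1)
 have [measurable]: "rho : bmeas borel" using rho(1) by (rule borel_measurable_continuous_onI)
 have ilw: "integrable lebesgue w" using w integrable_completion[of w lborel] by simp
 have irho: "integrable lborel rho" by (rule csupp_integrable(1)[OF rho(1,2)])
 have one: "(LINT z|lborel. rho z) = 1" using rho(5) by (simp add: integral_completion)
 have onen: "(\<integral>\<^sup>+z. ennreal (rho z) \<partial>lborel) = 1" using one by (subst nn_integral_eq_integral[OF irho]) (auto simp: rho(3))
 have conv_eq: "conv w rho x = (LINT z|lborel. w (x - z) * rho z)" for x
 proof -
 have "(LINT y|lebesgue. w y * rho (x - y)) = (LINT y|lebesgue. w (x - y) * rho (x - (x - y)))" by (rule lebesgue_integral_reflect[symmetric]) simp
 also have "... = (LINT z|lborel. w (x - z) * rho z)" by (subst integral_completion) auto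
 finally show ?thesis by (simp add: conv_def) qed
 have int: "integrable lborel (%z. w (x - z) * rho z)" for x
 proof -
 have "integrable lebesgue (%y. w y * rho (x - y))" by (rule conv_integrable[OF ilw rho(1,2)])
 hence i: "integrable lborel (%y. w y * rho (x - y))" by (subst (asm) integrable_completion) auto
 have "lborel = distr lborel borel (%y. x - y)" using lborel_affine[of "-1" x] by (simp add: density_1)
 with i have "integrable (distr lborel borel (%y. x - y)) (%y. w y * rho (x - y))" by simp
 thus ?thesis by (subst (asm) integrable_distr_eq) auto qed
 have cm[measurable]: "conv w rho : bmeas borel" unfolding conv_eq[abs_def] by measurable
 have pt: "ennreal ((conv w rho x - w x)\<^sup>2) <= (\<integral>\<^sup>+z. ennreal ((w (x - z) - w x)\<^sup>2 * rho z) \<partial>lborel)" for x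
 proof -
 have "conv w rho x - w x = (LINT z|lborel. (w (x - z) - w x) * rho z)" unfolding conv_eq using int[of x] irho one by (simp add: left_diff_distrib)
 hence "ennreal \<bar>conv w rho x - w x\<bar> <= (\<integral>\<^sup>+z. ennreal (norm ((w (x - z) - w x) * rho z)) \<partial>lborel)"
 using integral_norm_bound_ennreal[of lborel "%z. (w (x - z) - w x) * rho z"] int[of x] irho by (simp add: left_diff_distrib)
 also have "... = (\<integral>\<^sup>+z. ennreal (abs(w (x - z) - w x) * sqrt (rho z)) * ennreal (sqrt (rho z)) \<partial>lborel)"
 by (intro nn_integral_cong) (simp add: rho(3) abs_mult ennreal_mult[symmetric])
 finally have "(ennreal \<bar>conv w rho x - w x\<bar>)\<^sup>2 <= ...\<^sup>2" by (intro power_mono) auto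
 also have "... <= (\<integral>\<^sup>+z. (ennreal (abs(w (x - z) - w x) * sqrt (rho z)))\<^sup>2 \<partial>lborel) * (\<integral>\<^sup>+z. (ennreal (sqrt (rho z)))\<^sup>2 \<partial>lborel)"
 by (rule Cauchy_Schwarz_nn_integral) auto
 also have "... = (\<integral>\<^sup>+z. ennreal ((w (x - z) - w x)\<^sup>2 * rho z) \<partial>lborel)" using onen by (simp add: ennreal_power rho(3) power_mult_distrib)
 finally show ?thesis by (simp add: ennreal_power) qed
 have inner: "(\<integral>\<^sup>+x. ennreal ((w (x - z) - w x)\<^sup>2) \<partial>lborel) <= ennreal (e\<^sup>2)" if "norm z < d" for z
 proof -
 have "(\<integral>\<^sup>+x. ennreal ((w (x - z) - w x)\<^sup>2) \<partial>lborel) = ennreal ((nrm2 lborel (%x. w (x - z) - w x))\<^sup>2)"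
 using sq[of z] by (simp add: nrm2_square sqint_def nn_integral_eq_integral)
 also have "... <= ennreal (e\<^sup>2)" using close[OF that] e by (intro ennreal_leI power_mono) auto
 finally show ?thesis . qed
 have "(\<integral>\<^sup>+x. ennreal ((conv w rho x - w x)\<^sup>2) \<partial>lborel) <= (\<integral>\<^sup>+x. \<integral>\<^sup>+z. ennreal ((w (x - z) - w x)\<^sup>2 * rho z) \<partial>lborel \<partial>lborel)"
 by (intro nn_integral_mono pt)
 also have "... = (\<integral>\<^sup>+z. \<integral>\<^sup>+x. ennreal ((w (x - z) - w x)\<^sup>2 * rho z) \<partial>lborel \<partial>lborel)"
 by (rule lborel_pair.Fubini') measurable
 also have "... <= (\<integral>\<^sup>+z. ennreal (rho z) * ennreal (e\<^sup>2) \<partial>lborel)"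
 proof (rule nn_integral_mono)
 fix z
 have "(\<integral>\<^sup>+x. ennreal ((w (x - z) - w x)\<^sup>2 * rho z) \<partial>lborel) = ennreal (rho z) * (\<integral>\<^sup>+x. ennreal ((w (x - z) - w x)\<^sup>2) \<partial>lborel)"
 by (subst nn_integral_cmult[symmetric]) (auto simp: ennreal_mult' rho(3) mult.commute)
 also have "... <= ennreal (rho z) * ennreal (e\<^sup>2)" using inner[of z] rho(4)[of z] by (cases "norm z < d") (auto intro: mult_left_mono)
 finally show "(\<integral>\<^sup>+x. ennreal ((w (x - z) - w x)\<^sup>2 * rho z) \<partial>lborel) <= ennreal (rho z) * ennreal (e\<^sup>2)" . qed
 also have "... = ennreal (e\<^sup>2)" using onen by (simp add: nn_integral_multc)
 finally have le: "(\<integral>\<^sup>+x. ennreal ((conv w rho x - w x)\<^sup>2) \<partial>lborel) <= ennreal (e\<^sup>2)" .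
 have "integrable lborel (%x. (conv w rho x - w x)\<^sup>2)" using le by (intro integrableI_nonneg) (auto intro: le_less_trans)
 thus s: "sqint lborel (%x. conv w rho x - w x)" by (simp add: sqint_def)
 have "ennreal (LINT x|lborel. (conv w rho x - w x)\<^sup>2) <= ennreal (e\<^sup>2)" using le s by (simp add: sqint_def nn_integral_eq_integral)
 hence "(LINT x|lborel. (conv w rho x - w x)\<^sup>2) <= e\<^sup>2" by (simp add: ennreal_le_iff)
 thus "nrm2 lborel (%x. conv w rho x - w x) <= e" unfolding nrm2_def using e by (simp add: real_le_lsqrt) qed

text \<open>All approximating test functions live on one compact set, where F and g are integrable,
  and converge uniformly with their partial derivatives. A subset B of the basis covers both a full
  divergence and a single partial derivative.\<close>

lemma weak_divergence_C1:
 fixes F :: "'a::euclidean_space => 'a => real"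
 assumes U: "open U" and B: "B <= Basis"
 and F: "!!b K. b : B ==> compact K ==> K <= U ==> integrable (leb K) (F b)"
 and g: "!!K. compact K ==> K <= U ==> integrable (leb K) g"
 and weak: "!!psi. psi : test_functions U ==>
 (LINT x|leb U. (\<Sum>b\<in>B. F b x * fderiv psi (at x) b)) = - (LINT x|leb U. g x * psi x)"
 and psi: "Ck (Suc 0) psi" and K: "compact K" "{x. psi x ~= 0} <= K" "K <= U"
 shows "(LINT x|leb U. (\<Sum>b\<in>B. F b x * fderiv psi (at x) b)) = - (LINT x|leb U. g x * psi x)"
proof -
 obtain s K' where K': "compact K'" "K' <= U" and s: "!!n::nat. s n : test_functions U" "!!n. {x. s n x ~= 0} <= K'"
 "uniform_limit UNIV s psi sequentially"
 "!!b. b : Basis ==> uniform_limit UNIV (%n x. fderiv (s n) (at x) b) (%x. fderiv psi (at x) b) sequentially" using test_functions_approx[OF psi K U] by metis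
 have Um: "U : sets lebesgue" using U by simp
 have K'm: "K' : sets lebesgue" using compact_sets_leb[OF K'(1)] .
 have csu: "closure {x. s n x ~= 0} <= K'" for n using s(2) compact_imp_closed[OF K'(1)] closure_minimal by blast
 have conv: "(%n. LINT x|leb U. G x * r n x) ----> (LINT x|leb U. G x * q x)"
 and inte: "!!n. integrable (leb U) (%x. G x * r n x)" "integrable (leb U) (%x. G x * q x)"
 if G: "integrable (leb K') G" and r: "!!n. continuous_on UNIV (r n)" "!!n x. x ~: K' ==> r n x = 0"
 and lim: "uniform_limit UNIV r q sequentially" for G :: "'a => real" and r :: "nat => 'a => real" and q
 proof -
 have cq: "continuous_on UNIV q" by (rule uniform_limit_theorem[OF _ lim]) (use r(1) in auto)
 have pw: "(%n. r n x) ----> q x" for x using tendsto_uniform_limitI[OF lim] by simp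
 have q0: "q x = 0" if "x ~: K'" for x using pw[of x] r(2)[OF that] by (simp add: LIMSEQ_const_iff)
 have iG: "integrable lebesgue (%x. indicator K' x * G x)" using G integrable_leb_eq[OF K'm] by blast
 have eq: "indicator U x * (G x * h x) = indicator K' x * G x * h x" if "!!x. x ~: K' ==> h x = 0" for x and h :: "'a => real"
 using that[of x] K'(2) by (cases "h x = 0") (auto simp: indicator_def)
 have eqr: "(%x. indicator U x * (G x * r n x)) = (%x. indicator K' x * G x * r n x)" for n using eq[of "r n"] r(2) by blast
 have eqq: "(%x. indicator U x * (G x * q x)) = (%x. indicator K' x * G x * q x)" using eq[of q] q0 by blast
 have rcs: "csupp (r n)" for n unfolding csupp_def by (rule bounded_subset[OF compact_imp_bounded[OF K'(1)]]) (use r(2) in blast)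
 have int: "integrable lebesgue (%x. indicator K' x * G x * h x)" if hc: "continuous_on UNIV h" "csupp h" for h :: "'a => real"
 proof -
 obtain M where M: "!!x. norm (h x) <= M" "M >= 0" using csupp_bounded[OF hc] by metis
 show ?thesis
 proof (rule bi_integrable_bound)
 show "integrable lebesgue (%x. indicator K' x * G x * M)" using iG by simp
 show "(%x. indicator K' x * G x * h x) : bmeas lebesgue" by (rule borel_measurable_times[OF borel_measurable_integrable[OF iG] cont_measurable_leb(1)[OF hc(1)]])
 show "AE x in lebesgue. norm (indicator K' x * G x * h x) <= norm (indicator K' x * G x * M)" unfolding norm_mult using M by (intro AE_I2 mult_left_mono) auto qed qed
 show "integrable (leb U) (%x. G x * r n x)" for n unfolding integrable_leb_eq[OF Um] eqr by (rule int[OF r(1) rcs])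
 have qcs: "csupp q" unfolding csupp_def by (rule bounded_subset[OF compact_imp_bounded[OF K'(1)]]) (use q0 in blast)
 show "integrable (leb U) (%x. G x * q x)" unfolding integrable_leb_eq[OF Um] eqq by (rule int[OF cq qcs])
 show "(%n. LINT x|leb U. G x * r n x) ----> (LINT x|leb U. G x * q x)" unfolding integral_leb_eq[OF Um] eqr eqq
 proof (rule LIMSEQ_I)
 fix e :: real assume e: "0 < e"
 define I where "I = (LINT x|lebesgue. abs(indicator K' x * G x)) + 1"
 have I: "I > 0" by (simp add: I_def add_nonneg_pos)
 have "\<forall>\<^sub>F n in sequentially. ALL x:UNIV. dist (r n x) (q x) < e / I" using lim e I by (simp add: uniform_limit_iff)
 then obtain N where N: "!!n x. n >= N ==> abs(r n x - q x) < e / I" unfolding eventually_sequentially dist_real_def by blast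
 have "norm ((LINT x|lebesgue. indicator K' x * G x * r n x) - (LINT x|lebesgue. indicator K' x * G x * q x)) < e" if "n >= N" for n
 proof -
 have "(LINT x|lebesgue. indicator K' x * G x * r n x) - (LINT x|lebesgue. indicator K' x * G x * q x)
 = (LINT x|lebesgue. indicator K' x * G x * r n x - indicator K' x * G x * q x)" using int[OF r(1) rcs] int[OF cq qcs] by (rule bi_integral_diff[symmetric])
 also have "norm ... <= (LINT x|lebesgue. abs(indicator K' x * G x) * (e / I))"
 proof (rule bi_norm_bound)
 show "norm (indicator K' x * G x * r n x - indicator K' x * G x * q x) <= abs(indicator K' x * G x) * (e / I)" for x
 unfolding right_diff_distrib[symmetric] norm_mult using N[OF that, of x] by (intro mult_mono) auto qed (use iG int[OF r(1) rcs] int[OF cq qcs] in auto)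
 also have "... = (I - 1) * (e / I)" by (simp add: I_def)
 also have "... < I * (e / I)" using e I by (intro mult_strict_right_mono) auto
 also have "... = e" using I by simp
 finally show ?thesis . qed
 thus "EX N. ALL n>=N. norm ((LINT x|lebesgue. indicator K' x * G x * r n x) - (LINT x|lebesgue. indicator K' x * G x * q x)) < e" by blast qed qed
 have ders: "continuous_on UNIV (%x. fderiv (s n) (at x) b)" "x ~: K' ==> fderiv (s n) (at x) b = 0"
 if "b : B" for n b x
 proof -
 have b: "b : Basis" using that B by blast
 show "continuous_on UNIV (%x. fderiv (s n) (at x) b)" by (rule Ck_continuous[OF Ck_partial[OF tf_bounds(5)[OF s(1), of "Suc 0"] b]])
 show "fderiv (s n) (at x) b = 0" if "x ~: K'" using csupp_frechet(2)[OF tf_bounds(2)[OF s(1)], of n b] csu[of n] that by blast qed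
 have sb: "b : B ==> b : Basis" for b using B by blast
 have finB: "finite B" using B finite_Basis finite_subset by blast
 have s0: "x ~: K' ==> s n x = 0" for n x using s(2) by blast
 have L1: "(%n. LINT x|leb U. g x * s n x) ----> (LINT x|leb U. g x * psi x)" by (rule conv(1)[OF g[OF K'] tf_bounds(1)[OF s(1)] s0 s(3)])
 have L2: "(%n. LINT x|leb U. (\<Sum>b\<in>B. F b x * fderiv (s n) (at x) b))
 ----> (LINT x|leb U. (\<Sum>b\<in>B. F b x * fderiv psi (at x) b))"
 proof -
 have i1: "integrable (leb U) (%x. F b x * fderiv (s n) (at x) b)" if "b : B" for b n
 by (rule inte(1)[OF F[OF that K'] ders(1)[OF that] ders(2)[OF that] s(4)[OF sb[OF that]]])
 have i2: "integrable (leb U) (%x. F b x * fderiv psi (at x) b)" if "b : B" for b by (rule inte(2)[OF F[OF that K'] ders(1)[OF that] ders(2)[OF that] s(4)[OF sb[OF that]]])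
 have "(%n. \<Sum>b\<in>B. LINT x|leb U. F b x * fderiv (s n) (at x) b)
 ----> (\<Sum>b\<in>B. LINT x|leb U. F b x * fderiv psi (at x) b)" by (intro tendsto_sum) (rule conv(1)[OF F[OF _ K'] ders(1) ders(2) s(4)[OF sb]])
 thus ?thesis using i1 i2 by (simp add: bi_integral_sum) qed
 have "(%n. LINT x|leb U. (\<Sum>b\<in>B. F b x * fderiv (s n) (at x) b)) ----> - (LINT x|leb U. g x * psi x)" unfolding weak[OF s(1)] by (rule tendsto_minus[OF L1])
 thus ?thesis using LIMSEQ_unique[OF L2] by blast qed

lemma Ck_reflect: "Ck k f ==> Ck k (%y. f (x - y))"
proof (induction k arbitrary: f)
 case 0
 thus ?case by (auto intro!: continuous_on_compose2[of UNIV f] continuous_intros)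
next
 case (Suc k)
 show ?case
 proof (rule Ck_SucI)
 show "((%y. f (x - y)) has_derivative (%h. fderiv f (at (x - y)) (- h))) (at y)" for y
 by (rule has_derivative_compose[OF _ Ck_has_derivative[OF Suc.prems]]) (auto intro!: derivative_eq_intros)
 have lin: "fderiv f (at y) (- h) = (-1) * fderiv f (at y) h" for y h using linear_neg[OF has_derivative_linear[OF Ck_has_derivative[OF Suc.prems]]] by simp
 show "Ck k (%y. fderiv f (at (x - y)) (- b))" if "b : Basis" for b unfolding lin by (intro Ck_cmult Suc.IH Ck_partial Suc.prems that) qed qed

lemma frechet_reflect:
 assumes "Ck (Suc 0) f" shows "fderiv (%y. f (x - y)) (at y) h = - fderiv f (at (x - y)) h"
proof -
 have "((%y. f (x - y)) has_derivative (%h. fderiv f (at (x - y)) (- h))) (at y)"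
 by (rule has_derivative_compose[OF _ Ck_has_derivative[OF assms]]) (auto intro!: derivative_eq_intros)
 hence "fderiv (%y. f (x - y)) (at y) = (%h. fderiv f (at (x - y)) (- h))" using frechet_derivative_at by metis
 thus ?thesis using linear_neg[OF has_derivative_linear[OF Ck_has_derivative[OF assms, of "x - y"]]] by simp qed

lemma frechet_mult:
 assumes "Ck (Suc 0) f" "Ck (Suc 0) g" shows "fderiv (%x. f x * g x) (at x) h = f x * fderiv g (at x) h + fderiv f (at x) h * g x"
proof -
 have "((%x. f x * g x) has_derivative (%h. f x * fderiv g (at x) h + fderiv f (at x) h * g x)) (at x)"
 by (rule has_derivative_mult[OF Ck_has_derivative[OF assms(1)] Ck_has_derivative[OF assms(2)]])
 hence "fderiv (%x. f x * g x) (at x) = (%h. f x * fderiv g (at x) h + fderiv f (at x) h * g x)" using frechet_derivative_at by metis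
 thus ?thesis by simp qed

lemma sqint_restrict:
 fixes F :: "'a::euclidean_space => real"
 assumes F: "sqint lborel F" and S: "S : sets lebesgue" shows "sqint (leb S) F" "nrm2 (leb S) F <= nrm2 lborel F"
proof -
 have Fm: "F : bmeas lborel" and Fi: "integrable lborel (%x. (F x)\<^sup>2)" using F unfolding sqint_def by blast+
 have m: "F : bmeas lebesgue" by (rule measurable_completion[OF Fm])
 have i: "integrable lebesgue (%x. (F x)\<^sup>2)" by (rule integrable_completion[THEN iffD2, OF borel_measurable_integrable[OF Fi] Fi])
 have i': "integrable lebesgue (%x. indicator S x * (F x)\<^sup>2)" using integrable_mult_indicator[OF S i] by simp
 show "sqint (leb S) F" unfolding sqint_def integrable_leb_eq[OF S] using i' m borel_measurable_lebesgue_onI by blast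
 have "(LINT x|leb S. (F x)\<^sup>2) <= (LINT x|lebesgue. (F x)\<^sup>2)" unfolding integral_leb_eq[OF S] by (rule bi_integral_mono[OF i' i]) (auto simp: indicator_def)
 also have "... = (LINT x|lborel. (F x)\<^sup>2)" using F by (intro integral_completion) (auto simp: sqint_def)
 finally show "nrm2 (leb S) F <= nrm2 lborel F" by (simp add: nrm2_def) qed

lemma int_leb_subset:
 fixes f :: "'a::euclidean_space => real"
 assumes "integrable (leb S) f" "S : sets lebesgue" "K : sets lebesgue" "K <= S" shows "integrable (leb K) f"
proof -
 have "integrable lebesgue (%x. indicator K x *\<^sub>R (indicator S x * f x))" using assms by (intro integrable_mult_indicator) (auto simp: integrable_leb_eq)
 moreover have "(%x. indicator K x *\<^sub>R (indicator S x * f x)) = (%x. indicator K x * f x)" using assms(4) by (auto simp: indicator_def fun_eq_iff)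
 ultimately show ?thesis unfolding integrable_leb_eq[OF assms(3)] by (simp only:) qed

lemma sqint_integrable:
 assumes "sqint M f" "emeasure M (space M) < \<infinity>" shows "integrable M f"
proof -
 have "finite_measure M" using assms(2) by (intro finite_measureI) auto
 hence "sqint M (%_. 1)" by (simp add: sqint_def finite_measure.integrable_const)
 from sqint_mult[OF assms(1) this] show ?thesis by simp qed

text \<open>Tonelli in \<open>conv_L2_close\<close> works with Borel functions on the whole space,
  so a Borel version extended by zero takes the place of w.\<close>

lemma borel_representative:
 fixes w :: "'a::euclidean_space => real"
 assumes S: "open S" "bounded S" and w: "sqint (leb S) w"
 obtains w' where "w' : bmeas borel" "sqint lborel w'" "integrable lborel w'" "!!x. x ~: S ==> w' x = 0"
 "AE x in lebesgue. x : S --> w x = w' x"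
proof -
 have Sm: "S : sets lebesgue" using S by simp
 have "(%x. indicator S x * w x) : bmeas lebesgue" using w Sm borel_measurable_restrict_space_iff[of S lebesgue w] by (simp add: sqint_def)
 then obtain v where v: "v : bmeas lborel" "AE x in lborel. indicator S x * w x = v x" using completion_ex_borel_measurable_real by blast
 define w' where "w' x = indicator S x * v x" for x
 have w'm: "w' : bmeas borel" unfolding w'_def[abs_def] using v(1) S(1) by (intro borel_measurable_times borel_measurable_indicator) auto
 have ae: "AE x in lebesgue. x : S --> w x = w' x" using AE_completion[OF v(2)] by eventually_elim (auto simp: w'_def)
 have "integrable lebesgue (%x. indicator S x * (w x)\<^sup>2)" using w Sm by (simp add: sqint_def integrable_leb_eq)
 hence "integrable lebesgue (%x. (w' x)\<^sup>2)"
 proof (rule integrable_cong_AE_imp)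
 show "(%x. (w' x)\<^sup>2) : bmeas lebesgue" using measurable_lebesgueI[OF w'm] by (rule borel_measurable_power)
 show "AE x in lebesgue. indicator S x * (w x)\<^sup>2 = (w' x)\<^sup>2" using ae by eventually_elim (auto simp: w'_def indicator_def) qed
 hence sq: "sqint lborel w'" using w'm integrable_completion[of "%x. (w' x)\<^sup>2" lborel] by (simp add: sqint_def)
 have "emeasure lebesgue S < \<infinity>" using S bounded_set_imp_lmeasurable[of S] by (simp add: fmeasurable_def)
 hence "emeasure (leb S) (space (leb S)) < \<infinity>" by (simp add: space_restrict_space emeasure_restrict_space Sm)
 hence "integrable (leb S) w'" using sqint_integrable[OF sqint_restrict(1)[OF sq Sm]] by blast
 hence "integrable lebesgue w'" unfolding integrable_leb_eq[OF Sm]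
 proof (rule integrable_cong_AE_imp)
 show "AE x in lebesgue. indicator S x * w' x = w' x" by (rule AE_I2) (auto simp: w'_def indicator_def) qed (rule measurable_lebesgueI[OF w'm])
 hence "integrable lborel w'" using w'm integrable_completion[of w' lborel] by simp
 with that[of w'] w'm sq ae show ?thesis by (simp add: w'_def) qed

section \<open>Weak partial derivatives and their product rule\<close>

definition wderiv :: "'a::euclidean_space set => 'a => ('a => real) => ('a => real) => bool" where
 "wderiv S b w dw \<longleftrightarrow> (ALL psi:test_functions S.
 (LINT x|leb S. w x * fderiv psi (at x) b) = - (LINT x|leb S. dw x * psi x))"

lemma integral_leb_cong_AE:
 fixes f g :: "'a::euclidean_space => real"
 assumes S: "S : sets lebesgue" and "f : bmeas (leb S)" "g : bmeas (leb S)"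
 and ae: "AE x in lebesgue. x : S --> f x = g x" shows "integral\<^sup>L (leb S) f = integral\<^sup>L (leb S) g"
 by (rule integral_cong_AE[OF assms(2,3)]) (use S ae in "simp add: AE_restrict_space_iff")

text \<open>As the ball around x lies in S, the reflected kernel rho (x - y) is itself a test
  function of y; the sign produced by reflection cancels the one in the definition of the weak
  derivative.\<close>

lemma conv_wderiv:
 fixes w dw :: "'a::euclidean_space => real"
 assumes S: "open S" and b: "b : Basis" and wd: "wderiv S b w dw"
 and m: "w : bmeas (leb S)" "dw : bmeas (leb S)"
 and w': "w' : bmeas borel" "integrable lborel w'" "!!x. x ~: S ==> w' x = 0" "AE x in lebesgue. x : S --> w x = w' x"
 and dw': "dw' : bmeas borel" "integrable lborel dw'" "!!x. x ~: S ==> dw' x = 0" "AE x in lebesgue. x : S --> dw x = dw' x"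
 and rho: "!!k. Ck k rho" "csupp rho" "!!x. d <= norm x ==> rho x = 0" and x: "cball x d <= S" shows "fderiv (conv w' rho) (at x) b = conv dw' rho x"
proof -
 have Sm: "S : sets lebesgue" using S by simp
 have il: "integrable lebesgue w'" using w' integrable_completion[of w' lborel] by simp
 define psi where "psi y = rho (x - y)" for y
 have psi: "psi : test_functions S"
 proof -
 have sub: "{y. psi y ~= 0} <= cball x d" using rho(3) by (force simp: psi_def dist_norm)
 hence c: "closure {y. psi y ~= 0} <= cball x d" by (intro closure_minimal) auto
 hence "compact (closure {y. psi y ~= 0})" using bounded_subset[OF bounded_cball c] by (simp add: compact_eq_bounded_closed)
 moreover have "Ck k psi" for k unfolding psi_def[abs_def] by (rule Ck_reflect[OF rho(1)])
 ultimately show ?thesis using c x unfolding test_functions_def by blast qed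
 have dpsi: "fderiv psi (at y) b = - fderiv rho (at (x - y)) b" for y unfolding psi_def[abs_def] by (rule frechet_reflect[OF rho(1)])
 have cpsi: "continuous_on UNIV psi" using tf_bounds(1)[OF psi] .
 have cdpsi: "continuous_on UNIV (%y. fderiv psi (at y) b)" by (rule Ck_continuous[OF Ck_partial[OF tf_bounds(5)[OF psi, of "Suc 0"] b]])
 have "fderiv (conv w' rho) (at x) b = conv w' (%x. fderiv rho (at x) b) x" by (rule conv_frechet[OF il rho(1,2) b])
 also have "... = (LINT y|lebesgue. w' y * fderiv rho (at (x - y)) b)" by (simp add: conv_def)
 also have "... = (LINT y|lebesgue. - (indicator S y * (w' y * fderiv psi (at y) b)))" by (rule bi_integral_cong) (use w'(3) in "auto simp: dpsi indicator_def")
 also have "... = - (LINT y|leb S. w' y * fderiv psi (at y) b)" by (simp add: integral_leb_eq[OF Sm])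
 also have "(LINT y|leb S. w' y * fderiv psi (at y) b) = (LINT y|leb S. w y * fderiv psi (at y) b)"
 proof (rule integral_leb_cong_AE[OF Sm])
 show "(%y. w' y * fderiv psi (at y) b) : bmeas (leb S)"
 "(%y. w y * fderiv psi (at y) b) : bmeas (leb S)" using borel_measurable_lebesgue_onI[OF measurable_lebesgueI[OF w'(1)]] cont_measurable_leb(2)[OF cdpsi] m
 by (auto intro!: borel_measurable_times)
 show "AE y in lebesgue. y : S --> w' y * fderiv psi (at y) b = w y * fderiv psi (at y) b" using w'(4) by (rule eventually_mono) simp qed
 also have "- ... = (LINT y|leb S. dw y * psi y)" using wd psi by (simp add: wderiv_def)
 also have "... = (LINT y|leb S. dw' y * psi y)"
 proof (rule integral_leb_cong_AE[OF Sm])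
 show "(%y. dw' y * psi y) : bmeas (leb S)" "(%y. dw y * psi y) : bmeas (leb S)"
 using borel_measurable_lebesgue_onI[OF measurable_lebesgueI[OF dw'(1)]] cont_measurable_leb(2)[OF cpsi] m by (auto intro!: borel_measurable_times)
 show "AE y in lebesgue. y : S --> dw y * psi y = dw' y * psi y" using dw'(4) by (rule eventually_mono) simp qed
 also have "... = (LINT y|lebesgue. dw' y * rho (x - y))" unfolding integral_leb_eq[OF Sm] by (rule bi_integral_cong) (use dw'(3) in "auto simp: psi_def indicator_def")
 finally show ?thesis unfolding conv_def[of dw' rho x] . qed

text \<open>Only w is mollified. Then (w * rho) zeta is an admissible C^1 function in the weak
  identity for z, its derivative on the support of zeta contains the mollified dw, and everything
  converges in L^2 against factors built from z.\<close>

lemma weak_product_rule: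
 fixes w z dw dz zeta :: "'a::euclidean_space => real"
 assumes S: "open S" "bounded S" and b: "b : Basis"
 and w: "sqint (leb S) w" "sqint (leb S) dw" "wderiv S b w dw"
 and z: "sqint (leb S) z" "sqint (leb S) dz" "wderiv S b z dz"
 and zeta: "Ck (Suc 0) zeta" and K: "compact K" "{x. zeta x ~= 0} <= K" "K <= S" shows "(LINT x|leb S. w x * z x * fderiv zeta (at x) b)
 = - (LINT x|leb S. (w x * dz x + z x * dw x) * zeta x)"
proof -
 have Sm: "S : sets lebesgue" using S by simp
 have fin: "emeasure (leb S) (space (leb S)) < \<infinity>"
 using S bounded_set_imp_lmeasurable[of S] by (simp add: fmeasurable_def space_restrict_space emeasure_restrict_space Sm)
 obtain w' where w': "w' : bmeas borel" "sqint lborel w'" "integrable lborel w'" "!!x. x ~: S ==> w' x = 0"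
 "AE x in lebesgue. x : S --> w x = w' x" using borel_representative[OF S w(1)] by metis
 obtain dw' where dw': "dw' : bmeas borel" "sqint lborel dw'" "integrable lborel dw'" "!!x. x ~: S ==> dw' x = 0"
 "AE x in lebesgue. x : S --> dw x = dw' x" using borel_representative[OF S w(2)] by metis
 obtain r where r: "r > 0" "(\<Union>x\<in>K. cball x r) <= S" using compact_subset_open_imp_cball_epsilon_subset[OF K(1) S(1) K(3)] by blast
 have cszeta: "csupp zeta" unfolding csupp_def by (rule bounded_subset[OF compact_imp_bounded[OF K(1)] K(2)])
 have czeta: "continuous_on UNIV zeta" using zeta Ck_continuous by blast
 have cdzeta: "continuous_on UNIV (%x. fderiv zeta (at x) b)" by (rule Ck_continuous[OF Ck_partial[OF zeta b]])
 have csdzeta: "csupp (%x. fderiv zeta (at x) b)" by (rule csupp_frechet(1)[OF cszeta])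
 have bm: "sqint (leb S) (%x. q x * f x)"
 if q: "continuous_on UNIV q" "csupp q" and f: "sqint (leb S) f" for q f :: "'a => real"
 proof -
 obtain B where B: "!!x. norm (q x) <= B" using csupp_bounded[OF q] by metis
 show ?thesis by (rule sqint_bounded_mult[OF f cont_measurable_leb(2)[OF q(1)], of B]) (use B in auto) qed
 define I where "I f h = (LINT x|leb S. f x * h x)" for f h :: "'a => real"
 \<comment> \<open>C collects the L^2 norms of the three fixed factors, so the mollification error
   enters linearly as e times C.\<close>
 have key: "abs(I (%x. fderiv zeta (at x) b * z x) w' + I (%x. zeta x * z x) dw' + I (%x. zeta x * dz x) w') <= e * C"
 if e: "0 < e" and C: "C = nrm2 (leb S) (%x. fderiv zeta (at x) b * z x) + nrm2 (leb S) (%x. zeta x * z x) + nrm2 (leb S) (%x. zeta x * dz x)"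
 for e C
 proof -
 obtain d1 where d1: "0 < d1" "!!h. norm h < d1 ==> nrm2 lborel (%x. w' (x - h) - w' x) <= e" "!!h. sqint lborel (%x. w' (x - h) - w' x)"
 using L2_translation_continuous[OF w'(1) _ S(2) w'(4) e] w'(2) unfolding sqint_def by metis
 obtain d2 where d2: "0 < d2" "!!h. norm h < d2 ==> nrm2 lborel (%x. dw' (x - h) - dw' x) <= e" "!!h. sqint lborel (%x. dw' (x - h) - dw' x)"
 using L2_translation_continuous[OF dw'(1) _ S(2) dw'(4) e] dw'(2) unfolding sqint_def by metis
 \<comment> \<open>The bound by r keeps the mollification balls around points of K inside S; the
   other two give L^2 closeness for w and dw.\<close>
 define d where "d = min r (min d1 d2)"
 have d: "0 < d" "d <= r" "d <= d1" "d <= d2" using r(1) d1(1) d2(1) by (auto simp: d_def)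
 obtain rho :: "'a => real" where rho: "!!k. Ck k rho" "!!x. 0 <= rho x" "!!x. d <= norm x ==> rho x = 0" "integral\<^sup>L lebesgue rho = 1"
 using mollifier_exists[where 'a='a, OF d(1)] by metis
 have crho: "continuous_on UNIV rho" using rho(1) Ck_continuous by blast
 have csrho: "csupp rho" unfolding csupp_def bounded_iff using rho(3) by (intro exI[of _ d]) (metis linear mem_Collect_eq)
 have W: "sqint lborel (%x. conv w' rho x - w' x)" "nrm2 lborel (%x. conv w' rho x - w' x) <= e"
 using conv_L2_close[OF w'(1,3) crho csrho rho(2,3,4) less_imp_le[OF e] d1(3)] d1(2) d(3) by fastforce+
 have DW: "sqint lborel (%x. conv dw' rho x - dw' x)" "nrm2 lborel (%x. conv dw' rho x - dw' x) <= e"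
 using conv_L2_close[OF dw'(1,3) crho csrho rho(2,3,4) less_imp_le[OF e] d2(3)] d2(2) d(4) by fastforce+
 have ilw: "integrable lebesgue w'" using w'(1,3) integrable_completion[of w' lborel] by simp
 have Ckw: "Ck (Suc 0) (conv w' rho)" by (rule Ck_conv[OF ilw rho(1) csrho])
 define psi where "psi x = conv w' rho x * zeta x" for x
 have psi: "Ck (Suc 0) psi" unfolding psi_def[abs_def] by (rule Ck_mult[OF Ckw zeta])
 have "{x. psi x ~= 0} <= K" using K(2) by (auto simp: psi_def)
 have kint: "integrable (leb L) f" if "sqint (leb S) f" "compact L" "L <= S" for f L
 by (rule int_leb_subset[OF sqint_integrable[OF that(1) fin] Sm compact_sets_leb[OF that(2)] that(3)])
 have "(LINT x|leb S. (\<Sum>b\<in>{b}. z x * fderiv psi (at x) b)) = - (LINT x|leb S. dz x * psi x)"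
 by (rule weak_divergence_C1[OF S(1) _ kint[OF z(1)] kint[OF z(2)] _ psi K(1) \<open>{x. psi x ~= 0} <= K\<close> K(3)])
 (use b z(3) in "auto simp: wderiv_def")
 hence 1: "(LINT x|leb S. z x * fderiv psi (at x) b) = - (LINT x|leb S. dz x * psi x)" by simp
 have 2: "z x * fderiv psi (at x) b = fderiv zeta (at x) b * z x * conv w' rho x + zeta x * z x * conv dw' rho x" for x
 proof (cases "zeta x = 0")
 case True
 thus ?thesis unfolding psi_def[abs_def] frechet_mult[OF Ckw zeta] by simp
 next
 case False
 hence "x : K" using K(2) by blast
 hence cb: "cball x d <= S" using r(2) d(2) by (meson UN_subset_iff order_trans subset_cball)
 have "fderiv (conv w' rho) (at x) b = conv dw' rho x" by (rule conv_wderiv[OF S(1) b w(3) _ _ w'(1,3,4,5) dw'(1,3,4,5) rho(1) csrho rho(3) cb])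
 (use w in "auto simp: sqint_def")
 thus ?thesis unfolding psi_def[abs_def] frechet_mult[OF Ckw zeta] by (simp add: algebra_simps) qed
 have s1: "sqint (leb S) (%x. fderiv zeta (at x) b * z x)" by (rule bm[OF cdzeta csdzeta z(1)])
 have s2: "sqint (leb S) (%x. zeta x * z x)" by (rule bm[OF czeta cszeta z(1)])
 have s3: "sqint (leb S) (%x. zeta x * dz x)" by (rule bm[OF czeta cszeta z(2)])
 have sc: "sqint lborel (conv w' rho)" "sqint lborel (conv dw' rho)" using sqint_add[OF W(1) w'(2)] sqint_add[OF DW(1) dw'(2)] by simp_all
 have sce: "sqint (leb S) (conv w' rho)" "sqint (leb S) (conv dw' rho)" using sc Sm sqint_restrict(1) by blast+
 have "(LINT x|leb S. z x * fderiv psi (at x) b) = I (%x. fderiv zeta (at x) b * z x) (conv w' rho) + I (%x. zeta x * z x) (conv dw' rho)"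
 unfolding 2 I_def by (rule bi_integral_add[OF sqint_mult[OF s1 sce(1)] sqint_mult[OF s2 sce(2)]])
 moreover have "(LINT x|leb S. dz x * psi x) = I (%x. zeta x * dz x) (conv w' rho)" unfolding I_def psi_def by (rule bi_integral_cong) (simp_all add: mult_ac)
 ultimately have 3: "I (%x. fderiv zeta (at x) b * z x) (conv w' rho) + I (%x. zeta x * z x) (conv dw' rho) + I (%x. zeta x * dz x) (conv w' rho) = 0" using 1 by simp
 have close: "abs(I f g' - I f g) <= nrm2 (leb S) f * e"
 if f: "sqint (leb S) f" and g: "sqint lborel g" "sqint lborel (%x. g' x - g x)" "nrm2 lborel (%x. g' x - g x) <= e" for f g g'
 proof -
 have ge: "sqint (leb S) (%x. g' x - g x)" "sqint (leb S) g" using g sqint_restrict(1)[OF _ Sm] by blast+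
 have g'e: "sqint (leb S) g'" using sqint_add[OF ge] by simp
 have "I f g' - I f g = (LINT x|leb S. f x * (g' x - g x))"
 unfolding I_def right_diff_distrib by (rule bi_integral_diff[OF sqint_mult[OF f g'e] sqint_mult[OF f ge(2)], symmetric])
 also have "abs(...) <= nrm2 (leb S) f * nrm2 (leb S) (%x. g' x - g x)" by (rule sqint_cauchy_schwarz'[OF f ge(1)])
 also have "... <= nrm2 (leb S) f * e" using order_trans[OF sqint_restrict(2)[OF g(2) Sm] g(3)] by (rule mult_left_mono) simp
 finally show ?thesis . qed
 show ?thesis using 3 close[OF s1 w'(2) W] close[OF s2 dw'(2) DW] close[OF s3 w'(2) W] unfolding C by (simp add: algebra_simps) qed
 define C where "C = nrm2 (leb S) (%x. fderiv zeta (at x) b * z x) + nrm2 (leb S) (%x. zeta x * z x) + nrm2 (leb S) (%x. zeta x * dz x)"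
 have C0: "C >= 0" by (simp add: C_def)
 define X where "X = I (%x. fderiv zeta (at x) b * z x) w' + I (%x. zeta x * z x) dw' + I (%x. zeta x * dz x) w'"
 have "abs(X) <= 0"
 proof (rule field_le_epsilon)
 fix e :: real assume e: "0 < e"
 have "0 < e / (C + 1)" using e C0 by simp
 from key[OF this C_def] have "abs(X) <= e / (C + 1) * C" by (simp add: X_def)
 also have "... <= e" using e C0 by (simp add: field_simps)
 finally show "abs(X) <= 0 + e" by simp qed
 hence X0: "X = 0" by simp
 have s1: "sqint (leb S) (%x. fderiv zeta (at x) b * z x)" by (rule bm[OF cdzeta csdzeta z(1)])
 have s2: "sqint (leb S) (%x. zeta x * z x)" by (rule bm[OF czeta cszeta z(1)])
 have s3: "sqint (leb S) (%x. zeta x * dz x)" by (rule bm[OF czeta cszeta z(2)])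
 have Icong: "I f g = I f g'" if "sqint (leb S) f" "sqint (leb S) g" "sqint lborel g'" "AE x in lebesgue. x : S --> g x = g' x" for f g g' unfolding I_def
 proof (rule integral_leb_cong_AE[OF Sm])
 show "(%x. f x * g x) : bmeas (leb S)" "(%x. f x * g' x) : bmeas (leb S)" using sqint_mult[OF that(1,2)] sqint_mult[OF that(1) sqint_restrict(1)[OF that(3) Sm]] by auto
 show "AE x in lebesgue. x : S --> f x * g x = f x * g' x" using that(4) by (rule eventually_mono) simp qed
 have "I (%x. fderiv zeta (at x) b * z x) w + (I (%x. zeta x * z x) dw + I (%x. zeta x * dz x) w) = 0"
 using X0 Icong[OF s1 w(1) w'(2,5)] Icong[OF s2 w(2) dw'(2,5)] Icong[OF s3 w(1) w'(2,5)] unfolding X_def by simp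
 moreover have "I (%x. zeta x * z x) dw + I (%x. zeta x * dz x) w = (LINT x|leb S. (w x * dz x + z x * dw x) * zeta x)"
 unfolding I_def bi_integral_add[OF sqint_mult[OF s2 w(2)] sqint_mult[OF s3 w(1)], symmetric] by (rule bi_integral_cong) (simp_all add: algebra_simps)
 moreover have "I (%x. fderiv zeta (at x) b * z x) w = (LINT x|leb S. w x * z x * fderiv zeta (at x) b)" unfolding I_def by (rule bi_integral_cong) (simp_all add: mult_ac)
 ultimately show ?thesis by simp qed

section \<open>Evolution problems for families of bilinear forms\<close>

lemma Ck_real_deriv:
 fixes f :: "real => real"
 assumes "Ck (Suc k) f" shows "(f has_real_derivative deriv f t) (at t)" "Ck k (deriv f)" "fderiv f (at t) 1 = deriv f t"
proof -
 have d: "(f has_real_derivative deriv f t) (at t)" for t using Ck_has_derivative[OF assms, of t] by (metis DERIV_deriv_iff_real_differentiable differentiable_def)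
 show "(f has_real_derivative deriv f t) (at t)" by (rule d)
 have eq: "fderiv f (at t) 1 = deriv f t" for t using frechet_derivative_at[OF d[of t, unfolded has_field_derivative_def]] by (metis mult.right_neutral)
 thus "fderiv f (at t) 1 = deriv f t" .
 show "Ck k (deriv f)" using Ck_partial[OF assms, of 1] eq by simp qed

lemma leb_negligible_diff:
 fixes f :: "'a::euclidean_space => real"
 assumes S: "S : sets lebesgue" "U : sets lebesgue" "U <= S" "negligible (S - U)" shows "f : bmeas (leb U) \<longleftrightarrow> f : bmeas (leb S)"
 "integrable (leb U) f \<longleftrightarrow> integrable (leb S) f"
 "(LINT x|leb U. f x) = (LINT x|leb S. f x)"
proof -
 have N: "S - U : null_sets lebesgue" using S(4) by (simp only: negligible_iff_null_sets)
 hence ae: "AE t in lebesgue. t ~: S - U" by (rule AE_not_in)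
 have "S \<inter> (S - U) : null_sets lebesgue" using N by (simp add: Int_absorb1)
 hence N': "S \<inter> (S - U) : null_sets (leb S)" using S by (simp add: null_sets_restrict_space)
 have eqs: "S - (S \<inter> (S - U)) = U" using S(3) by auto
 show m: "f : bmeas (leb U) \<longleftrightarrow> f : bmeas (leb S)" using borel_measurable_diff_null[OF N', of f] S(1) unfolding eqs by simp
 have M: "(%t. indicator U t * f t) : bmeas lebesgue \<longleftrightarrow> (%t. indicator S t * f t) : bmeas lebesgue"
 using m borel_measurable_restrict_space_iff[of U lebesgue f] borel_measurable_restrict_space_iff[of S lebesgue f] S by simp
 have ae': "AE t in lebesgue. indicator U t * f t = indicator S t * f t" using ae by eventually_elim (use S(3) in "auto simp: indicator_def")
 have ae'': "AE t in lebesgue. indicator S t * f t = indicator U t * f t" by (rule eventually_mono[OF ae']) (rule sym)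
 show i: "integrable (leb U) f \<longleftrightarrow> integrable (leb S) f" unfolding integrable_leb_eq[OF S(1)] integrable_leb_eq[OF S(2)]
 using M ae' ae'' integrable_cong_AE_imp borel_measurable_integrable by blast
 show "(LINT t|leb U. f t) = (LINT t|leb S. f t)"
 proof (cases "integrable (leb S) f")
 case True
 hence 1: "integrable lebesgue (%t. indicator S t * f t)" by (simp add: integrable_leb_eq S)
 from True i have 2: "integrable lebesgue (%t. indicator U t * f t)" by (simp add: integrable_leb_eq S)
 show ?thesis unfolding integral_leb_eq[OF S(1)] integral_leb_eq[OF S(2)]
 by (rule integral_cong_AE[OF borel_measurable_integrable[OF 2] borel_measurable_integrable[OF 1] ae'])
 next
 case False
 thus ?thesis using i by (simp add: not_integrable_integral_eq) qed qed

lemma leb_Ioo_Icc: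
 fixes f :: "real => real" shows "integrable (leb {a<..<b}) f \<longleftrightarrow> integrable (leb {a..b}) f"
 "(LINT t|leb {a<..<b}. f t) = (LINT t|leb {a..b}. f t)"
 "f : bmeas (leb {a<..<b}) \<longleftrightarrow> f : bmeas (leb {a..b})"
proof -
 have n: "negligible ({a..b} - {a<..<b})" by (rule negligible_subset[of "{a, b}"]) auto
 have s: "{a..b} : sets lebesgue" "{a<..<b} : sets lebesgue" "{a<..<b} <= {a..b}" by auto
 note d = leb_negligible_diff[OF s n, of f]
 show "integrable (leb {a<..<b}) f \<longleftrightarrow> integrable (leb {a..b}) f" by (rule d(2))
 show "(LINT t|leb {a<..<b}. f t) = (LINT t|leb {a..b}. f t)" by (rule d(3))
 show "f : bmeas (leb {a<..<b}) \<longleftrightarrow> f : bmeas (leb {a..b})" by (rule d(1)) qed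

lemma sub_integrable:
 fixes f :: "real => real"
 assumes "integrable (leb {a..b}) f" "a <= s" "t <= b" shows "integrable (leb {s..t}) f" by (rule int_leb_subset[OF assms(1)]) (use assms in auto)

lemma lebesgue_on_bounded_mult:
 fixes f c :: "real => real"
 assumes f: "integrable (leb S) f" and c: "c : bmeas (leb S)" and B: "!!t. t : S ==> abs(c t) <= B" shows "integrable (leb S) (%t. f t * c t)"
proof (rule bi_integrable_bound)
 show "integrable (leb S) (%t. f t * B)" using f by simp
 show "(%t. f t * c t) : bmeas (leb S)" by (rule borel_measurable_times[OF borel_measurable_integrable[OF f] c])
 show "AE t in leb S. norm (f t * c t) <= norm (f t * B)" unfolding norm_mult
 proof (intro AE_I2 mult_left_mono)
 fix t assume "t : space (leb S)"
 thus "norm (c t) <= norm B" using B[of t] by (auto simp: space_restrict_space) qed simp qed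

lemma cont_integrable_Icc:
 fixes f :: "real => real"
 assumes "continuous_on {a..b} f" shows "integrable (leb {a..b}) f" by (rule continuous_imp_integrable[of a b f, unfolded cbox_interval, OF assms])

lemma continuous_dense_L1:
 fixes k :: "real => real"
 assumes k: "integrable (leb {a..b}) k" and e: "0 < e"
 obtains c where "continuous_on UNIV c" "(LINT t|leb {a..b}. abs(k t - c t)) < e"
proof -
 define k' where "k' t = indicator {a..b} t * k t" for t
 have k': "integrable lebesgue k'" using k unfolding k'_def by (simp add: integrable_leb_eq)
 have "strongly_measurable lebesgue k'" by (rule borel_strongly_measurable[OF borel_measurable_integrable[OF k']])
 then obtain c where c: "continuous_on UNIV c" "csupp c" "integrable lebesgue (%x. norm (k' x - c x) powr 1)" "(LINT x|lebesgue. norm (k' x - c x) powr 1) < e"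
 using Lp_continuous_dense[of 1 k' "{a..b}" e] k' e unfolding k'_def by auto
 have i: "integrable lebesgue (%x. indicator {a..b} x * abs(k x - c x))"
 proof -
 have "integrable lebesgue (%x. indicator {a..b} x *\<^sub>R \<bar>k' x - c x\<bar>)" by (rule integrable_mult_indicator) (use c(3) in auto)
 moreover have "(%x. indicator {a..b} x *\<^sub>R \<bar>k' x - c x\<bar>) = (%x. indicator {a..b} x * \<bar>k x - c x\<bar>)" by (auto simp: fun_eq_iff k'_def indicator_def)
 ultimately show ?thesis by (simp only:) qed
 have "(LINT t|leb {a..b}. abs(k t - c t)) = (LINT x|lebesgue. indicator {a..b} x * abs(k x - c x))" by (rule integral_leb_eq) simp
 also have "... <= (LINT x|lebesgue. norm (k' x - c x) powr 1)" by (rule bi_integral_mono[OF i c(3)]) (auto simp: k'_def indicator_def)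
 also have "... < e" by (rule c(4))
 finally show ?thesis using that c(1) by blast qed

text \<open>For continuous k this is the fundamental theorem of calculus, as phi vanishes at both
  ends. An L^1 approximation of k moves its primitive uniformly by at most e, which handles the
  general case.\<close>

lemma weak_integration_by_parts:
 fixes k phi :: "real => real"
 assumes T: "0 < T" and k: "integrable (leb {0..T}) k" and phi: "phi : test_functions {0<..<T}"
 shows "(LINT t|leb {0..T}. (LINT s|leb {0..t}. k s) * deriv phi t) = - (LINT t|leb {0..T}. k t * phi t)"
proof -
 have Ckphi: "Ck j phi" for j by (rule tf_bounds(5)[OF phi])
 have cphi: "continuous_on UNIV phi" by (rule tf_bounds(1)[OF phi])
 have cd: "continuous_on UNIV (deriv phi)" by (rule Ck_continuous[OF Ck_real_deriv(2)[OF Ckphi]])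
 have cs: "csupp phi" by (rule tf_bounds(2)[OF phi])
 have "(%x. fderiv phi (at x) 1) = deriv phi" using Ck_real_deriv(3)[OF Ckphi] by blast
 hence csd: "csupp (deriv phi)" using csupp_frechet(1)[OF cs, of 1] by simp
 obtain M1 where M1: "!!t. norm (phi t) <= M1" using csupp_bounded[OF cphi cs] by metis
 obtain M2 where M2: "!!t. norm (deriv phi t) <= M2" "0 <= M2" using csupp_bounded[OF cd csd] by metis
 have M10: "0 <= M1" using M1[of 0] norm_ge_zero order_trans by blast
 have phi0: "phi 0 = 0" "phi T = 0" using tf_bounds(4,6)[OF phi] by force+
 define K where "K t = (LINT s|leb {0..t}. k s)" for t
 have cK: "continuous_on {0..T} K" unfolding K_def by (rule indefinite_integral_continuous_real[OF k])
 have iK: "integrable (leb {0..T}) (%t. K t * deriv phi t)" by (intro cont_integrable_Icc continuous_on_mult cK continuous_on_subset[OF cd]) auto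
 have ik: "integrable (leb {0..T}) (%t. k t * phi t)" by (rule lebesgue_on_bounded_mult[OF k cont_measurable_leb(2)[OF cphi]]) (use M1 in auto)
 define X where "X = (LINT t|leb {0..T}. K t * deriv phi t) + (LINT t|leb {0..T}. k t * phi t)"
 have "abs(X) <= e * (T * M2 + M1)" if e: "0 < e" for e
 proof -
 obtain c where c: "continuous_on UNIV c" "(LINT t|leb {0..T}. abs(k t - c t)) < e" using continuous_dense_L1[OF k e] by metis
 have c': "continuous_on {0..t} c" for t using c(1) continuous_on_subset by blast
 have ic: "integrable (leb {0..T}) c" by (rule cont_integrable_Icc[OF c'])
 define Kc where "Kc t = integral {0..t} c" for t
 have Kc: "Kc t = (LINT s|leb {0..t}. c s)" for t unfolding Kc_def by (rule lebesgue_integral_eq_integral[symmetric]) (auto intro: cont_integrable_Icc c')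
 have dKc: "(Kc has_real_derivative c t) (at t within {0..T})" if "t : {0..T}" for t unfolding Kc_def[abs_def] by (rule integral_has_real_derivative[OF c' that])
 have cKc: "continuous_on {0..T} Kc" by (rule DERIV_continuous_on[OF dKc])
 have "((%t. c t * phi t + Kc t * deriv phi t) has_integral (Kc T * phi T - Kc 0 * phi 0)) {0..T}"
 proof (rule fundamental_theorem_of_calculus)
 fix t assume t: "t : {0..T}"
 have "((%t. Kc t * phi t) has_real_derivative (c t * phi t + deriv phi t * Kc t)) (at t within {0..T})"
 by (rule DERIV_mult[OF dKc[OF t] has_field_derivative_at_within[OF Ck_real_deriv(1)[OF Ckphi]]])
 thus "((%t. Kc t * phi t) has_vector_derivative c t * phi t + Kc t * deriv phi t) (at t within {0..T})"
 by (simp add: has_real_derivative_iff_has_vector_derivative mult.commute) qed (use T in auto)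
 moreover have "integrable (leb {0..T}) (%t. c t * phi t + Kc t * deriv phi t)"
 by (intro cont_integrable_Icc continuous_on_add continuous_on_mult cKc c' continuous_on_subset[OF cd] continuous_on_subset[OF cphi]) auto
 ultimately have z: "(LINT t|leb {0..T}. c t * phi t + Kc t * deriv phi t) = 0" using phi0 by (subst lebesgue_integral_eq_integral) (auto simp: integral_unique)
 have i1: "integrable (leb {0..T}) (%t. Kc t * deriv phi t)" by (intro cont_integrable_Icc continuous_on_mult cKc continuous_on_subset[OF cd]) auto
 have i2: "integrable (leb {0..T}) (%t. c t * phi t)" by (intro cont_integrable_Icc continuous_on_mult c' continuous_on_subset[OF cphi]) auto
 have z': "(LINT t|leb {0..T}. c t * phi t) + (LINT t|leb {0..T}. Kc t * deriv phi t) = 0" using z bi_integral_add[OF i2 i1] by simp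
 have ikc: "integrable (leb {0..T}) (%t. k t - c t)" by (rule bi_integrable_diff[OF k ic])
 have dK: "abs(K t - Kc t) <= e" if t: "t : {0..T}" for t
 proof -
 have sk: "integrable (leb {0..t}) k" "integrable (leb {0..t}) c" "integrable (leb {0..t}) (%t. k t - c t)"
 using t sub_integrable[OF k, of 0 t] sub_integrable[OF ic, of 0 t] sub_integrable[OF ikc, of 0 t] by auto
 have "K t - Kc t = (LINT s|leb {0..t}. k s - c s)" unfolding K_def Kc by (rule bi_integral_diff[OF sk(1,2), symmetric])
 also have "abs(...) <= (LINT s|leb {0..t}. abs(k s - c s))" by (rule integral_abs_bound)
 also have "... <= (LINT s|leb {0..T}. abs(k s - c s))" using t integrable_abs[OF sk(3)] integrable_abs[OF ikc] by (subst (1 2) integral_leb_eq, simp, simp)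
 (intro bi_integral_mono, auto simp: integrable_leb_eq indicator_def)
 finally show ?thesis using c(2) by simp qed
 have x1: "X = (LINT t|leb {0..T}. (K t - Kc t) * deriv phi t) + (LINT t|leb {0..T}. (k t - c t) * phi t)" unfolding X_def left_diff_distrib
 using bi_integral_diff[OF iK i1] bi_integral_diff[OF ik i2] z' by simp
 have x2: "abs(LINT t|leb {0..T}. (K t - Kc t) * deriv phi t) <= (LINT t|leb {0..T}. e * M2)" unfolding real_norm_def[symmetric]
 proof (rule bi_norm_bound)
 show "integrable (leb {0..T}) (%t. (K t - Kc t) * deriv phi t)" using bi_integrable_diff[OF iK i1] by (simp add: left_diff_distrib)
 show "integrable (leb {0..T}) (%t. e * M2)" by (rule cont_integrable_Icc) simp
 show "norm ((K t - Kc t) * deriv phi t) <= e * M2" if "t : space (leb {0..T})" for t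
 unfolding norm_mult using dK[of t] M2 that e by (intro mult_mono) (auto simp: space_restrict_space) qed
 have x3: "(LINT t|leb {0..T}. e * M2) = e * (T * M2)" using T by (subst lebesgue_integral_eq_integral) (auto intro: cont_integrable_Icc)
 have x4: "abs(LINT t|leb {0..T}. (k t - c t) * phi t) <= (LINT t|leb {0..T}. abs(k t - c t) * M1)" unfolding real_norm_def[symmetric]
 proof (rule bi_norm_bound)
 show "integrable (leb {0..T}) (%t. (k t - c t) * phi t)" using bi_integrable_diff[OF ik i2] by (simp add: left_diff_distrib)
 show "integrable (leb {0..T}) (%t. norm (k t - c t) * M1)" using ikc by simp
 show "norm ((k t - c t) * phi t) <= norm (k t - c t) * M1" for t unfolding norm_mult using M1[of t] by (intro mult_left_mono) auto qed
 have x5: "(LINT t|leb {0..T}. abs(k t - c t) * M1) <= e * M1" using c(2) M10 by (simp add: mult_right_mono)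
 show ?thesis unfolding distrib_left using x1 x2 x3 x4 x5 by linarith qed
 note bound = this
 have "abs(X) <= 0"
 proof (rule field_le_epsilon)
 fix e :: real assume e: "0 < e"
 define N where "N = T * M2 + M1 + 1"
 have N: "N > 0" using T M10 M2(2) by (simp add: N_def add_nonneg_pos)
 have "abs(X) <= e / N * (T * M2 + M1)" using bound[of "e / N"] e N by simp
 also have "... <= e / N * N" using e N by (intro mult_left_mono) (auto simp: N_def)
 finally show "abs(X) <= 0 + e" using N by simp qed
 thus ?thesis unfolding X_def K_def by simp qed

text \<open>The primitive vanishes to the left of the support of psi and, because the mean is zero,
  also to its right.\<close>

lemma test_primitive:
 fixes psi :: "real => real"
 assumes T: "0 < T" and psi: "psi : test_functions {0<..<T}" and z: "integral {0..T} psi = 0"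
 obtains phi where "phi : test_functions {0<..<T}" "!!t. deriv phi t = psi t"
proof -
 have cpsi: "continuous_on S psi" for S using tf_bounds(1)[OF psi] continuous_on_subset by blast
 define L where "L = closure {t. psi t ~= 0}"
 have L: "compact L" "L <= {0<..<T}" using tf_bounds(3,4)[OF psi] by (auto simp: L_def)
 have psi0: "psi t = 0" if "t ~: L" for t using that tf_bounds(6)[OF psi] unfolding L_def by blast
 obtain d where d: "0 < d" "!!t. t : L ==> d <= t & t <= T - d"
 proof (cases "L = {}")
 case True
 thus ?thesis using that[of 1] by simp
 next
 case False
 obtain x where x: "x : L" "!!y. y : L ==> x <= y" using compact_attains_inf[OF L(1) False] by metis
 obtain y where y: "y : L" "!!x. x : L ==> x <= y" using compact_attains_sup[OF L(1) False] by metis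
 show ?thesis by (rule that[of "min x (T - y)"]) (use x y L in "force+") qed
 define phi where "phi t = (if t <= 0 then 0 else integral {0..t} psi)" for t
 have left: "phi t = 0" if "t < d" for t
 proof -
 have "integral {0..t} psi = integral {0..t} (%_. 0)" by (rule Henstock_Kurzweil_Integration.integral_cong) (use d(2) that psi0 in force)
 thus ?thesis by (simp add: phi_def) qed
 have right: "phi t = 0" if t: "t > T - d" for t
 proof (cases "t <= T")
 case True
 show ?thesis
 proof (cases "t <= 0")
 case False
 have "integral {0..t} psi + integral {t..T} psi = integral {0..T} psi"
 by (rule Henstock_Kurzweil_Integration.integral_combine) (use False True in "auto intro: integrable_continuous_real cpsi")
 moreover have "integral {t..T} psi = integral {t..T} (%_. 0)" by (rule Henstock_Kurzweil_Integration.integral_cong) (use d(2) t psi0 in force)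
 ultimately show ?thesis using z by (simp add: phi_def) qed (simp add: phi_def)
 next
 case False
 have "integral {0..T} psi + integral {T..t} psi = integral {0..t} psi"
 by (rule Henstock_Kurzweil_Integration.integral_combine) (use False T in "auto intro: integrable_continuous_real cpsi")
 moreover have "integral {T..t} psi = integral {T..t} (%_. 0)" by (rule Henstock_Kurzweil_Integration.integral_cong) (use d(1,2) psi0 in force)
 ultimately show ?thesis using z by (simp add: phi_def) qed
 have der: "(phi has_real_derivative psi t) (at t)" for t
 proof (cases "t < d")
 case True
 have "(phi has_real_derivative 0) (at t)" by (rule has_field_derivative_transform_within_open[of "%_. 0" 0 t "{..<d}"]) (use True left in auto)
 moreover have "psi t = 0" using True d(2) psi0 by force
 ultimately show ?thesis by simp
 next
 case False
 hence t: "0 < t" using d(1) by simp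
 have "((%x. integral {0..x} psi) has_real_derivative psi t) (at t within {0..t + 1})" by (rule integral_has_real_derivative[OF cpsi]) (use t in auto)
 hence "((%x. integral {0..x} psi) has_real_derivative psi t) (at t)" using t by (simp add: at_within_Icc_at)
 thus ?thesis by (rule has_field_derivative_transform_within_open[of _ _ _ "{0<..}"]) (use t in "auto simp: phi_def") qed
 have deq: "deriv phi = psi" using der DERIV_imp_deriv by blast
 have CkS: "Ck (Suc k) phi" for k
 proof (rule Ck_SucI)
 show "(phi has_derivative (*) (psi t)) (at t)" for t using der[of t] by (simp add: has_field_derivative_def)
 show "Ck k (%t. psi t * b)" for b by (rule Ck_mult[OF tf_bounds(5)[OF psi] Ck_const]) qed
 have "Ck k phi" for k using Ck_Suc_imp[OF CkS] .
 moreover have cl: "closure {t. phi t ~= 0} <= {d..T - d}" by (rule closure_minimal) (use left right in "force+")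
 moreover have "compact (closure {t. phi t ~= 0})" using bounded_subset[OF bounded_closed_interval cl] by (simp add: compact_eq_bounded_closed)
 ultimately have "phi : test_functions {0<..<T}" unfolding test_functions_def using d(1) by fastforce
 thus ?thesis using that deq by simp qed

text \<open>Modulo a multiple of one fixed c0 of positive integral, every test function is the
  derivative of a test function. Hence h minus its c0-weighted mean \<open>\<kappa>\<close>
  annihilates all test functions.\<close>

lemma weakly_constant:
 fixes h :: "real => real"
 assumes T: "0 < T" and h: "integrable (leb {0..T}) h"
 and weak: "!!phi. phi : test_functions {0<..<T} ==> (LINT t|leb {0..T}. h t * deriv phi t) = 0"
 obtains c where "AE t in lebesgue. t : {0<..<T} --> h t = c"
proof -
 obtain c0 where c0: "c0 : test_functions {0<..<T}" "!!t. 0 <= c0 t" "!!t. t : {T/3..T/2} ==> c0 t = 1"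
 proof -
 have "{T/3..T/2} <= {0<..<T}" using T by auto
 from test_cutoff[OF compact_Icc this open_greaterThanLessThan] that show ?thesis by metis qed
 have cont: "continuous_on S psi" if "psi : test_functions {0<..<T}" for psi :: "real => real" and S using tf_bounds(1)[OF that] continuous_on_subset by blast
 have intc: "psi integrable_on {s..t}" if "psi : test_functions {0<..<T}" for psi :: "real => real" and s t by (rule integrable_continuous_real[OF cont[OF that]])
 have "integral {T/3..T/2} c0 <= integral {0..T} c0" by (rule integral_subset_le) (use T intc c0 in auto)
 moreover have "integral {T/3..T/2} c0 = integral {T/3..T/2} (%_. 1)" by (rule Henstock_Kurzweil_Integration.integral_cong) (use c0 in auto)
 ultimately have I0: "integral {0..T} c0 > 0" using T by simp
 define \<kappa> where "\<kappa> = (LINT t|leb {0..T}. h t * c0 t) / integral {0..T} c0"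
 have bm: "integrable (leb {0..T}) (%t. h t * psi t)" if psi: "psi : test_functions {0<..<T}" for psi
 proof -
 obtain M where M: "!!t. norm (psi t) <= M" using csupp_bounded[OF tf_bounds(1,2)[OF psi]] by metis
 show ?thesis by (rule lebesgue_on_bounded_mult[OF h cont_measurable_leb(2)[OF tf_bounds(1)[OF psi]]]) (use M in auto) qed
 have key: "(LINT t|leb {0..T}. (h t - \<kappa>) * psi t) = 0" if psi: "psi : test_functions {0<..<T}" for psi
 proof -
 define c where "c = integral {0..T} psi / integral {0..T} c0"
 define eta where "eta t = psi t - c * c0 t" for t
 have sub: "{t. eta t ~= 0} <= closure {t. psi t ~= 0} \<union> closure {t. c0 t ~= 0}" using tf_bounds(6)[OF psi] tf_bounds(6)[OF c0(1)] by (force simp: eta_def)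
 have cl: "closure {t. eta t ~= 0} <= closure {t. psi t ~= 0} \<union> closure {t. c0 t ~= 0}" by (rule closure_minimal[OF sub closed_Un[OF closed_closure closed_closure]])
 have "bounded (closure {t. eta t ~= 0})" by (rule bounded_subset[OF _ cl]) (use tf_bounds(3)[OF psi] tf_bounds(3)[OF c0(1)] compact_imp_bounded in auto)
 moreover have "Ck k eta" for k unfolding eta_def[abs_def] by (intro Ck_diff Ck_cmult tf_bounds(5)[OF psi] tf_bounds(5)[OF c0(1)])
 ultimately have eta: "eta : test_functions {0<..<T}" unfolding test_functions_def using cl tf_bounds(4)[OF psi] tf_bounds(4)[OF c0(1)]
 by (auto simp: compact_eq_bounded_closed)
 have "integral {0..T} eta = integral {0..T} psi - c * integral {0..T} c0" unfolding eta_def using intc[OF psi, of 0 T] intc[OF c0(1), of 0 T]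
 by (subst Henstock_Kurzweil_Integration.integral_diff) (auto simp: integrable_on_mult_right)
 hence "integral {0..T} eta = 0" using I0 by (simp add: c_def)
 then obtain phi where phi: "phi : test_functions {0<..<T}" "!!t. deriv phi t = eta t" using test_primitive[OF T eta] by metis
 have "(LINT t|leb {0..T}. h t * psi t - c * (h t * c0 t)) = 0" using weak[OF phi(1)] unfolding phi(2) eta_def by (simp add: algebra_simps)
 hence 1: "(LINT t|leb {0..T}. h t * psi t) = c * (LINT t|leb {0..T}. h t * c0 t)" using bm[OF psi] bm[OF c0(1)] by simp
 have ipsi: "integrable (leb {0..T}) psi" by (rule cont_integrable_Icc[OF cont[OF psi]])
 have 2: "(LINT t|leb {0..T}. psi t) = integral {0..T} psi" by (rule lebesgue_integral_eq_integral[OF ipsi]) simp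
 have "(LINT t|leb {0..T}. (h t - \<kappa>) * psi t) = (LINT t|leb {0..T}. h t * psi t) - \<kappa> * (LINT t|leb {0..T}. psi t)"
 using bm[OF psi] ipsi by (simp add: left_diff_distrib)
 also have "... = 0" unfolding 1 2 using I0 by (simp add: c_def \<kappa>_def)
 finally show ?thesis . qed
 have ihk: "integrable (leb {0..T}) (%t. h t - \<kappa>)" using h by (intro bi_integrable_diff) (auto intro: cont_integrable_Icc)
 have "AE t in lebesgue. t : {0<..<T} --> h t - \<kappa> = 0"
 proof (rule fundamental_lemma)
 show "integrable (leb K) (%t. h t - \<kappa>)" if "compact K" "K <= {0<..<T}" for K by (rule int_leb_subset[OF ihk _ compact_sets_leb[OF that(1)]]) (use that in auto)
 show "(LINT t|leb {0<..<T}. (h t - \<kappa>) * psi t) = 0" if "psi : test_functions {0<..<T}" for psi using key[OF that] by (simp add: leb_Ioo_Icc(2)) qed simp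
 hence "AE t in lebesgue. t : {0<..<T} --> h t = \<kappa>" by eventually_elim simp
 thus ?thesis by (rule that) qed

text \<open>Subtracting the primitive of k reduces the claim to
  \<open>weakly_constant\<close>.\<close>

lemma du_bois_reymond:
 fixes f k :: "real => real"
 assumes T: "0 < T" and f: "integrable (leb {0..T}) f" and k: "integrable (leb {0..T}) k"
 and weak: "!!phi. phi : test_functions {0<..<T} ==>
 (LINT t|leb {0..T}. f t * deriv phi t) = - (LINT t|leb {0..T}. k t * phi t)"
 obtains c where "AE t in lebesgue. t : {0<..<T} --> f t = c + (LINT s|leb {0..t}. k s)"
proof -
 define K where "K t = (LINT s|leb {0..t}. k s)" for t
 have cK: "continuous_on {0..T} K" unfolding K_def by (rule indefinite_integral_continuous_real[OF k])
 have iK: "integrable (leb {0..T}) K" by (rule cont_integrable_Icc[OF cK])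
 have "(LINT t|leb {0..T}. (f t - K t) * deriv phi t) = 0" if phi: "phi : test_functions {0<..<T}" for phi
 proof -
 have Ckphi: "Ck j phi" for j by (rule tf_bounds(5)[OF phi])
 have cd: "continuous_on UNIV (deriv phi)" by (rule Ck_continuous[OF Ck_real_deriv(2)[OF Ckphi]])
 have "bounded (deriv phi ` {0..T})" by (intro compact_imp_bounded compact_continuous_image continuous_on_subset[OF cd]) auto
 hence "EX M. ALL t:{0..T}. abs(deriv phi t) <= M" by (simp add: bounded_iff)
 then obtain M where M: "!!t. t : {0..T} ==> abs(deriv phi t) <= M" by blast
 have b: "integrable (leb {0..T}) (%t. q t * deriv phi t)" if "integrable (leb {0..T}) q" for q
 by (rule lebesgue_on_bounded_mult[OF that cont_measurable_leb(2)[OF cd] M])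
 have "(LINT t|leb {0..T}. (f t - K t) * deriv phi t) = (LINT t|leb {0..T}. f t * deriv phi t) - (LINT t|leb {0..T}. K t * deriv phi t)"
 unfolding left_diff_distrib by (rule bi_integral_diff[OF b[OF f] b[OF iK]])
 thus ?thesis using weak[OF phi] weak_integration_by_parts[OF T k phi] by (simp add: K_def) qed
 then obtain c where "AE t in lebesgue. t : {0<..<T} --> f t - K t = c" using weakly_constant[OF T bi_integrable_diff[OF f iK]] by metis
 hence "AE t in lebesgue. t : {0<..<T} --> f t = c + (LINT s|leb {0..t}. k s)" by eventually_elim (auto simp: K_def)
 thus ?thesis by (rule that) qed

text \<open>A separable substitute for V: almost all values lie in the closure of a countable set,
  which suffices because the equations are tested with values of the solutions themselves.\<close>

lemma strongly_measurable_separable: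
 assumes "strongly_measurable M f"
 obtains D where "countable D" "AE t in M. f t : closure D"
proof -
 obtain s where s: "!!n::nat. simple_function M (s n)" "AE t in M. (%n. s n t) ----> f t" using assms unfolding strongly_measurable_def by blast
 define D where "D = (\<Union>n. s n ` space M)"
 have "countable D" unfolding D_def using simple_functionD(1)[OF s(1)] by (auto intro: countable_finite)
 moreover have "AE t in M. f t : closure D" using s(2)
 proof (rule AE_mp, intro AE_I2 impI)
 fix t assume "t : space M" "(%n. s n t) ----> f t"
 thus "f t : closure D" unfolding closure_sequential by (intro exI[of _ "%n. s n t"]) (auto simp: D_def) qed
 ultimately show ?thesis by (rule that) qed

section \<open>Exponents and integrals over intervals\<close>

lemma powr_dominates:
 fixes x p :: real
 assumes "0 <= x" "2 <= p" shows "x\<^sup>2 <= 1 + x powr p"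
proof (cases "x <= 1")
 case True
 hence "x\<^sup>2 <= 1" using assms(1) by (simp add: power_le_one)
 thus ?thesis by (simp add: add_increasing2)
next
 case False
 hence "x powr 2 <= x powr p" using assms by (intro powr_mono) auto
 thus ?thesis using False by (simp add: add_increasing) qed

lemma le_one_plus_powr:
 fixes x p :: real
 assumes "0 <= x" "1 <= p" shows "x <= 1 + x powr p"
proof (cases "x <= 1")
 case False
 hence "x powr 1 <= x powr p" using assms by (intro powr_mono) auto
 thus ?thesis using False by simp qed (simp add: add_increasing2)

lemma mult_le_powr:
 fixes a b p q :: real
 assumes "1 < p" "1 < q" "1/p + 1/q = 1" "0 <= a" "0 <= b" shows "a * b <= a powr p + b powr q"
proof -
 have "a * b <= a powr p / p + b powr q / q" by (rule Youngs_inequality[OF assms])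
 also have "... <= a powr p + b powr q" using assms(1,2) by (intro add_mono) (auto simp: divide_le_eq mult_left_le intro: order_trans[OF _ mult_left_mono[of 1]])
 finally show ?thesis . qed

lemma Icc_integral_bound:
 fixes f g :: "real => real"
 assumes "integrable (leb {s..t}) f" "integrable (leb {s..t}) g" "!!x. x : {s..t} ==> abs(f x) <= g x" shows "abs(LINT x|leb {s..t}. f x) <= (LINT x|leb {s..t}. g x)"
 unfolding real_norm_def[symmetric] by (rule bi_norm_bound[OF assms(1,2)]) (use assms(3) in "auto simp: space_restrict_space")

lemma Icc_integral_const: "s <= t ==> (LINT x|leb {s..t}. c) = (t - s) * (c::real)" by (subst lebesgue_integral_eq_integral) (auto intro: cont_integrable_Icc)

lemma Icc_integral_mono_set:
 fixes f :: "real => real"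
 assumes f: "integrable (leb {a..b}) f" and s: "a <= s" "t <= b" and nn: "!!x. x : {a..b} ==> 0 <= f x" shows "(LINT x|leb {s..t}. f x) <= (LINT x|leb {a..b}. f x)"
proof -
 have "integrable lebesgue (%x. indicator {s..t} x * f x)" "integrable lebesgue (%x. indicator {a..b} x * f x)"
 using f sub_integrable[OF f s] by (auto simp: integrable_leb_eq)
 hence "(LINT x|lebesgue. indicator {s..t} x * f x) <= (LINT x|lebesgue. indicator {a..b} x * f x)" by (rule bi_integral_mono) (use s nn in "auto simp: indicator_def")
 thus ?thesis by (simp add: integral_leb_eq) qed

text \<open>Separates the evolution argument from the geometry. For fixed arguments \<open>a\<close>
  is the time density of \<open>m\<close>. The formula \<open>m_diff\<close> is required strictly
  between 0 and T, the times for which the flow maps are assumed to be diffeomorphisms.\<close>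

locale form_family =
 fixes T C :: real and m a :: "real => 'v::real_normed_vector => 'v => real" and p q :: real
 assumes T: "0 < T" and C0: "0 <= C"
 and m_bilinear: "!!t. t : {0<..<T} ==> bounded_bilinear (m t)"
 and a_bilinear: "!!t. t : {0<..<T} ==> bounded_bilinear (a t)"
 and m_sym: "!!t w z. t : {0<..<T} ==> m t w z = m t z w"
 and a_sym: "!!t w z. t : {0<..<T} ==> a t w z = a t z w"
 and m_bound: "!!t w z. t : {0<..<T} ==> abs(m t w z) <= C * norm w * norm z"
 and a_bound: "!!t w z. t : {0<..<T} ==> abs(a t w z) <= C * norm w * norm z"
 and a_measurable: "!!w z. (%t. a t w z) : bmeas (leb {0<..<T})"
 and m_diff: "!!s t w z. 0 < s ==> s <= t ==> t < T ==> m t w z - m s w z = (LINT x|leb {s..t}. a x w z)"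
 and p: "2 <= p" and q_def: "q = p / (p - 1)"
begin


section \<open>Solutions of the abstract problem and their integrated equations\<close>

abbreviation (input) "J \<equiv> {0<..<T}"

lemma q: "1 < q" "1 / p + 1 / q = 1" using p unfolding q_def by (auto simp: field_simps)

text \<open>The distributional form of d/dt m(t;u,w) = <g,w> + a(t;u,w), with g in the role of the
  weighted time derivative.\<close>

definition sol :: "(real => 'v) => (real => 'v \<Rightarrow>\<^sub>L real) => bool" where
 "sol u g \<longleftrightarrow> u : Lp_space p J & g : Lp_space q J &
 (ALL phi:test_functions J. ALL w.
 (LINT t|leb J. m t (u t) w * deriv phi t + phi t * a t (u t) w)
 = - (LINT t|leb J. phi t * bapp (g t) w))"

text \<open>One integrable majorant for all integrands that occur: the summand 1 absorbs lower
  powers of the norms, since p >= 2 and q > 1.\<close>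

definition rho :: "(real => 'v) => (real => 'v \<Rightarrow>\<^sub>L real) => real => real" where
 "rho u g t = 1 + norm (u t) powr p + norm (g t) powr q"

lemma rho_ge: "1 <= rho u g t" "norm (u t) powr p <= rho u g t" "norm (g t) powr q <= rho u g t"
 "norm (u t) <= rho u g t" "norm (g t) <= rho u g t" "(norm (u t))\<^sup>2 <= rho u g t"
 "0 <= rho u g t"
proof -
 show "1 <= rho u g t" "norm (u t) powr p <= rho u g t" "norm (g t) powr q <= rho u g t" "0 <= rho u g t" by (simp_all add: rho_def add_increasing add_increasing2)
 have "norm (u t) <= 1 + norm (u t) powr p" "norm (g t) <= 1 + norm (g t) powr q" using le_one_plus_powr p q by auto
 moreover have "0 <= norm (u t) powr p" "0 <= norm (g t) powr q" by simp_all
 ultimately show "norm (u t) <= rho u g t" "norm (g t) <= rho u g t" unfolding rho_def by linarith+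
 have "(norm (u t))\<^sup>2 <= 1 + norm (u t) powr p" using powr_dominates p by auto
 with \<open>0 <= norm (g t) powr q\<close> show "(norm (u t))\<^sup>2 <= rho u g t" unfolding rho_def by linarith qed

lemma rho_mult: "norm (g t) * norm (u' t) <= rho u g t + rho u' g' t"
proof -
 have "norm (u' t) * norm (g t) <= norm (u' t) powr p + norm (g t) powr q" by (rule mult_le_powr) (use p q in auto)
 thus ?thesis using rho_ge(3)[of g t u] rho_ge(2)[of u' t g'] by (simp add: mult.commute) qed

lemma rho_integrable:
 assumes "sol u g" shows "integrable (leb J) (rho u g)"
proof -
 have "integrable (leb J) (%t. 1::real)" unfolding leb_Ioo_Icc by (rule cont_integrable_Icc) simp
 thus ?thesis using assms unfolding sol_def Lp_space_def rho_def[abs_def] by (intro bi_integrable_add) auto qed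

lemma dominated_integrable:
 fixes f r :: "real => real"
 assumes f: "f : bmeas (leb J)" and r: "integrable (leb J) r"
 and le: "!!t. t : J ==> abs(f t) <= r t" shows "integrable (leb {0..T}) f"
proof -
 have "integrable (leb J) f"
 proof (rule bi_integrable_bound[OF r f], rule AE_I2)
 fix t assume "t : space (leb J)"
 thus "norm (f t) <= norm (r t)" using le[of t] by (auto simp: space_restrict_space) qed
 thus ?thesis by (simp only: leb_Ioo_Icc) qed

lemma m_lipschitz:
 assumes "0 < s" "s <= t" "t < T" shows "abs(m t w z - m s w z) <= C * norm w * norm z * (t - s)"
proof -
 have st: "{s..t} <= J" using assms by auto
 have am: "(%x. a x w z) : bmeas (leb {s..t})" by (rule measurable_restrict_mono[OF a_measurable st])
 have ic: "integrable (leb {s..t}) (%_. C * norm w * norm z)" by (rule cont_integrable_Icc[OF continuous_on_const])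
 have i: "integrable (leb {s..t}) (%x. a x w z)"
 proof (rule bi_integrable_bound[OF ic am], rule AE_I2)
 fix x assume "x : space (leb {s..t})"
 hence "x : J" using st by (auto simp: space_restrict_space)
 thus "norm (a x w z) <= norm (C * norm w * norm z)" using order_trans[OF a_bound abs_ge_self] by simp qed
 have "abs(LINT x|leb {s..t}. a x w z) <= (LINT x|leb {s..t}. C * norm w * norm z)" by (rule Icc_integral_bound[OF i ic a_bound[OF subsetD[OF st]]])
 thus ?thesis unfolding m_diff[OF assms] Icc_integral_const[OF assms(2)] by (simp only: mult_ac) qed

lemma m_measurable: "(%t. m t w z) : bmeas (leb J)"
proof -
 have "continuous_on J (%t. m t w z)"
 proof (rule lipschitz_on_continuous_on, rule lipschitz_onI)
 show "dist (m x w z) (m y w z) <= (C * norm w * norm z) * dist x y" if "x : J" "y : J" for x y using m_lipschitz[of x y w z] m_lipschitz[of y x w z] that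
 by (cases "x <= y") (auto simp: dist_real_def abs_minus_commute) qed (use C0 in auto)
 thus ?thesis by (rule continuous_imp_measurable_on_sets_lebesgue) simp qed

lemma form_measurable:
 fixes b :: "real => 'w::real_normed_vector => 'x::real_normed_vector => real"
 assumes bil: "!!t. t : J ==> bounded_bilinear (b t)" and b: "!!w z. (%t. b t w z) : bmeas (leb J)"
 and u: "strongly_measurable (leb J) u" "strongly_measurable (leb J) z" shows "(%t. b t (u t) (z t)) : bmeas (leb J)"
proof -
 have "(%t. (%t x. b t (fst x) (snd x)) t (u t, z t)) : bmeas (leb J)"
 proof (rule strong_comp_measurable[OF _ strongly_measurable_Pair[OF u], where H="%t x. b t (fst x) (snd x)"])
 fix t assume "t : J"
 thus "isCont (%x. b t (fst x) (snd x)) (u t, z t)" by (intro bounded_bilinear.isCont[OF bil] continuous_fst continuous_snd continuous_ident) qed (use b in auto)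
 thus ?thesis by simp qed

lemma g_measurable:
 fixes g :: "real => 'w::real_normed_vector \<Rightarrow>\<^sub>L real"
 assumes "strongly_measurable (leb J) g" "strongly_measurable (leb J) z" shows "(%t. bapp (g t) (z t)) : bmeas (leb J)"
proof -
 have "(%t. (%t x. bapp (fst x) (snd x)) t (g t, z t)) : bmeas (leb J)"
 by (rule strong_comp_measurable[OF _ strongly_measurable_Pair[OF assms], where H="%t x. bapp (fst x) (snd x)"])
 (auto intro!: bounded_bilinear.isCont[OF bounded_bilinear_blinfun_apply] continuous_fst continuous_snd continuous_ident)
 thus ?thesis by simp qed

lemma strongly_measurable_const: "strongly_measurable (leb J) (%_. w)" unfolding strongly_measurable_def by (intro exI[of _ "%_ _. w"]) auto

lemma solD:
 assumes "sol u g" shows "strongly_measurable (leb J) u" "strongly_measurable (leb J) g"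
 "integrable (leb J) (%t. norm (u t) powr p)" "integrable (leb J) (%t. norm (g t) powr q)" using assms by (auto simp: sol_def Lp_space_def)

lemma g_bound: "abs(bapp h w) <= norm h * norm w" for h :: "'v \<Rightarrow>\<^sub>L real" using norm_blinfun[of h w] by simp

lemma a_integrable:
 assumes u: "sol u g" "sol z g'" shows "integrable (leb {0..T}) (%t. a t (u t) (z t))"
 "integrable (leb {0..T}) (%t. m t (u t) (z t))"
proof -
 have r: "integrable (leb J) (%t. C * (rho u g t + rho z g' t))" using rho_integrable[OF u(1)] rho_integrable[OF u(2)] by simp
 have le: "C * norm (u t) * norm (z t) <= C * (rho u g t + rho z g' t)" for t
 proof -
 have "0 <= (norm (u t) - norm (z t))\<^sup>2" by simp
 hence "2 * (norm (u t) * norm (z t)) <= (norm (u t))\<^sup>2 + (norm (z t))\<^sup>2" by (simp add: power2_diff)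
 moreover have "0 <= norm (u t) * norm (z t)" by simp
 ultimately have "norm (u t) * norm (z t) <= rho u g t + rho z g' t" using rho_ge(6)[of u t g] rho_ge(6)[of z t g'] by linarith
 thus ?thesis using C0 by (simp only: mult.assoc) (rule mult_left_mono) qed
 show "integrable (leb {0..T}) (%t. a t (u t) (z t))" by (rule dominated_integrable[OF form_measurable[OF a_bilinear a_measurable solD(1)[OF u(1)] solD(1)[OF u(2)]] r])
 (assumption, rule order_trans[OF a_bound le])
 show "integrable (leb {0..T}) (%t. m t (u t) (z t))" by (rule dominated_integrable[OF form_measurable[OF m_bilinear m_measurable solD(1)[OF u(1)] solD(1)[OF u(2)]] r])
 (assumption, rule order_trans[OF m_bound le]) qed

lemma g_integrable:
 assumes u: "sol u g" "sol z g'" shows "integrable (leb {0..T}) (%t. bapp (g t) (z t))"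
proof -
 have r: "integrable (leb J) (%t. rho u g t + rho z g' t)" using rho_integrable[OF u(1)] rho_integrable[OF u(2)] by simp
 show ?thesis by (rule dominated_integrable[OF g_measurable[OF solD(2)[OF u(1)] solD(1)[OF u(2)]] r])
 (rule order_trans[OF g_bound rho_mult]) qed

lemma const_integrable:
 assumes u: "sol u g" shows "integrable (leb {0..T}) (%t. bapp (g t) w)"
 "integrable (leb {0..T}) (%t. a t (u t) w)"
 "integrable (leb {0..T}) (%t. m t (u t) w)"
 "integrable (leb {0..T}) (%t. a t w w')"
proof -
 have r: "integrable (leb J) (%t. rho u g t * norm w)" "integrable (leb J) (%t. C * rho u g t * norm w)" using rho_integrable[OF u] by simp_all
 show "integrable (leb {0..T}) (%t. bapp (g t) w)" by (rule dominated_integrable[OF g_measurable[OF solD(2)[OF u] strongly_measurable_const] r(1)])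
 (rule order_trans[OF g_bound mult_right_mono[OF rho_ge(5)]], simp)
 have le: "C * norm (u t) * norm w <= C * rho u g t * norm w" for t by (intro mult_right_mono mult_left_mono rho_ge C0) simp
 show "integrable (leb {0..T}) (%t. a t (u t) w)" by (rule dominated_integrable[OF form_measurable[OF a_bilinear a_measurable solD(1)[OF u] strongly_measurable_const] r(2)])
 (assumption, rule order_trans[OF a_bound le])
 show "integrable (leb {0..T}) (%t. m t (u t) w)" by (rule dominated_integrable[OF form_measurable[OF m_bilinear m_measurable solD(1)[OF u] strongly_measurable_const] r(2)])
 (assumption, rule order_trans[OF m_bound le])
 have c: "integrable (leb J) (%_. C * norm w * norm w')" unfolding leb_Ioo_Icc by (rule cont_integrable_Icc) simp
 show "integrable (leb {0..T}) (%t. a t w w')" by (rule dominated_integrable[OF a_measurable c a_bound]) qed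

lemma weak_primitive:
 assumes u: "sol u g" shows "EX c. AE t in lebesgue. t : J -->
 m t (u t) w = c + (LINT x|leb {0..t}. bapp (g x) w + a x (u x) w)"
proof -
 have k: "integrable (leb {0..T}) (%x. bapp (g x) w + a x (u x) w)" by (rule bi_integrable_add[OF const_integrable(1,2)[OF u]])
 have weak: "(LINT t|leb {0..T}. m t (u t) w * deriv phi t) = - (LINT t|leb {0..T}. (bapp (g t) w + a t (u t) w) * phi t)"
 if phi: "phi : test_functions J" for phi
 proof -
 have Ckphi: "Ck j phi" for j by (rule tf_bounds(5)[OF phi])
 have cd: "continuous_on UNIV (deriv phi)" by (rule Ck_continuous[OF Ck_real_deriv(2)[OF Ckphi]])
 have cphi: "continuous_on UNIV phi" by (rule tf_bounds(1)[OF phi])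
 have bnd: "integrable (leb {0..T}) (%t. f t * h t)" if f: "integrable (leb {0..T}) f" and h: "continuous_on UNIV h" for f h :: "real => real"
 proof -
 have "bounded (h ` {0..T})" by (intro compact_imp_bounded compact_continuous_image continuous_on_subset[OF h]) auto
 hence "EX M. ALL t:{0..T}. abs(h t) <= M" by (simp add: bounded_iff)
 then obtain M where M: "!!t. t : {0..T} ==> abs(h t) <= M" by blast
 show ?thesis by (rule lebesgue_on_bounded_mult[OF f cont_measurable_leb(2)[OF h] M]) qed
 have i: "integrable (leb {0..T}) (%t. m t (u t) w * deriv phi t)" "integrable (leb {0..T}) (%t. phi t * a t (u t) w)"
 "integrable (leb {0..T}) (%t. phi t * bapp (g t) w)"
 using bnd[OF const_integrable(3)[OF u] cd] bnd[OF const_integrable(2)[OF u] cphi] bnd[OF const_integrable(1)[OF u] cphi] by (simp_all add: mult.commute)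
 have "(LINT t|leb {0..T}. m t (u t) w * deriv phi t + phi t * a t (u t) w) = - (LINT t|leb {0..T}. phi t * bapp (g t) w)"
 using u phi unfolding sol_def leb_Ioo_Icc(2) by blast
 hence "(LINT t|leb {0..T}. m t (u t) w * deriv phi t) = - ((LINT t|leb {0..T}. phi t * bapp (g t) w) + (LINT t|leb {0..T}. phi t * a t (u t) w))"
 using bi_integral_add[OF i(1,2)] by simp
 also have "... = - (LINT t|leb {0..T}. phi t * bapp (g t) w + phi t * a t (u t) w)" using bi_integral_add[OF i(3,2)] by simp
 finally show ?thesis by (simp add: algebra_simps) qed
 show ?thesis by (rule du_bois_reymond[OF T const_integrable(3)[OF u] k weak]) (assumption, rule exI) qed

definition bal :: "(real => 'v) => (real => 'v \<Rightarrow>\<^sub>L real) => 'v => real => real => bool" where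
 "bal u g w s t \<longleftrightarrow> m t (u t) w - m s (u s) w = (LINT x|leb {s..t}. bapp (g x) w + a x (u x) w)"

lemma Icc_integral_split:
 fixes f :: "real => real"
 assumes "integrable (leb {0..T}) f" "0 <= s" "s <= t" "t <= T" shows "(LINT x|leb {0..t}. f x) - (LINT x|leb {0..s}. f x) = (LINT x|leb {s..t}. f x)"
 using integral_combine[OF sub_integrable[OF assms(1) order_refl assms(4)] assms(2,3)] by simp

text \<open>The exceptional times depend on w, but countably many w share one null set. Between two
  fixed good times both sides are continuous in w, which extends the identity to the
  closure.\<close>

lemma balanced_closure:
 assumes u: "sol u g" and D: "countable D"
 obtains N where "N : null_sets lebesgue"
 "!!w s t. w : closure D ==> s : J - N ==> t : J - N ==> s <= t ==> bal u g w s t"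
proof -
 define k where "k w x = bapp (g x) w + a x (u x) w" for w x
 have ik: "integrable (leb {0..T}) (k w)" for w unfolding k_def by (rule bi_integrable_add[OF const_integrable(1,2)[OF u]])
 have "EX c. AE t in lebesgue. t : J --> m t (u t) w = c + (LINT x|leb {0..t}. k w x)" for w unfolding k_def by (rule weak_primitive[OF u])
 then obtain c where c: "!!w. AE t in lebesgue. t : J --> m t (u t) w = c w + (LINT x|leb {0..t}. k w x)" by metis
 have "AE t in lebesgue. ALL w:D. t : J --> m t (u t) w = c w + (LINT x|leb {0..t}. k w x)" by (intro AE_ball_countable[OF D, THEN iffD2] ballI c)
 note ae = this
 obtain N where N0: "!!t. t : space lebesgue - N ==> ALL w:D. t : J --> m t (u t) w = c w + (LINT x|leb {0..t}. k w x)"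
 "N : null_sets lebesgue" using AE_E3[OF ae] by blast
 hence N: "N : null_sets lebesgue"
 "!!t w. t ~: N ==> w : D ==> t : J ==> m t (u t) w = c w + (LINT x|leb {0..t}. k w x)" by (simp_all add: space_completion)
 have "bal u g w s t" if w: "w : closure D" and st: "s : J - N" "t : J - N" "s <= t" for w s t
 proof -
 have iks: "integrable (leb {s..t}) (k w)" for w using sub_integrable[OF ik[of w], of s t] st by auto
 define L where "L w = (LINT x|leb {s..t}. k w x)" for w
 define M where "M = (LINT x|leb {s..t}. (1 + C) * rho u g x)"
 have irho: "integrable (leb {s..t}) (%x. (1 + C) * rho u g x)" using sub_integrable[of 0 T "rho u g" s t] rho_integrable[OF u] st by (simp add: leb_Ioo_Icc)
 have sub: "x : J" if "x : {s..t}" for x using that st by auto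
 have kb: "abs(k w x) <= (1 + C) * rho u g x * norm w" if "x : {s..t}" for w x
 proof -
 have "abs(bapp (g x) w) <= rho u g x * norm w" by (rule order_trans[OF g_bound mult_right_mono[OF rho_ge(5)]]) simp
 moreover have "abs(a x (u x) w) <= C * rho u g x * norm w" by (rule order_trans[OF a_bound[OF sub[OF that]]]) (intro mult_right_mono mult_left_mono rho_ge C0, simp)
 ultimately show ?thesis unfolding k_def by (simp add: algebra_simps) qed
 have "bounded_linear L"
 proof (rule bounded_linear_intro)
 have kadd: "LINT x|leb {s..t}. k (x1 + x2) x = (LINT x|leb {s..t}. k x1 x + k x2 x)" for x1 x2
 proof (rule bi_integral_cong[OF refl])
 fix x assume "x : space (leb {s..t})"
 hence "x : J" using sub by (simp add: space_restrict_space)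
 thus "k (x1 + x2) x = k x1 x + k x2 x" unfolding k_def by (simp add: blinfun.add_right bounded_bilinear.add_right[OF a_bilinear]) qed
 thus "L (x + y) = L x + L y" for x y unfolding L_def using bi_integral_add[OF iks iks] by simp
 have kscale: "LINT x|leb {s..t}. k (r *\<^sub>R y) x = (LINT x|leb {s..t}. r * k y x)" for r y
 proof (rule bi_integral_cong[OF refl])
 fix x assume "x : space (leb {s..t})"
 hence "x : J" using sub by (simp add: space_restrict_space)
 thus "k (r *\<^sub>R y) x = r * k y x" unfolding k_def by (simp add: blinfun.scaleR_right bounded_bilinear.scaleR_right[OF a_bilinear] distrib_left) qed
 thus "L (r *\<^sub>R y) = r *\<^sub>R L y" for r y unfolding L_def by simp
 show "norm (L w) <= norm w * M" for w
 proof -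
 have "abs(L w) <= (LINT x|leb {s..t}. (1 + C) * rho u g x * norm w)" unfolding L_def by (rule Icc_integral_bound[OF iks _ kb]) (use irho in auto)
 thus ?thesis by (simp add: M_def mult.commute) qed qed
 note linL = this
 obtain y where y: "!!n. y n : D" "y ----> w" using w unfolding closure_sequential by blast
 have "m t (u t) v - m s (u s) v = L v" if "v : D" for v using N(2)[of s v] N(2)[of t v] Icc_integral_split[OF ik[of v], of s t] st that unfolding L_def by auto
 hence eq: "m t (u t) (y n) - m s (u s) (y n) = L (y n)" for n using y(1) by blast
 have "(%n. m t (u t) (y n) - m s (u s) (y n)) ----> m t (u t) w - m s (u s) w"
 by (intro tendsto_diff bounded_bilinear.tendsto[OF m_bilinear] tendsto_const y(2)) (use st in auto)
 moreover have "(%n. L (y n)) ----> L w" by (rule bounded_linear.tendsto[OF linL y(2)])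
 ultimately have "m t (u t) w - m s (u s) w = L w" unfolding eq by (rule LIMSEQ_unique)
 thus ?thesis by (simp add: bal_def L_def k_def) qed
 with N(1) show ?thesis by (rule that) qed

text \<open>G also demands that u t and z t lie in the separable sets, so that values of either
  solution at times in G are admissible test elements for both equations.\<close>

lemma balanced_set:
 assumes u: "sol u gu" and z: "sol z gz"
 obtains G where "G <= J" "AE t in lebesgue. t : J --> t : G"
 "!!w s t. w : u ` G \<union> z ` G ==> s : G ==> t : G ==> s <= t ==> bal u gu w s t & bal z gz w s t"
proof -
 obtain D1 where D1: "countable D1" "AE t in leb J. u t : closure D1" using strongly_measurable_separable[OF solD(1)[OF u]] by metis
 obtain D2 where D2: "countable D2" "AE t in leb J. z t : closure D2" using strongly_measurable_separable[OF solD(1)[OF z]] by metis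
 have D: "countable (D1 \<union> D2)" using D1 D2 by simp
 obtain N1 where N1: "N1 : null_sets lebesgue"
 "!!w s t. w : closure (D1 \<union> D2) ==> s : J - N1 ==> t : J - N1 ==> s <= t ==> bal u gu w s t" using balanced_closure[OF u D] by metis
 obtain N2 where N2: "N2 : null_sets lebesgue"
 "!!w s t. w : closure (D1 \<union> D2) ==> s : J - N2 ==> t : J - N2 ==> s <= t ==> bal z gz w s t" using balanced_closure[OF z D] by metis
 define G where "G = {t : J - N1 - N2. u t : closure D1 & z t : closure D2}"
 show ?thesis
 proof (rule that[of G])
 show "G <= J" by (auto simp: G_def)
 have "AE t in lebesgue. t : J --> u t : closure D1" "AE t in lebesgue. t : J --> z t : closure D2" using D1(2) D2(2) by (simp_all add: AE_restrict_space_iff)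
 thus "AE t in lebesgue. t : J --> t : G" using AE_not_in[OF N1(1)] AE_not_in[OF N2(1)] by eventually_elim (auto simp: G_def)
 have "closure D1 <= closure (D1 \<union> D2)" "closure D2 <= closure (D1 \<union> D2)" by (intro closure_mono, blast)+
 thus "bal u gu w s t & bal z gz w s t"
 if "w : u ` G \<union> z ` G" "s : G" "t : G" "s <= t" for w s t using that N1(2)[of w s t] N2(2)[of w s t] by (auto simp: G_def) qed qed

end

text \<open>The increments telescope: their integral over [a,b] is the integral of P over [b,b+h]
  minus that over [a,a+h], where P is nonnegative and bounded by P T.\<close>

lemma Icc_average:
 fixes A :: "real => real"
 assumes A: "integrable (leb {0..T}) A" "!!x. x : {0..T} ==> 0 <= A x"
 and ab: "0 <= a" "a <= b" "0 <= h" "b + h <= T"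
 defines "P \<equiv> %t. LINT x|leb {0..t}. A x" shows "integrable (leb {a..b}) (%t. P (t + h) - P t)" "(LINT t|leb {a..b}. P (t + h) - P t) <= h * P T"
proof -
 have cP: "continuous_on {0..T} P" unfolding P_def by (rule indefinite_integral_continuous_real[OF A(1)])
 have P0: "0 <= P t" if "t : {0..T}" for t unfolding P_def by (intro bi_integral_nonneg) (use A(2) that in "auto simp: space_restrict_space")
 have PT: "P t <= P T" if "t : {0..T}" for t unfolding P_def by (rule Icc_integral_mono_set[OF A(1)]) (use that A(2) in auto)
 have cPs: "continuous_on {s..t} P" if "0 <= s" "t <= T" for s t by (rule continuous_on_subset[OF cP]) (use that in auto)
 have iP: "P integrable_on {s..t}" if "0 <= s" "t <= T" for s t by (rule integrable_continuous_real[OF cPs[OF that]])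
 define Q where "Q x = integral {0..x} P" for x
 have Qd: "integral {s..t} P = Q t - Q s" if "0 <= s" "s <= t" "t <= T" for s t using Henstock_Kurzweil_Integration.integral_combine[of 0 s t P] that iP by (auto simp: Q_def)
 have cs: "continuous_on {a..b} (%t. P (t + h))" by (rule continuous_on_compose2[OF cP]) (use ab in "auto intro!: continuous_intros")
 have ca: "continuous_on {a..b} P" by (rule cPs) (use ab in auto)
 have cd: "continuous_on {a..b} (%t. P (t + h) - P t)" by (intro continuous_on_diff cs ca)
 show i: "integrable (leb {a..b}) (%t. P (t + h) - P t)" by (rule cont_integrable_Icc[OF cd])
 have "(LINT t|leb {a..b}. P (t + h) - P t) = integral {a..b} (%t. P (t + h) - P t)" by (rule lebesgue_integral_eq_integral[OF i]) simp
 also have "... = integral {a..b} (%t. P (t + h)) - integral {a..b} P" by (rule Henstock_Kurzweil_Integration.integral_diff) (auto intro: integrable_continuous_real cs ca)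
 also have "integral {a..b} (%t. P (t + h)) = integral {a + h..b + h} P" using integral_shift_Icc_real[of a b P h] by (simp add: comp_def add.commute)
 also have "... - integral {a..b} P = (Q (b + h) - Q b) - (Q (a + h) - Q a)" using ab by (simp add: Qd)
 also have "Q (b + h) - Q b = integral {b..b + h} P" using ab by (simp add: Qd)
 also have "... <= integral {b..b + h} (%_. P T)" by (rule Henstock_Kurzweil_Integration.integral_le) (use ab iP PT in auto)
 also have "... = h * P T" using ab by simp
 finally have "(LINT t|leb {a..b}. P (t + h) - P t) <= h * P T - (Q (a + h) - Q a)" by simp
 moreover have "Q (a + h) - Q a = integral {a..a + h} P" using ab by (simp add: Qd)
 moreover have "0 <= integral {a..a + h} P" by (rule Henstock_Kurzweil_Integration.integral_nonneg) (use ab iP P0 in auto)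
 ultimately show "(LINT t|leb {a..b}. P (t + h) - P t) <= h * P T" by simp qed

lemma test_support_margin:
 fixes T :: real
 assumes "psi : test_functions {0<..<T}" "0 < T"
 obtains d where "0 < d" "!!t. psi t ~= 0 ==> d <= t & t <= T - d" "d <= T - d"
proof -
 define L where "L = closure {t. psi t ~= 0}"
 have L: "compact L" "L <= {0<..<T}" using tf_bounds(3,4)[OF assms(1)] by (auto simp: L_def)
 have psiL: "t : L" if "psi t ~= 0" for t using that tf_bounds(6)[OF assms(1)] unfolding L_def by blast
 show ?thesis
 proof (cases "L = {}")
 case True
 thus ?thesis using that[of "T / 2"] psiL assms(2) by auto
 next
 case False
 obtain x where x: "x : L" "!!y. y : L ==> x <= y" using compact_attains_inf[OF L(1) False] by metis
 obtain y where y: "y : L" "!!x. x : L ==> x <= y" using compact_attains_sup[OF L(1) False] by metis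
 have xy: "0 < x" "x <= y" "y < T" using x y L(2) by auto
 show ?thesis
 proof (rule that[of "min x (T - y)"])
 show "min x (T - y) <= t & t <= T - min x (T - y)" if "psi t ~= 0" for t using x(2)[OF psiL[OF that]] y(2)[OF psiL[OF that]] by linarith qed (use xy in linarith)+ qed qed

lemma strongly_measurable_extend:
 fixes f :: "'a::euclidean_space => 'b::real_normed_vector"
 assumes S: "S : sets lebesgue" and f: "strongly_measurable (leb S) f" shows "strongly_measurable lebesgue (%x. if x : S then f x else 0)"
proof -
 obtain s where s: "!!n::nat. simple_function (leb S) (s n)" "AE t in leb S. (%n. s n t) ----> f t" using f unfolding strongly_measurable_def by blast
 define s' where "s' n x = (if x : S then s n x else 0)" for n x
 have "simple_function lebesgue (s' n)" for n unfolding simple_function_def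
 proof (intro conjI ballI)
 have "finite (s n ` S)" using simple_functionD(1)[OF s(1), of n] by (simp add: space_restrict_space)
 moreover have "s' n ` space lebesgue <= insert 0 (s n ` S)" by (auto simp: s'_def)
 ultimately show "finite (s' n ` space lebesgue)" by (rule finite_subset[rotated, OF finite.insertI])
 next
 fix y
 have "s n -` {y} \<inter> S : sets (leb S)" using simple_functionD(2)[OF s(1), of n "{y}"] by (simp add: space_restrict_space)
 hence "s n -` {y} \<inter> S : sets lebesgue" using S by (simp add: sets_restrict_space_iff)
 moreover have "s' n -` {y} \<inter> space lebesgue = (if y = 0 then (s n -` {y} \<inter> S) \<union> (UNIV - S) else s n -` {y} \<inter> S)"
 by (auto simp: s'_def split: if_splits)
 moreover have "UNIV - S : sets lebesgue" using sets.Diff[OF _ S, of UNIV] by simp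
 ultimately show "s' n -` {y} \<inter> space lebesgue : sets lebesgue" by auto qed
 moreover have "AE t in lebesgue. (%n. s' n t) ----> (if t : S then f t else 0)" using s(2) S unfolding s'_def by (auto simp: AE_restrict_space_iff elim!: eventually_mono)
 ultimately show ?thesis unfolding strongly_measurable_def by blast qed

text \<open>Young's inequality after rescaling the first factor by c, with c^q equal to delta; K is
  the resulting power (1/c)^p.\<close>

lemma young_eps:
 fixes p q \<delta> :: real
 assumes pq: "1 < p" "1 < q" "1 / p + 1 / q = 1" and \<delta>: "0 < \<delta>"
 obtains K where "0 <= K" "!!\<gamma> x. 0 <= \<gamma> ==> 0 <= x ==> \<gamma> * x <= \<delta> * \<gamma> powr q + K * x powr p"
proof -
 define c where "c = \<delta> powr (1 / q)"
 have c: "0 < c" "c powr q = \<delta>" using \<delta> pq by (auto simp: c_def powr_powr)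
 have "\<gamma> * x <= \<delta> * \<gamma> powr q + (1 / c) powr p * x powr p" if "0 <= \<gamma>" "0 <= x" for \<gamma> x
 proof -
 have "x * (1 / c) * (c * \<gamma>) <= (x * (1 / c)) powr p + (c * \<gamma>) powr q" by (rule mult_le_powr[OF pq]) (use c that in auto)
 also have "(x * (1 / c)) powr p = x powr p * (1 / c) powr p" by (rule powr_mult)
 also have "(c * \<gamma>) powr q = c powr q * \<gamma> powr q" by (rule powr_mult)
 finally show ?thesis using c by (simp add: mult_ac) qed
 thus ?thesis using that[of "(1 / c) powr p"] by simp qed

text \<open>Squares below delta are absorbed by delta. Beyond it, x^(p-2) is at least the power of
  sqrt delta called c, because p >= 2, and so x^2 is at most x^p / c.\<close>

lemma square_eps:
 fixes p \<delta> :: real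
 assumes p: "2 <= p" and \<delta>: "0 < \<delta>"
 obtains K where "0 <= K" "!!x y. 0 <= x ==> 0 <= y ==> x * y <= \<delta> + K * (x powr p + y powr p)"
proof -
 define c where "c = sqrt \<delta> powr (p - 2)"
 have c: "c > 0" using \<delta> by (simp add: c_def)
 have sq: "x\<^sup>2 <= \<delta> + 1 / c * x powr p" if x: "0 <= x" for x
 proof (cases "x\<^sup>2 <= \<delta>")
 case True
 have "0 <= 1 / c * x powr p" using c by simp
 with True show ?thesis by linarith
 next
 case False
 hence sx: "sqrt \<delta> <= x" using x by (simp add: real_le_lsqrt)
 have x0: "0 < x" using False x \<delta> by (cases "x = 0") auto
 have "c <= x powr (p - 2)" unfolding c_def by (rule powr_mono2) (use p sx \<delta> in auto)
 hence "x\<^sup>2 * c <= x\<^sup>2 * x powr (p - 2)" by (intro mult_left_mono) auto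
 also have "... = x powr p"
 proof -
 have "x powr p = x powr (2 + (p - 2))" by simp
 also have "... = x powr 2 * x powr (p - 2)" by (rule powr_add)
 finally show ?thesis using x0 by simp qed
 finally have "x\<^sup>2 <= 1 / c * x powr p" using c by (simp add: field_simps)
 thus ?thesis using \<delta> by simp qed
 have "x * y <= \<delta> + 1 / c * (x powr p + y powr p)" if "0 <= x" "0 <= y" for x y
 proof -
 have "0 <= (x - y)\<^sup>2" by simp
 hence "2 * (x * y) <= x\<^sup>2 + y\<^sup>2" by (simp add: power2_diff)
 moreover have "0 <= 1 / c * (x powr p + y powr p)" using c by simp
 ultimately show ?thesis using sq[OF that(1)] sq[OF that(2)] unfolding distrib_left by linarith qed
 thus ?thesis using that[of "1 / c"] c by simp qed

lemma powr_add3_le: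
 fixes a b c p :: real
 assumes "0 <= a" "0 <= b" "0 <= c" "0 <= p" "x <= a + b + c" "0 <= x" shows "x powr p <= 3 powr p * (a powr p + b powr p + c powr p)"
proof -
 define M where "M = max a (max b c)"
 have "x powr p <= (3 * M) powr p" using assms by (intro powr_mono2) (auto simp: M_def)
 also have "... = 3 powr p * M powr p" using assms by (simp add: powr_mult M_def)
 also have "M powr p <= a powr p + b powr p + c powr p" by (simp add: M_def max_def)
 finally show ?thesis by (simp add: mult_left_mono) qed

section \<open>The product formula\<close>

context form_family
begin

text \<open>The p-th power of the error is returned as a nonnegative integrable function on the
  whole line, because it is translated in time later.\<close>

lemma Lp_approx:
 assumes u: "sol u g" and e: "0 < e"
 obtains c D where "continuous_on UNIV c" "!!t. t : J ==> D t = norm (u t - c t) powr p"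
 "integrable lebesgue D" "(LINT t|lebesgue. D t) < e" "!!t. 0 <= D t" "csupp c"
proof -
 define u' where "u' t = (if t : J then u t else 0)" for t
 have sm: "strongly_measurable lebesgue u'" unfolding u'_def[abs_def] by (rule strongly_measurable_extend[OF _ solD(1)[OF u]]) simp
 have "integrable lebesgue (%t. indicator J t * norm (u t) powr p)" using solD(3)[OF u] by (simp add: integrable_leb_eq)
 moreover have "(%t. indicator J t * norm (u t) powr p) = (%t. norm (u' t) powr p)" using p by (auto simp: u'_def indicator_def fun_eq_iff)
 ultimately have i: "integrable lebesgue (%t. norm (u' t) powr p)" by simp
 obtain c where c: "continuous_on UNIV c" "csupp c" "integrable lebesgue (%x. norm (u' x - c x) powr p)"
 "(LINT x|lebesgue. norm (u' x - c x) powr p) < e"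
 proof (rule Lp_continuous_dense[OF _ sm bounded_box[of 0 T] _ i e])
 show "1 <= p" using p by simp
 show "u' x = 0" if "x ~: box 0 T" for x using that by (auto simp: u'_def box_real) qed blast
 show ?thesis by (rule that[of c "%x. norm (u' x - c x) powr p"]) (use c in "auto simp: u'_def") qed

text \<open>The equation of u is tested with z t, that of z with u s, and the formula for constant
  arguments is applied to the pair (u s, z t). The sum of the first two minus the third is exactly
  the increment of m(.;u,z), so no limit is involved here.\<close>

lemma product_error:
 assumes u: "sol u gu" and z: "sol z gz" and G: "G <= J"
 and bal: "!!w s t. w : u ` G \<union> z ` G ==> s : G ==> t : G ==> s <= t ==> bal u gu w s t & bal z gz w s t"
 and st: "s : G" "t : G" "s <= t"
 and r: "integrable (leb {s..t}) r"
 and le: "!!x. x : {s..t} ==> norm (gu x) * norm (z t - z x) + norm (gz x) * norm (u s - u x) + C * norm (u x - u s) * norm (z t - z x) <= r x"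
 shows "\<bar>m t (u t) (z t) - m s (u s) (z s)
 - (LINT x|leb {s..t}. bapp (gu x) (z x) + bapp (gz x) (u x) + a x (u x) (z x))\<bar>
 <= (LINT x|leb {s..t}. r x)"
proof -
 have sub: "x : J" if "x : {s..t}" for x using that st G by auto
 have st0: "0 <= s" "t <= T" "0 < s" "t < T" using st G by auto
 note si = sub_integrable[OF _ st0(1,2)]
 define k1 where "k1 x = bapp (gu x) (z t) + a x (u x) (z t)" for x
 define k2 where "k2 x = bapp (gz x) (u s) + a x (z x) (u s)" for x
 define k3 where "k3 x = a x (u s) (z t)" for x
 define R where "R x = bapp (gu x) (z x) + bapp (gz x) (u x) + a x (u x) (z x)" for x
 have i1: "integrable (leb {s..t}) k1" unfolding k1_def by (intro bi_integrable_add si const_integrable(1,2)[OF u])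
 have i2: "integrable (leb {s..t}) k2" unfolding k2_def by (intro bi_integrable_add si const_integrable(1,2)[OF z])
 have i3: "integrable (leb {s..t}) k3" unfolding k3_def by (intro si const_integrable(4)[OF u])
 have iR: "integrable (leb {s..t}) R" unfolding R_def by (intro bi_integrable_add si g_integrable[OF u z] g_integrable[OF z u] a_integrable(1)[OF u z])
 have tt: "t : J" "s : J" using st G by auto
 have e1: "m t (u t) (z t) - m s (u s) (z t) = (LINT x|leb {s..t}. k1 x)" using bal[of "z t" s t] st unfolding bal_def k1_def by blast
 have e2: "m t (z t) (u s) - m s (z s) (u s) = (LINT x|leb {s..t}. k2 x)" using bal[of "u s" s t] st unfolding bal_def k2_def by blast
 have e3: "m t (u s) (z t) - m s (u s) (z t) = (LINT x|leb {s..t}. k3 x)" unfolding k3_def by (rule m_diff[OF st0(3) st(3) st0(4)])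
 have "m t (u t) (z t) - m s (u s) (z s) - (LINT x|leb {s..t}. R x)
 = (LINT x|leb {s..t}. k1 x) + (LINT x|leb {s..t}. k2 x) - (LINT x|leb {s..t}. k3 x) - (LINT x|leb {s..t}. R x)"
 using e1 e2 e3 m_sym[OF tt(1), of "z t" "u s"] m_sym[OF tt(2), of "z s" "u s"] by simp
 also have "... = (LINT x|leb {s..t}. k1 x + k2 x - k3 x - R x)" using i1 i2 i3 iR by simp
 finally have eq: "m t (u t) (z t) - m s (u s) (z s) - (LINT x|leb {s..t}. R x) = (LINT x|leb {s..t}. k1 x + k2 x - k3 x - R x)" .
 have "abs(LINT x|leb {s..t}. k1 x + k2 x - k3 x - R x) <= (LINT x|leb {s..t}. r x)"
 proof (rule Icc_integral_bound[OF _ r])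
 show "integrable (leb {s..t}) (%x. k1 x + k2 x - k3 x - R x)" by (intro bi_integrable_diff bi_integrable_add i1 i2 i3 iR)
 fix x assume x: "x : {s..t}"
 interpret bounded_bilinear "a x" by (rule a_bilinear[OF sub[OF x]])
 \<comment> \<open>Symmetry of \<open>a\<close> collects its four terms into one product of
   increments, a(u x - u s, z t - z x).\<close>
 have "k1 x + k2 x - k3 x - R x = bapp (gu x) (z t - z x) + bapp (gz x) (u s - u x) + a x (u x - u s) (z t - z x)"
 unfolding k1_def k2_def k3_def R_def using a_sym[OF sub[OF x], of "z x" "u s"] by (simp add: blinfun.diff_right diff_left diff_right)
 also have "abs(...) <= norm (gu x) * norm (z t - z x) + norm (gz x) * norm (u s - u x) + C * norm (u x - u s) * norm (z t - z x)"
 using g_bound[of "gu x" "z t - z x"] g_bound[of "gz x" "u s - u x"] a_bound[OF sub[OF x], of "u x - u s" "z t - z x"] by linarith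
 also have "... <= r x" by (rule le[OF x])
 finally show "abs(k1 x + k2 x - k3 x - R x) <= r x" . qed
 thus ?thesis unfolding eq[unfolded R_def] R_def . qed

end

context form_family
begin

text \<open>The defect e has zero weak derivative: phi' is replaced by a difference quotient, a
  translation moves the difference onto e, and \<open>product_error\<close> makes the increment of e
  over a step h negligible compared with h after averaging in time.\<close>

lemma product_weakly_constant:
 assumes u: "sol u gu" and z: "sol z gz" and G: "G <= J" "AE t in lebesgue. t : J --> t : G"
 and bal: "!!w s t. w : u ` G \<union> z ` G ==> s : G ==> t : G ==> s <= t ==> bal u gu w s t & bal z gz w s t"
 defines "R \<equiv> %x. bapp (gu x) (z x) + bapp (gz x) (u x) + a x (u x) (z x)"
 defines "e \<equiv> %t. m t (u t) (z t) - (LINT x|leb {0..t}. R x)"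
 assumes phi: "phi : test_functions J" shows "(LINT t|leb {0..T}. e t * deriv phi t) = 0"
proof -
 have iR: "integrable (leb {0..T}) R" unfolding R_def by (intro bi_integrable_add g_integrable[OF u z] g_integrable[OF z u] a_integrable(1)[OF u z])
 have ie: "integrable (leb {0..T}) e" unfolding e_def by (intro bi_integrable_diff a_integrable(2)[OF u z] cont_integrable_Icc indefinite_integral_continuous_real[OF iR])
 \<comment> \<open>Extension by zero to the line, where translations by h make sense.\<close>
 define E where "E t = indicator {0..T} t * e t" for t
 have iE: "integrable lebesgue E" using ie unfolding E_def by (simp add: integrable_leb_eq)
 have Ckphi: "Ck j phi" for j by (rule tf_bounds(5)[OF phi])
 have cphi: "continuous_on UNIV phi" by (rule tf_bounds(1)[OF phi])
 have csphi: "csupp phi" by (rule tf_bounds(2)[OF phi])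
 obtain M where M: "!!t. norm (phi t) <= M" "0 <= M" using csupp_bounded[OF cphi csphi] by metis
 obtain d where d: "0 < d" "!!t. phi t ~= 0 ==> d <= t & t <= T - d" "d <= T - d" using test_support_margin[OF phi T] by metis
 have cd: "continuous_on UNIV (deriv phi)" by (rule Ck_continuous[OF Ck_real_deriv(2)[OF Ckphi]])
 have "(%x. fderiv phi (at x) 1) = deriv phi" using Ck_real_deriv(3)[OF Ckphi] by blast
 hence csd: "csupp (deriv phi)" using csupp_frechet(1)[OF csphi, of 1] by simp
 have Emult: "integrable lebesgue (%t. F t * h t)" if F: "integrable lebesgue F" and h: "continuous_on UNIV h" "csupp h" for F h :: "real => real"
 proof -
 have "continuous_on UNIV (%y. h (- y))" by (rule continuous_on_compose2[OF h(1)]) (auto intro: continuous_intros)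
 moreover have "csupp (%y. h (- y))"
 proof -
 obtain B where B: "!!x. h x ~= 0 ==> norm x <= B" using h(2) unfolding csupp_def bounded_iff by auto
 show ?thesis unfolding csupp_def bounded_iff by (intro exI[of _ B]) (use B in force) qed
 ultimately show ?thesis using conv_integrable[OF F, of "%y. h (- y)" 0] by simp qed
 define I where "I = (LINT t|lebesgue. E t * deriv phi t)"
 define N where "N = (LINT t|lebesgue. abs(E t))"
 have N0: "0 <= N" unfolding N_def by simp
 define \<Gamma> where "\<Gamma> t = norm (gu t) powr q + norm (gz t) powr q" for t
 have i\<Gamma>: "integrable (leb {0..T}) \<Gamma>" unfolding \<Gamma>_def leb_Ioo_Icc(1)[symmetric] by (intro bi_integrable_add solD(4)[OF u] solD(4)[OF z])
 define g where "g = (LINT t|leb {0..T}. \<Gamma> t)"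
 have g0: "0 <= g" unfolding g_def \<Gamma>_def by (intro bi_integral_nonneg) simp
 have bound: "abs(I) <= eta * (3 * M + N)" if eta: "0 < eta" for eta
 proof -
 \<comment> \<open>The parameters share one budget. \<open>\<delta>\<close> controls the powers of
   gu, gz and the constant in the square estimate, \<open>eps\<close> the L^p distance to continuous
   functions, \<open>\<omega>\<close> the oscillation of those functions over a step. In the end the
   three groups contribute at most eta each.\<close>
 define \<delta> where "\<delta> = eta / (g + T * C + 1)"
 have den: "0 < g + T * C + 1" using g0 T C0 by (simp add: add_nonneg_pos)
 have \<delta>: "0 < \<delta>" "\<delta> * (g + T * C) <= eta" using eta den by (auto simp: \<delta>_def field_simps)
 have p1: "1 < p" using p by simp
 obtain K1 where K1: "0 <= K1" "!!\<gamma> x. 0 <= \<gamma> ==> 0 <= x ==> \<gamma> * x <= \<delta> * \<gamma> powr q + K1 * x powr p"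
 using young_eps[OF p1 q \<delta>(1)] by metis
 obtain K2 where K2: "0 <= K2" "!!x y. 0 <= x ==> 0 <= y ==> x * y <= \<delta> + K2 * (x powr p + y powr p)" using square_eps[OF p \<delta>(1)] by metis
 define K where "K = (K1 + C * K2) * 3 powr p"
 have K0: "0 <= K" using K1(1) K2(1) C0 by (simp add: K_def)
 define eps where "eps = eta / (4 * K + 1)"
 have eps: "0 < eps" "K * (4 * eps) <= eta" using eta K0 by (auto simp: eps_def field_simps)
 define \<omega> where "\<omega> = (eta / (2 * T * K + 1)) powr (1 / p)"
 have TK: "0 < 2 * T * K + 1" using T K0 by (simp add: add_nonneg_pos)
 have \<omega>: "0 < \<omega>" "T * (2 * K * \<omega> powr p) <= eta" using eta TK p by (auto simp: \<omega>_def powr_powr field_simps)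
 obtain cz Dz where cz: "continuous_on UNIV cz" "!!t. t : J ==> Dz t = norm (z t - cz t) powr p"
 "integrable lebesgue Dz" "(LINT t|lebesgue. Dz t) < eps" "!!t. 0 <= Dz t" "csupp cz" using Lp_approx[OF z eps(1)] by metis
 obtain cu Du where cu: "continuous_on UNIV cu" "!!t. t : J ==> Du t = norm (u t - cu t) powr p"
 "integrable lebesgue Du" "(LINT t|lebesgue. Du t) < eps" "!!t. 0 <= Du t" "csupp cu" using Lp_approx[OF u eps(1)] by metis
 obtain h1 where h1: "0 < h1" "!!x y. dist y x < h1 ==> dist (cz y) (cz x) < \<omega>"
 using csupp_uniform[OF cz(1,6)] \<omega>(1) unfolding uniformly_continuous_on_def by (metis UNIV_I)
 obtain h2 where h2: "0 < h2" "!!x y. dist y x < h2 ==> dist (cu y) (cu x) < \<omega>"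
 using csupp_uniform[OF cu(1,6)] \<omega>(1) unfolding uniformly_continuous_on_def by (metis UNIV_I)
 obtain h3 where h3: "0 < h3" "!!x h. norm h < h3 ==> abs(phi (x + h) - phi x - fderiv phi (at x) h) <= eta * norm h"
 using Ck1_uniformly_differentiable[OF Ckphi csphi eta] by metis
 define h where "h = min (min h1 h2) (min h3 d) / 2"
 have h: "0 < h" "h < h1" "h < h2" "h < h3" "h < d" using h1(1) h2(1) h3(1) d(1) by (auto simp: h_def)
 have fd: "fderiv phi (at x) y = deriv phi x * y" for x y using frechet_derivative_at[OF Ck_real_deriv(1)[OF Ckphi, unfolded has_field_derivative_def]] by (metis (full_types))
 have quot: "abs((phi t - phi (t - h)) / h - deriv phi t) <= eta" for t
 proof -
 have "abs(phi (t + (- h)) - phi t - deriv phi t * (- h)) <= eta * h" using h3(2)[of "- h" t] h by (simp add: fd)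
 moreover have "(phi t - phi (t - h)) / h - deriv phi t = - (phi (t + (- h)) - phi t - deriv phi t * (- h)) / h" using h(1) by (simp add: field_simps)
 ultimately show ?thesis using h(1) by (simp only: abs_divide abs_minus_cancel) (simp add: pos_divide_le_eq) qed
 define phih where "phih t = phi (t - h)" for t
 have cphih: "continuous_on UNIV phih" unfolding phih_def by (rule continuous_on_compose2[OF cphi]) (auto intro: continuous_intros)
 have csphih: "csupp phih" unfolding csupp_def
 proof (rule bounded_subset[OF bounded_closed_interval[of 0 T]], rule subsetI)
 fix t assume "t : {t. phih t ~= 0}"
 hence "d <= t - h & t - h <= T - d" by (intro d(2)) (simp add: phih_def)
 thus "t : {0..T}" using h(1,5) d(1) by auto qed
 have iEphi: "integrable lebesgue (%t. E t * phi t)" "integrable lebesgue (%t. E t * phih t)" "integrable lebesgue (%t. E t * deriv phi t)"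
 by (rule Emult[OF iE cphi csphi] Emult[OF iE cphih csphih] Emult[OF iE cd csd])+
 \<comment> \<open>A change of variables turns this into minus the integral of (E (t + h) - E t) phi
   / h.\<close>
 define S where "S = (LINT t|lebesgue. E t * ((phi t - phi (t - h)) / h))"
 have Seq: "(%t. E t * ((phi t - phi (t - h)) / h)) = (%t. (E t * phi t - E t * phih t) / h)" by (simp add: fun_eq_iff phih_def right_diff_distrib diff_divide_distrib)
 have iS: "integrable lebesgue (%t. E t * ((phi t - phi (t - h)) / h))" unfolding Seq by (intro integrable_divide_zero bi_integrable_diff iEphi)
 have 1: "abs(I - S) <= N * eta"
 proof -
 have "I - S = (LINT t|lebesgue. E t * deriv phi t - E t * ((phi t - phi (t - h)) / h))" unfolding I_def S_def by (rule bi_integral_diff[OF iEphi(3) iS, symmetric])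
 also have "abs(...) <= (LINT t|lebesgue. abs(E t) * eta)" unfolding real_norm_def[symmetric]
 proof (rule bi_norm_bound)
 show "integrable lebesgue (%t. E t * deriv phi t - E t * ((phi t - phi (t - h)) / h))" by (rule bi_integrable_diff[OF iEphi(3) iS])
 show "integrable lebesgue (%t. norm (E t) * eta)" using iE by simp
 show "norm (E t * deriv phi t - E t * ((phi t - phi (t - h)) / h)) <= norm (E t) * eta" for t unfolding right_diff_distrib[symmetric] norm_mult
 using quot[of t] by (intro mult_left_mono) (auto simp: abs_minus_commute) qed
 finally show ?thesis by (simp add: N_def) qed
 have iEh: "integrable lebesgue (%t. E (t + h))" using lebesgue_integrable_real_affine[OF iE, of 1 h] by (simp add: add.commute)
 have iEhphi: "integrable lebesgue (%t. E (t + h) * phi t)" by (rule Emult[OF iEh cphi csphi])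
 have "(LINT t|lebesgue. E t * phih t) = (LINT t|lebesgue. E (t + h) * phi t)"
 using lebesgue_integral_real_affine[of 1 "%t. E t * phih t" h] by (simp add: phih_def add.commute)
 hence Sh: "S = - (LINT t|lebesgue. (E (t + h) - E t) * phi t) / h" unfolding S_def Seq left_diff_distrib using iEphi iEhphi by simp
 \<comment> \<open>A gathers the error terms that depend on the integration variable; those frozen
   at t and t + h are constant under the integral and give the part of \<open>B\<close> with the
   factor h.\<close>
 define A where "A t = \<delta> * \<Gamma> t + K * (Dz t + Du t)" for t
 have Ds: "integrable (leb {0..T}) Dz" "integrable (leb {0..T}) Du" using integrable_mult_indicator[OF _ cz(3), of "{0..T}"] integrable_mult_indicator[OF _ cu(3), of "{0..T}"]
 by (simp_all add: integrable_leb_eq)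
 have iA: "integrable (leb {0..T}) A" unfolding A_def by (intro bi_integrable_add integrable_mult_right i\<Gamma> Ds)
 have A0: "0 <= A t" for t unfolding A_def \<Gamma>_def using \<delta>(1) K0 cz(5) cu(5) by simp
 define P where "P t = (LINT x|leb {0..t}. A x)" for t
 define \<kappa> where "\<kappa> = 2 * K * \<omega> powr p + C * \<delta>"
 have \<kappa>0: "0 <= \<kappa>" using K0 C0 \<delta>(1) by (simp add: \<kappa>_def)
 define B where "B t = (P (t + h) - P t) + h * (K * Dz (t + h) + K * Du t + \<kappa>)" for t
 have key: "abs(e (t + h) - e t) <= B t" if tG: "t : G" "t + h : G" for t
 proof -
 have tJ: "t : J" "t + h : J" using tG G(1) by auto
 define r where "r x = A x + (K * Dz (t + h) + K * Du t + \<kappa>)" for x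
 have iAs: "integrable (leb {t..t + h}) A" by (rule sub_integrable[OF iA]) (use tJ in auto)
 have ic: "integrable (leb {t..t + h}) (%_. K * Dz (t + h) + K * Du t + \<kappa>)" by (rule cont_integrable_Icc[OF continuous_on_const])
 have ir: "integrable (leb {t..t + h}) r" unfolding r_def by (rule bi_integrable_add[OF iAs ic])
 have le: "norm (gu x) * norm (z (t + h) - z x) + norm (gz x) * norm (u t - u x) + C * norm (u x - u t) * norm (z (t + h) - z x) <= r x"
 if x: "x : {t..t + h}" for x
 proof -
 have xJ: "x : J" using x tJ by auto
 define X where "X = norm (z (t + h) - z x)"
 define Y where "Y = norm (u t - u x)"
 have XY0: "0 <= X" "0 <= Y" by (simp_all add: X_def Y_def)
 have dist: "dist (t + h) x < h1" "dist t x < h2" using x h by (auto simp: dist_real_def)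
 have "X <= norm (z (t + h) - cz (t + h)) + norm (cz (t + h) - cz x) + norm (z x - cz x)"
 proof -
 have "z (t + h) - z x = (z (t + h) - cz (t + h)) + (cz (t + h) - cz x) - (z x - cz x)" by simp
 hence "X <= norm ((z (t + h) - cz (t + h)) + (cz (t + h) - cz x)) + norm (z x - cz x)" unfolding X_def by (metis norm_triangle_ineq4)
 thus ?thesis using norm_triangle_ineq[of "z (t + h) - cz (t + h)" "cz (t + h) - cz x"] by linarith qed
 moreover have "norm (cz (t + h) - cz x) <= \<omega>" using h1(2)[OF dist(1)] by (simp add: dist_norm)
 ultimately have X3: "X <= norm (z (t + h) - cz (t + h)) + \<omega> + norm (z x - cz x)" by linarith
 have "X powr p <= 3 powr p * (norm (z (t + h) - cz (t + h)) powr p + \<omega> powr p + norm (z x - cz x) powr p)"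
 by (rule powr_add3_le[OF _ _ _ _ X3 XY0(1)]) (use \<omega>(1) p in auto)
 hence Xp: "X powr p <= 3 powr p * (Dz (t + h) + \<omega> powr p + Dz x)" by (simp only: cz(2)[OF tJ(2)] cz(2)[OF xJ])
 have "Y <= norm (u t - cu t) + norm (cu t - cu x) + norm (u x - cu x)"
 proof -
 have "u t - u x = (u t - cu t) + (cu t - cu x) - (u x - cu x)" by simp
 hence "Y <= norm ((u t - cu t) + (cu t - cu x)) + norm (u x - cu x)" unfolding Y_def by (metis norm_triangle_ineq4)
 thus ?thesis using norm_triangle_ineq[of "u t - cu t" "cu t - cu x"] by linarith qed
 moreover have "norm (cu t - cu x) <= \<omega>" using h2(2)[OF dist(2)] by (simp add: dist_norm)
 ultimately have Y3: "Y <= norm (u t - cu t) + \<omega> + norm (u x - cu x)" by linarith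
 have "Y powr p <= 3 powr p * (norm (u t - cu t) powr p + \<omega> powr p + norm (u x - cu x) powr p)" by (rule powr_add3_le[OF _ _ _ _ Y3 XY0(2)]) (use \<omega>(1) p in auto)
 hence Yp: "Y powr p <= 3 powr p * (Du t + \<omega> powr p + Du x)" by (simp only: cu(2)[OF tJ(1)] cu(2)[OF xJ])
 have XYp: "X powr p + Y powr p <= 3 powr p * (Dz (t + h) + Du t + Dz x + Du x + 2 * \<omega> powr p)" using Xp Yp by (simp add: algebra_simps)
 have y1: "norm (gu x) * X <= \<delta> * norm (gu x) powr q + K1 * X powr p" by (rule K1(2)) (use XY0 in auto)
 have y2: "norm (gz x) * Y <= \<delta> * norm (gz x) powr q + K1 * Y powr p" by (rule K1(2)) (use XY0 in auto)
 have "C * (Y * X) <= C * (\<delta> + K2 * (Y powr p + X powr p))" by (intro mult_left_mono K2(2) XY0 C0)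
 hence "norm (gu x) * X + norm (gz x) * Y + C * Y * X <= \<delta> * \<Gamma> x + C * \<delta> + (K1 + C * K2) * (X powr p + Y powr p)"
 using y1 y2 by (simp add: \<Gamma>_def algebra_simps)
 also have "(K1 + C * K2) * (X powr p + Y powr p) <= (K1 + C * K2) * (3 powr p * (Dz (t + h) + Du t + Dz x + Du x + 2 * \<omega> powr p))"
 using K1(1) K2(1) C0 by (intro mult_left_mono XYp) auto
 also have "... = K * (Dz (t + h) + Du t + Dz x + Du x + 2 * \<omega> powr p)" by (simp add: K_def)
 finally have "norm (gu x) * X + norm (gz x) * Y + C * Y * X <= r x" unfolding r_def A_def \<kappa>_def by (simp add: algebra_simps)
 moreover have "norm (u x - u t) = Y" by (simp add: Y_def norm_minus_commute)
 ultimately show ?thesis by (simp only: X_def[symmetric] Y_def[symmetric]) qed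
 have th: "t <= t + h" using h by simp
 have "abs(m (t + h) (u (t + h)) (z (t + h)) - m t (u t) (z t) - (LINT x|leb {t..t + h}. R x)) <= (LINT x|leb {t..t + h}. r x)"
 unfolding R_def by (rule product_error[OF u z G(1) bal tG th ir le])
 moreover have "(LINT x|leb {t..t + h}. R x) = (LINT x|leb {0..t + h}. R x) - (LINT x|leb {0..t}. R x)" by (rule Icc_integral_split[OF iR, symmetric]) (use tJ th in auto)
 moreover have "(LINT x|leb {t..t + h}. r x) = (LINT x|leb {t..t + h}. A x) + h * (K * Dz (t + h) + K * Du t + \<kappa>)"
 unfolding r_def bi_integral_add[OF iAs ic] Icc_integral_const[OF th] by (simp only: add_diff_cancel_left')
 moreover have "(LINT x|leb {t..t + h}. A x) = P (t + h) - P t" unfolding P_def by (rule Icc_integral_split[OF iA, symmetric]) (use tJ th in auto)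
 ultimately show ?thesis unfolding e_def B_def by linarith qed
 \<comment> \<open>phi vanishes outside L, and h < d keeps t + h inside J for t in L.\<close>
 define L where "L = {d..T - d}"
 have Lb: "0 <= d" "d <= T - d" "0 <= h" "T - d + h <= T" using d h by auto
 have iP: "integrable (leb L) (%t. P (t + h) - P t)" "(LINT t|leb L. P (t + h) - P t) <= h * P T" unfolding L_def P_def by (rule Icc_average[OF iA A0 Lb])+
 have shift: "integrable lebesgue (%t. Dz (t + h))" "(LINT t|lebesgue. Dz (t + h)) = (LINT t|lebesgue. Dz t)"
 using lebesgue_integrable_real_affine[OF cz(3), of 1 h] lebesgue_integral_real_affine[of 1 Dz h] by (simp_all add: add.commute)
 have onL: "integrable (leb L) F & (LINT t|leb L. F t) <= (LINT t|lebesgue. F t)" if "integrable lebesgue F" "!!t. 0 <= F t" for F :: "real => real"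
 proof -
 have i: "integrable lebesgue (%t. indicator L t * F t)" using integrable_mult_indicator[OF _ that(1), of L] by (simp add: L_def)
 have "(LINT t|lebesgue. indicator L t * F t) <= (LINT t|lebesgue. F t)" by (rule bi_integral_mono[OF i that(1)]) (use that(2) in "auto simp: indicator_def")
 thus ?thesis using i by (simp add: L_def integrable_leb_eq integral_leb_eq) qed
 have z1: "integrable (leb L) (%t. Dz (t + h))" "(LINT t|leb L. Dz (t + h)) <= eps"
 proof -
 note * = onL[OF shift(1) cz(5)]
 show "integrable (leb L) (%t. Dz (t + h))" using * by (rule conjunct1)
 have "(LINT t|leb L. Dz (t + h)) <= (LINT t|lebesgue. Dz (t + h))" using * by (rule conjunct2)
 thus "(LINT t|leb L. Dz (t + h)) <= eps" unfolding shift(2) using cz(4) by linarith qed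
 have u1: "integrable (leb L) Du" "(LINT t|leb L. Du t) <= eps"
 proof -
 note * = onL[OF cu(3,5)]
 show "integrable (leb L) Du" using * by (rule conjunct1)
 have "(LINT t|leb L. Du t) <= (LINT t|lebesgue. Du t)" using * by (rule conjunct2)
 thus "(LINT t|leb L. Du t) <= eps" using cu(4) by linarith qed
 have c1: "integrable (leb L) (%_. \<kappa>)" "(LINT t|leb L. \<kappa>) <= T * \<kappa>"
 proof -
 show "integrable (leb L) (%_. \<kappa>)" unfolding L_def by (rule cont_integrable_Icc[OF continuous_on_const])
 show "(LINT t|leb L. \<kappa>) <= T * \<kappa>" unfolding L_def Icc_integral_const[OF Lb(2)] using \<kappa>0 d(1) by (intro mult_right_mono) auto qed
 have iB: "integrable (leb L) B" unfolding B_def by (intro bi_integrable_add integrable_mult_right iP z1 u1 c1)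
 have "(LINT t|leb L. B t) = (LINT t|leb L. P (t + h) - P t) + h * (K * (LINT t|leb L. Dz (t + h)) + K * (LINT t|leb L. Du t) + (LINT t|leb L. \<kappa>))"
 proof -
 have j1: "integrable (leb L) (%t. K * Dz (t + h) + K * Du t)" using z1 u1 by simp
 have j2: "integrable (leb L) (%t. K * Dz (t + h) + K * Du t + \<kappa>)" by (rule bi_integrable_add[OF j1 c1(1)])
 have "(LINT t|leb L. B t) = (LINT t|leb L. P (t + h) - P t) + (LINT t|leb L. h * (K * Dz (t + h) + K * Du t + \<kappa>))"
 unfolding B_def by (rule bi_integral_add[OF iP(1) integrable_mult_right[OF j2]])
 also have "(LINT t|leb L. h * (K * Dz (t + h) + K * Du t + \<kappa>)) = h * (LINT t|leb L. K * Dz (t + h) + K * Du t + \<kappa>)" by (rule integral_mult_right_zero)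
 also have "(LINT t|leb L. K * Dz (t + h) + K * Du t + \<kappa>) = (LINT t|leb L. K * Dz (t + h) + K * Du t) + (LINT t|leb L. \<kappa>)" by (rule bi_integral_add[OF j1 c1(1)])
 also have "(LINT t|leb L. K * Dz (t + h) + K * Du t) = K * (LINT t|leb L. Dz (t + h)) + K * (LINT t|leb L. Du t)" using z1(1) u1(1) by simp
 finally show ?thesis . qed
 also have "... <= h * P T + h * (K * eps + K * eps + T * \<kappa>)" using iP(2) z1(2) u1(2) c1(2) K0 h(1) by (intro add_mono mult_left_mono) auto
 also have "P T <= \<delta> * g + K * (2 * eps)"
 proof -
 have DT: "(LINT t|leb {0..T}. F t) <= (LINT t|lebesgue. F t)" if "integrable lebesgue F" "!!t. 0 <= F t" for F :: "real => real"
 proof -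
 have i: "integrable lebesgue (%t. indicator {0..T} t * F t)" using integrable_mult_indicator[OF _ that(1), of "{0..T}"] by simp
 have "(LINT t|lebesgue. indicator {0..T} t * F t) <= (LINT t|lebesgue. F t)" by (rule bi_integral_mono[OF i that(1)]) (use that(2) in "auto simp: indicator_def")
 thus ?thesis by (simp add: integral_leb_eq) qed
 have "P T = \<delta> * g + K * ((LINT t|leb {0..T}. Dz t) + (LINT t|leb {0..T}. Du t))" unfolding P_def A_def g_def using i\<Gamma> Ds by simp
 also have "... <= \<delta> * g + K * (eps + eps)" using DT[OF cz(3,5)] DT[OF cu(3,5)] cz(4) cu(4) K0 by (intro add_left_mono mult_left_mono add_mono) auto
 finally show ?thesis by simp qed
 finally have "(LINT t|leb L. B t) <= h * (\<delta> * g + K * (2 * eps)) + h * (K * eps + K * eps + T * \<kappa>)" using h(1) by (simp add: mult_left_mono)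
 also have "... = h * (\<delta> * (g + T * C) + K * (4 * eps) + T * (2 * K * \<omega> powr p))" unfolding \<kappa>_def by (simp add: algebra_simps)
 also have "... <= h * (eta + eta + eta)" using \<delta>(2) eps(2) \<omega>(2) h(1) by (intro mult_left_mono add_mono) auto
 finally have IB: "(LINT t|leb L. B t) <= h * (3 * eta)" by simp
 \<comment> \<open>The estimate needs both t and t + h in G; translates of null sets are
   null.\<close>
 have aeG: "AE t in lebesgue. t : J --> t + h : J --> t : G & t + h : G"
 proof -
 obtain Nz where Nz: "!!t. t : space lebesgue - Nz ==> t : J --> t : G" "Nz : null_sets lebesgue" using AE_E3[OF G(2)] by blast
 have "negligible ((+) (- h) ` Nz)" using Nz(2) by (intro negligible_translation) (simp add: negligible_iff_null_sets)
 hence "(+) (- h) ` Nz : null_sets lebesgue" by (simp add: negligible_iff_null_sets)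
 hence "AE t in lebesgue. t ~: (+) (- h) ` Nz" by (rule AE_not_in)
 thus ?thesis using AE_not_in[OF Nz(2)]
 proof eventually_elim
 case (elim t)
 have "t + h ~: Nz" using elim(1) by (metis add.commute add_minus_cancel image_eqI minus_add_cancel)
 thus ?case using elim(2) Nz(1)[of t] Nz(1)[of "t + h"] by (simp add: space_completion) qed qed
 have "abs(LINT t|lebesgue. (E (t + h) - E t) * phi t) <= (LINT t|lebesgue. indicator L t * B t * M)" unfolding real_norm_def[symmetric]
 proof (rule order_trans[OF integral_norm_bound], rule integral_mono_AE)
 show "integrable lebesgue (%t. norm ((E (t + h) - E t) * phi t))" unfolding left_diff_distrib by (intro integrable_norm bi_integrable_diff iEhphi iEphi)
 show "integrable lebesgue (%t. indicator L t * B t * M)" using iB by (simp add: integrable_leb_eq L_def)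
 show "AE t in lebesgue. norm ((E (t + h) - E t) * phi t) <= indicator L t * B t * M" using aeG
 proof eventually_elim
 case (elim t)
 show ?case
 proof (cases "t : L")
 case True
 hence tt: "t : J" "t + h : J" using d(1) h(1,5) by (auto simp: L_def)
 hence "abs(e (t + h) - e t) <= B t" using key elim by blast
 hence "abs(E (t + h) - E t) <= B t" using tt by (simp add: E_def)
 hence "abs(E (t + h) - E t) * abs(phi t) <= B t * M" using M(1)[of t] by (intro mult_mono) auto
 thus ?thesis using True by (simp add: abs_mult)
 next
 case False
 hence "phi t = 0" using d(2)[of t] by (auto simp: L_def)
 thus ?thesis using False by simp qed qed qed
 also have "... = M * (LINT t|leb L. B t)" by (simp add: integral_leb_eq L_def)
 also have "... <= M * (h * (3 * eta))" by (rule mult_left_mono[OF IB M(2)])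
 finally have "abs(S) * h <= M * (3 * eta) * h" unfolding Sh using h(1) by (simp add: mult_ac)
 hence "abs(S) <= M * (3 * eta)" using h(1) by simp
 with 1 have "abs(I) <= N * eta + M * (3 * eta)" by linarith
 thus ?thesis by (simp add: algebra_simps) qed
 have "abs(I) <= 0"
 proof (rule field_le_epsilon)
 fix x :: real assume x: "0 < x"
 have n: "0 < 3 * M + N + 1" using M(2) N0 by simp
 have "abs(I) <= x / (3 * M + N + 1) * (3 * M + N)" by (rule bound) (use x n in simp)
 also have "... <= x / (3 * M + N + 1) * (3 * M + N + 1)" using x n by (intro mult_left_mono) auto
 also have "... = x" using n by simp
 finally show "abs(I) <= 0 + x" by simp qed
 moreover have "(LINT t|leb {0..T}. e t * deriv phi t) = I" unfolding I_def E_def by (simp add: integral_leb_eq mult.assoc)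
 ultimately show ?thesis by simp qed

lemma product_identity:
 assumes u: "sol u gu" and z: "sol z gz"
 obtains G where "G <= J" "AE t in lebesgue. t : J --> t : G"
 "!!w s t. w : u ` G \<union> z ` G ==> s : G ==> t : G ==> s <= t ==> bal u gu w s t & bal z gz w s t"
 "!!s t. s : G ==> t : G ==> s <= t ==> m t (u t) (z t) - m s (u s) (z s)
 = (LINT x|leb {s..t}. bapp (gu x) (z x) + bapp (gz x) (u x) + a x (u x) (z x))"
proof (rule balanced_set[OF u z])
 fix G assume G: "G <= J" "AE t in lebesgue. t : J --> t : G"
 "!!w s t. w : u ` G \<union> z ` G ==> s : G ==> t : G ==> s <= t ==> bal u gu w s t & bal z gz w s t"
 define R where "R x = bapp (gu x) (z x) + bapp (gz x) (u x) + a x (u x) (z x)" for x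
 have iR: "integrable (leb {0..T}) R" unfolding R_def by (intro bi_integrable_add g_integrable[OF u z] g_integrable[OF z u] a_integrable(1)[OF u z])
 define e where "e t = m t (u t) (z t) - (LINT x|leb {0..t}. R x)" for t
 have ie: "integrable (leb {0..T}) e" unfolding e_def by (intro bi_integrable_diff a_integrable(2)[OF u z] cont_integrable_Icc indefinite_integral_continuous_real[OF iR])
 have "(LINT t|leb {0..T}. e t * deriv phi t) = 0" if "phi : test_functions J" for phi unfolding e_def R_def by (rule product_weakly_constant[OF u z G that])
 then obtain c where c: "AE t in lebesgue. t : J --> e t = c" using weakly_constant[OF T ie] by metis
 \<comment> \<open>Discarding the times at which the defect differs from its constant value makes
   the product formula exact between any two remaining times.\<close>
 define G' where "G' = {t : G. e t = c}"
 show ?thesis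
 proof (rule that[of G'])
 show "G' <= J" using G(1) by (auto simp: G'_def)
 show "AE t in lebesgue. t : J --> t : G'" using G(2) c by eventually_elim (auto simp: G'_def)
 show "bal u gu w s t & bal z gz w s t" if "w : u ` G' \<union> z ` G'" "s : G'" "t : G'" "s <= t" for w s t using G(3)[of w s t] that by (auto simp: G'_def)
 fix s t assume st: "s : G'" "t : G'" "s <= t"
 hence "s : J" "t : J" using G(1) by (auto simp: G'_def)
 hence "(LINT x|leb {0..t}. R x) - (LINT x|leb {0..s}. R x) = (LINT x|leb {s..t}. R x)" using st by (intro Icc_integral_split[OF iR]) auto
 moreover have "e t = e s" using st by (simp add: G'_def)
 ultimately show "m t (u t) (z t) - m s (u s) (z s)
 = (LINT x|leb {s..t}. bapp (gu x) (z x) + bapp (gz x) (u x) + a x (u x) (z x))" unfolding e_def R_def by linarith qed qed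

end

section \<open>Energy bound and Cauchy property\<close>

context form_family
begin

text \<open>The energy at t is at most the energy at any s in G plus the variation W. Integrating
  over s gives the factor T on the left and the time integral of the energy, which the bound on
  \<open>m\<close> controls, on the right.\<close>

lemma energy_bound:
 assumes u: "sol u g" and G: "G <= J" "AE t in lebesgue. t : J --> t : G"
 and id: "!!s t. s : G ==> t : G ==> s <= t ==> m t (u t) (u t) - m s (u s) (u s)
 = (LINT x|leb {s..t}. bapp (g x) (u x) + bapp (g x) (u x) + a x (u x) (u x))"
 and N: "0 < N" "(LINT t|leb {0..T}. norm (u t) powr p) <= N powr p" "(LINT t|leb {0..T}. norm (g t) powr q) <= N powr q"
 and t: "t : G" shows "T * m t (u t) (u t) <= (C * (T + 1) + T * (4 + C * (T + 1))) * N\<^sup>2"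
proof -
 define R where "R x = bapp (g x) (u x) + bapp (g x) (u x) + a x (u x) (u x)" for x
 have iR: "integrable (leb {0..T}) R" unfolding R_def by (intro bi_integrable_add g_integrable[OF u u] a_integrable(1)[OF u u])
 have iu: "integrable (leb {0..T}) (%t. norm (u t) powr p)" "integrable (leb {0..T}) (%t. norm (g t) powr q)" using solD(3,4)[OF u] by (simp_all only: leb_Ioo_Icc(1))
 \<comment> \<open>After division by N both powers have integral at most 1, and all bounds become
   homogeneous of degree two in N although p and q differ.\<close>
 define X where "X t = norm (u t) powr p / N powr p" for t
 define Y where "Y t = norm (g t) powr q / N powr q" for t
 have Np: "0 < N powr p" "0 < N powr q" using N(1) by simp_all
 have iX: "integrable (leb {0..T}) X" "integrable (leb {0..T}) Y" unfolding X_def Y_def using iu by (auto intro: integrable_divide_zero)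
 have IX: "(LINT t|leb {0..T}. X t) <= 1" "(LINT t|leb {0..T}. Y t) <= 1" unfolding X_def Y_def integral_divide_zero using N Np by (simp_all add: divide_le_eq)
 have X0: "0 <= X t" "0 <= Y t" for t using Np by (simp_all add: X_def Y_def)
 have sq: "(norm (u t))\<^sup>2 <= N\<^sup>2 * (1 + X t)" for t
 proof -
 have "(norm (u t) / N)\<^sup>2 <= 1 + (norm (u t) / N) powr p" by (rule powr_dominates) (use p N in auto)
 also have "(norm (u t) / N) powr p = X t" using N by (simp add: powr_divide X_def)
 finally show ?thesis using N(1) by (simp add: power_divide divide_le_eq mult.commute) qed
 have gu: "norm (g t) * norm (u t) <= N\<^sup>2 * (X t + Y t)" for t
 proof -
 have "(norm (u t) / N) * (norm (g t) / N) <= (norm (u t) / N) powr p + (norm (g t) / N) powr q" by (rule mult_le_powr) (use p q N in auto)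
 also have "... = X t + Y t" using N by (simp add: powr_divide X_def Y_def)
 finally show ?thesis using N(1) by (simp add: power2_eq_square divide_le_eq mult_ac) qed
 \<comment> \<open>Its integral is at most N^2 (2 (1 + 1) + C (T + 1)): this is the second group in
   the constant.\<close>
 define r where "r t = N\<^sup>2 * (2 * (X t + Y t) + C * (1 + X t))" for t
 have i1: "integrable (leb {0..T}) (%t. 1 + X t)" by (intro bi_integrable_add iX cont_integrable_Icc continuous_on_const)
 have ir: "integrable (leb {0..T}) r" unfolding r_def by (intro bi_integrable_add integrable_mult_right iX i1)
 have I1: "(LINT t|leb {0..T}. 1 + X t) <= T + 1"
 proof -
 have "(LINT t|leb {0..T}. 1 + X t) = (LINT t|leb {0..T}. 1) + (LINT t|leb {0..T}. X t)" by (intro bi_integral_add iX cont_integrable_Icc continuous_on_const)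
 thus ?thesis using IX(1) Icc_integral_const[OF less_imp_le[OF T], of 1] by simp qed
 have Ir: "(LINT t|leb {0..T}. r t) <= N\<^sup>2 * (4 + C * (T + 1))"
 proof -
 have ixy: "integrable (leb {0..T}) (%t. X t + Y t)" by (rule bi_integrable_add[OF iX])
 have "(LINT t|leb {0..T}. r t) = N\<^sup>2 * (LINT t|leb {0..T}. 2 * (X t + Y t) + C * (1 + X t))" unfolding r_def by (rule integral_mult_right_zero)
 also have "(LINT t|leb {0..T}. 2 * (X t + Y t) + C * (1 + X t)) = (LINT t|leb {0..T}. 2 * (X t + Y t)) + (LINT t|leb {0..T}. C * (1 + X t))"
 by (rule bi_integral_add[OF integrable_mult_right[OF ixy] integrable_mult_right[OF i1]])
 also have "... = 2 * (LINT t|leb {0..T}. X t + Y t) + C * (LINT t|leb {0..T}. 1 + X t)" by (simp only: integral_mult_right_zero)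
 also have "(LINT t|leb {0..T}. X t + Y t) = (LINT t|leb {0..T}. X t) + (LINT t|leb {0..T}. Y t)" by (rule bi_integral_add[OF iX])
 also have "N\<^sup>2 * (2 * ((LINT t|leb {0..T}. X t) + (LINT t|leb {0..T}. Y t)) + C * (LINT t|leb {0..T}. 1 + X t)) <= N\<^sup>2 * (2 * (1 + 1) + C * (T + 1))"
 using IX I1 C0 by (intro mult_left_mono add_mono) auto
 finally show ?thesis by simp qed
 have Rr: "abs(R x) <= r x" if x: "x : J" for x
 proof -
 have "abs(R x) <= 2 * (norm (g x) * norm (u x)) + C * norm (u x) * norm (u x)" unfolding R_def using g_bound[of "g x" "u x"] a_bound[OF x, of "u x" "u x"] by linarith
 moreover have "C * norm (u x) * norm (u x) <= C * (N\<^sup>2 * (1 + X x))" using mult_left_mono[OF sq[of x] C0] by (simp add: power2_eq_square mult.assoc)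
 ultimately show ?thesis unfolding r_def using gu[of x] by (simp add: algebra_simps) qed
 have r0: "0 <= r x" for x unfolding r_def using X0[of x] C0 by simp
 define W where "W = (LINT t|leb {0..T}. r t)"
 have diff: "abs(m t (u t) (u t) - m s (u s) (u s)) <= W" if st: "s : G" "t : G" "s <= t" for s t
 proof -
 have st0: "0 <= s" "t <= T" and sub: "!!x. x : {s..t} ==> x : J" using st G(1) by auto
 have "abs(LINT x|leb {s..t}. R x) <= (LINT x|leb {s..t}. r x)" by (rule Icc_integral_bound[OF sub_integrable[OF iR st0] sub_integrable[OF ir st0] Rr[OF sub]])
 also have "... <= W" unfolding W_def by (rule Icc_integral_mono_set[OF ir st0 r0])
 finally show ?thesis unfolding id[OF st] R_def . qed
 have le: "m t (u t) (u t) <= m s (u s) (u s) + W" if "s : G" for s using diff[OF that t] diff[OF t that] by (cases "s <= t") auto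
 have im: "integrable (leb {0..T}) (%s. m s (u s) (u s))" by (rule a_integrable(2)[OF u u])
 have ic: "integrable (leb {0..T}) (%s. c)" for c :: real by (rule cont_integrable_Icc[OF continuous_on_const])
 have ae0: "AE s in leb {0..T}. s : J"
 proof -
 have "{0, T} : null_sets lebesgue" by (simp add: negligible_iff_null_sets[symmetric])
 from AE_not_in[OF this] have "AE s in lebesgue. s : {0..T} --> s : J" by (rule eventually_mono) auto
 thus ?thesis by (rule AE_restrict_space_iff[THEN iffD2, rotated]) simp qed
 have aeG: "AE s in leb {0..T}. s : J --> s : G"
 proof -
 have "AE s in lebesgue. s : {0..T} --> s : J --> s : G" using G(2) by (rule eventually_mono) auto
 thus ?thesis by (rule AE_restrict_space_iff[THEN iffD2, rotated]) simp qed
 have "(LINT s|leb {0..T}. m t (u t) (u t)) <= (LINT s|leb {0..T}. m s (u s) (u s) + W)" by (rule integral_mono_AE[OF ic bi_integrable_add[OF im ic]])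
 (use ae0 aeG in eventually_elim, use le in blast)
 also have "... = (LINT s|leb {0..T}. m s (u s) (u s)) + (LINT s|leb {0..T}. W)" by (rule bi_integral_add[OF im ic])
 also have "(LINT s|leb {0..T}. m s (u s) (u s)) <= (LINT s|leb {0..T}. C * (N\<^sup>2 * (1 + X s)))"
 proof (rule integral_mono_AE[OF im])
 show "integrable (leb {0..T}) (%s. C * (N\<^sup>2 * (1 + X s)))" by (intro integrable_mult_right i1)
 show "AE s in leb {0..T}. m s (u s) (u s) <= C * (N\<^sup>2 * (1 + X s))" using ae0
 proof eventually_elim
 case (elim s)
 have "m s (u s) (u s) <= C * norm (u s) * norm (u s)" using m_bound[OF elim, of "u s" "u s"] by linarith
 also have "... <= C * (N\<^sup>2 * (1 + X s))" using mult_left_mono[OF sq[of s] C0] by (simp add: power2_eq_square mult.assoc)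
 finally show ?case . qed qed
 also have "(LINT s|leb {0..T}. C * (N\<^sup>2 * (1 + X s))) = C * (N\<^sup>2 * (LINT s|leb {0..T}. 1 + X s))" by (simp only: integral_mult_right_zero)
 also have "... <= C * (N\<^sup>2 * (T + 1))" using I1 C0 by (intro mult_left_mono) auto
 finally have "(T - 0) * m t (u t) (u t) <= C * (N\<^sup>2 * (T + 1)) + (T - 0) * W" using T by (simp only: Icc_integral_const less_imp_le)
 also have "... <= C * (N\<^sup>2 * (T + 1)) + T * (N\<^sup>2 * (4 + C * (T + 1)))" using Ir T by (simp add: W_def mult_left_mono)
 finally show ?thesis by (simp add: algebra_simps) qed

text \<open>If the inequality failed at all points of G in the window, integrating it would exceed
  the integral of r by e.\<close>

lemma Icc_average_point:
 assumes r: "integrable (leb {0..T}) r" and l: "0 <= l" "l + d <= T" "0 < d" and e: "0 < e"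
 and G: "AE t in lebesgue. t : J --> t : G"
 obtains x where "x : G" "x : {l..l + d}" "d * r x <= (LINT t|leb {l..l + d}. r t) + e"
proof -
 have "EX x. x : G & x : {l..l + d} & d * r x <= (LINT t|leb {l..l + d}. r t) + e"
 proof (rule ccontr)
 assume none: "\<not> ?thesis"
 define c where "c = ((LINT t|leb {l..l + d}. r t) + e) / d"
 have ir: "integrable (leb {l..l + d}) r" by (rule sub_integrable[OF r]) (use l in auto)
 have "{0, T} : null_sets lebesgue" by (simp add: negligible_iff_null_sets[symmetric])
 from AE_not_in[OF this] G have ae: "AE t in lebesgue. t : {l..l + d} --> c <= r t"
 proof eventually_elim
 case (elim t)
 show ?case
 proof
 assume t: "t : {l..l + d}"
 hence "t : J" using elim(1) l by auto
 hence "t : G" using elim(2) by blast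
 with none t have "(LINT t|leb {l..l + d}. r t) + e < d * r t" by (metis not_le)
 thus "c <= r t" using l(3) by (simp add: c_def divide_le_eq mult.commute) qed qed
 have "(LINT t|leb {l..l + d}. c) <= (LINT t|leb {l..l + d}. r t)" by (rule integral_mono_AE[OF cont_integrable_Icc[OF continuous_on_const] ir])
 (rule AE_restrict_space_iff[THEN iffD2, rotated, OF ae], simp)
 moreover have "(LINT t|leb {l..l + d}. c) = d * c" using l(3) by (subst Icc_integral_const) auto
 moreover have "d * c = (LINT t|leb {l..l + d}. r t) + e" using l(3) by (simp add: c_def)
 ultimately show False using e by linarith qed
 thus ?thesis using that by blast qed

text \<open>The energy of u - u r vanishes at time r and changes by an integrable amount plus |t -
  r| times \<open>rho\<close> at r. The latter may be large, so r is selected by averaging over a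
  window of length d: then d times \<open>rho\<close> at r is small, uniformly for t near
  tau.\<close>

lemma energy_cauchy:
 assumes u: "sol u g" and G: "G <= J" "AE t in lebesgue. t : J --> t : G"
 and bal: "!!w s t. w : u ` G ==> s : G ==> t : G ==> s <= t ==> bal u g w s t"
 and id: "!!s t. s : G ==> t : G ==> s <= t ==> m t (u t) (u t) - m s (u s) (u s)
 = (LINT x|leb {s..t}. bapp (g x) (u x) + bapp (g x) (u x) + a x (u x) (u x))"
 and tau: "tau : {0..T}" and eps: "0 < eps" shows "EX d>0. EX r:G. ALL t:G. abs(t - tau) < d --> m t (u t - u r) (u t - u r) <= eps"
proof -
 have irho: "integrable (leb {0..T}) (rho u g)" using rho_integrable[OF u] by (simp only: leb_Ioo_Icc(1))
 \<comment> \<open>The bound on F below has 6 + 2 C times the density at x and 2 + 2 C times the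
   density at r.\<close>
 define c where "c = 6 + 2 * C"
 have c0: "0 < c" using C0 by (simp add: c_def)
 define R where "R x = bapp (g x) (u x) + bapp (g x) (u x) + a x (u x) (u x)" for x
 have iR: "integrable (leb {0..T}) R" unfolding R_def by (intro bi_integrable_add g_integrable[OF u u] a_integrable(1)[OF u u])
 \<comment> \<open>The density in the energy balance of u - w with w frozen, obtained by expanding
   the square.\<close>
 define F where "F w x = R x - 2 * (bapp (g x) w + a x (u x) w) + a x w w" for w x
 have iF: "integrable (leb {0..T}) (F w)" for w unfolding F_def by (intro bi_integrable_add bi_integrable_diff integrable_mult_right iR const_integrable[OF u])
 have bF: "abs(F (u r) x) <= c * (rho u g x + rho u g r)" if x: "x : J" for r x
 proof -
 define A where "A = rho u g x"
 define B where "B = rho u g r"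
 have 1: "norm (g x) * norm (u x) <= A + A" unfolding A_def by (rule rho_mult)
 have 2: "norm (g x) * norm (u r) <= A + B" unfolding A_def B_def using rho_mult[of g x "%_. u r" u "%_. g r"] by (simp add: rho_def)
 have ux: "norm (u x) * norm (u x) <= A" "norm (u r) * norm (u r) <= B" using rho_ge(6)[of u x g] rho_ge(6)[of u r g] by (simp_all add: A_def B_def power2_eq_square)
 have "0 <= (norm (u x) - norm (u r))\<^sup>2" by simp
 hence 3: "2 * (norm (u x) * norm (u r)) <= A + B" using ux by (simp add: power2_eq_square algebra_simps)
 have a1: "abs(a x (u x) (u x)) <= C * A" using order_trans[OF a_bound[OF x]] mult_left_mono[OF ux(1) C0] by (simp add: mult.assoc)
 have a2: "abs(a x (u r) (u r)) <= C * B" using order_trans[OF a_bound[OF x]] mult_left_mono[OF ux(2) C0] by (simp add: mult.assoc)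
 have a3: "2 * abs(a x (u x) (u r)) <= C * (A + B)" using a_bound[OF x, of "u x" "u r"] mult_left_mono[OF 3 C0] by (simp add: mult.assoc mult.left_commute[of 2])
 have AB: "0 <= A" "0 <= B" using rho_ge(7) by (simp_all add: A_def B_def)
 have "abs(F (u r) x) <= 2 * (A + A) + C * A + 2 * (A + B) + C * (A + B) + C * B"
 proof -
 have gen: "abs(x1 + x1 + y1 - 2 * (x2 + y2) + y3) <= 2 * a1 + b1 + 2 * a2 + b2 + b3"
 if "abs(x1) <= a1" "abs(y1) <= b1" "abs(x2) <= a2" "2 * abs(y2) <= b2" "abs(y3) <= b3" for x1 x2 y1 y2 y3 a1 a2 b1 b2 b3 :: real
 proof -
 have "2 * y2 <= b2" "- (2 * y2) <= b2" using that(4) by linarith+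
 with that(1,2,3,5) show ?thesis unfolding abs_le_iff by auto qed
 show ?thesis unfolding F_def R_def by (rule gen[OF order_trans[OF g_bound 1] a1 order_trans[OF g_bound 2] a3 a2]) qed
 also have "... <= c * (A + B)" using AB C0 by (simp add: c_def algebra_simps)
 finally show ?thesis by (simp add: A_def B_def) qed
 define P where "P t = (LINT x|leb {0..t}. rho u g x)" for t
 have cP: "continuous_on {0..T} P" unfolding P_def by (rule indefinite_integral_continuous_real[OF irho])
 have Pd: "(LINT x|leb {s..t}. rho u g x) = P t - P s" if "0 <= s" "s <= t" "t <= T" for s t unfolding P_def by (rule Icc_integral_split[OF irho that, symmetric])
 have est: "m t (u t - u r) (u t - u r) <= c * (abs(P t - P r) + abs(t - r) * rho u g r)" if tr: "t : G" "r : G" for t r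
 proof -
 define lo where "lo = min t r"
 define hi where "hi = max t r"
 have lh: "lo : G" "hi : G" "lo <= hi" using tr by (auto simp: lo_def hi_def min_def max_def)
 have lh0: "0 <= lo" "hi <= T" "0 < lo" "hi < T" and sub: "!!x. x : {lo..hi} ==> x : J" using lh G(1) by auto
 define n where "n s = m s (u s) (u s) - 2 * m s (u s) (u r) + m s (u r) (u r)" for s
 have nexp: "m s (u s - u r) (u s - u r) = n s" if "s : G" for s
 proof -
 have s: "s : J" using that G(1) by blast
 interpret bounded_bilinear "m s" by (rule m_bilinear[OF s])
 show ?thesis unfolding n_def using m_sym[OF s, of "u r" "u s"] by (simp add: diff_left diff_right) qed
 have si: "integrable (leb {lo..hi}) f" if "integrable (leb {0..T}) f" for f :: "real => real" by (rule sub_integrable[OF that lh0(1,2)])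
 have j1: "integrable (leb {lo..hi}) R" by (rule si[OF iR])
 have j2: "integrable (leb {lo..hi}) (%x. bapp (g x) (u r) + a x (u x) (u r))" by (intro si bi_integrable_add const_integrable[OF u])
 have j3: "integrable (leb {lo..hi}) (%x. a x (u r) (u r))" by (intro si const_integrable(4)[OF u])
 have "n hi - n lo = (LINT x|leb {lo..hi}. R x) - 2 * (LINT x|leb {lo..hi}. bapp (g x) (u r) + a x (u x) (u r)) + (LINT x|leb {lo..hi}. a x (u r) (u r))"
 using id[OF lh] bal[of "u r", OF _ lh] m_diff[OF lh0(3) lh(3) lh0(4), of "u r" "u r"] tr(2) unfolding n_def bal_def R_def by simp
 also have "... = (LINT x|leb {lo..hi}. F (u r) x)" unfolding F_def bi_integral_add[OF bi_integrable_diff[OF j1 integrable_mult_right[OF j2]] j3]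
 bi_integral_diff[OF j1 integrable_mult_right[OF j2]] integral_mult_right_zero ..
 finally have eq: "n hi - n lo = (LINT x|leb {lo..hi}. F (u r) x)" .
 have ib: "integrable (leb {lo..hi}) (%x. rho u g x + rho u g r)" by (intro bi_integrable_add si[OF irho] cont_integrable_Icc continuous_on_const)
 have "abs(n hi - n lo) <= (LINT x|leb {lo..hi}. c * (rho u g x + rho u g r))" unfolding eq by (rule Icc_integral_bound[OF si[OF iF] integrable_mult_right[OF ib] bF[OF sub]])
 also have "... = c * (LINT x|leb {lo..hi}. rho u g x + rho u g r)" by (rule integral_mult_right_zero)
 also have "(LINT x|leb {lo..hi}. rho u g x + rho u g r) = (LINT x|leb {lo..hi}. rho u g x) + (LINT x|leb {lo..hi}. rho u g r)"
 by (rule bi_integral_add[OF si[OF irho] cont_integrable_Icc[OF continuous_on_const]])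
 also have "(LINT x|leb {lo..hi}. rho u g x) = P hi - P lo" by (rule Pd) (use lh0 lh in auto)
 also have "(LINT x|leb {lo..hi}. rho u g r) = (hi - lo) * rho u g r" by (rule Icc_integral_const[OF lh(3)])
 finally have "abs(n hi - n lo) <= c * ((P hi - P lo) + (hi - lo) * rho u g r)" .
 moreover have "P hi - P lo <= abs(P t - P r)" "hi - lo = abs(t - r)" by (auto simp: lo_def hi_def min_def max_def)
 ultimately have "abs(n hi - n lo) <= c * (abs(P t - P r) + abs(t - r) * rho u g r)" using c0 by (elim order_trans) (auto intro: mult_left_mono)
 moreover have "n r = 0" unfolding n_def by simp
 hence "n t <= abs(n hi - n lo)" by (auto simp: lo_def hi_def min_def max_def)
 ultimately show ?thesis using nexp[OF tr(1)] by linarith qed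
 \<comment> \<open>One share e goes to the increment of P, and four to the term |t - r| times
   \<open>rho\<close> at r.\<close>
 define e where "e = eps / (5 * c)"
 have e: "0 < e" using eps c0 by (simp add: e_def)
 have "uniformly_continuous_on {0..T} P" by (rule compact_uniformly_continuous[OF cP]) simp
 then obtain d0 where d0: "0 < d0" "!!x y. x : {0..T} ==> y : {0..T} ==> dist y x < d0 ==> dist (P y) (P x) < e" using e unfolding uniformly_continuous_on_def by metis
 define d where "d = min (d0 / 4) (T / 2)"
 have d: "0 < d" "4 * d <= d0" "d <= T / 2" using d0(1) T by (auto simp: d_def)
 \<comment> \<open>The window [l, l + d] lies within distance d of tau and stays inside [0,T], also
   when tau is an end point.\<close>
 define l where "l = (if T / 2 <= tau then tau - d else tau)"
 have l: "0 <= l" "l + d <= T" "tau - d <= l" "l + d <= tau + d" using d tau by (auto simp: l_def)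
 obtain r where r: "r : G" "r : {l..l + d}" "d * rho u g r <= (LINT t|leb {l..l + d}. rho u g t) + e" using Icc_average_point[OF irho l(1,2) d(1) e G(2)] by metis
 have "(LINT t|leb {l..l + d}. rho u g t) = P (l + d) - P l" by (rule Pd) (use l d in auto)
 also have "... < e" using d0(2)[of l "l + d"] l d by (auto simp: dist_real_def)
 finally have dr: "d * rho u g r < 2 * e" using r(3) by linarith
 have "m t (u t - u r) (u t - u r) <= eps" if t: "t : G" "abs(t - tau) < d" for t
 proof -
 have tr: "abs(t - r) <= 2 * d" using t(2) r(2) l by auto
 have "t : {0..T}" "r : {0..T}" using t r(1) G(1) by auto
 hence "abs(P t - P r) < e" using d0(2)[of r t] tr d by (simp add: dist_real_def)
 moreover have "abs(t - r) * rho u g r <= 2 * d * rho u g r" using tr rho_ge(7) by (intro mult_right_mono) auto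
 ultimately have "abs(P t - P r) + abs(t - r) * rho u g r <= 5 * e" using dr by linarith
 hence "c * (abs(P t - P r) + abs(t - r) * rho u g r) <= c * (5 * e)" using c0 by (intro mult_left_mono) auto
 also have "... = eps" using c0 by (simp add: e_def)
 finally show ?thesis using est[OF t(1) r(1)] by linarith qed
 thus ?thesis using d(1) r(1) by blast qed

end

section \<open>Geometry of the moving domains\<close>

lemma inverse_Suc_tendsto:
 fixes X :: "nat => real"
 assumes X: "!!n. abs(X n - l) < 1 / Suc n" shows "X ----> l"
proof (rule LIMSEQ_I)
 fix e :: real assume "0 < e"
 then obtain N where N: "1 / Suc N < e" using reals_Archimedean[of e] by (auto simp: inverse_eq_divide)
 have "norm (X n - l) < e" if "n >= N" for n
 proof -
 have "1 / Suc n <= 1 / Suc N" using that by (simp add: frac_le)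
 thus ?thesis using X[of n] N unfolding real_norm_def by linarith qed
 thus "EX N. ALL n>=N. norm (X n - l) < e" by blast qed

lemma lipschitz_domainD:
 assumes "lipschitz_domain U" shows "open U" "bounded U" "U ~= {}" "compact (closure U)" using assms by (auto simp: lipschitz_domain_def compact_closure)

text \<open>The last conclusion adds the closure to the chart: the region strictly below the graph
  is open and misses U near z, hence it misses the closure of U as well.\<close>

lemma lipschitz_domain_chart:
 fixes U :: "(real^'n) set"
 assumes U: "lipschitz_domain U" and z: "z : frontier U"
 obtains r e L and \<gamma> :: "real^'n => real" where "0 < r" "norm e = 1" "L-lipschitz_on UNIV \<gamma>"
 "U \<inter> ball z r = {x : ball z r. \<gamma> (x - (x \<bullet> e) *\<^sub>R e) < x \<bullet> e}"
 "closure U \<inter> ball z r <= {x. \<gamma> (x - (x \<bullet> e) *\<^sub>R e) <= x \<bullet> e}"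
proof -
 have "EX r>0. EX e L. EX \<gamma> :: real^'n => real. norm e = 1 & L-lipschitz_on UNIV \<gamma> &
 U \<inter> ball z r = {x : ball z r. \<gamma> (x - (x \<bullet> e) *\<^sub>R e) < x \<bullet> e}" using U z unfolding lipschitz_domain_def by blast
 then obtain r e L \<gamma> where c: "0 < r" "norm e = 1" "L-lipschitz_on UNIV (\<gamma> :: real^'n => real)"
 "U \<inter> ball z r = {x : ball z r. \<gamma> (x - (x \<bullet> e) *\<^sub>R e) < x \<bullet> e}" by blast
 have c\<gamma>: "continuous_on UNIV (%x. \<gamma> (x - (x \<bullet> e) *\<^sub>R e))"
 by (rule continuous_on_compose2[OF lipschitz_on_continuous_on[OF c(3)]]) (auto intro!: continuous_intros)
 define W where "W = {x. x \<bullet> e < \<gamma> (x - (x \<bullet> e) *\<^sub>R e)}"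
 have W: "open W" unfolding W_def by (rule open_Collect_less) (auto intro!: continuous_intros c\<gamma>)
 have "W \<inter> ball z r \<inter> U = {}" using c(4) unfolding W_def by force
 hence "W \<inter> ball z r \<inter> closure U = {}" using open_Int_closure_eq_empty[of "W \<inter> ball z r" U] W by auto
 hence "closure U \<inter> ball z r <= {x. \<gamma> (x - (x \<bullet> e) *\<^sub>R e) <= x \<bullet> e}" unfolding W_def by force
 with c show ?thesis by (rule that) qed

text \<open>Near a boundary point the frontier lies on the graph of \<open>\<gamma>\<close>, the
  image of the hyperplane orthogonal to e under the Lipschitz map y -> y + \<open>\<gamma>\<close> y
  e.\<close>

lemma lipschitz_domain_frontier_negligible:
 fixes U :: "(real^'n) set"
 assumes U: "lipschitz_domain U" shows "negligible (frontier U)"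
proof -
 have oU: "open U" using U lipschitz_domainD by blast
 have loc: "EX r>0. negligible (frontier U \<inter> ball z r)" if z: "z : frontier U" for z
 proof (rule lipschitz_domain_chart[OF U z])
 fix r e L and \<gamma> :: "real^'n => real"
 assume r: "0 < r" and e: "norm e = 1" and \<gamma>: "L-lipschitz_on UNIV \<gamma>"
 and eq: "U \<inter> ball z r = {x : ball z r. \<gamma> (x - (x \<bullet> e) *\<^sub>R e) < x \<bullet> e}"
 and cl: "closure U \<inter> ball z r <= {x. \<gamma> (x - (x \<bullet> e) *\<^sub>R e) <= x \<bullet> e}"
 define S where "S = {y. e \<bullet> y = 0}"
 define h where "h y = y + \<gamma> y *\<^sub>R e" for y
 have ee: "e \<bullet> e = 1" using e by (simp add: norm_eq_1)
 have "frontier U \<inter> ball z r <= h ` S"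
 proof
 fix x assume x: "x : frontier U \<inter> ball z r"
 hence "x ~: U" "x : closure U" using oU by (auto simp: frontier_def interior_open)
 hence g: "\<gamma> (x - (x \<bullet> e) *\<^sub>R e) = x \<bullet> e" using x eq cl by force
 have "x = h (x - (x \<bullet> e) *\<^sub>R e)" unfolding h_def g by simp
 moreover have "x - (x \<bullet> e) *\<^sub>R e : S" using ee by (simp add: S_def inner_diff_right inner_commute)
 ultimately show "x : h ` S" by blast qed
 moreover have "negligible (h ` S)"
 proof (rule negligible_locally_Lipschitz_image)
 show "negligible S" unfolding S_def using e by (intro negligible_hyperplane) auto
 fix x assume "x : S"
 have "norm (h y - h x) <= (1 + L) * norm (y - x)" for y
 proof -
 have "h y - h x = (y - x) + (\<gamma> y - \<gamma> x) *\<^sub>R e" by (simp add: h_def algebra_simps)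
 hence "norm (h y - h x) <= norm (y - x) + abs(\<gamma> y - \<gamma> x)" using norm_triangle_ineq[of "y - x" "(\<gamma> y - \<gamma> x) *\<^sub>R e"] e by simp
 moreover have "abs(\<gamma> y - \<gamma> x) <= L * norm (y - x)" using lipschitz_onD[OF \<gamma>, of y x] by (simp add: dist_norm)
 ultimately show ?thesis by (simp add: algebra_simps) qed
 thus "EX T B. open T & x : T & (ALL y:S \<inter> T. norm (h y - h x) <= B * norm (y - x))" by (intro exI[of _ UNIV] exI[of _ "1 + L"]) auto qed simp
 ultimately show ?thesis using r negligible_subset by blast qed
 show ?thesis
 proof (subst locally_negligible_alt, intro ballI)
 fix z assume z: "z : frontier U"
 obtain r where r: "0 < r" "negligible (frontier U \<inter> ball z r)" using loc[OF z] by blast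
 have "openin (top_of_set (frontier U)) (frontier U \<inter> ball z r)" by (rule openin_open_Int) simp
 thus "EX W. openin (top_of_set (frontier U)) W & z : W & negligible W" using r z by (intro exI[of _ "frontier U \<inter> ball z r"]) simp qed qed

text \<open>Moving a frontier point slightly in the direction -e puts it strictly below the graph,
  hence outside the closure: there are no slits. This recovers open sets from their closures, in
  terms of which the flow is described.\<close>

lemma lipschitz_domain_interior_closure:
 fixes U :: "(real^'n) set"
 assumes U: "lipschitz_domain U" shows "interior (closure U) = U"
proof -
 have oU: "open U" using U lipschitz_domainD by blast
 have "z ~: interior (closure U)" if z: "z : frontier U" for z
 proof (rule lipschitz_domain_chart[OF U z])
 fix r e L and \<gamma> :: "real^'n => real"
 assume r: "0 < r" and e: "norm e = 1"
 and eq: "U \<inter> ball z r = {x : ball z r. \<gamma> (x - (x \<bullet> e) *\<^sub>R e) < x \<bullet> e}"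
 and cl: "closure U \<inter> ball z r <= {x. \<gamma> (x - (x \<bullet> e) *\<^sub>R e) <= x \<bullet> e}"
 have ee: "e \<bullet> e = 1" using e by (simp add: norm_eq_1)
 have "z ~: U" using z oU by (auto simp: frontier_def interior_open)
 hence g: "z \<bullet> e <= \<gamma> (z - (z \<bullet> e) *\<^sub>R e)" using eq r by force
 show "z ~: interior (closure U)"
 proof
 assume "z : interior (closure U)"
 then obtain d where d: "0 < d" "ball z d <= closure U" by (auto simp: mem_interior)
 define s where "s = min d r / 2"
 have s: "0 < s" "s < d" "s < r" using d(1) r by (auto simp: s_def)
 define x where "x = z - s *\<^sub>R e"
 have "dist z x = s" using s e by (simp add: x_def dist_norm)
 hence "x : closure U \<inter> ball z r" using d(2) s by auto
 hence "\<gamma> (x - (x \<bullet> e) *\<^sub>R e) <= x \<bullet> e" using cl by blast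
 moreover have xe: "x \<bullet> e = z \<bullet> e - s" using ee by (simp add: x_def inner_diff_left)
 moreover have "x - (x \<bullet> e) *\<^sub>R e = z - (z \<bullet> e) *\<^sub>R e" unfolding xe by (simp add: x_def algebra_simps)
 ultimately show False using g s by simp qed qed
 hence "interior (closure U) <= U" using interior_subset[of "closure U"] oU by (auto simp: frontier_def interior_open)
 moreover have "U <= interior (closure U)" using oU closure_subset by (rule interior_maximal[rotated])
 ultimately show ?thesis by blast qed

lemma C1_barE:
 assumes "f : C1_bar U"
 obtains f' where "continuous_on (closure U) f" "continuous_on (closure U) f'"
 "!!x. x : U ==> (f has_derivative bapp (f' x)) (at x)" using assms unfolding C1_bar_def by blast

section \<open>The flow and the two phases\<close>

context moving_domains
begin


abbreviation (input) "J \<equiv> {0<..<T}"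
abbreviation (input) "Om \<equiv> \<Omega>"

text \<open>Facts are established for the first phase and transferred to the second by interchanging
  the two.\<close>

lemma swap: "moving_domains Om T \<Omega>2 \<Omega>1 \<Phi> v" by unfold_locales
 (use dimension T_pos domain subdomain1 subdomain2 disjoint decomposition flow_smooth flow_closed flow_initial
 flow_diffeo flow_subdomain1 flow_subdomain2 velocity velocity_smooth in "auto simp: interface_def Int_commute Un_commute")

lemma open_domains: "open Om" "t : {0..T} ==> open (\<Omega>1 t)" "t : {0..T} ==> open (\<Omega>2 t)" using domain subdomain1 subdomain2 lipschitz_domainD by blast+

lemma closure_cylinder: "closure (Om \<times> J) = closure Om \<times> {0..T}" using T_pos by (simp add: closure_Times)

text \<open>The flow is described on closed phases; this expresses an open phase through the closure
  of the other one. The interface lies in that closure, and the open first phase misses it.\<close>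

lemma \<Omega>1_eq: "t : {0..T} ==> \<Omega>1 t = Om - closure (\<Omega>2 t)"
proof -
 assume t: "t : {0..T}"
 have "\<Omega>1 t \<inter> closure (\<Omega>2 t) = {}" using disjoint[OF t] open_Int_closure_eq_empty[OF open_domains(2)[OF t]] by simp
 moreover have "interface \<Omega>1 \<Omega>2 t <= closure (\<Omega>2 t)" "\<Omega>2 t <= closure (\<Omega>2 t)" by (auto simp: interface_def frontier_def closure_subset)
 ultimately show ?thesis using decomposition[OF t] by blast qed

lemma \<Phi>_continuous: "continuous_on (closure Om \<times> {0..T}) \<Phi>" using flow_smooth unfolding C1_bar_def closure_cylinder by blast

lemma \<Phi>t_continuous: "t : {0..T} ==> continuous_on (closure Om) (%x. \<Phi> (x, t))"
 by (rule continuous_on_compose2[OF \<Phi>_continuous]) (auto intro!: continuous_intros)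

lemma \<Phi>_inj: "t : J ==> inj_on (%x. \<Phi> (x, t)) (closure Om)" using flow_diffeo by (auto simp: C1_bar_diffeomorphism_def bij_betw_def)

lemma \<Phi>_image_open:
 assumes t: "t : J" and S: "open S" "S <= Om" shows "open ((%x. \<Phi> (x, t)) ` S)"
proof (rule invariance_of_domain[OF _ S(1)])
 have sub: "S <= closure Om" using S(2) closure_subset by blast
 show "continuous_on S (%x. \<Phi> (x, t))" by (rule continuous_on_subset[OF \<Phi>t_continuous sub]) (use t in auto)
 show "inj_on (%x. \<Phi> (x, t)) S" by (rule inj_on_subset[OF \<Phi>_inj[OF t] sub]) qed

definition inv\<Phi> :: "real => real^'n => real^'n" where
 "inv\<Phi> t = inv_into (closure Om) (%x. \<Phi> (x, t))"

lemma inv\<Phi>: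
 assumes t: "t : J" shows "x : closure Om ==> \<Phi> (inv\<Phi> t x, t) = x" "x : closure Om ==> inv\<Phi> t x : closure Om"
 "x : closure Om ==> inv\<Phi> t (\<Phi> (x, t)) = x" "inv\<Phi> t : C1_bar Om" "inj_on (inv\<Phi> t) (closure Om)"
proof -
 have b: "bij_betw (%x. \<Phi> (x, t)) (closure Om) (closure Om)" using flow_diffeo[OF t] by (simp add: C1_bar_diffeomorphism_def)
 hence im: "(%x. \<Phi> (x, t)) ` closure Om = closure Om" by (simp add: bij_betw_def)
 show "x : closure Om ==> \<Phi> (inv\<Phi> t x, t) = x" "x : closure Om ==> inv\<Phi> t x : closure Om"
 unfolding inv\<Phi>_def using f_inv_into_f[of x "%x. \<Phi> (x, t)" "closure Om"] inv_into_into[of x "%x. \<Phi> (x, t)" "closure Om"] im by auto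
 show "x : closure Om ==> inv\<Phi> t (\<Phi> (x, t)) = x" unfolding inv\<Phi>_def by (rule inv_into_f_f[OF \<Phi>_inj[OF t]])
 show "inv\<Phi> t : C1_bar Om" using flow_diffeo[OF t] by (simp add: C1_bar_diffeomorphism_def inv\<Phi>_def)
 show "inj_on (inv\<Phi> t) (closure Om)" unfolding inv\<Phi>_def using im by (metis inj_on_inv_into order_refl) qed

text \<open>The assumed bijection is one of closures. Invariance of domain makes the images of Omega
  under the flow map and its inverse open, and an open subset of the closure lies in Omega because
  Omega is the interior of its closure.\<close>

lemma \<Phi>_image_\<Omega>:
 assumes t: "t : J" shows "(%x. \<Phi> (x, t)) ` Om = Om"
proof
 have int: "interior (closure Om) = Om" by (rule lipschitz_domain_interior_closure[OF domain])
 have cl: "Om <= closure Om" by (rule closure_subset)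
 have "(%x. \<Phi> (x, t)) ` Om <= closure Om" using flow_closed t cl by force
 thus "(%x. \<Phi> (x, t)) ` Om <= Om" using interior_maximal[OF _ \<Phi>_image_open[OF t open_domains(1) order_refl], of "closure Om"] int by simp
 have cinv: "continuous_on Om (inv\<Phi> t)" using inv\<Phi>(4)[OF t] continuous_on_subset[OF _ cl] by (auto simp: C1_bar_def)
 have "open (inv\<Phi> t ` Om)" by (rule invariance_of_domain[OF cinv open_domains(1) inj_on_subset[OF inv\<Phi>(5)[OF t] cl]])
 moreover have "inv\<Phi> t ` Om <= closure Om" using inv\<Phi>(2)[OF t] cl by blast
 ultimately have sub: "inv\<Phi> t ` Om <= Om" using interior_maximal[of "inv\<Phi> t ` Om" "closure Om"] int by simp
 show "Om <= (%x. \<Phi> (x, t)) ` Om"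
 proof
 fix x assume x: "x : Om"
 hence "x = \<Phi> (inv\<Phi> t x, t)" using inv\<Phi>(1)[OF t, of x] cl by auto
 moreover have "inv\<Phi> t x : Om" using sub x by blast
 ultimately show "x : (%x. \<Phi> (x, t)) ` Om" by blast qed qed

lemma inv\<Phi>_\<Omega>:
 assumes t: "t : J" and x: "x : Om" shows "inv\<Phi> t x : Om"
proof -
 have "x : (%y. \<Phi> (y, t)) ` Om" using \<Phi>_image_\<Omega>[OF t] x by simp
 then obtain y where y: "y : Om" "x = \<Phi> (y, t)" by blast
 have "inv\<Phi> t (\<Phi> (y, t)) = y" by (rule inv\<Phi>(3)[OF t]) (rule subsetD[OF closure_subset y(1)])
 thus ?thesis using y by simp qed

text \<open>The first phase is carried along as a complement: Omega and the closed second phase are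
  both mapped correctly by an injective map.\<close>

lemma \<Phi>_image_\<Omega>1:
 assumes t: "t : J" shows "(%x. \<Phi> (x, t)) ` \<Omega>1 0 = \<Omega>1 t"
proof -
 have t': "t : {0..T}" "0 : {0..T}" using t T_pos by auto
 have cl: "Om <= closure Om" by (rule closure_subset)
 have s2: "closure (\<Omega>2 0) <= closure Om" using decomposition[OF t'(2)] by (intro closure_mono) blast
 have "\<Phi> (y, t) : closure (\<Omega>2 t) \<longleftrightarrow> y : closure (\<Omega>2 0)" if y: "y : Om" for y unfolding flow_subdomain2[OF t, symmetric]
 using inj_on_image_mem_iff[OF \<Phi>_inj[OF t] _ s2, of y] y cl by blast
 hence "(%x. \<Phi> (x, t)) ` (Om - closure (\<Omega>2 0)) = (%x. \<Phi> (x, t)) ` Om - closure (\<Omega>2 t)" by blast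
 thus ?thesis by (simp only: \<Omega>1_eq[OF t'(1)] \<Omega>1_eq[OF t'(2)] \<Phi>_image_\<Omega>[OF t]) qed

text \<open>The flow as a time-preserving map of space-time. Openness of the space-time phases and
  differentiability of the inverse flow in time are obtained from it.\<close>

definition G :: "(real^'n) \<times> real => (real^'n) \<times> real" where
 "G = (%(y, t). (\<Phi> (y, t), t))"

lemma G_continuous: "continuous_on (Om \<times> J) G"
proof -
 have "Om \<times> J <= closure Om \<times> {0..T}" by (intro Sigma_mono closure_subset) auto
 hence "continuous_on (Om \<times> J) \<Phi>" by (rule continuous_on_subset[OF \<Phi>_continuous])
 thus ?thesis unfolding G_def case_prod_beta by (intro continuous_on_Pair continuous_intros) simp qed

lemma G_inj: "inj_on G (Om \<times> J)"
proof (rule inj_onI)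
 fix p p' assume p: "p : Om \<times> J" "p' : Om \<times> J" and eq: "G p = G p'"
 have t: "snd p = snd p'" "\<Phi> (fst p, snd p) = \<Phi> (fst p', snd p)" using eq unfolding G_def case_prod_beta by (metis prod.inject)+
 have cl: "Om <= closure Om" by (rule closure_subset)
 have "fst p = fst p'" by (rule inj_onD[OF \<Phi>_inj t(2)]) (use p cl in auto)
 with t show "p = p'" by (simp add: prod_eq_iff) qed

text \<open>The space-time phase is the image of an open cylinder under the injective continuous map
  \<open>G\<close>, so invariance of domain applies.\<close>

lemma P1_open: "open {(x, t). t : J & x : \<Omega>1 t}"
proof -
 have 0: "0 : {0..T}" using T_pos by simp
 have sub: "\<Omega>1 0 \<times> J <= Om \<times> J" using decomposition[OF 0] by blast
 have "open (G ` (\<Omega>1 0 \<times> J))"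
 by (intro invariance_of_domain continuous_on_subset[OF G_continuous sub] inj_on_subset[OF G_inj sub] open_Times open_domains(2)[OF 0] open_greaterThanLessThan)
 moreover have "G ` (\<Omega>1 0 \<times> J) = {(x, t). t : J & x : \<Omega>1 t}"
 proof -
 have "(x, t) : G ` (\<Omega>1 0 \<times> J) \<longleftrightarrow> t : J & x : (%x. \<Phi> (x, t)) ` \<Omega>1 0" for x t unfolding G_def by auto
 hence "(x, t) : G ` (\<Omega>1 0 \<times> J) \<longleftrightarrow> t : J & x : \<Omega>1 t" for x t using \<Phi>_image_\<Omega>1[of t] by metis
 thus ?thesis by (simp add: set_eq_iff split_paired_all) qed
 ultimately show ?thesis by simp qed

lemma interface_negligible: "t : {0..T} ==> negligible (interface \<Omega>1 \<Omega>2 t)" unfolding interface_def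
 by (rule negligible_subset[OF lipschitz_domain_frontier_negligible[OF subdomain1]]) auto

text \<open>At the nearby times x is the image of points of the closed initial second phase; by
  compactness these preimages have a limit point, which is a preimage at tau.\<close>

lemma limit_point_of_flow:
 assumes tau: "tau : {0..T}" and x: "x : Om" and no: "!!d. 0 < d ==> EX t:J. abs(t - tau) < d & x ~: \<Omega>1 t" shows "EX y:closure (\<Omega>2 0). \<Phi> (y, tau) = x"
proof -
 have 0: "0 : {0..T}" using T_pos by simp
 have s2: "closure (\<Omega>2 0) <= closure Om" using decomposition[OF 0] by (intro closure_mono) blast
 have "ALL n::nat. EX t:J. abs(t - tau) < 1 / Suc n & x ~: \<Omega>1 t" using no by simp
 then obtain t where t: "!!n::nat. t n : J" "!!n. abs(t n - tau) < 1 / Suc n" "!!n. x ~: \<Omega>1 (t n)" by metis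
 have tlim: "t ----> tau" by (rule inverse_Suc_tendsto[OF t(2)])
 have "x : closure (\<Omega>2 (t n))" for n using \<Omega>1_eq[of "t n"] t(1,3)[of n] x by auto
 hence "EX y. y : closure (\<Omega>2 0) & x = \<Phi> (y, t n)" for n using flow_subdomain2[OF t(1)[of n]] by blast
 then obtain y where y: "!!n. y n : closure (\<Omega>2 0)" "!!n. x = \<Phi> (y n, t n)" by metis
 have "compact (closure (\<Omega>2 0))" using subdomain2[OF 0] lipschitz_domainD by blast
 then obtain l r where l: "l : closure (\<Omega>2 0)" "strict_mono r" "(y \<circ> r) ----> l" using y(1) unfolding compact_def by blast
 have "(%n. \<Phi> ((y \<circ> r) n, (t \<circ> r) n)) ----> \<Phi> (l, tau)"
 proof (rule continuous_on_tendsto_compose[OF \<Phi>_continuous])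
 show "(%n. ((y \<circ> r) n, (t \<circ> r) n)) ----> (l, tau)" by (intro tendsto_Pair l LIMSEQ_subseq_LIMSEQ[OF tlim l(2)])
 show "(l, tau) : closure Om \<times> {0..T}" using l(1) s2 tau by auto
 show "\<forall>\<^sub>F n in sequentially. ((y \<circ> r) n, (t \<circ> r) n) : closure Om \<times> {0..T}"
 proof (rule always_eventually, rule allI)
 fix n show "((y \<circ> r) n, (t \<circ> r) n) : closure Om \<times> {0..T}" using y(1)[of "r n"] s2 t(1)[of "r n"] by auto qed qed
 hence "(%n. x) ----> \<Phi> (l, tau)" by (simp add: y(2)[symmetric])
 hence "\<Phi> (l, tau) = x" by (simp add: LIMSEQ_const_iff)
 thus ?thesis using l(1) by blast qed

lemma \<Phi>_derivative:
 obtains \<Phi>' where "continuous_on (closure Om \<times> {0..T}) \<Phi>'"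
 "!!y t. y : Om ==> t : J ==> (\<Phi> has_derivative bapp (\<Phi>' (y, t))) (at (y, t))"
 "!!y t. y : Om ==> t : J ==> v (\<Phi> (y, t), t) = bapp (\<Phi>' (y, t)) (0, 1)"
 "!!y t. y : Om ==> t : J ==> ((%s. \<Phi> (y, s)) has_vector_derivative v (\<Phi> (y, t), t)) (at t)"
proof (rule C1_barE[OF flow_smooth])
 fix \<Phi>' assume c: "continuous_on (closure (Om \<times> J)) \<Phi>'"
 and d: "!!x. x : Om \<times> J ==> (\<Phi> has_derivative bapp (\<Phi>' x)) (at x)"
 have vd: "((%s. \<Phi> (y, s)) has_vector_derivative bapp (\<Phi>' (y, t)) (0, 1)) (at t)"
 if "y : Om" "t : J" for y t
 proof -
 have "((%s. \<Phi> (y, s)) has_derivative (%h. bapp (\<Phi>' (y, t)) (0, h))) (at t)"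
 proof (rule has_derivative_compose[of "%s. (y, s)" "%h. (0, h)"])
 show "((%s. (y, s)) has_derivative (%h. (0, h))) (at t)" by (auto intro!: derivative_eq_intros)
 show "(\<Phi> has_derivative bapp (\<Phi>' (y, t))) (at (y, t))" by (rule d) (use that in auto) qed
 moreover have "(%h. bapp (\<Phi>' (y, t)) (0, h)) = (%h. h *\<^sub>R bapp (\<Phi>' (y, t)) (0, 1))"
 proof
 fix h
 have "(0, h) = h *\<^sub>R (0 :: real^'n, 1 :: real)" by simp
 thus "bapp (\<Phi>' (y, t)) (0, h) = h *\<^sub>R bapp (\<Phi>' (y, t)) (0, 1)" by (simp only: blinfun.scaleR_right) qed
 ultimately show ?thesis unfolding has_vector_derivative_def by (simp only:) qed
 have v: "v (\<Phi> (y, t), t) = bapp (\<Phi>' (y, t)) (0, 1)" if y: "y : Om" and t: "t : J" for y t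
 proof -
 have yc: "y : closure Om" using y closure_subset by blast
 have "v (\<Phi> (y, t), t) = vector_derivative (%s. \<Phi> (inv\<Phi> t (\<Phi> (y, t)), s)) (at t)"
 unfolding inv\<Phi>_def by (rule velocity[OF flow_closed[OF yc] t]) (use t in auto)
 also have "... = bapp (\<Phi>' (y, t)) (0, 1)" unfolding inv\<Phi>(3)[OF t yc] by (rule vector_derivative_at[OF vd[OF y t]])
 finally show ?thesis . qed
 show ?thesis by (rule that[of \<Phi>']) (use c d v vd in "auto simp: closure_cylinder") qed

lemma blinfun_norm_bounded:
 assumes "continuous_on (closure Om \<times> {0..T}) F" shows "EX M>=0. ALL p:closure Om \<times> {0..T}. norm (F p) <= M"
proof -
 have "compact (F ` (closure Om \<times> {0..T}))" by (intro compact_continuous_image assms compact_Times lipschitz_domainD(4)[OF domain] compact_Icc)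
 hence "bounded (F ` (closure Om \<times> {0..T}))" by (rule compact_imp_bounded)
 then obtain B where B: "ALL x:F ` (closure Om \<times> {0..T}). norm x <= B" by (auto simp: bounded_iff)
 show ?thesis by (rule exI[of _ "max B 0"]) (use B in "auto simp: le_max_iff_disj") qed

section \<open>The flow at the final time\<close>

lemma flow_end_tendsto:
 assumes "y : closure Om" shows "((%t. \<Phi> (y, t)) \<longlongrightarrow> \<Phi> (y, T)) (at_left T)"
proof -
 have "continuous_on {0..T} (%t. \<Phi> (y, t))" by (rule continuous_on_compose2[OF \<Phi>_continuous]) (use assms in "auto intro!: continuous_intros")
 hence "((%t. \<Phi> (y, t)) \<longlongrightarrow> \<Phi> (y, T)) (at T within {0..T})" using T_pos by (simp add: continuous_on_def)
 thus ?thesis using T_pos by (simp add: at_within_Icc_at_left) qed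

lemma eventually_J: "\<forall>\<^sub>F t in at_left T. t : J" using eventually_at_left_real[OF T_pos] .

text \<open>No diffeomorphism property is assumed at the end time \<open>T\<close>; injectivity of the final flow map follows from
 uniqueness of trajectories, backward in time, near an interior point.\<close>

lemma flow_end_injective:
 assumes y: "y : Om" and z: "z : Om" and eq: "\<Phi> (y, T) = \<Phi> (z, T)" and x: "\<Phi> (y, T) : Om" shows "y = z"
proof (rule \<Phi>_derivative)
 fix \<Phi>' assume vd: "!!y t. y : Om ==> t : J ==> ((%s. \<Phi> (y, s)) has_vector_derivative v (\<Phi> (y, t), t)) (at t)"
 show ?thesis
 proof (rule C1_barE[OF velocity_smooth])
 fix v' assume cv': "continuous_on (closure (Om \<times> J)) v'"
 and dv: "!!p. p : Om \<times> J ==> (v has_derivative bapp (v' p)) (at p)"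
 have yz: "y : closure Om" "z : closure Om" using y z closure_subset by blast+
 obtain L where L: "0 <= L" "!!p. p : closure Om \<times> {0..T} ==> norm (v' p) <= L" using blinfun_norm_bounded[OF cv'[unfolded closure_cylinder]] by blast
 \<comment> \<open>A ball inside Omega is convex, so the bound on the derivative of v gives a
   Lipschitz constant there, and both trajectories lie in the ball shortly before T.\<close>
 obtain r where r: "0 < r" "ball (\<Phi> (y, T)) r <= Om" using x open_domains(1) open_contains_ball by blast
 define B where "B = ball (\<Phi> (y, T)) r"
 have lip: "norm (v (a, t) - v (b, t)) <= L * norm (a - b)" if ab: "a : B" "b : B" and t: "t : J" for a b t
 proof (rule differentiable_bound[of B "%x. v (x, t)" "%x h. bapp (v' (x, t)) (h, 0)"])
 show "convex B" unfolding B_def by (rule convex_ball)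
 fix c assume c: "c : B"
 have cO: "c : Om" using c r(2) by (auto simp: B_def)
 have "((%x. v (x, t)) has_derivative (%h. bapp (v' (c, t)) (h, 0))) (at c)"

 proof (rule has_derivative_compose[of "%x. (x, t)" "%h. (h, 0)"])
 show "((%x. (x, t)) has_derivative (%h. (h, 0))) (at c)" by (auto intro!: derivative_eq_intros)
 show "(v has_derivative bapp (v' (c, t))) (at (c, t))" by (rule dv) (use cO t in auto) qed
 thus "((%x. v (x, t)) has_derivative (%h. bapp (v' (c, t)) (h, 0))) (at c within B)" by (rule has_derivative_at_withinI)
 have n: "norm (v' (c, t)) <= L" by (rule L(2)) (use cO t closure_subset in auto)
 show "onorm (%h. bapp (v' (c, t)) (h, 0)) <= L"
 proof (rule onorm_le)
 fix h
 have "norm (bapp (v' (c, t)) (h, 0)) <= norm (v' (c, t)) * norm (h, 0::real)" by (rule norm_blinfun)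
 also have "... <= L * norm h" using n by (simp add: norm_Pair mult_right_mono)
 finally show "norm (bapp (v' (c, t)) (h, 0)) <= L * norm h" . qed qed (use ab in auto)
 \<comment> \<open>A backward Gronwall argument: D exp(2 L t) is nondecreasing near T and tends to 0
   at T, so it vanishes at earlier times, where the flow map is injective.\<close>
 define D where "D t = (\<Phi> (y, t) - \<Phi> (z, t)) \<bullet> (\<Phi> (y, t) - \<Phi> (z, t))" for t
 define E where "E t = D t * exp (2 * L * t)" for t
 have Blim: "\<forall>\<^sub>F t in at_left T. \<Phi> (y, t) : B" "\<forall>\<^sub>F t in at_left T. \<Phi> (z, t) : B"
 using topological_tendstoD[OF flow_end_tendsto[OF yz(1)], of B] topological_tendstoD[OF flow_end_tendsto[OF yz(2)], of B] r(1) eq by (auto simp: B_def)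
 have "\<forall>\<^sub>F t in at_left T. t : J & \<Phi> (y, t) : B & \<Phi> (z, t) : B" using Blim eventually_J by eventually_elim blast
 then obtain s where s: "s < T" "!!t. s < t ==> t < T ==> t : J & \<Phi> (y, t) : B & \<Phi> (z, t) : B" unfolding eventually_at_left_field by blast
 have dE: "EX d. (E has_real_derivative d) (at t) & 0 <= d" if t: "s < t" "t < T" for t
 proof -
 have tJ: "t : J" "\<Phi> (y, t) : B" "\<Phi> (z, t) : B" using s(2)[OF t] by auto
 define w where "w = \<Phi> (y, t) - \<Phi> (z, t)"
 define w' where "w' = v (\<Phi> (y, t), t) - v (\<Phi> (z, t), t)"
 have "((%t. \<Phi> (y, t) - \<Phi> (z, t)) has_vector_derivative w') (at t)" unfolding w'_def by (intro has_vector_derivative_diff vd y z tJ(1))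
 hence "((%t. \<Phi> (y, t) - \<Phi> (z, t)) has_derivative (%h. h *\<^sub>R w')) (at t)" by (simp add: has_vector_derivative_def)
 from has_derivative_inner[OF this this] have "(D has_derivative (%h. w \<bullet> (h *\<^sub>R w') + (h *\<^sub>R w') \<bullet> w)) (at t)" unfolding D_def[abs_def] w_def .
 hence dD: "(D has_real_derivative (2 * (w \<bullet> w'))) (at t)"
 proof -
 have "(%h. w \<bullet> (h *\<^sub>R w') + (h *\<^sub>R w') \<bullet> w) = (*) (2 * (w \<bullet> w'))" by (simp add: fun_eq_iff inner_commute)
 thus ?thesis using \<open>(D has_derivative _) (at t)\<close> unfolding has_field_derivative_def by simp qed
 have de: "((%t. exp (2 * L * t)) has_real_derivative exp (2 * L * t) * (2 * L)) (at t)" by (auto intro!: derivative_eq_intros)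
 have "(E has_real_derivative (2 * (w \<bullet> w') * exp (2 * L * t) + exp (2 * L * t) * (2 * L) * D t)) (at t)" unfolding E_def[abs_def] by (rule DERIV_mult[OF dD de])
 moreover have "abs(w \<bullet> w') <= norm w * (L * norm w)"
 proof -
 have "norm w' <= L * norm w" unfolding w_def w'_def by (rule lip[OF tJ(2,3,1)])
 hence "norm w * norm w' <= norm w * (L * norm w)" by (rule mult_left_mono) simp
 thus ?thesis using Cauchy_Schwarz_ineq2[of w w'] by linarith qed
 hence "0 <= w \<bullet> w' + L * D t" unfolding D_def w_def[symmetric] by (simp add: dot_square_norm power2_eq_square algebra_simps)
 hence "0 <= 2 * exp (2 * L * t) * (w \<bullet> w' + L * D t)" by simp
 hence "0 <= 2 * (w \<bullet> w') * exp (2 * L * t) + exp (2 * L * t) * (2 * L) * D t" by (simp add: algebra_simps)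
 ultimately show ?thesis by blast qed
 define s' where "s' = (s + T) / 2"
 have s': "s < s'" "s' < T" using s(1) by (auto simp: s'_def)
 have mono: "E s' <= E t" if "s' < t" "t < T" for t by (rule DERIV_nonneg_imp_nondecreasing[of s' t E]) (use that s' dE in auto)
 have "((%t. \<Phi> (y, t) - \<Phi> (z, t)) \<longlongrightarrow> \<Phi> (y, T) - \<Phi> (z, T)) (at_left T)" by (intro tendsto_diff flow_end_tendsto yz)
 hence "(D \<longlongrightarrow> 0 \<bullet> (0::real^'n)) (at_left T)" unfolding D_def using eq by (intro tendsto_inner) simp_all
 hence "(E \<longlongrightarrow> 0 * exp (2 * L * T)) (at_left T)" unfolding E_def by (intro tendsto_mult tendsto_exp tendsto_const tendsto_ident_at) simp
 hence E0: "(E \<longlongrightarrow> 0) (at_left T)" by simp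
 have "\<forall>\<^sub>F t in at_left T. E s' <= E t" unfolding eventually_at_left_field using mono s'(2) by blast
 hence "E s' <= 0" by (rule tendsto_lowerbound[OF E0]) simp
 hence "D s' <= 0" unfolding E_def by (simp add: mult_le_0_iff)
 hence "\<Phi> (y, s') = \<Phi> (z, s')" unfolding D_def by (simp add: dot_square_norm)
 moreover have "s' : J" using s(2)[OF s'] by blast
 ultimately show "y = z" using inj_onD[OF \<Phi>_inj _ yz] by blast qed qed

text \<open>Before T the flow map is injective and maps Omega onto itself, so y is sent to the
  closed complement of Omega; so is its limit.\<close>

lemma flow_end_frontier:
 assumes y: "y : closure Om" "y ~: Om" shows "\<Phi> (y, T) ~: Om"
proof -
 have cl: "Om <= closure Om" by (rule closure_subset)
 have "\<forall>\<^sub>F t in at_left T. \<Phi> (y, t) : - Om" using eventually_J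
 proof eventually_elim
 case (elim t)
 have "\<Phi> (y, t) ~: (%x. \<Phi> (x, t)) ` Om" using inj_on_image_mem_iff[OF \<Phi>_inj[OF elim] y(1) cl] y(2) by blast
 thus ?case using \<Phi>_image_\<Omega>[OF elim] by simp qed
 hence "\<Phi> (y, T) : - Om" using Lim_in_closed_set[OF closed_Compl[OF open_domains(1)] _ _ flow_end_tendsto[OF y(1)]] by simp
 thus ?thesis by simp qed

text \<open>The flow maps before T are Lipschitz on small balls with one common constant; the
  estimate passes to the limit, and locally Lipschitz maps preserve null sets.\<close>

lemma flow_end_negligible:
 assumes S: "negligible S" "S <= Om" shows "negligible ((%y. \<Phi> (y, T)) ` S)"
proof (rule \<Phi>_derivative)
 fix \<Phi>' assume c: "continuous_on (closure Om \<times> {0..T}) \<Phi>'"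
 and d: "!!y t. y : Om ==> t : J ==> (\<Phi> has_derivative bapp (\<Phi>' (y, t))) (at (y, t))"
 obtain M where M: "0 <= M" "!!p. p : closure Om \<times> {0..T} ==> norm (\<Phi>' p) <= M" using blinfun_norm_bounded[OF c] by blast
 show ?thesis
 proof (rule negligible_locally_Lipschitz_image[OF order_refl S(1)])
 fix x assume "x : S"
 then obtain r where r: "0 < r" "ball x r <= Om" using S(2) open_domains(1) open_contains_ball by blast
 have lip: "norm (\<Phi> (y, t) - \<Phi> (x, t)) <= M * norm (y - x)" if y: "y : ball x r" and t: "t : J" for y t
 proof (rule differentiable_bound[of "ball x r" "%x. \<Phi> (x, t)" "%x h. bapp (\<Phi>' (x, t)) (h, 0)"])
 fix c assume c: "c : ball x r"
 have cO: "c : Om" using c r(2) by auto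
 have "((%x. \<Phi> (x, t)) has_derivative (%h. bapp (\<Phi>' (c, t)) (h, 0))) (at c)"

 proof (rule has_derivative_compose[of "%x. (x, t)" "%h. (h, 0)"])
 show "((%x. (x, t)) has_derivative (%h. (h, 0))) (at c)" by (auto intro!: derivative_eq_intros)
 show "(\<Phi> has_derivative bapp (\<Phi>' (c, t))) (at (c, t))" by (rule d[OF cO t]) qed
 thus "((%x. \<Phi> (x, t)) has_derivative (%h. bapp (\<Phi>' (c, t)) (h, 0))) (at c within ball x r)" by (rule has_derivative_at_withinI)
 have n: "norm (\<Phi>' (c, t)) <= M" by (rule M(2)) (use cO t closure_subset in auto)
 show "onorm (%h. bapp (\<Phi>' (c, t)) (h, 0)) <= M"
 proof (rule onorm_le)
 fix h
 have "norm (bapp (\<Phi>' (c, t)) (h, 0)) <= norm (\<Phi>' (c, t)) * norm (h, 0::real)" by (rule norm_blinfun)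
 also have "... <= M * norm h" using n by (simp add: norm_Pair mult_right_mono)
 finally show "norm (bapp (\<Phi>' (c, t)) (h, 0)) <= M * norm h" . qed qed (use y r in auto)
 have "norm (\<Phi> (y, T) - \<Phi> (x, T)) <= M * norm (y - x)" if y: "y : S \<inter> ball x r" for y
 proof -
 have yx: "y : closure Om" "x : closure Om" using y \<open>x : S\<close> S(2) closure_subset by blast+
 have "((%t. norm (\<Phi> (y, t) - \<Phi> (x, t))) \<longlongrightarrow> norm (\<Phi> (y, T) - \<Phi> (x, T))) (at_left T)"
 by (intro tendsto_norm tendsto_diff flow_end_tendsto yx)
 moreover have "\<forall>\<^sub>F t in at_left T. norm (\<Phi> (y, t) - \<Phi> (x, t)) <= M * norm (y - x)" using eventually_J by eventually_elim (use lip y in blast)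
 ultimately show ?thesis by (rule tendsto_upperbound) simp qed
 thus "EX T' B. open T' & x : T' & (ALL y:S \<inter> T'. norm (\<Phi> (y, T) - \<Phi> (x, T)) <= B * norm (y - x))" using r(1) by (intro exI[of _ "ball x r"] exI[of _ M]) auto
 qed qed

end

text \<open>At an inner time each point off the interface stays by openness of the space-time
  phases. At 0 and T an exceptional point is reached from both closed initial phases. At 0 the flow
  is the identity, so the point is on their common boundary. At T both preimages coincide, so the
  point lies in the image of a null set.\<close>

lemma (in moving_domains) eventually_one_phase:
 assumes tau: "tau : {0..T}"
 shows "AE x in lebesgue. x : Om --> (EX d>0. (ALL t:J. abs(t - tau) < d --> x : \<Omega>1 t) \<or> (ALL t:J. abs(t - tau) < d --> x : \<Omega>2 t))"
 (is "AE x in lebesgue. x : Om --> ?P x")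
proof -
 interpret sw: moving_domains Om T \<Omega>2 \<Omega>1 \<Phi> v by (rule swap)
 have 0: "0 : {0..T}" using T_pos by simp
 have neg: "negligible {x : Om. \<not> ?P x}"
 proof (cases "tau : J")
 case True
 have one: "?P x" if x: "x : \<Omega>1 tau \<or> x : \<Omega>2 tau" for x
 proof -
 have sl: "EX d>0. ALL t:J. abs(t - tau) < d --> x : W t" if o: "open {(x, t). t : J & x : W t}" and xW: "x : W tau" for W
 proof -
 obtain d where d: "0 < d" "ball (x, tau) d <= {(x, t). t : J & x : W t}" using o xW True unfolding open_contains_ball by blast
 have "(x, t) : ball (x, tau) d" if "abs(t - tau) < d" for t using that by (simp add: dist_Pair_Pair dist_real_def abs_minus_commute)
 thus ?thesis using d by blast qed
 show ?thesis using x sl[OF P1_open] sl[OF sw.P1_open] by blast qed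
 have "{x : Om. \<not> ?P x} <= interface \<Omega>1 \<Omega>2 tau"
 proof
 fix x assume "x : {x : Om. \<not> ?P x}"
 hence "x : Om" "x ~: \<Omega>1 tau" "x ~: \<Omega>2 tau" using one by blast+
 thus "x : interface \<Omega>1 \<Omega>2 tau" using decomposition[OF tau] by blast qed
 thus ?thesis using interface_negligible[OF tau] negligible_subset by blast
 next
 case False
 hence end0: "tau = 0 \<or> tau = T" using tau by auto
 have pts: "EX y:closure (\<Omega>1 0). EX z:closure (\<Omega>2 0). \<Phi> (y, tau) = x & \<Phi> (z, tau) = x" if x: "x : Om" "\<not> ?P x" for x
 proof -
 have "EX t:J. abs(t - tau) < d & x ~: \<Omega>1 t" "EX t:J. abs(t - tau) < d & x ~: \<Omega>2 t" if "0 < d" for d using x(2) that by blast+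
 thus ?thesis using limit_point_of_flow[OF tau x(1)] sw.limit_point_of_flow[OF tau x(1)] by blast qed
 have nf: "negligible (frontier (\<Omega>1 0))" by (rule lipschitz_domain_frontier_negligible[OF subdomain1[OF 0]])
 have fr: "y : frontier (\<Omega>1 0)" if "y : closure (\<Omega>1 0)" "y : closure (\<Omega>2 0)" for y
 using that \<Omega>1_eq[OF 0] open_domains(2)[OF 0] by (auto simp: frontier_def interior_open)
 show ?thesis
 proof (cases "tau = 0")
 case True
 have s: "closure (\<Omega>1 0) <= closure Om" "closure (\<Omega>2 0) <= closure Om" using decomposition[OF 0] by (intro closure_mono, blast)+
 have "{x : Om. \<not> ?P x} <= frontier (\<Omega>1 0)"
 proof
 fix x assume "x : {x : Om. \<not> ?P x}"
 hence x: "x : Om" "\<not> ?P x" by simp_all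
 obtain y z where yz: "y : closure (\<Omega>1 0)" "z : closure (\<Omega>2 0)" "\<Phi> (y, 0) = x" "\<Phi> (z, 0) = x" using pts[OF x, unfolded True] by blast
 hence "y = x" "z = x" using flow_initial s by auto
 thus "x : frontier (\<Omega>1 0)" using fr yz by blast qed
 thus ?thesis using nf negligible_subset by blast
 next
 case False
 hence tauT: "tau = T" using end0 by blast
 have s: "closure (\<Omega>1 0) <= closure Om" "closure (\<Omega>2 0) <= closure Om" using decomposition[OF 0] by (intro closure_mono, blast)+
 have "{x : Om. \<not> ?P x} <= (%y. \<Phi> (y, T)) ` (frontier (\<Omega>1 0) \<inter> Om)"
 proof
 fix x assume "x : {x : Om. \<not> ?P x}"
 hence x: "x : Om" "\<not> ?P x" by simp_all
 obtain y where y: "y : closure (\<Omega>1 0)" "EX z:closure (\<Omega>2 0). \<Phi> (y, T) = x & \<Phi> (z, T) = x" using pts[OF x, unfolded tauT] by (rule bexE)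
 obtain z where z: "z : closure (\<Omega>2 0)" "\<Phi> (y, T) = x & \<Phi> (z, T) = x" using y(2) by (rule bexE)
 have yz: "y : closure (\<Omega>1 0)" "z : closure (\<Omega>2 0)" "\<Phi> (y, T) = x" "\<Phi> (z, T) = x" using y z by simp_all
 have yzO: "y : Om" "z : Om" using flow_end_frontier[of y] flow_end_frontier[of z] yz x(1) subsetD[OF s(1) yz(1)] subsetD[OF s(2) yz(2)] by metis+
 have "y = z" by (rule flow_end_injective[OF yzO]) (use yz x(1) in simp_all)
 hence "y : frontier (\<Omega>1 0) \<inter> Om" using fr[OF yz(1)] yz(2) yzO(1) by simp
 thus "x : (%y. \<Phi> (y, T)) ` (frontier (\<Omega>1 0) \<inter> Om)" by (rule image_eqI[rotated]) (rule yz(3)[symmetric]) qed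
 moreover have "negligible ((%y. \<Phi> (y, T)) ` (frontier (\<Omega>1 0) \<inter> Om))" by (rule flow_end_negligible) (use negligible_subset[OF nf] in auto)
 ultimately show ?thesis using negligible_subset by blast qed qed
 hence "AE x in lebesgue. x ~: {x : Om. \<not> ?P x}" by (intro AE_not_in) (simp add: negligible_iff_null_sets)
 thus ?thesis by (rule eventually_mono) blast qed

section \<open>Cut-off functions transported by the flow\<close>

context moving_domains
begin

definition d\<Phi> :: "(real^'n) \<times> real => ((real^'n) \<times> real) \<Rightarrow>\<^sub>L (real^'n)" where
 "d\<Phi> = (SOME F. continuous_on (closure Om \<times> {0..T}) F & (ALL y:\<Omega>. ALL t:J.
 (\<Phi> has_derivative bapp (F (y, t))) (at (y, t)) & v (\<Phi> (y, t), t) = bapp (F (y, t)) (0, 1)))"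

lemma d\<Phi>: shows "continuous_on (closure Om \<times> {0..T}) d\<Phi>"
 and "y : Om ==> t : J ==> (\<Phi> has_derivative bapp (d\<Phi> (y, t))) (at (y, t))"
 and "y : Om ==> t : J ==> v (\<Phi> (y, t), t) = bapp (d\<Phi> (y, t)) (0, 1)"
proof -
 have "EX F. continuous_on (closure Om \<times> {0..T}) F & (ALL y:\<Omega>. ALL t:J.
 (\<Phi> has_derivative bapp (F (y, t))) (at (y, t)) & v (\<Phi> (y, t), t) = bapp (F (y, t)) (0, 1))"
 proof (rule \<Phi>_derivative)
 fix F assume F: "continuous_on (closure Om \<times> {0..T}) F"
 "!!y t. y : Om ==> t : J ==> (\<Phi> has_derivative bapp (F (y, t))) (at (y, t))"
 "!!y t. y : Om ==> t : J ==> v (\<Phi> (y, t), t) = bapp (F (y, t)) (0, 1)"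
 thus ?thesis by (intro exI[of _ F]) simp qed
 from someI_ex[OF this] have *: "continuous_on (closure Om \<times> {0..T}) d\<Phi> & (ALL y:\<Omega>. ALL t:J.
 (\<Phi> has_derivative bapp (d\<Phi> (y, t))) (at (y, t)) & v (\<Phi> (y, t), t) = bapp (d\<Phi> (y, t)) (0, 1))" unfolding d\<Phi>_def .
 thus "continuous_on (closure Om \<times> {0..T}) d\<Phi>" by (rule conjunct1)
 show "y : Om ==> t : J ==> (\<Phi> has_derivative bapp (d\<Phi> (y, t))) (at (y, t))"
 "y : Om ==> t : J ==> v (\<Phi> (y, t), t) = bapp (d\<Phi> (y, t)) (0, 1)" using *[THEN conjunct2] by blast+ qed

definition dinv\<Phi> :: "real => real^'n => (real^'n) \<Rightarrow>\<^sub>L (real^'n)" where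
 "dinv\<Phi> t = (SOME X. continuous_on (closure Om) X & (ALL x:\<Omega>. (inv\<Phi> t has_derivative bapp (X x)) (at x)))"

lemma dinv\<Phi>:
 assumes t: "t : J" shows "continuous_on (closure Om) (dinv\<Phi> t)"
 and "x : Om ==> (inv\<Phi> t has_derivative bapp (dinv\<Phi> t x)) (at x)"
proof -
 have "EX X. continuous_on (closure Om) X & (ALL x:\<Omega>. (inv\<Phi> t has_derivative bapp (X x)) (at x))" using inv\<Phi>(4)[OF t] unfolding C1_bar_def by blast
 from someI_ex[OF this] have *: "continuous_on (closure Om) (dinv\<Phi> t) & (ALL x:\<Omega>. (inv\<Phi> t has_derivative bapp (dinv\<Phi> t x)) (at x))"
 unfolding dinv\<Phi>_def .
 thus "continuous_on (closure Om) (dinv\<Phi> t)" by (rule conjunct1)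
 show "x : Om ==> (inv\<Phi> t has_derivative bapp (dinv\<Phi> t x)) (at x)" using * by blast qed

lemma \<Phi>_\<Omega>: "y : Om ==> t : J ==> \<Phi> (y, t) : Om" using \<Phi>_image_\<Omega>[of t] by blast

lemma in_closure: "y : Om ==> y : closure Om" by (rule subsetD[OF closure_subset])

lemma dinv\<Phi>_d\<Phi>:
 assumes y: "y : Om" and t: "t : J" shows "dinv\<Phi> t (\<Phi> (y, t)) (d\<Phi> (y, t) (h, 0)) = h"
proof -
 have 1: "((%y. \<Phi> (y, t)) has_derivative (%h. d\<Phi> (y, t) (h, 0))) (at y)"
 proof (rule has_derivative_compose[of "%y. (y, t)" "%h. (h, 0)"])
 show "((%y. (y, t)) has_derivative (%h. (h, 0))) (at y)" by (auto intro!: derivative_eq_intros)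
 show "(\<Phi> has_derivative bapp (d\<Phi> (y, t))) (at (y, t))" by (rule d\<Phi>(2)[OF y t]) qed
 have "((%y. inv\<Phi> t (\<Phi> (y, t))) has_derivative (%h. dinv\<Phi> t (\<Phi> (y, t)) (d\<Phi> (y, t) (h, 0)))) (at y)"
 by (rule has_derivative_compose[OF 1 dinv\<Phi>(2)[OF t \<Phi>_\<Omega>[OF y t]]])
 moreover have "((%y. inv\<Phi> t (\<Phi> (y, t))) has_derivative (%h. h)) (at y)" by (rule has_derivative_transform_within_open[OF has_derivative_ident open_domains(1) y])
 (simp add: inv\<Phi>(3)[OF t in_closure])
 ultimately have "(%h. dinv\<Phi> t (\<Phi> (y, t)) (d\<Phi> (y, t) (h, 0))) = (%h. h)" by (rule has_derivative_unique)
 thus ?thesis by (rule fun_cong) qed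

text \<open>Regularity of the inverse flow in time comes from inverting the space-time map
  \<open>G\<close>: its derivative is block triangular, so a left inverse can be written down from
  the spatial one. Continuity of the inverse follows from invariance of domain.\<close>

lemma inv\<Phi>_time_derivative:
 assumes x: "x : Om" and t: "t : J" shows "((%s. inv\<Phi> s x) has_vector_derivative - dinv\<Phi> t x (v (x, t))) (at t)"
proof -
 define S where "S = Om \<times> J"
 define y where "y = inv\<Phi> t x"
 define g where "g = (%(x, t). (inv\<Phi> t x, t))"
 have y: "y : Om" unfolding y_def by (rule inv\<Phi>_\<Omega>[OF t x])
 have xy: "\<Phi> (y, t) = x" unfolding y_def by (rule inv\<Phi>(1)[OF t in_closure[OF x]])
 have oS: "open S" unfolding S_def by (intro open_Times open_domains open_greaterThanLessThan)
 have gG: "g (G p) = p" if "p : S" for p using that inv\<Phi>(3)[OF _ in_closure] by (auto simp: g_def G_def S_def)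
 have GS: "G ` S = S"
 proof -
 have "(x, t) : G ` S \<longleftrightarrow> t : J & x : (%x. \<Phi> (x, t)) ` Om" for x t unfolding G_def S_def by auto
 hence "(x, t) : G ` S \<longleftrightarrow> (x, t) : S" for x t using \<Phi>_image_\<Omega>[of t] unfolding S_def by auto
 thus ?thesis by (simp add: set_eq_iff split_paired_all) qed
 have cG: "continuous_on S G" unfolding S_def by (rule G_continuous)
 have cg: "continuous_on (G ` S) g"
 proof (rule invariance_of_domain_homeomorphism[OF oS cG _ G_inj[folded S_def]])
 fix g' assume "homeomorphism S (G ` S) G g'"
 hence h: "continuous_on (G ` S) g'" "!!p. p : S ==> g' (G p) = p" by (auto simp: homeomorphism_def)
 show "continuous_on (G ` S) g" by (rule continuous_on_eq[OF h(1)]) (use h(2) gG in auto) qed simp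
 define f' where "f' = (%q. (d\<Phi> (y, t) q, snd q))"
 define g' where "g' = (%q. (dinv\<Phi> t x (fst q - d\<Phi> (y, t) (0, snd q)), snd q))"
 have dG: "(G has_derivative f') (at (y, t))" unfolding G_def f'_def case_prod_beta
 by (intro has_derivative_Pair has_derivative_snd has_derivative_ident) (simp add: d\<Phi>(2)[OF y t])
 have bg: "bounded_linear g'"
 proof -
 have "bounded_linear (%q::(real^'n) \<times> real. (0 :: real^'n, snd q))" by (intro bounded_linear_Pair bounded_linear_zero bounded_linear_snd)
 hence "bounded_linear (%q::(real^'n) \<times> real. d\<Phi> (y, t) (0, snd q))" by (rule bounded_linear_compose[OF blinfun.bounded_linear_right])
 hence "bounded_linear (%q::(real^'n) \<times> real. fst q - d\<Phi> (y, t) (0, snd q))" by (intro bounded_linear_sub bounded_linear_fst)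
 hence "bounded_linear (%q::(real^'n) \<times> real. dinv\<Phi> t x (fst q - d\<Phi> (y, t) (0, snd q)))" by (rule bounded_linear_compose[OF blinfun.bounded_linear_right])
 thus ?thesis unfolding g'_def by (intro bounded_linear_Pair bounded_linear_snd) qed
 have idg: "g' \<circ> f' = id"
 proof
 fix q :: "(real^'n) \<times> real"
 have "d\<Phi> (y, t) q - d\<Phi> (y, t) (0, snd q) = d\<Phi> (y, t) (fst q, 0)"
 by (simp add: blinfun.diff_right[symmetric] prod_eq_iff del: diff_Pair) (simp add: minus_prod_def)
 thus "(g' \<circ> f') q = id q" using dinv\<Phi>_d\<Phi>[OF y t, of "fst q"] by (simp add: g'_def f'_def xy) qed
 have "(g has_derivative g') (at (G (y, t)))" by (rule has_derivative_inverse_dieudonne[OF oS _ cG cg gG _ dG bg idg]) (use GS oS y t in "auto simp: S_def")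
 hence dg: "(g has_derivative g') (at (x, t))" by (simp add: G_def xy)
 have "((%s. g (x, s)) has_derivative (%k. g' (0, k))) (at t)"
 proof (rule has_derivative_compose[of "%s. (x, s)" "%k. (0, k)"])
 show "((%s. (x, s)) has_derivative (%k. (0, k))) (at t)" by (auto intro!: derivative_eq_intros) qed (rule dg)
 hence "((%s. fst (g (x, s))) has_derivative (%k. fst (g' (0, k)))) (at t)" by (rule has_derivative_fst)
 moreover have "(%s. fst (g (x, s))) = (%s. inv\<Phi> s x)" by (simp add: g_def)
 moreover have "(%k. fst (g' (0, k))) = (%k. k *\<^sub>R (- dinv\<Phi> t x (v (x, t))))"
 proof
 fix k
 have k: "(0, k) = k *\<^sub>R (0 :: real^'n, 1 :: real)" by simp
 have "d\<Phi> (y, t) (0, k) = k *\<^sub>R d\<Phi> (y, t) (0, 1)" unfolding k by (rule blinfun.scaleR_right)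
 also have "... = k *\<^sub>R v (x, t)" using d\<Phi>(3)[OF y t] by (simp add: xy)
 finally show "fst (g' (0, k)) = k *\<^sub>R (- dinv\<Phi> t x (v (x, t)))" by (simp add: g'_def blinfun.minus_right blinfun.scaleR_right) qed
 ultimately show ?thesis unfolding has_vector_derivative_def by (simp only:) qed

text \<open>Pull-back by the inverse flow: constant along trajectories, so that a function supported
  in an initial phase stays supported in the moving one.\<close>

definition transport :: "(real^'n => real) => real => real^'n => real" where
 "transport eta t x = (if x : Om then eta (inv\<Phi> t x) else 0)"

context
 fixes eta :: "real^'n => real"
 assumes eta: "eta : test_functions (\<Omega>1 0)"
begin

definition K where "K = closure {y. eta y ~= 0}"

lemma K: "compact K" "K <= \<Omega>1 0" "K <= Om" "y ~: K ==> eta y = 0"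
proof -
 show "compact K" "K <= \<Omega>1 0" "y ~: K ==> eta y = 0" using eta closure_subset[of "{y. eta y ~= 0}"] by (auto simp: K_def test_functions_def)
 thus "K <= Om" using decomposition[of 0] T_pos by auto qed

lemma eta_derivative: "(eta has_derivative fderiv eta (at y)) (at y)" using eta by (intro Ck_has_derivative[of 0]) (auto simp: test_functions_def simp del: Ck.simps)

lemma transport_support:
 assumes t: "t : J" shows "compact ((%y. \<Phi> (y, t)) ` K)" "(%y. \<Phi> (y, t)) ` K <= \<Omega>1 t"
 "x ~: (%y. \<Phi> (y, t)) ` K ==> transport eta t x = 0"
proof -
 have Kc: "K <= closure Om" using K(3) in_closure by blast
 show "compact ((%y. \<Phi> (y, t)) ` K)" by (rule compact_continuous_image[OF continuous_on_subset[OF \<Phi>t_continuous Kc] K(1)]) (use t in auto)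
 show "(%y. \<Phi> (y, t)) ` K <= \<Omega>1 t" using \<Phi>_image_\<Omega>1[OF t] K(2) by blast
 assume x: "x ~: (%y. \<Phi> (y, t)) ` K"
 show "transport eta t x = 0"
 proof (cases "x : Om")
 case True
 have "x = \<Phi> (inv\<Phi> t x, t)" using inv\<Phi>(1)[OF t in_closure[OF True]] by simp
 hence "inv\<Phi> t x ~: K" using x by blast
 thus ?thesis by (simp add: transport_def K(4)) qed (simp add: transport_def) qed

lemma transport_derivative:
 assumes t: "t : J" and x: "x : Om" shows "(transport eta t has_derivative (%h. fderiv eta (at (inv\<Phi> t x)) (dinv\<Phi> t x h))) (at x)"
proof -
 have "((%x. eta (inv\<Phi> t x)) has_derivative (%h. fderiv eta (at (inv\<Phi> t x)) (dinv\<Phi> t x h))) (at x)"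
 by (rule has_derivative_compose[OF dinv\<Phi>(2)[OF t x] eta_derivative])
 thus ?thesis by (rule has_derivative_transform_within_open[OF _ open_domains(1) x]) (simp add: transport_def) qed

lemma transport_derivative_outside:
 assumes t: "t : J" and x: "x ~: (%y. \<Phi> (y, t)) ` K" shows "(transport eta t has_derivative (%h. 0)) (at x)"
proof -
 have "open (- ((%y. \<Phi> (y, t)) ` K))" using transport_support(1)[OF t] by (simp add: open_Compl compact_imp_closed)
 thus ?thesis by (rule has_derivative_transform_within_open[OF has_derivative_const[of 0]]) (use x transport_support(3)[OF t] in auto) qed

lemma transport_Ck:
 assumes t: "t : J" shows "Ck (Suc 0) (transport eta t)"
proof (rule Ck1_extension[OF open_domains(1) transport_support(1)[OF t] _ transport_support(3)[OF t] transport_derivative[OF t]])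
 show "(%y. \<Phi> (y, t)) ` K <= Om" using K(3) \<Phi>_\<Omega>[OF _ t] by blast
 fix b :: "real^'n" assume b: "b : Basis"
 have C1: "Ck (Suc 0) eta" using eta unfolding test_functions_def by blast
 have part: "continuous_on UNIV (%x. fderiv eta (at x) e)" if "e : Basis" for e using Ck_partial[OF C1 that] by simp
 have ci: "continuous_on Om (inv\<Phi> t)" using inv\<Phi>(4)[OF t] continuous_on_subset[OF _ closure_subset] by (auto simp: C1_bar_def)
 \<comment> \<open>Continuity of the derivative of eta is known along basis directions, whereas the
   direction here depends on x; hence the expansion.\<close>
 have cont: "continuous_on Om (%x. \<Sum>e\<in>Basis. (dinv\<Phi> t x b \<bullet> e) * fderiv eta (at (inv\<Phi> t x)) e)"
 proof (intro continuous_on_sum continuous_on_mult continuous_on_inner continuous_on_const)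
 show "continuous_on Om (%x. dinv\<Phi> t x b)" by (intro continuous_intros continuous_on_subset[OF dinv\<Phi>(1)[OF t] closure_subset])
 fix e :: "real^'n" assume "e : Basis"
 from continuous_on_compose2[OF part[OF this] ci]
 show "continuous_on Om (%x. fderiv eta (at (inv\<Phi> t x)) e)" by simp qed
 have eq: "fderiv eta (at (inv\<Phi> t x)) (dinv\<Phi> t x b) = (\<Sum>e\<in>Basis. (dinv\<Phi> t x b \<bullet> e) * fderiv eta (at (inv\<Phi> t x)) e)" for x
 proof -
 interpret l: linear "fderiv eta (at (inv\<Phi> t x))" by (rule has_derivative_linear[OF eta_derivative])
 have "fderiv eta (at (inv\<Phi> t x)) (dinv\<Phi> t x b) = fderiv eta (at (inv\<Phi> t x)) (\<Sum>e\<in>Basis. (dinv\<Phi> t x b \<bullet> e) *\<^sub>R e)"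
 by (simp add: euclidean_representation)
 thus ?thesis by (simp only: l.sum l.scale real_scaleR_def) qed
 show "continuous_on Om (%x. fderiv eta (at (inv\<Phi> t x)) (dinv\<Phi> t x b))" by (rule continuous_on_eq[OF cont]) (rule eq[symmetric]) qed

text \<open>This is the transport equation. The derivative of the inverse flow produced by the chain
  rule is absorbed into the spatial derivative of the transported function.\<close>

lemma transport_time_derivative:
 assumes t: "t : J" and x: "x : Om" shows "((%s. transport eta s x) has_real_derivative - fderiv (transport eta t) (at x) (v (x, t))) (at t)"
proof -
 define D where "D = fderiv eta (at (inv\<Phi> t x))"
 interpret l: linear D unfolding D_def by (rule has_derivative_linear[OF eta_derivative])
 have "((%s. inv\<Phi> s x) has_derivative (%k. k *\<^sub>R (- dinv\<Phi> t x (v (x, t))))) (at t)"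
 using inv\<Phi>_time_derivative[OF x t] by (simp add: has_vector_derivative_def)
 hence "((%s. eta (inv\<Phi> s x)) has_derivative (%k. D (k *\<^sub>R (- dinv\<Phi> t x (v (x, t)))))) (at t)"
 unfolding D_def by (rule has_derivative_compose[OF _ eta_derivative])
 moreover have "D (k *\<^sub>R (- dinv\<Phi> t x (v (x, t)))) = - D (dinv\<Phi> t x (v (x, t))) * k" for k by (simp only: l.scale l.neg real_scaleR_def mult.commute)
 moreover have "D (dinv\<Phi> t x (v (x, t))) = fderiv (transport eta t) (at x) (v (x, t))"
 unfolding D_def by (simp add: frechet_derivative_at[OF transport_derivative[OF t x], symmetric])
 ultimately have "((%s. eta (inv\<Phi> s x)) has_real_derivative - fderiv (transport eta t) (at x) (v (x, t))) (at t)"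
 proof -
 assume a: "((%s. eta (inv\<Phi> s x)) has_derivative (%k. D (k *\<^sub>R (- dinv\<Phi> t x (v (x, t)))))) (at t)"
 and b: "!!k. D (k *\<^sub>R (- dinv\<Phi> t x (v (x, t)))) = - D (dinv\<Phi> t x (v (x, t))) * k"
 and c: "D (dinv\<Phi> t x (v (x, t))) = fderiv (transport eta t) (at x) (v (x, t))"
 have "(%k. D (k *\<^sub>R (- dinv\<Phi> t x (v (x, t))))) = (*) (- fderiv (transport eta t) (at x) (v (x, t)))" by (intro ext) (simp only: b c)
 with a show ?thesis unfolding has_field_derivative_def by (simp only:) qed
 thus ?thesis using x by (simp add: transport_def) qed

text \<open>Makes products with a coefficient that jumps across the interface differentiable in time
  at points outside the phase.\<close>

lemma transport_vanishes:
 assumes t: "t : J" and x: "x : Om" "x ~: \<Omega>1 t" shows "\<forall>\<^sub>F s in nhds t. transport eta s x = 0"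
proof -
 have "inv\<Phi> t x ~: K"
 proof
 assume "inv\<Phi> t x : K"
 hence "\<Phi> (inv\<Phi> t x, t) : \<Omega>1 t" using transport_support(2)[OF t] by blast
 thus False using x inv\<Phi>(1)[OF t in_closure[OF x(1)]] by simp qed
 moreover have "isCont (%s. inv\<Phi> s x) t" using inv\<Phi>_time_derivative[OF x(1) t] by (simp add: has_vector_derivative_def has_derivative_continuous)
 ultimately have "\<forall>\<^sub>F s in at t. inv\<Phi> s x : - K" unfolding isCont_def by (intro topological_tendstoD) (auto simp: K(1) compact_imp_closed open_Compl)
 hence "\<forall>\<^sub>F s in nhds t. inv\<Phi> s x : - K" using \<open>inv\<Phi> t x ~: K\<close> by (simp add: eventually_nhds_conv_at)
 thus ?thesis by eventually_elim (simp add: transport_def K(4)) qed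

text \<open>The inverse flow is given as C^1 at each time separately, so a bound uniform in time is
  derived from the forward derivative, which is continuous in space-time.\<close>

lemma transport_time_derivative_bounded:
 assumes st: "0 < s" "t < T" shows "EX M>=0. ALL tau:{s..t}. ALL x:\<Omega>. abs(fderiv (transport eta tau) (at x) (v (x, tau))) <= M"
proof -
 obtain B where B: "0 <= B" "!!y h. abs(fderiv eta (at y) h) <= B * norm h"
 proof -
 have "ALL e:Basis. EX B. ALL y. abs(fderiv eta (at y) e) <= B"
 proof
 fix e :: "real^'n" assume e: "e : Basis"
 have "continuous_on K (%y. fderiv eta (at y) e)" using eta Ck_partial[OF _ e, of 0 eta] continuous_on_subset[OF _ subset_UNIV] by (fastforce simp: test_functions_def)
 hence "bounded ((%y. fderiv eta (at y) e) ` K)" by (intro compact_imp_bounded compact_continuous_image K(1))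
 then obtain B where B: "!!y. y : K ==> abs(fderiv eta (at y) e) <= B" by (auto simp: bounded_iff)
 have "abs(fderiv eta (at y) e) <= max B 0" for y
 proof (cases "y : K")
 case True thus ?thesis using B by (simp add: le_max_iff_disj)
 next
 case False
 hence yK: "y : - K" by simp
 have "(eta has_derivative (%h. 0)) (at y)" by (rule has_derivative_transform_within_open[OF has_derivative_const[of 0] _ yK])
 (use K(1,4) in "auto simp: open_Compl compact_imp_closed")
 from frechet_derivative_at[OF this] show ?thesis by (simp add: fun_eq_iff) qed
 thus "EX B. ALL y. abs(fderiv eta (at y) e) <= B" by blast qed
 then obtain B where B: "!!e y. e : Basis ==> abs(fderiv eta (at y) e) <= B e" by (meson bchoice)
 show ?thesis
 proof (rule that[of "\<Sum>e\<in>Basis. abs(B e)"])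
 fix y h
 interpret l: linear "fderiv eta (at y)" by (rule has_derivative_linear[OF eta_derivative])
 have "fderiv eta (at y) h = fderiv eta (at y) (\<Sum>e\<in>Basis. (h \<bullet> e) *\<^sub>R e)" by (simp add: euclidean_representation)
 also have "... = (\<Sum>e\<in>Basis. (h \<bullet> e) * fderiv eta (at y) e)" by (simp only: l.sum l.scale real_scaleR_def)
 also have "abs(...) <= (\<Sum>e\<in>Basis. abs((h \<bullet> e) * fderiv eta (at y) e))" by (rule sum_abs)
 also have "... <= (\<Sum>e\<in>Basis. norm h * abs(B e))"
 proof (rule sum_mono)
 fix e :: "real^'n" assume e: "e : Basis"
 have "abs(fderiv eta (at y) e) <= abs(B e)" using B[OF e, of y] by linarith
 thus "abs((h \<bullet> e) * fderiv eta (at y) e) <= norm h * abs(B e)" unfolding abs_mult using Basis_le_norm[OF e, of h] by (intro mult_mono) auto qed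
 finally show "abs(fderiv eta (at y) h) <= (\<Sum>e\<in>Basis. abs(B e)) * norm h" by (simp add: sum_distrib_left mult.commute) qed (simp add: sum_nonneg) qed
 \<comment> \<open>The spatial derivative is injective, hence bounded below on the compact product
   of K, the time interval and the unit sphere.\<close>
 obtain c where c: "0 < c" "!!y tau h. y : K ==> tau : {s..t} ==> c * norm h <= norm (d\<Phi> (y, tau) (h, 0))"
 proof -
 define Z where "Z = (K \<times> {s..t}) \<times> sphere (0 :: real^'n) 1"
 define f where "f q = norm (d\<Phi> (fst q) (snd q, 0))" for q
 have cZ: "compact Z" unfolding Z_def by (intro compact_Times K(1)) auto
 have "fst ` Z <= closure Om \<times> {0..T}" using K(3) in_closure st unfolding Z_def by fastforce
 hence cf: "continuous_on Z f" unfolding f_def by (intro continuous_intros continuous_on_compose2[OF d\<Phi>(1)])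
 have pos: "0 < f q" if "q : Z" for q
 proof -
 define y tau h where "y = fst (fst q)" and "tau = snd (fst q)" and "h = snd q"
 hence q: "q = ((y, tau), h)" "y : K" "tau : {s..t}" "norm h = 1" using that unfolding Z_def by (auto simp: dist_norm)
 have "h = 0" if "d\<Phi> (y, tau) (h, 0) = 0" using dinv\<Phi>_d\<Phi>[of y tau h] that q K(3) st by (auto simp: blinfun.zero_right)
 thus ?thesis using q by (auto simp: f_def) qed
 obtain c where c: "0 < c" "!!q. q : Z ==> c <= f q"
 proof (cases "Z = {}")
 case True thus ?thesis using that[of 1] by auto
 next
 case False
 then obtain q0 where "q0 : Z" "!!q. q : Z ==> f q0 <= f q" using continuous_attains_inf[OF cZ _ cf] by blast
 thus ?thesis using that[of "f q0"] pos by blast qed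
 show ?thesis
 proof (rule that[OF c(1)])
 fix y tau and h :: "real^'n" assume y: "y : K" "tau : {s..t}"
 show "c * norm h <= norm (d\<Phi> (y, tau) (h, 0))"
 proof (cases "h = 0")
 case False
 have "c <= f ((y, tau), h /\<^sub>R norm h)" by (rule c(2)) (use y False in "simp add: Z_def")
 also have "... = norm (d\<Phi> (y, tau) ((1 / norm h) *\<^sub>R (h, 0)))" by (simp add: f_def divide_inverse)
 also have "... = norm (d\<Phi> (y, tau) (h, 0)) / norm h" by (simp only: blinfun.scaleR_right norm_scaleR) simp
 finally show ?thesis using False by (simp add: pos_le_divide_eq) qed simp qed qed
 have "EX M>=0. ALL p:closure Om \<times> {0..T}. norm (v p) <= M" by (rule blinfun_norm_bounded) (use velocity_smooth closure_cylinder in "auto simp: C1_bar_def")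
 then obtain V where V: "0 <= V" "!!p. p : closure Om \<times> {0..T} ==> norm (v p) <= V" by blast
 show ?thesis
 proof (intro exI[of _ "B * (V / c)"] conjI ballI)
 show "0 <= B * (V / c)" using B V c by simp
 fix tau x assume tau: "tau : {s..t}" and x: "x : Om"
 have tauJ: "tau : J" using tau st by auto
 show "abs(fderiv (transport eta tau) (at x) (v (x, tau))) <= B * (V / c)"
 proof (cases "x : (%y. \<Phi> (y, tau)) ` K")
 case False
 from frechet_derivative_at[OF transport_derivative_outside[OF tauJ this], symmetric]
 show ?thesis using B V c by (simp add: fun_eq_iff)
 next
 case True
 then obtain y where y: "y : K" "x = \<Phi> (y, tau)" by blast
 have yO: "y : Om" using y K(3) by blast
 define k where "k = dinv\<Phi> tau x (v (x, tau))"
 \<comment> \<open>An injective linear map of a finite-dimensional space is onto, so v is the image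
   of some vector, and the left inverse identifies that vector as k.\<close>
 have vv: "v (x, tau) = d\<Phi> (y, tau) (k, 0)"
 proof -
 have lin: "linear (%h. d\<Phi> (y, tau) (h, 0))" by (rule linearI) (simp_all add: blinfun.add_right[symmetric] blinfun.scaleR_right[symmetric])
 have "inj (%h. d\<Phi> (y, tau) (h, 0))" by (rule inj_on_inverseI[where g="dinv\<Phi> tau (\<Phi> (y, tau))"]) (rule dinv\<Phi>_d\<Phi>[OF yO tauJ])
 hence "surj (%h. d\<Phi> (y, tau) (h, 0))" by (rule linear_injective_imp_surjective[OF lin]) simp
 then obtain h where h: "v (x, tau) = d\<Phi> (y, tau) (h, 0)" by (rule surjE)
 have "k = h" unfolding k_def h using dinv\<Phi>_d\<Phi>[OF yO tauJ, of h] y(2) by simp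
 thus ?thesis using h by simp qed
 have "c * norm k <= V" using c(2)[OF y(1) tau, of k] V(2)[of "(x, tau)"] x tauJ in_closure by (simp add: vv[symmetric])
 hence "norm k <= V / c" using c(1) by (simp add: pos_le_divide_eq mult.commute)
 moreover have "fderiv (transport eta tau) (at x) (v (x, tau)) = fderiv eta (at (inv\<Phi> tau x)) k"
 unfolding k_def by (simp add: frechet_derivative_at[OF transport_derivative[OF tauJ x], symmetric])
 ultimately show ?thesis using B(2)[of "inv\<Phi> tau x" k] mult_left_mono[of "norm k" "V / c" B] B(1) by simp qed qed qed

end

end

section \<open>The forms of the weighted problem\<close>

lemma int_mult_csupp:
 fixes f h :: "'a::euclidean_space => real"
 assumes U: "U : sets lebesgue" and K: "compact K" "K <= U" and f: "integrable (leb K) f"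
 and h: "continuous_on U h" "!!x. x : U ==> x ~: K ==> h x = 0" shows "integrable (leb U) (%x. f x * h x)"
proof -
 have Km: "K : sets lebesgue" by (rule compact_sets_leb[OF K(1)])
 have hK: "continuous_on K h" by (rule continuous_on_subset[OF h(1) K(2)])
 have "bounded (h ` K)" by (intro compact_imp_bounded compact_continuous_image hK K(1))
 then obtain B where B: "!!x. x : K ==> abs(h x) <= B" by (auto simp: bounded_iff)
 have "integrable (leb K) (%x. f x * h x)"
 proof (rule bi_integrable_bound[of _ "%x. B * f x"])
 show "integrable (leb K) (%x. B * f x)" using f by (rule integrable_mult_right)
 show "(%x. f x * h x) : bmeas (leb K)" by (intro borel_measurable_times borel_measurable_integrable[OF f] continuous_imp_measurable_on_sets_lebesgue hK Km)
 show "AE x in leb K. norm (f x * h x) <= norm (B * f x)"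
 proof (rule AE_I2)
 fix x assume "x : space (leb K)"
 hence "abs(h x) <= abs(B)" using B[of x] by (simp add: space_restrict_space)
 thus "norm (f x * h x) <= norm (B * f x)" by (simp add: abs_mult mult.commute[of "abs(B)"] mult_left_mono) qed qed
 hence "integrable lebesgue (%x. indicator K x * (f x * h x))" by (simp add: integrable_leb_eq Km)
 moreover have "indicator K x * (f x * h x) = indicator U x * (f x * h x)" for x using h(2)[of x] K(2) by (auto simp: indicator_def)
 ultimately show ?thesis by (simp add: integrable_leb_eq U) qed

text \<open>For each basis vector b the function (c . b) psi is C^1 with compact support, so
  \<open>weak_product_rule\<close> applies to it; its derivative separates the term with psi' from
  the one with the derivative of c.\<close>

lemma weak_divergence_product:
 fixes c :: "'a::euclidean_space => 'a" and w z psi :: "'a => real"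
 assumes U: "open U" "bounded U"
 and c: "!!x. x : U ==> (c has_derivative c' x) (at x)" "!!b e. b : Basis ==> e : Basis ==> continuous_on U (%x. c' x e \<bullet> b)"
 and w: "sqint (leb U) w" "!!b. b : Basis ==> sqint (leb U) (dw b)" "!!b. b : Basis ==> wderiv U b w (dw b)"
 and z: "sqint (leb U) z" "!!b. b : Basis ==> sqint (leb U) (dz b)" "!!b. b : Basis ==> wderiv U b z (dz b)"
 and psi: "psi : test_functions U" shows "(LINT x|leb U. (\<Sum>b\<in>Basis. (w x * z x * (c x \<bullet> b)) * fderiv psi (at x) b))
 = - (LINT x|leb U. (\<Sum>b\<in>Basis. w x * z x * (c' x b \<bullet> b) + (c x \<bullet> b) * (w x * dz b x + z x * dw b x)) * psi x)"
proof -
 define K where "K = closure {x. psi x ~= 0}"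
 have K: "compact K" "K <= U" "!!x. x ~: K ==> psi x = 0" unfolding K_def using tf_bounds[OF psi] by blast+
 have Um: "U : sets lebesgue" using U by simp
 have Km: "K : sets lebesgue" by (rule compact_sets_leb[OF K(1)])
 have dpsi: "(psi has_derivative fderiv psi (at x)) (at x)" for x by (rule Ck_has_derivative[of 0]) (rule tf_bounds(5)[OF psi])
 have cpsi: "continuous_on U psi" using tf_bounds(1)[OF psi] continuous_on_subset by blast
 have cdpsi: "continuous_on U (%x. fderiv psi (at x) b)" if "b : Basis" for b
 using Ck_partial[OF tf_bounds(5)[OF psi, of "Suc 0"] that] continuous_on_subset[OF _ subset_UNIV] by simp
 have dpsi0: "fderiv psi (at x) b = 0" if "x ~: K" for x b by (rule derivative_outside_support(2)[OF K(1,3) that])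
 have cc: "continuous_on U (%x. c x \<bullet> b)" for b
 by (intro continuous_on_inner continuous_on_const continuous_at_imp_continuous_on ballI has_derivative_continuous[OF c(1)])
 have wz: "integrable (leb K) (%x. w x * z x)" by (rule int_leb_subset[OF sqint_mult[OF w(1) z(1)] Um Km K(2)])
 have one: "integrable (leb U) (%x. w x * z x * (c x \<bullet> b) * fderiv psi (at x) b)"
 "integrable (leb U) (%x. (w x * z x * (c' x b \<bullet> b) + (c x \<bullet> b) * (w x * dz b x + z x * dw b x)) * psi x)"
 "(LINT x|leb U. w x * z x * (c x \<bullet> b) * fderiv psi (at x) b)
 = - (LINT x|leb U. (w x * z x * (c' x b \<bullet> b) + (c x \<bullet> b) * (w x * dz b x + z x * dw b x)) * psi x)"
 if b: "b : Basis" for b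
 proof -
 define zeta where "zeta x = (c x \<bullet> b) * psi x" for x
 have dzeta: "(zeta has_derivative (%h. (c x \<bullet> b) * fderiv psi (at x) h + (c' x h \<bullet> b) * psi x)) (at x)" if "x : U" for x
 unfolding zeta_def by (intro has_derivative_mult has_derivative_inner_left c(1) that dpsi)
 have zeta0: "zeta x = 0" if "x ~: K" for x using K(3)[OF that] by (simp add: zeta_def)
 have C1: "Ck (Suc 0) zeta"
 proof (rule Ck1_extension[OF U(1) K(1,2) zeta0 dzeta])
 fix e :: 'a assume "e : Basis"
 thus "continuous_on U (%x. (c x \<bullet> b) * fderiv psi (at x) e + (c' x e \<bullet> b) * psi x)" by (intro continuous_on_add continuous_on_mult cc c(2) cdpsi cpsi b) qed
 have fzeta: "fderiv zeta (at x) b = (c x \<bullet> b) * fderiv psi (at x) b + (c' x b \<bullet> b) * psi x" if "x : U" for x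
 using frechet_derivative_at[OF dzeta[OF that]] by metis
 have wp: "(LINT x|leb U. w x * z x * fderiv zeta (at x) b)
 = - (LINT x|leb U. (w x * dz b x + z x * dw b x) * zeta x)"
 by (rule weak_product_rule[OF U b w(1) w(2)[OF b] w(3)[OF b] z(1) z(2)[OF b] z(3)[OF b] C1 K(1) _ K(2)]) (use zeta0 in auto)
 have dwz: "integrable (leb K) (%x. w x * dz b x + z x * dw b x)" by (rule int_leb_subset[OF _ Um Km K(2)]) (intro bi_integrable_add sqint_mult w z b)
 have I1: "integrable (leb U) (%x. w x * z x * ((c x \<bullet> b) * fderiv psi (at x) b))"
 by (rule int_mult_csupp[OF Um K(1,2) wz]) (intro continuous_on_mult cc cdpsi b, simp add: dpsi0)
 have I2: "integrable (leb U) (%x. w x * z x * ((c' x b \<bullet> b) * psi x))"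
 by (rule int_mult_csupp[OF Um K(1,2) wz]) (intro continuous_on_mult c(2) cpsi b, simp add: K(3))
 have I3: "integrable (leb U) (%x. (w x * dz b x + z x * dw b x) * zeta x)" by (rule int_mult_csupp[OF Um K(1,2) dwz])
 (use zeta0 in "auto simp: zeta_def intro!: continuous_on_mult cc cpsi")
 show "integrable (leb U) (%x. w x * z x * (c x \<bullet> b) * fderiv psi (at x) b)" using I1 by (simp add: mult.assoc)
 have e: "(w x * z x * (c' x b \<bullet> b) + (c x \<bullet> b) * (w x * dz b x + z x * dw b x)) * psi x
 = w x * z x * ((c' x b \<bullet> b) * psi x) + (w x * dz b x + z x * dw b x) * zeta x" for x by (simp add: zeta_def algebra_simps)
 show "integrable (leb U) (%x. (w x * z x * (c' x b \<bullet> b) + (c x \<bullet> b) * (w x * dz b x + z x * dw b x)) * psi x)"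
 unfolding e by (rule bi_integrable_add[OF I2 I3])
 have "(LINT x|leb U. w x * z x * fderiv zeta (at x) b)
 = (LINT x|leb U. w x * z x * ((c x \<bullet> b) * fderiv psi (at x) b) + w x * z x * ((c' x b \<bullet> b) * psi x))"
 by (rule bi_integral_cong[OF refl]) (simp add: fzeta space_restrict_space distrib_left)
 also have "... = (LINT x|leb U. w x * z x * ((c x \<bullet> b) * fderiv psi (at x) b)) + (LINT x|leb U. w x * z x * ((c' x b \<bullet> b) * psi x))"
 by (rule bi_integral_add[OF I1 I2])
 finally show "(LINT x|leb U. w x * z x * (c x \<bullet> b) * fderiv psi (at x) b)
 = - (LINT x|leb U. (w x * z x * (c' x b \<bullet> b) + (c x \<bullet> b) * (w x * dz b x + z x * dw b x)) * psi x)"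
 unfolding e bi_integral_add[OF I2 I3] using wp by (simp add: mult.assoc) qed
 have "(LINT x|leb U. (\<Sum>b\<in>Basis. (w x * z x * (c x \<bullet> b)) * fderiv psi (at x) b))
 = (\<Sum>b\<in>Basis. LINT x|leb U. w x * z x * (c x \<bullet> b) * fderiv psi (at x) b)" by (rule bi_integral_sum) (rule one(1))
 also have "... = (\<Sum>b\<in>Basis. - (LINT x|leb U. (w x * z x * (c' x b \<bullet> b) + (c x \<bullet> b) * (w x * dz b x + z x * dw b x)) * psi x))"
 by (rule sum.cong[OF refl one(3)])
 also have "... = - (LINT x|leb U. (\<Sum>b\<in>Basis. (w x * z x * (c' x b \<bullet> b) + (c x \<bullet> b) * (w x * dz b x + z x * dw b x)) * psi x))"
 unfolding sum_negf by (subst bi_integral_sum) (use one(2) in auto)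
 finally show ?thesis by (simp only: sum_distrib_right) qed

lemma inner_grad: "y \<bullet> grad psi x = (\<Sum>b\<in>Basis. (y \<bullet> b) * fderiv psi (at x) b)"
proof -
 have "grad psi x \<bullet> b = fderiv psi (at x) b" if "b : Basis" for b
 proof -
 obtain i where "b = axis i 1" using \<open>b : Basis\<close> by (auto simp: Basis_vec_def)
 thus ?thesis by (simp add: grad_def inner_axis) qed
 thus ?thesis by (subst euclidean_inner) simp qed

lemma weak_divergence_integrable:
 assumes U: "open U" and g: "is_weak_divergence U F g" and psi: "psi : test_functions U" shows "integrable (leb U) (%x. g x * psi x)"
proof (rule int_mult_csupp[where K="closure {x. psi x ~= 0}"])
 show "U : sets lebesgue" using U by simp
 show "compact (closure {x. psi x ~= 0})" "closure {x. psi x ~= 0} <= U" using tf_bounds(3,4)[OF psi] .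
 thus "integrable (leb (closure {x. psi x ~= 0})) g" using g unfolding is_weak_divergence_def by blast
 show "continuous_on U psi" using tf_bounds(1)[OF psi] continuous_on_subset by blast
 show "psi x = 0" if "x ~: closure {x. psi x ~= 0}" for x using tf_bounds(6)[OF psi] that by blast qed

text \<open>By the fundamental lemma; hence the choice operator in \<open>weak_divergence\<close> is
  harmless up to null sets.\<close>

lemma weak_divergence_unique:
 assumes U: "open U" and g: "is_weak_divergence U F g" "is_weak_divergence U F g'" shows "AE x in lebesgue. x : U --> g x = g' x"
proof -
 have "AE x in lebesgue. x : U --> g x - g' x = 0"
 proof (rule fundamental_lemma[OF U])
 fix K assume "compact K" "K <= U"
 thus "integrable (leb K) (%x. g x - g' x)" using g unfolding is_weak_divergence_def by (intro bi_integrable_diff) blast+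
 next
 fix psi assume psi: "psi : test_functions U"
 have "(LINT x|leb U. (g x - g' x) * psi x) = (LINT x|leb U. g x * psi x) - (LINT x|leb U. g' x * psi x)" unfolding left_diff_distrib
 by (rule bi_integral_diff[OF weak_divergence_integrable[OF U g(1) psi] weak_divergence_integrable[OF U g(2) psi]])
 also have "... = 0" using g psi unfolding is_weak_divergence_def by (metis diff_self minus_minus)
 finally show "(LINT x|leb U. (g x - g' x) * psi x) = 0" . qed
 thus ?thesis by (rule eventually_mono) simp qed

section \<open>Regularity of the coefficient on the phases\<close>

context moving_coefficient
begin

definition phase :: "(real => (real^'n) set) => ((real^'n) \<times> real) set" where
 "phase W = {(x, t). t : J & x : W t}"

lemma phase_open: "W = \<Omega>1 \<or> W = \<Omega>2 ==> open (phase W)" using P1_open moving_domains.P1_open[OF swap] unfolding phase_def by metis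

lemma phase_subset: "W = \<Omega>1 \<or> W = \<Omega>2 ==> phase W <= Om \<times> J"
proof
 fix p assume W: "W = \<Omega>1 \<or> W = \<Omega>2" and p: "p : phase W"
 have "snd p : {0..T}" "fst p : W (snd p)" "snd p : J" using p by (auto simp: phase_def)
 thus "p : Om \<times> J" using decomposition[of "snd p"] W by (auto simp: mem_Times_iff) qed

lemma phase_disjoint: "phase \<Omega>1 \<inter> phase \<Omega>2 = {}"
proof -
 have "p ~: phase \<Omega>2" if p: "p : phase \<Omega>1" for p
 proof -
 have "snd p : {0..T}" "fst p : \<Omega>1 (snd p)" using p by (auto simp: phase_def)
 thus ?thesis using disjoint[of "snd p"] by (auto simp: phase_def) qed
 thus ?thesis by blast qed

lemma phase_compact: "W = \<Omega>1 \<or> W = \<Omega>2 ==> compact (closure (phase W))"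
 using bounded_subset[OF _ phase_subset] lipschitz_domainD(2)[OF domain] by (simp add: compact_closure bounded_Times)

text \<open>\<open>Q1\<close> is the first space-time phase, while \<open>Q2\<close> is defined as a
  complement and contains the second. In both cases the C^1 extension restricts to the phase, an
  open set on which it agrees with the coefficient.\<close>

lemma coefficient_phase:
 assumes W: "W = \<Omega>1 \<or> W = \<Omega>2" shows "EX \<beta> A. continuous_on (closure (phase W)) \<beta> & continuous_on (closure (phase W)) A &
 (ALL p:phase W. \<alpha> p = \<beta> p & (\<alpha> has_derivative bapp (A p)) (at p))"
proof -
 have P1: "Q1 = phase \<Omega>1" using phase_subset[of \<Omega>1] by (auto simp: Q1_def phase_def)
 have "phase \<Omega>2 \<inter> closure Q1 = {}" using open_Int_closure_eq_empty[OF phase_open[of \<Omega>2], of Q1] phase_disjoint by (auto simp: P1)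
 hence P2: "phase \<Omega>2 <= Q2" using phase_subset[of \<Omega>2] by (auto simp: Q2_def)
 obtain Q where Q: "phase W <= Q" "EX \<beta>:C1_bar Q. ALL t:{0..T}. ALL x:W t. \<alpha> (x, t) = \<beta> (x, t)" using W P1 P2 smooth1 smooth2 by blast
 then obtain \<beta> where \<beta>: "\<beta> : C1_bar Q" "!!t x. t : {0..T} ==> x : W t ==> \<alpha> (x, t) = \<beta> (x, t)" by blast
 have eq: "\<alpha> p = \<beta> p" if "p : phase W" for p using that \<beta>(2) by (auto simp: phase_def)
 show ?thesis
 proof (rule C1_barE[OF \<beta>(1)])
 fix A assume A: "continuous_on (closure Q) \<beta>" "continuous_on (closure Q) A"
 "!!p. p : Q ==> (\<beta> has_derivative bapp (A p)) (at p)"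
 have "(\<alpha> has_derivative bapp (A p)) (at p)" if p: "p : phase W" for p
 by (rule has_derivative_transform_within_open[OF A(3) phase_open[OF W] p]) (use p Q(1) eq in auto)
 thus ?thesis using eq continuous_on_subset[OF A(1) closure_mono[OF Q(1)]] continuous_on_subset[OF A(2) closure_mono[OF Q(1)]] by (intro exI[of _ \<beta>] exI[of _ A]) simp
 qed qed

text \<open>Packages derivatives and one common bound in an existential statement, from which
  \<open>weighted_forms\<close> is instantiated.\<close>

lemma regular_data:
 shows "EX d\<alpha> dv M. 0 <= M & continuous_on (phase \<Omega>1 \<union> phase \<Omega>2) d\<alpha> & continuous_on (phase \<Omega>1 \<union> phase \<Omega>2) dv &
 (ALL p:phase \<Omega>1 \<union> phase \<Omega>2. (\<alpha> has_derivative bapp (d\<alpha> p)) (at p) & (v has_derivative bapp (dv p)) (at p) &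
 \<bar>\<alpha> p\<bar> <= M & norm (v p) <= M & norm (d\<alpha> p) <= M & norm (dv p) <= M)"
proof (rule C1_barE[OF velocity_smooth])
 fix dv assume dv: "continuous_on (closure (Om \<times> J)) v" "continuous_on (closure (Om \<times> J)) dv"
 "!!p. p : Om \<times> J ==> (v has_derivative bapp (dv p)) (at p)"
 have bd: "EX B. ALL p:S. norm (f p) <= B" if "compact S" "continuous_on S f" for S and f :: "(real^'n) \<times> real => 'z::real_normed_vector"
 using compact_imp_bounded[OF compact_continuous_image[OF that(2,1)]] by (auto simp: bounded_iff)
 obtain B1 where B1: "!!p. p : closure Om \<times> {0..T} ==> norm (v p) <= B1" using blinfun_norm_bounded[OF dv(1)[unfolded closure_cylinder]] by blast
 obtain B2 where B2: "!!p. p : closure Om \<times> {0..T} ==> norm (dv p) <= B2" using blinfun_norm_bounded[OF dv(2)[unfolded closure_cylinder]] by blast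
 have half: "EX A B. continuous_on (phase W) A & (ALL p:phase W. (\<alpha> has_derivative bapp (A p)) (at p) & abs(\<alpha> p) <= B & norm (A p) <= B)"
 if W: "W = \<Omega>1 \<or> W = \<Omega>2" for W
 proof -
 obtain \<beta> A where A: "continuous_on (closure (phase W)) \<beta>" "continuous_on (closure (phase W)) A"
 "!!p. p : phase W ==> \<alpha> p = \<beta> p & (\<alpha> has_derivative bapp (A p)) (at p)" using coefficient_phase[OF W] by blast
 obtain C D where "ALL p:closure (phase W). norm (\<beta> p) <= C" "ALL p:closure (phase W). norm (A p) <= D"
 using bd[OF phase_compact[OF W] A(1)] bd[OF phase_compact[OF W] A(2)] by blast
 hence "ALL p:phase W. norm (\<beta> p) <= max C D & norm (A p) <= max C D" using closure_subset[of "phase W"] by (meson le_max_iff_disj subsetD)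
 thus ?thesis using A(3) continuous_on_subset[OF A(2) closure_subset] by (intro exI[of _ A] exI[of _ "max C D"]) (simp add: real_norm_def) qed
 obtain A1 C1 where A1: "continuous_on (phase \<Omega>1) A1"
 "!!p. p : phase \<Omega>1 ==> (\<alpha> has_derivative bapp (A1 p)) (at p) & abs(\<alpha> p) <= C1 & norm (A1 p) <= C1" using half[of \<Omega>1] by blast
 obtain A2 C2 where A2: "continuous_on (phase \<Omega>2) A2"
 "!!p. p : phase \<Omega>2 ==> (\<alpha> has_derivative bapp (A2 p)) (at p) & abs(\<alpha> p) <= C2 & norm (A2 p) <= C2" using half[of \<Omega>2] by blast
 define A where "A p = (if p : phase \<Omega>1 then A1 p else A2 p)" for p
 have disj: "p ~: phase \<Omega>1" if "p : phase \<Omega>2" for p using phase_disjoint that by blast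
 define M where "M = max 0 (max (max B1 B2) (max C1 C2))"
 have M: "0 <= M" "B1 <= M" "B2 <= M" "C1 <= M" "C2 <= M" unfolding M_def by simp_all
 have sub: "phase \<Omega>1 \<union> phase \<Omega>2 <= Om \<times> J" using phase_subset[of \<Omega>1] phase_subset[of \<Omega>2] by simp
 have sub': "Om \<times> J <= closure Om \<times> {0..T}" by (intro Sigma_mono closure_subset) auto
 have cA: "continuous_on (phase \<Omega>1 \<union> phase \<Omega>2) A"
 proof (intro continuous_on_open_Un phase_open)
 show "continuous_on (phase \<Omega>1) A" by (rule continuous_on_eq[OF A1(1)]) (simp add: A_def)
 show "continuous_on (phase \<Omega>2) A" by (rule continuous_on_eq[OF A2(1)]) (simp add: A_def disj) qed simp_all
 have cdv: "continuous_on (phase \<Omega>1 \<union> phase \<Omega>2) dv" by (rule continuous_on_subset[OF dv(2)]) (use sub sub' closure_cylinder in blast)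
 have "(\<alpha> has_derivative bapp (A p)) (at p) & (v has_derivative bapp (dv p)) (at p) &
 \<bar>\<alpha> p\<bar> <= M & norm (v p) <= M & norm (A p) <= M & norm (dv p) <= M" if p: "p : phase \<Omega>1 \<union> phase \<Omega>2" for p
 proof -
 have ps: "p : Om \<times> J" "p : closure Om \<times> {0..T}" using p subsetD[OF sub] subsetD[OF sub'] by blast+
 have "(\<alpha> has_derivative bapp (A p)) (at p) & abs(\<alpha> p) <= M & norm (A p) <= M"
 proof (cases "p : phase \<Omega>1")
 case True
 hence "A p = A1 p" by (simp add: A_def)
 thus ?thesis using A1(2)[OF True] M by (metis order_trans)
 next
 case False
 hence "A p = A2 p" "p : phase \<Omega>2" using p by (simp_all add: A_def)
 thus ?thesis using A2(2)[of p] M by (metis order_trans) qed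
 moreover have "norm (v p) <= M" using B1[OF ps(2)] M by (metis order_trans)
 moreover have "norm (dv p) <= M" using B2[OF ps(2)] M by (metis order_trans)
 moreover have "(v has_derivative bapp (dv p)) (at p)" by (rule dv(3)[OF ps(1)])
 ultimately show ?thesis by blast qed
 thus ?thesis using cA cdv M(1) by (intro exI[of _ A] exI[of _ dv] exI[of _ M] conjI ballI) blast+ qed

end

section \<open>The weighted forms, their linearity and bounds\<close>

lemma bounded_bilinear_symI:
 fixes m :: "'v::real_normed_vector => 'v => real"
 assumes lin: "!!r s w w' z. m (r *\<^sub>R w + s *\<^sub>R w') z = r * m w z + s * m w' z"
 and sym: "!!w z. m w z = m z w" and bd: "!!w z. abs(m w z) <= C * norm w * norm z" shows "bounded_bilinear m"
proof
 show add: "m (a + a') b = m a b + m a' b" for a a' b using lin[of 1 a 1 a' b] by simp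
 show "m a (b + b') = m a b + m a b'" for a b b' using add[of b b' a] sym by simp
 show sc: "m (r *\<^sub>R a) b = r *\<^sub>R m a b" for r a b using lin[of r a 0 0 b] by simp
 show "m a (r *\<^sub>R b) = r *\<^sub>R m a b" for r a b using sc[of r b a] sym by simp
 show "EX K. ALL a b. norm (m a b) <= norm a * norm b * K" by (intro exI[of _ C] allI) (use bd in "simp add: mult.commute mult.left_commute") qed

text \<open>The gradient of an element of V is picked by choice, so its linearity holds almost
  everywhere and is a consequence of uniqueness.\<close>

lemma wderiv_linear:
 fixes w1 :: "'a::euclidean_space => real"
 assumes S: "open S" "bounded S" and b: "b : Basis"
 and w1: "sqint (leb S) w1" "sqint (leb S) d1" "wderiv S b w1 d1"
 and w2: "sqint (leb S) w2" "sqint (leb S) d2" "wderiv S b w2 d2"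
 and w3: "sqint (leb S) w3" "sqint (leb S) d3" "wderiv S b w3 d3"
 and ae: "AE x in lebesgue. x : S --> w3 x = r * w1 x + s * w2 x" shows "AE x in lebesgue. x : S --> d3 x = r * d1 x + s * d2 x"
proof -
 have Sm: "S : sets lebesgue" using S by simp
 have fin: "emeasure (leb S) (space (leb S)) < \<infinity>"
 using S bounded_set_imp_lmeasurable[of S] by (simp add: fmeasurable_def space_restrict_space emeasure_restrict_space Sm)
 have "AE x in lebesgue. x : S --> d3 x - (r * d1 x + s * d2 x) = 0"
 proof (rule fundamental_lemma[OF S(1)])
 fix K :: "'a set" assume K: "compact K" "K <= S"
 have "integrable (leb S) (%x. d3 x - (r * d1 x + s * d2 x))" by (intro bi_integrable_diff bi_integrable_add integrable_mult_right sqint_integrable[OF _ fin] w1 w2 w3)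
 thus "integrable (leb K) (%x. d3 x - (r * d1 x + s * d2 x))" by (rule int_leb_subset[OF _ Sm compact_sets_leb[OF K(1)] K(2)])
 next
 fix psi assume psi: "psi : test_functions S"
 define K where "K = closure {x. psi x ~= 0}"
 have K: "compact K" "K <= S" "!!x. x ~: K ==> psi x = 0" unfolding K_def using tf_bounds[OF psi] by blast+
 have dpsi0: "fderiv psi (at x) b = 0" if "x ~: K" for x by (rule derivative_outside_support(2)[OF K(1,3) that])
 have cpsi: "continuous_on S psi" using tf_bounds(1)[OF psi] continuous_on_subset by blast
 have cdpsi: "continuous_on S (%x. fderiv psi (at x) b)" using Ck_partial[OF tf_bounds(5)[OF psi, of "Suc 0"] b] continuous_on_subset[OF _ subset_UNIV] by simp
 have ipsi: "integrable (leb S) (%x. f x * psi x)" if "sqint (leb S) f" for f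
 by (rule int_mult_csupp[OF Sm K(1,2) int_leb_subset[OF sqint_integrable[OF that fin] Sm compact_sets_leb[OF K(1)] K(2)] cpsi])
 (rule K(3))
 have idpsi: "integrable (leb S) (%x. f x * fderiv psi (at x) b)" if "sqint (leb S) f" for f
 by (rule int_mult_csupp[OF Sm K(1,2) int_leb_subset[OF sqint_integrable[OF that fin] Sm compact_sets_leb[OF K(1)] K(2)] cdpsi])
 (rule dpsi0)
 have "- (LINT x|leb S. d3 x * psi x) = (LINT x|leb S. w3 x * fderiv psi (at x) b)" using w3(3) psi by (simp add: wderiv_def)
 also have "... = (LINT x|leb S. r * (w1 x * fderiv psi (at x) b) + s * (w2 x * fderiv psi (at x) b))"
 proof (rule integral_leb_cong_AE[OF Sm])
 show "(%x. w3 x * fderiv psi (at x) b) : bmeas (leb S)" by (rule borel_measurable_integrable[OF idpsi[OF w3(1)]])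
 show "(%x. r * (w1 x * fderiv psi (at x) b) + s * (w2 x * fderiv psi (at x) b)) : bmeas (leb S)"
 by (intro borel_measurable_add borel_measurable_times borel_measurable_const borel_measurable_integrable[OF idpsi[OF w1(1)]] borel_measurable_integrable[OF idpsi[OF w2(1)]])
 show "AE x in lebesgue. x : S --> w3 x * fderiv psi (at x) b
 = r * (w1 x * fderiv psi (at x) b) + s * (w2 x * fderiv psi (at x) b)" using ae by eventually_elim (simp add: algebra_simps) qed
 also have "... = r * (LINT x|leb S. w1 x * fderiv psi (at x) b) + s * (LINT x|leb S. w2 x * fderiv psi (at x) b)"
 using idpsi[OF w1(1)] idpsi[OF w2(1)] by (subst bi_integral_add) auto
 also have "... = - (r * (LINT x|leb S. d1 x * psi x) + s * (LINT x|leb S. d2 x * psi x))" using w1(3) w2(3) psi by (simp add: wderiv_def)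
 finally have e: "(LINT x|leb S. d3 x * psi x) = r * (LINT x|leb S. d1 x * psi x) + s * (LINT x|leb S. d2 x * psi x)" by simp
 have "(LINT x|leb S. (d3 x - (r * d1 x + s * d2 x)) * psi x)
 = (LINT x|leb S. d3 x * psi x - (r * (d1 x * psi x) + s * (d2 x * psi x)))" by (rule bi_integral_cong[OF refl]) (simp add: algebra_simps)
 also have "... = (LINT x|leb S. d3 x * psi x) - (LINT x|leb S. r * (d1 x * psi x) + s * (d2 x * psi x))"
 by (rule bi_integral_diff) (use ipsi[OF w1(2)] ipsi[OF w2(2)] ipsi[OF w3(2)] in auto)
 also have "(LINT x|leb S. r * (d1 x * psi x) + s * (d2 x * psi x)) = r * (LINT x|leb S. d1 x * psi x) + s * (LINT x|leb S. d2 x * psi x)"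
 using ipsi[OF w1(2)] ipsi[OF w2(2)] by (subst bi_integral_add) auto
 finally show "(LINT x|leb S. (d3 x - (r * d1 x + s * d2 x)) * psi x) = 0" using e by simp qed
 thus ?thesis by (rule eventually_mono) simp qed

locale weighted_forms = moving_coefficient \<Omega> T \<Omega>1 \<Omega>2 \<Phi> v \<alpha> \<alpha>0 + gelfand_embedding \<Omega> emb
 for \<Omega> :: "(real^'n) set" and T :: real
 and \<Omega>1 \<Omega>2 :: "real => (real^'n) set"
 and \<Phi> v :: "(real^'n) \<times> real => real^'n"
 and \<alpha> :: "(real^'n) \<times> real => real" and \<alpha>0 :: real
 and emb :: "'v::{real_inner, complete_space} => real^'n => real" +
 fixes d\<alpha> :: "(real^'n) \<times> real => ((real^'n) \<times> real) \<Rightarrow>\<^sub>L real"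
 and dv :: "(real^'n) \<times> real => ((real^'n) \<times> real) \<Rightarrow>\<^sub>L (real^'n)" and M :: real
 assumes M: "0 <= M"
 and d_continuous: "continuous_on (phase \<Omega>1 \<union> phase \<Omega>2) d\<alpha>" "continuous_on (phase \<Omega>1 \<union> phase \<Omega>2) dv"
 and regular: "ALL p:phase \<Omega>1 \<union> phase \<Omega>2. (\<alpha> has_derivative bapp (d\<alpha> p)) (at p) &
 (v has_derivative bapp (dv p)) (at p) &
 \<bar>\<alpha> p\<bar> <= M & norm (v p) <= M & norm (d\<alpha> p) <= M & norm (dv p) <= M"
begin

abbreviation (input) "\<L> \<equiv> lebesgue_on \<Omega>"

definition U :: "real => (real^'n) set" where "U t = \<Omega>1 t \<union> \<Omega>2 t"

definition c :: "real => real^'n => real^'n" where "c t x = \<alpha> (x, t) *\<^sub>R v (x, t)"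

definition dc :: "real => real^'n => real^'n => real^'n" where
 "dc t x h = \<alpha> (x, t) *\<^sub>R dv (x, t) (h, 0) + d\<alpha> (x, t) (h, 0) *\<^sub>R v (x, t)"

definition gr :: "'v => real^'n => real^'n" where "gr w = weak_gradient Om (emb w)"

text \<open>The product rule for the divergence of alpha w z v, with c = alpha v and
  \<open>dc\<close> its derivative. Unlike the divergence obtained by choice, it admits pointwise
  bounds.\<close>

definition flux :: "'v => 'v => real => real^'n => real" where
 "flux w z t x = (\<Sum>b\<in>Basis. emb w x * emb z x * (dc t x b \<bullet> b)
 + (c t x \<bullet> b) * (emb w x * (gr z x \<bullet> b) + emb z x * (gr w x \<bullet> b)))"

definition dens :: "'v => 'v => real => real^'n => real" where
 "dens w z t x = emb w x * emb z x * d\<alpha> (x, t) (0, 1) + flux w z t x"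

definition m :: "real => 'v => 'v => real" where
 "m t w z = (LINT x|\<L>. \<alpha> (x, t) * emb w x * emb z x)"

text \<open>Stated with the chosen divergence, to match the weighted distribution literally;
  \<open>a_integrand\<close> passes to the explicit \<open>dens\<close>.\<close>

definition a :: "real => 'v => 'v => real" where
 "a t w z = (LINT x|\<L>. emb w x * emb z x * dt \<alpha> x t + flux_div \<Omega>1 \<Omega>2 v \<alpha> t (emb w) (emb z) x)"

lemma \<Omega>_sets: "Om : sets lebesgue" "bounded Om" using open_domains(1) lipschitz_domainD(2)[OF domain] by auto

lemma U:
 assumes "t : J" shows "open (U t)" "U t <= Om" "bounded (U t)" "U t : sets lebesgue" "negligible (Om - U t)"
proof -
 have t: "t : {0..T}" using assms by auto
 show o: "open (U t)" unfolding U_def by (intro open_Un open_domains t)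
 show s: "U t <= Om" unfolding U_def using decomposition[OF t] by blast
 show "bounded (U t)" by (rule bounded_subset[OF \<Omega>_sets(2) s])
 show "U t : sets lebesgue" using o by simp
 show "negligible (Om - U t)" by (rule negligible_subset[OF interface_negligible[OF t]]) (use decomposition[OF t] in "auto simp: U_def") qed

lemma restrict_U:
 fixes f :: "real^'n => real"
 assumes "t : J" shows "f : bmeas (leb (U t)) \<longleftrightarrow> f : bmeas \<L>"
 "integrable (leb (U t)) f \<longleftrightarrow> integrable \<L> f"
 "(LINT x|leb (U t). f x) = (LINT x|\<L>. f x)" using leb_negligible_diff[OF \<Omega>_sets(1) U(4)[OF assms] U(2)[OF assms] U(5)[OF assms], of f] .

lemma AE_U: "t : J ==> AE x in lebesgue. x : Om --> x : U t"
proof -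
 assume t: "t : J"
 have "AE x in lebesgue. x ~: Om - U t" by (rule AE_not_in) (use U(5)[OF t] in "simp add: negligible_iff_null_sets")
 thus ?thesis by (rule eventually_mono) blast qed

lemma in_phase: "t : J ==> x : U t ==> (x, t) : phase \<Omega>1 \<union> phase \<Omega>2" by (auto simp: U_def phase_def)

lemma regularU:
 assumes "t : J" "x : U t" shows "(\<alpha> has_derivative bapp (d\<alpha> (x, t))) (at (x, t))" "(v has_derivative bapp (dv (x, t))) (at (x, t))"
 "abs(\<alpha> (x, t)) <= M" "norm (v (x, t)) <= M" "norm (d\<alpha> (x, t)) <= M" "norm (dv (x, t)) <= M" using regular in_phase[OF assms] by blast+

lemma slice_derivative:
 fixes f :: "(real^'n) \<times> real => 'b::real_normed_vector"
 assumes "(f has_derivative f') (at (x, t))" shows "((%x. f (x, t)) has_derivative (%h. f' (h, 0))) (at x)"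
proof (rule has_derivative_compose[of "%x. (x, t)" "%h. (h, 0)"])
 show "((%x. (x, t)) has_derivative (%h. (h, 0))) (at x)" by (auto intro!: derivative_eq_intros) qed (rule assms)

lemma slice_continuous:
 assumes t: "t : J" shows "continuous_on (U t) (%x. \<alpha> (x, t))" "continuous_on (U t) (%x. v (x, t))"
 "continuous_on (U t) (%x. d\<alpha> (x, t) h)" "continuous_on (U t) (%x. dv (x, t) h)"
proof -
 show "continuous_on (U t) (%x. \<alpha> (x, t))" "continuous_on (U t) (%x. v (x, t))"
 using has_derivative_continuous[OF slice_derivative[OF regularU(1)[OF t]]] has_derivative_continuous[OF slice_derivative[OF regularU(2)[OF t]]]
 by (auto intro!: continuous_at_imp_continuous_on)
 have s: "(%x. (x, t)) ` U t <= phase \<Omega>1 \<union> phase \<Omega>2" using in_phase[OF t] by blast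
 have p: "continuous_on (U t) (%x. (x, t))" by (intro continuous_intros)
 show "continuous_on (U t) (%x. d\<alpha> (x, t) h)" "continuous_on (U t) (%x. dv (x, t) h)"
 by (intro blinfun.continuous_on continuous_on_const continuous_on_compose2[OF d_continuous(1) p s] continuous_on_compose2[OF d_continuous(2) p s])+ qed

lemma c_derivative: "t : J ==> x : U t ==> (c t has_derivative dc t x) (at x)"
 unfolding c_def[abs_def] dc_def[abs_def] by (intro has_derivative_scaleR slice_derivative regularU)

lemma c_continuous:
 assumes t: "t : J" shows "continuous_on (U t) (%x. c t x \<bullet> b)" "continuous_on (U t) (%x. dc t x h \<bullet> b)" unfolding c_def dc_def
 by (intro continuous_on_inner continuous_on_add continuous_on_scaleR continuous_on_const slice_continuous t)+

lemma c_bound: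
 assumes t: "t : J" and x: "x : U t" and b: "b : Basis" shows "abs(c t x \<bullet> b) <= M * M" "abs(dc t x b \<bullet> b) <= 2 * (M * M)" "abs(d\<alpha> (x, t) (0, 1)) <= M"
proof -
 note r = regularU[OF t x]
 have nb: "norm (b, 0::real) = 1" using b by (simp add: norm_Pair)
 have cM: "norm (\<alpha> (x, t) *\<^sub>R v (x, t)) <= M * M" using r M by (simp add: mult_mono)
 thus "abs(c t x \<bullet> b) <= M * M" unfolding c_def using Basis_le_norm[OF b] order_trans by blast
 have "norm (dv (x, t) (b, 0)) <= M" using norm_blinfun[of "dv (x, t)" "(b, 0)"] nb r(6) by simp
 hence 1: "norm (\<alpha> (x, t) *\<^sub>R dv (x, t) (b, 0)) <= M * M" using r M by (simp add: mult_mono)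
 have "abs(d\<alpha> (x, t) (b, 0)) <= M" using norm_blinfun[of "d\<alpha> (x, t)" "(b, 0)"] nb r(5) by simp
 hence 2: "norm (d\<alpha> (x, t) (b, 0) *\<^sub>R v (x, t)) <= M * M" using r M by (simp add: mult_mono)
 have "norm (dc t x b) <= 2 * (M * M)"
 unfolding dc_def using norm_triangle_ineq[of "\<alpha> (x, t) *\<^sub>R dv (x, t) (b, 0)" "d\<alpha> (x, t) (b, 0) *\<^sub>R v (x, t)"] 1 2 by linarith
 thus "abs(dc t x b \<bullet> b) <= 2 * (M * M)" using Basis_le_norm[OF b] order_trans by blast
 show "abs(d\<alpha> (x, t) (0, 1)) <= M" using norm_blinfun[of "d\<alpha> (x, t)" "(0, 1)"] r(5) by (simp add: norm_Pair) qed

lemma L2_norm_eq: "L2_norm Om f = nrm2 \<L> f" by (simp add: L2_norm_def L2_inner_def nrm2_def power2_eq_square)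

lemma L2_sqint: "f : L2 Om \<longleftrightarrow> sqint \<L> f" by (simp add: L2_def sqint_def)

lemma gr: "(ALL i. (%x. gr w x $ i) : L2 Om) & is_weak_gradient Om (emb w) (gr w)"
proof -
 have "EX g. (ALL i. (%x. g x $ i) : L2 Om) & is_weak_gradient Om (emb w) g" using emb_H1[of w] by (simp add: H1_def)
 from someI_ex[OF this] show ?thesis unfolding gr_def weak_gradient_def . qed

lemma emb_sqint: "sqint \<L> (emb w)" using emb_H1[of w] by (simp add: H1_def L2_sqint)

lemma gr_sqint: "b : Basis ==> sqint \<L> (%x. gr w x \<bullet> b)"
proof -
 assume "b : Basis"
 then obtain i where "b = axis i 1" by (auto simp: Basis_vec_def)
 thus ?thesis using gr[of w] by (simp add: inner_axis L2_sqint) qed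

lemma gr_wderiv: "b : Basis ==> wderiv Om b (emb w) (%x. gr w x \<bullet> b)"
proof -
 assume "b : Basis"
 then obtain i where "b = axis i 1" by (auto simp: Basis_vec_def)
 thus ?thesis using gr[of w] by (simp add: inner_axis wderiv_def is_weak_gradient_def grad_def) qed

lemma sqint_U: "t : J ==> sqint (leb (U t)) f \<longleftrightarrow> sqint \<L> f" using restrict_U(1)[of t f] restrict_U(2)[of t "%x. (f x)\<^sup>2"] by (simp add: sqint_def)

lemma wderiv_U:
 assumes t: "t : J" shows "wderiv Om b f g ==> wderiv (U t) b f g" unfolding wderiv_def restrict_U(3)[OF t] using test_functions_mono[OF U(2)[OF t]] by blast

lemma emb_bound: "EX C>=0. ALL w. nrm2 \<L> (emb w) <= C * norm w &
 (ALL b:Basis. nrm2 \<L> (%x. gr w x \<bullet> b) <= C * norm w)"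
proof -
 obtain C where C: "!!w. H1_norm Om (emb w) <= C * norm w" using emb_continuous by blast
 have "H1_norm Om (emb w) <= abs(C) * norm w" for w using order_trans[OF C[of w] mult_right_mono[OF abs_ge_self norm_ge_zero]] .
 moreover have "nrm2 \<L> (emb w) <= H1_norm Om (emb w)" for w unfolding H1_norm_def L2_norm_eq by (rule real_le_rsqrt) (simp add: sum_nonneg)
 moreover have "nrm2 \<L> (%x. gr w x \<bullet> b) <= H1_norm Om (emb w)" if b: "b : Basis" for w b
 proof -
 obtain i where i: "b = axis i 1" using b by (auto simp: Basis_vec_def)
 have "(nrm2 \<L> (%x. gr w x $ i))\<^sup>2 <= (\<Sum>i\<in>UNIV. (nrm2 \<L> (%x. gr w x $ i))\<^sup>2)" by (rule member_le_sum) auto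
 thus ?thesis unfolding H1_norm_def L2_norm_eq gr_def[symmetric] i by (intro real_le_rsqrt) (simp add: inner_axis add_increasing) qed
 ultimately show ?thesis by (intro exI[of _ "abs(C)"]) (meson abs_ge_zero order_trans) qed

text \<open>A majorant of \<open>dens\<close> that is free of time, obtained by bounding alpha, v
  and their derivatives by M.\<close>

definition dom :: "'v => 'v => real^'n => real" where
 "dom w z x = M * \<bar>emb w x * emb z x\<bar> + (\<Sum>b\<in>Basis. 2 * (M * M) * \<bar>emb w x * emb z x\<bar>
 + M * M * (\<bar>emb w x * (gr z x \<bullet> b)\<bar> + \<bar>emb z x * (gr w x \<bullet> b)\<bar>))"

lemma dom_integrable: "integrable \<L> (dom w z)" unfolding dom_def[abs_def]
 by (intro bi_integrable_add integrable_mult_right bi_integrable_sum integrable_abs sqint_mult emb_sqint gr_sqint)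

lemma dom_bound: "EX C>=0. ALL w z. (LINT x|\<L>. dom w z x) <= C * norm w * norm z &
 (LINT x|\<L>. M * \<bar>emb w x * emb z x\<bar>) <= C * norm w * norm z"
proof -
 obtain C where C: "0 <= C" "!!w. nrm2 \<L> (emb w) <= C * norm w"
 "!!w b. b : Basis ==> nrm2 \<L> (%x. gr w x \<bullet> b) <= C * norm w" using emb_bound by blast
 have prod: "(LINT x|\<L>. abs(f x * g x)) <= C * C * norm w * norm z"
 if "sqint \<L> f" "sqint \<L> g" "nrm2 \<L> f <= C * norm w" "nrm2 \<L> g <= C * norm z"
 for f g :: "real^'n => real" and w z :: 'v
 proof -
 have "(LINT x|\<L>. abs(f x * g x)) <= nrm2 \<L> f * nrm2 \<L> g" by (rule sqint_cauchy_schwarz) (use that in auto)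
 also have "... <= (C * norm w) * (C * norm z)" by (intro mult_mono that) (use C(1) in auto)
 finally show ?thesis by (simp add: mult_ac) qed
 define n where "n = real (card (Basis :: (real^'n) set))"
 \<comment> \<open>Each basis direction contributes 2 M^2 from the zero-order term and 2 M^2 from
   the two gradient terms.\<close>
 define C' where "C' = (M + n * (4 * (M * M))) * (C * C)"
 have n: "0 <= n" by (simp add: n_def)
 have "(LINT x|\<L>. dom w z x) <= C' * norm w * norm z & (LINT x|\<L>. M * abs(emb w x * emb z x)) <= C' * norm w * norm z" for w z
 proof -
 define P where "P = C * C * norm w * norm z"
 have i: "integrable \<L> (%x. abs(emb w x * emb z x))"
 "!!b w z. b : Basis ==> integrable \<L> (%x. abs(emb w x * (gr z x \<bullet> b)))" by (intro integrable_abs sqint_mult emb_sqint gr_sqint; assumption?)+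
 have p1: "(LINT x|\<L>. abs(emb w x * emb z x)) <= P" unfolding P_def by (intro prod emb_sqint C)
 have p2: "(LINT x|\<L>. abs(emb w x * (gr z x \<bullet> b))) <= P" if "b : Basis" for b unfolding P_def by (intro prod emb_sqint gr_sqint C that)
 have p3: "(LINT x|\<L>. abs(emb z x * (gr w x \<bullet> b))) <= P" if "b : Basis" for b
 proof -
 have "(LINT x|\<L>. abs(emb z x * (gr w x \<bullet> b))) <= C * C * norm z * norm w" by (intro prod emb_sqint gr_sqint C that)
 thus ?thesis by (simp add: P_def mult_ac) qed
 have P0: "0 <= P" unfolding P_def using C(1) by simp
 have "(LINT x|\<L>. dom w z x) = M * (LINT x|\<L>. \<bar>emb w x * emb z x\<bar>)
 + (\<Sum>b\<in>Basis. 2 * (M * M) * (LINT x|\<L>. \<bar>emb w x * emb z x\<bar>)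
 + M * M * ((LINT x|\<L>. \<bar>emb w x * (gr z x \<bullet> b)\<bar>) + (LINT x|\<L>. \<bar>emb z x * (gr w x \<bullet> b)\<bar>)))" unfolding dom_def
 by (subst bi_integral_add, (intro integrable_mult_right i bi_integrable_sum bi_integrable_add; assumption)+,
 subst bi_integral_sum, (intro integrable_mult_right i bi_integrable_add; assumption)+)
 (use i in "simp cong: sum.cong")
 also have "... <= M * P + (\<Sum>b\<in>(Basis :: (real^'n) set). 2 * (M * M) * P + M * M * (P + P))" by (intro add_mono mult_left_mono sum_mono p1 p2 p3) (use M in auto)
 also have "... = C' * norm w * norm z" by (simp add: C'_def n_def P_def algebra_simps)
 finally have 1: "(LINT x|\<L>. dom w z x) <= C' * norm w * norm z" .
 have "(LINT x|\<L>. M * abs(emb w x * emb z x)) <= M * P" using p1 M by (simp add: mult_left_mono)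
 also have "... <= (M + n * (4 * (M * M))) * P" using n M P0 by (intro mult_right_mono) auto
 also have "... = C' * norm w * norm z" by (simp add: C'_def P_def mult_ac)
 finally show ?thesis using 1 by blast qed
 moreover have "0 <= C'" unfolding C'_def using n M C(1) by simp
 ultimately show ?thesis by blast qed

lemma dens_bound:
 assumes t: "t : J" and x: "x : U t" shows "abs(dens w z t x) <= dom w z x" "abs(flux w z t x) <= dom w z x"
proof -
 have f: "abs(flux w z t x) <= (\<Sum>b\<in>Basis. 2 * (M * M) * abs(emb w x * emb z x) + M * M * (abs(emb w x * (gr z x \<bullet> b)) + abs(emb z x * (gr w x \<bullet> b))))"
 unfolding flux_def
 proof (rule order_trans[OF sum_abs sum_mono])
 fix b :: "real^'n" assume b: "b : Basis"
 have 1: "abs(emb w x * emb z x * (dc t x b \<bullet> b)) <= 2 * (M * M) * abs(emb w x * emb z x)"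
 unfolding abs_mult[of _ "dc t x b \<bullet> b"] using mult_left_mono[OF c_bound(2)[OF t x b], of "abs(emb w x * emb z x)"] by (simp add: mult.commute)
 have "abs(emb w x * (gr z x \<bullet> b) + emb z x * (gr w x \<bullet> b)) <= abs(emb w x * (gr z x \<bullet> b)) + abs(emb z x * (gr w x \<bullet> b))"
 by (rule abs_triangle_ineq)
 hence 2: "abs((c t x \<bullet> b) * (emb w x * (gr z x \<bullet> b) + emb z x * (gr w x \<bullet> b))) <= M * M * (abs(emb w x * (gr z x \<bullet> b)) + abs(emb z x * (gr w x \<bullet> b)))"
 unfolding abs_mult[of "c t x \<bullet> b"] using c_bound(1)[OF t x b] by (intro mult_mono) (use M in auto)
 show "\<bar>emb w x * emb z x * (dc t x b \<bullet> b) + (c t x \<bullet> b) * (emb w x * (gr z x \<bullet> b) + emb z x * (gr w x \<bullet> b))\<bar>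
 <= 2 * (M * M) * \<bar>emb w x * emb z x\<bar> + M * M * (\<bar>emb w x * (gr z x \<bullet> b)\<bar> + \<bar>emb z x * (gr w x \<bullet> b)\<bar>)"
 by (rule order_trans[OF abs_triangle_ineq add_mono[OF 1 2]]) qed
 have g: "abs(emb w x * emb z x * d\<alpha> (x, t) (0, 1)) <= M * abs(emb w x * emb z x)"
 unfolding abs_mult[of _ "d\<alpha> (x, t) (0, 1)"] using mult_left_mono[OF c_bound(3)[OF t x SOME_Basis], of "abs(emb w x * emb z x)"] by (simp add: mult.commute)
 show "abs(dens w z t x) <= dom w z x" unfolding dens_def dom_def by (rule order_trans[OF abs_triangle_ineq add_mono[OF g f]])
 show "abs(flux w z t x) <= dom w z x" unfolding dom_def using f M by (simp add: add_increasing) qed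

lemma dens_measurable:
 assumes t: "t : J" shows "flux w z t : bmeas \<L>" "dens w z t : bmeas \<L>"
 "(%x. \<alpha> (x, t)) : bmeas \<L>"
proof -
 have cm: "f : bmeas \<L>" if "continuous_on (U t) f" for f :: "real^'n => real"
 using continuous_imp_measurable_on_sets_lebesgue[OF that U(4)[OF t]] restrict_U(1)[OF t] by blast
 have e: "emb w : bmeas \<L>" for w using emb_sqint[of w] by (simp add: sqint_def)
 have g: "(%x. gr w x \<bullet> b) : bmeas \<L>" if "b : Basis" for w b using gr_sqint[OF that, of w] by (simp add: sqint_def)
 show f: "flux w z t : bmeas \<L>" unfolding flux_def[abs_def] by (intro borel_measurable_sum borel_measurable_add borel_measurable_times e g cm c_continuous t)
 show "dens w z t : bmeas \<L>" unfolding dens_def[abs_def] by (intro borel_measurable_add borel_measurable_times e f cm slice_continuous t)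
 show "(%x. \<alpha> (x, t)) : bmeas \<L>" by (intro cm slice_continuous t) qed

lemma dens_integrable:
 assumes t: "t : J" shows "integrable \<L> (flux w z t)" "integrable \<L> (dens w z t)"
proof -
 have ae: "AE x in \<L>. x : U t" using AE_U[OF t] by (simp add: AE_restrict_space_iff \<Omega>_sets)
 have 1: "AE x in \<L>. norm (flux w z t x) <= norm (dom w z x)" using ae
 proof eventually_elim
 case (elim x)
 show ?case unfolding real_norm_def by (rule order_trans[OF dens_bound(2)[OF t elim] abs_ge_self]) qed
 have 2: "AE x in \<L>. norm (dens w z t x) <= norm (dom w z x)" using ae
 proof eventually_elim
 case (elim x)
 show ?case unfolding real_norm_def by (rule order_trans[OF dens_bound(1)[OF t elim] abs_ge_self]) qed
 show "integrable \<L> (flux w z t)" by (rule bi_integrable_bound[OF dom_integrable dens_measurable(1)[OF t] 1])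
 show "integrable \<L> (dens w z t)" by (rule bi_integrable_bound[OF dom_integrable dens_measurable(2)[OF t] 2]) qed

lemma flux_weak_divergence:
 assumes t: "t : J" shows "is_weak_divergence (U t) (%x. (\<alpha> (x, t) * emb w x * emb z x) *\<^sub>R v (x, t)) (flux w z t)" unfolding is_weak_divergence_def
proof (intro conjI allI impI ballI)
 fix K assume K: "compact K & K <= U t"
 show "integrable (leb K) (flux w z t)" by (rule int_leb_subset[OF dens_integrable(1)[OF t] \<Omega>_sets(1) compact_sets_leb]) (use K U(2)[OF t] in auto)
next
 fix psi assume psi: "psi : test_functions (U t)"
 have F: "((\<alpha> (x, t) * emb w x * emb z x) *\<^sub>R v (x, t)) \<bullet> grad psi x
 = (\<Sum>b\<in>Basis. (emb w x * emb z x * (c t x \<bullet> b)) * fderiv psi (at x) b)" for x unfolding inner_grad by (intro sum.cong refl) (simp add: c_def)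
 have sq: "sqint (leb (U t)) (emb w)" "b : Basis ==> sqint (leb (U t)) (%x. gr w x \<bullet> b)" for w b unfolding sqint_U[OF t] by (rule emb_sqint, rule gr_sqint)
 show "(LINT x|leb (U t). ((\<alpha> (x, t) * emb w x * emb z x) *\<^sub>R v (x, t)) \<bullet> grad psi x)
 = - (LINT x|leb (U t). flux w z t x * psi x)" unfolding F flux_def
 by (rule weak_divergence_product[where c="c t" and c'="dc t", OF U(1)[OF t] U(3)[OF t] c_derivative[OF t] c_continuous(2)[OF t]
 sq(1) sq(2) wderiv_U[OF t gr_wderiv] sq(1) sq(2) wderiv_U[OF t gr_wderiv] psi]) qed

text \<open>\<open>flux\<close> witnesses that a weak divergence exists, so the chosen one is a weak
  divergence too, and uniqueness identifies them almost everywhere.\<close>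

lemma flux_div_AE:
 assumes t: "t : J" shows "AE x in lebesgue. x : Om --> emb w x * emb z x * dt \<alpha> x t + flux_div \<Omega>1 \<Omega>2 v \<alpha> t (emb w) (emb z) x = dens w z t x"
proof -
 have "is_weak_divergence (U t) (%x. (\<alpha> (x, t) * emb w x * emb z x) *\<^sub>R v (x, t)) (flux_div \<Omega>1 \<Omega>2 v \<alpha> t (emb w) (emb z))"
 unfolding flux_div_def weak_divergence_def U_def[symmetric]
 by (rule someI[of "is_weak_divergence (U t) (%x. (\<alpha> (x, t) * emb w x * emb z x) *\<^sub>R v (x, t))", OF flux_weak_divergence[OF t]])
 from weak_divergence_unique[OF U(1)[OF t] this flux_weak_divergence[OF t]] AE_U[OF t]
 show ?thesis
 proof eventually_elim
 case (elim x)
 have "dt \<alpha> x t = d\<alpha> (x, t) (0, 1)" if x: "x : U t"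
 proof -
 have d: "((%s. \<alpha> (x, s)) has_derivative (%h. d\<alpha> (x, t) (0, h))) (at t)"
 proof (rule has_derivative_compose[of "%s. (x, s)" "%h. (0, h)"])
 show "((%s. (x, s)) has_derivative (%h. (0, h))) (at t)" by (auto intro!: derivative_eq_intros) qed (rule regularU(1)[OF t x])
 have "(%h. d\<alpha> (x, t) (0, h)) = (*) (d\<alpha> (x, t) (0, 1))"
 proof
 fix h
 have "(0, h) = h *\<^sub>R (0 :: real^'n, 1 :: real)" by simp
 thus "d\<alpha> (x, t) (0, h) = d\<alpha> (x, t) (0, 1) * h" by (simp only: blinfun.scaleR_right real_scaleR_def mult.commute) qed
 with d have "((%s. \<alpha> (x, s)) has_real_derivative d\<alpha> (x, t) (0, 1)) (at t)" by (simp only: has_field_derivative_def)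
 thus ?thesis unfolding dt_def by (rule DERIV_imp_deriv) qed
 thus ?case using elim by (simp add: dens_def) qed qed

lemma a_integrand:
 assumes t: "t : J" shows "(%x. emb w x * emb z x * dt \<alpha> x t + flux_div \<Omega>1 \<Omega>2 v \<alpha> t (emb w) (emb z) x) : bmeas \<L>"
 "integrable \<L> (%x. emb w x * emb z x * dt \<alpha> x t + flux_div \<Omega>1 \<Omega>2 v \<alpha> t (emb w) (emb z) x)"
 "a t w z = (LINT x|\<L>. dens w z t x)"
proof -
 have ae: "AE x in \<L>. dens w z t x = emb w x * emb z x * dt \<alpha> x t + flux_div \<Omega>1 \<Omega>2 v \<alpha> t (emb w) (emb z) x"
 proof -
 have "AE x in \<L>. emb w x * emb z x * dt \<alpha> x t + flux_div \<Omega>1 \<Omega>2 v \<alpha> t (emb w) (emb z) x = dens w z t x"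
 using flux_div_AE[OF t, of w z] by (simp add: AE_restrict_space_iff \<Omega>_sets)
 thus ?thesis by (rule eventually_mono) (rule sym) qed
 show me: "(%x. emb w x * emb z x * dt \<alpha> x t + flux_div \<Omega>1 \<Omega>2 v \<alpha> t (emb w) (emb z) x) : bmeas \<L>"
 proof (rule measurable_AE_limit[OF \<Omega>_sets(1), where f="%n. dens w z t"])
 show "dens w z t : bmeas \<L>" by (rule dens_measurable(2)[OF t])
 show "AE x in \<L>. (%n. dens w z t x) ----> emb w x * emb z x * dt \<alpha> x t + flux_div \<Omega>1 \<Omega>2 v \<alpha> t (emb w) (emb z) x"
 by (rule eventually_mono[OF ae]) (simp only: tendsto_const) qed
 show "integrable \<L> (%x. emb w x * emb z x * dt \<alpha> x t + flux_div \<Omega>1 \<Omega>2 v \<alpha> t (emb w) (emb z) x)"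
 by (rule integrable_cong_AE_imp[OF dens_integrable(2)[OF t] me ae])
 show "a t w z = (LINT x|\<L>. dens w z t x)" unfolding a_def by (rule integral_leb_cong_AE[OF \<Omega>_sets(1) me dens_measurable(2)[OF t] flux_div_AE[OF t]]) qed

lemma m_integrable:
 assumes t: "t : J" shows "integrable \<L> (%x. \<alpha> (x, t) * emb w x * emb z x)"
 "AE x in \<L>. abs(\<alpha> (x, t) * emb w x * emb z x) <= M * abs(emb w x * emb z x)"
proof -
 have ae: "AE x in \<L>. x : U t" using AE_U[OF t] by (simp add: AE_restrict_space_iff \<Omega>_sets)
 show b: "AE x in \<L>. abs(\<alpha> (x, t) * emb w x * emb z x) <= M * abs(emb w x * emb z x)" using ae
 proof eventually_elim
 case (elim x)
 thus ?case using mult_right_mono[OF regularU(3)[OF t elim], of "abs(emb w x * emb z x)"] by (simp add: abs_mult mult.assoc) qed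
 show "integrable \<L> (%x. \<alpha> (x, t) * emb w x * emb z x)"
 proof (rule bi_integrable_bound)
 show "integrable \<L> (%x. M * abs(emb w x * emb z x))" by (intro integrable_mult_right integrable_abs sqint_mult emb_sqint)
 show "(%x. \<alpha> (x, t) * emb w x * emb z x) : bmeas \<L>"
 using emb_sqint[of w] emb_sqint[of z] by (intro borel_measurable_times dens_measurable(3)[OF t]) (simp_all add: sqint_def)
 show "AE x in \<L>. norm (\<alpha> (x, t) * emb w x * emb z x) <= norm (M * abs(emb w x * emb z x))" using b by eventually_elim (use M in simp) qed qed

lemma forms_sym: "m t w z = m t z w" "a t w z = a t z w"
proof -
 have e: "\<alpha> (x, t) * emb w x * emb z x = \<alpha> (x, t) * emb z x * emb w x" "emb w x * emb z x = emb z x * emb w x" for x by (simp_all add: mult_ac)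
 have f: "(%x. (\<alpha> (x, t) * emb w x * emb z x) *\<^sub>R v (x, t)) = (%x. (\<alpha> (x, t) * emb z x * emb w x) *\<^sub>R v (x, t))"
 by (rule ext) (subst e(1), rule refl)
 show "m t w z = m t z w" unfolding m_def by (rule bi_integral_cong[OF refl e(1)])
 show "a t w z = a t z w" unfolding a_def flux_div_def f by (rule bi_integral_cong[OF refl]) (subst e(2), rule refl) qed

lemma forms_linear:
 assumes t: "t : J" shows "m t (r *\<^sub>R w + s *\<^sub>R w') z = r * m t w z + s * m t w' z"
 "a t (r *\<^sub>R w + s *\<^sub>R w') z = r * a t w z + s * a t w' z"
proof -
 have ae: "AE x in lebesgue. x : Om --> emb (r *\<^sub>R w + s *\<^sub>R w') x = r * emb w x + s * emb w' x"
 using emb_linear[of r w s w'] by (simp add: AE_restrict_space_iff \<Omega>_sets)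
 have aeg: "AE x in lebesgue. ALL b:Basis. x : Om --> gr (r *\<^sub>R w + s *\<^sub>R w') x \<bullet> b = r * (gr w x \<bullet> b) + s * (gr w' x \<bullet> b)"
 by (rule AE_finite_allI[OF finite_Basis]) (intro wderiv_linear[OF open_domains(1) \<Omega>_sets(2) _ emb_sqint gr_sqint gr_wderiv emb_sqint gr_sqint gr_wderiv emb_sqint gr_sqint gr_wderiv ae]; assumption)
 have e: "m t (r *\<^sub>R w + s *\<^sub>R w') z = (LINT x|\<L>. r * (\<alpha> (x, t) * emb w x * emb z x) + s * (\<alpha> (x, t) * emb w' x * emb z x))" unfolding m_def
 proof (rule integral_leb_cong_AE[OF \<Omega>_sets(1)])
 show "(%x. r * (\<alpha> (x, t) * emb w x * emb z x) + s * (\<alpha> (x, t) * emb w' x * emb z x)) : bmeas \<L>"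
 by (intro borel_measurable_integrable bi_integrable_add integrable_mult_right m_integrable t)
 show "AE x in lebesgue. x : Om --> \<alpha> (x, t) * emb (r *\<^sub>R w + s *\<^sub>R w') x * emb z x = r * (\<alpha> (x, t) * emb w x * emb z x) + s * (\<alpha> (x, t) * emb w' x * emb z x)"
 using ae by eventually_elim (simp add: algebra_simps) qed (rule borel_measurable_integrable[OF m_integrable(1)[OF t]])
 show "m t (r *\<^sub>R w + s *\<^sub>R w') z = r * m t w z + s * m t w' z" unfolding e
 by (simp only: m_def bi_integral_add[OF integrable_mult_right[OF m_integrable(1)[OF t]] integrable_mult_right[OF m_integrable(1)[OF t]]] integral_mult_right_zero)
 have "(LINT x|\<L>. dens (r *\<^sub>R w + s *\<^sub>R w') z t x) = (LINT x|\<L>. r * dens w z t x + s * dens w' z t x)"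
 proof (rule integral_leb_cong_AE[OF \<Omega>_sets(1) dens_measurable(2)[OF t]])
 show "(%x. r * dens w z t x + s * dens w' z t x) : bmeas \<L>" by (intro borel_measurable_add borel_measurable_times borel_measurable_const dens_measurable(2)[OF t])
 show "AE x in lebesgue. x : Om --> dens (r *\<^sub>R w + s *\<^sub>R w') z t x = r * dens w z t x + s * dens w' z t x" using ae aeg
 proof eventually_elim
 case (elim x)
 show ?case
 proof
 assume x: "x : Om"
 define w'' where "w'' = r *\<^sub>R w + s *\<^sub>R w'"
 have e: "emb w'' x = r * emb w x + s * emb w' x" using elim(1) x unfolding w''_def by blast
 have g: "gr w'' x \<bullet> b = r * (gr w x \<bullet> b) + s * (gr w' x \<bullet> b)" if "b : Basis" for b using elim(2) x that unfolding w''_def by blast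
 have "flux w'' z t x = (\<Sum>b\<in>Basis. r * (emb w x * emb z x * (dc t x b \<bullet> b)
 + (c t x \<bullet> b) * (emb w x * (gr z x \<bullet> b) + emb z x * (gr w x \<bullet> b)))
 + s * (emb w' x * emb z x * (dc t x b \<bullet> b)
 + (c t x \<bullet> b) * (emb w' x * (gr z x \<bullet> b) + emb z x * (gr w' x \<bullet> b))))" unfolding flux_def
 proof (rule sum.cong[OF refl])
 fix b :: "real^'n" assume "b : Basis"
 show "emb w'' x * emb z x * (dc t x b \<bullet> b) + (c t x \<bullet> b) * (emb w'' x * (gr z x \<bullet> b) + emb z x * (gr w'' x \<bullet> b))
 = r * (emb w x * emb z x * (dc t x b \<bullet> b) + (c t x \<bullet> b) * (emb w x * (gr z x \<bullet> b) + emb z x * (gr w x \<bullet> b)))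
 + s * (emb w' x * emb z x * (dc t x b \<bullet> b) + (c t x \<bullet> b) * (emb w' x * (gr z x \<bullet> b) + emb z x * (gr w' x \<bullet> b)))"
 unfolding e g[OF \<open>b : Basis\<close>] by algebra qed
 also have "... = r * flux w z t x + s * flux w' z t x" unfolding flux_def by (subst sum.distrib) (simp only: sum_distrib_left)
 finally have f: "flux w'' z t x = r * flux w z t x + s * flux w' z t x" .
 have "dens w'' z t x = r * dens w z t x + s * dens w' z t x" unfolding dens_def e f by algebra
 thus "dens (r *\<^sub>R w + s *\<^sub>R w') z t x = r * dens w z t x + s * dens w' z t x" unfolding w''_def . qed qed qed
 thus "a t (r *\<^sub>R w + s *\<^sub>R w') z = r * a t w z + s * a t w' z" unfolding a_integrand(3)[OF t]
 by (simp only: bi_integral_add[OF integrable_mult_right[OF dens_integrable(2)[OF t]] integrable_mult_right[OF dens_integrable(2)[OF t]]] integral_mult_right_zero) qed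

lemma forms_bound: "EX C>=0. ALL t:J. ALL w z. abs(m t w z) <= C * norm w * norm z & abs(a t w z) <= C * norm w * norm z"
proof -
 obtain C where C: "0 <= C" "!!w z. (LINT x|\<L>. dom w z x) <= C * norm w * norm z"
 "!!w z. (LINT x|\<L>. M * abs(emb w x * emb z x)) <= C * norm w * norm z" using dom_bound by blast
 have "abs(m t w z) <= C * norm w * norm z & abs(a t w z) <= C * norm w * norm z" if t: "t : J" for t w z
 proof
 have ae: "AE x in \<L>. x : U t" using AE_U[OF t] by (simp add: AE_restrict_space_iff \<Omega>_sets)
 have "abs(m t w z) <= (LINT x|\<L>. abs(\<alpha> (x, t) * emb w x * emb z x))" unfolding m_def by (rule integral_abs_bound)
 also have "... <= (LINT x|\<L>. M * abs(emb w x * emb z x))" by (rule integral_mono_AE[OF integrable_abs[OF m_integrable(1)[OF t]] _ m_integrable(2)[OF t]])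
 (intro integrable_mult_right integrable_abs sqint_mult emb_sqint)
 finally show "abs(m t w z) <= C * norm w * norm z" using C(3)[of w z] by linarith
 have "abs(a t w z) <= (LINT x|\<L>. abs(dens w z t x))" unfolding a_integrand(3)[OF t] by (rule integral_abs_bound)
 also have "... <= (LINT x|\<L>. dom w z x)"
 by (rule integral_mono_AE[OF integrable_abs[OF dens_integrable(2)[OF t]] dom_integrable]) (use ae in eventually_elim, rule dens_bound(1)[OF t])
 finally show "abs(a t w z) <= C * norm w * norm z" using C(2)[of w z] by linarith qed
 thus ?thesis using C(1) by blast qed

end

section \<open>Reynolds transport\<close>

lemma cutoff_sequence:
 fixes S :: "'a::euclidean_space set"
 assumes S: "open S" shows "EX eta. ALL n::nat. eta n : test_functions S & (ALL x. 0 <= eta n x & eta n x <= 1) & (ALL x:S. \<forall>\<^sub>F n in sequentially. eta n x = 1)"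
proof (rule open_Union_compact_subsets[OF S])
 fix C assume C: "!!n::nat. compact (C n)" "!!n. C n <= S" "!!K. compact K ==> K <= S ==> EX N. ALL n>=N. K <= C n"
 have "EX c. c : test_functions S & (ALL x. 0 <= c x & c x <= 1) & (ALL x:C n. c x = 1)" for n
 proof (rule test_cutoff[OF C(1) C(2) S, of n])
 fix c assume "c : test_functions S" "!!x. 0 <= c x" "!!x. c x <= 1" "!!x. x : C n ==> c x = 1"
 thus ?thesis by (intro exI[of _ c]) simp qed
 then obtain eta where eta: "!!n. eta n : test_functions S & (ALL x. 0 <= eta n x & eta n x <= 1) & (ALL x:C n. eta n x = 1)" by metis
 have "\<forall>\<^sub>F n in sequentially. eta n x = 1" if x: "x : S" for x
 proof -
 obtain N where "!!n. n >= N ==> x : C n" using C(3)[of "{x}"] x by auto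
 hence "ALL n>=N. eta n x = 1" using eta by blast
 thus ?thesis unfolding eventually_sequentially by blast qed
 thus ?thesis using eta by (intro exI[of _ eta]) blast qed

context moving_domains
begin

text \<open>States the facts on transported cut-offs for either phase at once, the second one by
  interchanging the phases.\<close>

lemma transport_facts:
 assumes W: "W = \<Omega>1 \<or> W = \<Omega>2" and eta: "eta : test_functions (W 0)" shows "t : J ==> Ck (Suc 0) (transport eta t)"
 and "t : J ==> EX K. compact K & K <= W t & {x. transport eta t x ~= 0} <= K"
 and "t : J ==> x : Om ==>
 ((%s. transport eta s x) has_real_derivative - fderiv (transport eta t) (at x) (v (x, t))) (at t)"
 and "t : J ==> x : Om ==> x ~: W t ==> \<forall>\<^sub>F s in nhds t. transport eta s x = 0"
 and "0 < s ==> t < T ==> EX B>=0. ALL tau:{s..t}. ALL x:\<Omega>. abs(fderiv (transport eta tau) (at x) (v (x, tau))) <= B"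
 and "t : J ==> y : W t ==> inv\<Phi> t y : W 0"
proof -
 have inv1: "inv\<Phi> t y : W 0" if W': "(%x. \<Phi> (x, t)) ` W 0 = W t" "W 0 <= Om" and t: "t : J" and y: "y : W t" for t y
 proof -
 obtain x where x: "x : W 0" "y = \<Phi> (x, t)" using W'(1) y by blast
 thus ?thesis using inv\<Phi>(3)[OF t in_closure, of x] W'(2) by auto qed
 have W0: "W 0 <= Om" using W decomposition[of 0] T_pos by auto
 interpret sw: moving_domains Om T \<Omega>2 \<Omega>1 \<Phi> v by (rule swap)
 from W have or: "W = \<Omega>1 \<or> W = \<Omega>2" .
 {
 assume t: "t : J"
 show "Ck (Suc 0) (transport eta t)" using or transport_Ck[OF _ t, of eta] sw.transport_Ck[OF _ t, of eta] eta by blast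
 show "EX K. compact K & K <= W t & {x. transport eta t x ~= 0} <= K" using or
 proof
 assume e: "W = \<Omega>1"
 hence eta': "eta : test_functions (\<Omega>1 0)" using eta by simp
 show ?thesis using transport_support[OF eta' t] e by (intro exI conjI) (assumption, simp, blast)
 next
 assume e: "W = \<Omega>2"
 hence eta': "eta : test_functions (\<Omega>2 0)" using eta by simp
 show ?thesis using sw.transport_support[OF eta' t] e by (intro exI conjI) (assumption, simp, blast) qed
 show "inv\<Phi> t y : W 0" if y: "y : W t" by (rule inv1[OF _ W0 t y]) (use or \<Phi>_image_\<Omega>1[OF t] sw.\<Phi>_image_\<Omega>1[OF t] in auto)
 assume x: "x : Om"
 show "((%s. transport eta s x) has_real_derivative - fderiv (transport eta t) (at x) (v (x, t))) (at t)"
 using or transport_time_derivative[OF _ t x, of eta] sw.transport_time_derivative[OF _ t x, of eta] eta by blast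
 show "\<forall>\<^sub>F s in nhds t. transport eta s x = 0" if xW: "x ~: W t" using or
 proof
 assume e: "W = \<Omega>1" show ?thesis by (rule transport_vanishes[OF _ t x]) (use e eta xW in auto)
 next
 assume e: "W = \<Omega>2" show ?thesis by (rule sw.transport_vanishes[OF _ t x]) (use e eta xW in auto) qed
 }
 assume st: "0 < s" "t < T"
 show "EX B>=0. ALL tau:{s..t}. ALL x:\<Omega>. abs(fderiv (transport eta tau) (at x) (v (x, tau))) <= B" using or
 proof
 assume e: "W = \<Omega>1" show ?thesis by (rule transport_time_derivative_bounded[OF _ st]) (use e eta in auto)
 next
 assume e: "W = \<Omega>2" show ?thesis by (rule sw.transport_time_derivative_bounded[OF _ st]) (use e eta in auto) qed qed

end

section \<open>The Reynolds formula for pairs in V\<close>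

context weighted_forms
begin

text \<open>Differentiation under the integral gives the derivative of alpha times the cut-off; the
  transport equation replaces the time derivative of the cut-off by minus v times its gradient, and
  the weak divergence moves that gradient onto alpha w z v.\<close>

lemma localized_reynolds_derivative:
 assumes W: "W = \<Omega>1 \<or> W = \<Omega>2" and eta: "eta : test_functions (W 0)" "!!x. 0 <= eta x" "!!x. eta x <= 1"
 and t0: "t0 : J" shows "((%t. LINT x|\<L>. emb w x * emb z x * (\<alpha> (x, t) * transport eta t x)) has_real_derivative
 (LINT x|\<L>. dens w z t0 x * transport eta t0 x)) (at t0)"
proof -
 note facts = transport_facts[OF W eta(1)]
 define psi where "psi = transport eta"
 define N where "N t = (LINT x|\<L>. emb w x * emb z x * (\<alpha> (x, t) * psi t x))" for t
 \<comment> \<open>Outside the phase alpha need not be differentiable in time, but the cut-off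
   vanishes at all nearby times, so the product has derivative 0.\<close>
 define h' where "h' x t = (if x : W t then d\<alpha> (x, t) (0, 1) * psi t x - \<alpha> (x, t) * fderiv (psi t) (at x) (v (x, t)) else 0)" for x t
 \<comment> \<open>A compact time interval around t0 inside J, on which the time derivative of the
   cut-off is bounded uniformly.\<close>
 define s t where "s = t0 / 2" and "t = (t0 + T) / 2"
 have st: "0 < s" "s < t0" "t0 < t" "t < T" using t0 by (auto simp: s_def t_def)
 have WU: "W tau <= U tau" for tau using W by (auto simp: U_def)
 have psi1: "abs(psi tau x) <= 1" for tau x using eta(2,3) by (simp add: psi_def transport_def)
 obtain B where B: "0 <= B" "!!tau x. tau : {s..t} ==> x : Om ==> abs(fderiv (psi tau) (at x) (v (x, tau))) <= B" using facts(5)[of s t] st unfolding psi_def by blast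
 have psi0: "psi tau x = 0 & fderiv (psi tau) (at x) (v (x, tau)) = 0" if tau: "tau : J" and x: "x : Om" "x ~: W tau" for tau x
 proof -
 have ev: "\<forall>\<^sub>F s in nhds tau. psi s x = 0" unfolding psi_def by (rule facts(4)[OF tau x])
 have "((%s. 0) has_real_derivative - fderiv (psi tau) (at x) (v (x, tau))) (at tau)" using DERIV_cong_ev[OF refl ev refl] facts(3)[OF tau x(1)] by (simp add: psi_def)
 from DERIV_unique[OF this DERIV_const[of 0]] show ?thesis using eventually_nhds_x_imp_x[OF ev] by simp qed
 have dh: "((%r. \<alpha> (x, r) * psi r x) has_real_derivative h' x tau) (at tau)" if tau: "tau : J" and x: "x : Om" for tau x
 proof (cases "x : W tau")
 case True
 hence xU: "x : U tau" using WU by blast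
 have "((%r. \<alpha> (x, r)) has_derivative (%k. d\<alpha> (x, tau) (0, k))) (at tau)"
 proof (rule has_derivative_compose[of "%s. (x, s)" "%h. (0, h)"])
 show "((%s. (x, s)) has_derivative (%h. (0, h))) (at tau)" by (auto intro!: derivative_eq_intros) qed (rule regularU(1)[OF tau xU])
 moreover have "(%k. d\<alpha> (x, tau) (0, k)) = (*) (d\<alpha> (x, tau) (0, 1))"
 proof
 fix k
 have "(0, k) = k *\<^sub>R (0 :: real^'n, 1 :: real)" by simp
 thus "d\<alpha> (x, tau) (0, k) = d\<alpha> (x, tau) (0, 1) * k" by (simp only: blinfun.scaleR_right real_scaleR_def mult.commute) qed
 ultimately have d1: "((%r. \<alpha> (x, r)) has_real_derivative d\<alpha> (x, tau) (0, 1)) (at tau)" by (simp only: has_field_derivative_def)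
 have d2: "((%r. psi r x) has_real_derivative - fderiv (psi tau) (at x) (v (x, tau))) (at tau)" unfolding psi_def by (rule facts(3)[OF tau x])
 show ?thesis using DERIV_mult[OF d1 d2] True by (simp add: h'_def algebra_simps)
 next
 case False
 have ev: "\<forall>\<^sub>F r in nhds tau. \<alpha> (x, r) * psi r x = 0" using facts(4)[OF tau x False] by (rule eventually_mono) (simp add: psi_def)
 show ?thesis using DERIV_cong_ev[OF refl ev refl] False by (simp add: h'_def) qed
 \<comment> \<open>A bound for the time derivative of the product, hence for its difference
   quotients uniformly in x: the majorant for dominated convergence.\<close>
 define D where "D = M + M * B"
 have D0: "0 <= D" using M B(1) by (simp add: D_def)
 have h'b: "abs(h' x tau) <= D" if tau: "tau : {s..t}" and x: "x : Om" for x tau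
 proof (cases "x : W tau")
 case True
 have tauJ: "tau : J" using tau st by auto
 have xU: "x : U tau" using True WU by blast
 have 1: "abs(d\<alpha> (x, tau) (0, 1) * psi tau x) <= M * 1" unfolding abs_mult using c_bound(3)[OF tauJ xU SOME_Basis] psi1[of tau x] M by (intro mult_mono) auto
 have 2: "abs(\<alpha> (x, tau) * fderiv (psi tau) (at x) (v (x, tau))) <= M * B" unfolding abs_mult using regularU(3)[OF tauJ xU] B(2)[OF tau x] M by (intro mult_mono) auto
 have "abs(h' x tau) <= abs(d\<alpha> (x, tau) (0, 1) * psi tau x) + abs(\<alpha> (x, tau) * fderiv (psi tau) (at x) (v (x, tau)))"
 using True by (simp add: h'_def abs_triangle_ineq4)
 thus ?thesis using 1 2 by (simp add: D_def) qed (use D0 in "simp add: h'_def")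
 have lip: "abs(\<alpha> (x, tau) * psi tau x - \<alpha> (x, t0) * psi t0 x) <= D * abs(tau - t0)" if tau: "tau : {s..t}" and x: "x : Om" for x tau
 proof -
 have "norm (\<alpha> (x, tau) * psi tau x - \<alpha> (x, t0) * psi t0 x) <= D * norm (tau - t0)"
 proof (rule field_differentiable_bound[where S="{s..t}" and f="%r. \<alpha> (x, r) * psi r x" and f'="h' x"])
 fix r assume r: "r : {s..t}"
 show "((%r. \<alpha> (x, r) * psi r x) has_field_derivative h' x r) (at r within {s..t})" by (rule has_field_derivative_at_within[OF dh]) (use r st x in auto)
 show "norm (h' x r) <= D" using h'b[OF r x] by simp qed (use tau st in auto)
 thus ?thesis by simp qed
 have wz: "integrable \<L> (%x. emb w x * emb z x)" by (intro sqint_mult emb_sqint)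
 have psim: "psi tau : bmeas \<L>" if "tau : J" for tau unfolding psi_def by (rule cont_measurable_leb(2)[OF Ck_continuous[OF facts(1)[OF that]]])
 have iN: "integrable \<L> (%x. emb w x * emb z x * (\<alpha> (x, tau) * psi tau x))" if tau: "tau : J" for tau
 proof (rule bi_integrable_bound[OF m_integrable(1)[OF tau, of w z]])
 show "(%x. emb w x * emb z x * (\<alpha> (x, tau) * psi tau x)) : bmeas \<L>"
 by (intro borel_measurable_times[OF borel_measurable_integrable[OF wz]] borel_measurable_times[OF dens_measurable(3)[OF tau]] psim tau)
 show "AE x in \<L>. norm (emb w x * emb z x * (\<alpha> (x, tau) * psi tau x)) <= norm (\<alpha> (x, tau) * emb w x * emb z x)"
 proof (rule AE_I2)
 fix x
 have "abs(\<alpha> (x, tau) * emb w x * emb z x) * abs(psi tau x) <= abs(\<alpha> (x, tau) * emb w x * emb z x) * 1" by (rule mult_left_mono[OF psi1]) simp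
 thus "norm (emb w x * emb z x * (\<alpha> (x, tau) * psi tau x)) <= norm (\<alpha> (x, tau) * emb w x * emb z x)" by (simp add: abs_mult mult_ac) qed qed
 have "(%r. (N r - N t0) / (r - t0)) \<midarrow>t0\<rightarrow> (LINT x|\<L>. emb w x * emb z x * h' x t0)"
 proof (subst LIMSEQ_SEQ_conv[symmetric], intro allI impI)
 fix S :: "nat => real" assume S: "(ALL n. S n ~= t0) & S ----> t0"
 have "\<forall>\<^sub>F n in sequentially. S n : {s<..<t}" using S st by (intro topological_tendstoD[of S t0]) auto
 then obtain n0 where n0: "!!n. n >= n0 ==> S n : {s<..<t}" by (auto simp: eventually_sequentially)
 define R where "R n = S (n + n0)" for n
 have R: "R n : {s..t}" "R n : J" "R n ~= t0" for n using n0[of "n + n0"] S st by (auto simp: R_def)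
 have Rl: "R ----> t0" unfolding R_def using S by (intro LIMSEQ_ignore_initial_segment) blast
 have q: "(N (R n) - N t0) / (R n - t0) = (LINT x|\<L>. emb w x * emb z x * ((\<alpha> (x, R n) * psi (R n) x - \<alpha> (x, t0) * psi t0 x) / (R n - t0)))" for n
 proof -
 have "N (R n) - N t0 = (LINT x|\<L>. emb w x * emb z x * (\<alpha> (x, R n) * psi (R n) x) - emb w x * emb z x * (\<alpha> (x, t0) * psi t0 x))"
 unfolding N_def by (rule bi_integral_diff[symmetric]) (intro iN R t0)+
 hence "(N (R n) - N t0) / (R n - t0) = (LINT x|\<L>. (emb w x * emb z x * (\<alpha> (x, R n) * psi (R n) x) - emb w x * emb z x * (\<alpha> (x, t0) * psi t0 x)) / (R n - t0))"
 by simp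
 thus ?thesis by (simp add: right_diff_distrib) qed
 have "(%n. LINT x|\<L>. emb w x * emb z x * ((\<alpha> (x, R n) * psi (R n) x - \<alpha> (x, t0) * psi t0 x) / (R n - t0)))
 ----> (LINT x|\<L>. emb w x * emb z x * h' x t0)"
 proof (rule integral_dominated_convergence[where w="%x. D * abs(emb w x * emb z x)"])
 show "integrable \<L> (%x. D * abs(emb w x * emb z x))" by (intro integrable_mult_right integrable_abs wz)
 show qm: "(%x. emb w x * emb z x * ((\<alpha> (x, R n) * psi (R n) x - \<alpha> (x, t0) * psi t0 x) / (R n - t0))) : bmeas \<L>" for n
 by (intro borel_measurable_times borel_measurable_divide borel_measurable_diff borel_measurable_const borel_measurable_integrable[OF wz] dens_measurable(3) psim R t0
 sqint_def[THEN iffD1, OF emb_sqint, THEN conjunct1])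
 have lim: "(%n. emb w x * emb z x * ((\<alpha> (x, R n) * psi (R n) x - \<alpha> (x, t0) * psi t0 x) / (R n - t0))) ----> emb w x * emb z x * h' x t0"
 if x: "x : Om" for x
 proof (rule tendsto_mult_left)
 have "(%r. (\<alpha> (x, r) * psi r x - \<alpha> (x, t0) * psi t0 x) / (r - t0)) \<midarrow>t0\<rightarrow> h' x t0" using dh[OF t0 x] by (simp add: has_field_derivative_iff)
 from this[unfolded LIMSEQ_SEQ_conv[symmetric]] R(3) Rl
 show "(%n. (\<alpha> (x, R n) * psi (R n) x - \<alpha> (x, t0) * psi t0 x) / (R n - t0)) ----> h' x t0" by blast qed
 thus lim': "AE x in \<L>. (%n. emb w x * emb z x * ((\<alpha> (x, R n) * psi (R n) x - \<alpha> (x, t0) * psi t0 x) / (R n - t0))) ----> emb w x * emb z x * h' x t0"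
 by (intro AE_I2) (simp add: space_restrict_space)
 show "(%x. emb w x * emb z x * h' x t0) : bmeas \<L>" by (rule measurable_AE_limit[OF \<Omega>_sets(1) qm lim'])
 show "AE x in \<L>. norm (emb w x * emb z x * ((\<alpha> (x, R n) * psi (R n) x - \<alpha> (x, t0) * psi t0 x) / (R n - t0))) <= D * abs(emb w x * emb z x)" for n
 proof (rule AE_I2)
 fix x assume "x : space \<L>"
 hence x: "x : Om" by (simp add: space_restrict_space)
 have "abs((\<alpha> (x, R n) * psi (R n) x - \<alpha> (x, t0) * psi t0 x) / (R n - t0)) <= D" using lip[OF R(1)[of n] x] R(3)[of n] by (simp add: pos_divide_le_eq)
 thus "norm (emb w x * emb z x * ((\<alpha> (x, R n) * psi (R n) x - \<alpha> (x, t0) * psi t0 x) / (R n - t0))) <= D * abs(emb w x * emb z x)"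
 unfolding real_norm_def abs_mult[of "emb w x * emb z x"] by (metis mult.commute mult_left_mono abs_ge_zero) qed qed
 hence "(%n. (N (R n) - N t0) / (R n - t0)) ----> (LINT x|\<L>. emb w x * emb z x * h' x t0)" by (simp only: q)
 thus "(%n. (N (S n) - N t0) / (S n - t0)) ----> (LINT x|\<L>. emb w x * emb z x * h' x t0)" unfolding R_def by (rule LIMSEQ_offset) qed
 hence dN: "(N has_real_derivative (LINT x|\<L>. emb w x * emb z x * h' x t0)) (at t0)" by (simp add: has_field_derivative_iff)
 note u = U[OF t0]
 define F where "F b x = emb w x * emb z x * (c t0 x \<bullet> b)" for b x
 have h'U: "emb w x * emb z x * h' x t0 = emb w x * emb z x * d\<alpha> (x, t0) (0, 1) * psi t0 x - (\<Sum>b\<in>Basis. F b x * fderiv (psi t0) (at x) b)"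
 if x: "x : U t0" for x
 proof -
 have h: "h' x t0 = d\<alpha> (x, t0) (0, 1) * psi t0 x - \<alpha> (x, t0) * fderiv (psi t0) (at x) (v (x, t0))" using psi0[OF t0, of x] x u(2) by (auto simp: h'_def)
 interpret l: linear "fderiv (psi t0) (at x)" unfolding psi_def by (rule has_derivative_linear[OF Ck_has_derivative[OF facts(1)[OF t0]]])
 have "fderiv (psi t0) (at x) (v (x, t0)) = fderiv (psi t0) (at x) (\<Sum>b\<in>Basis. (v (x, t0) \<bullet> b) *\<^sub>R b)" by (simp add: euclidean_representation)
 also have "... = (\<Sum>b\<in>Basis. (v (x, t0) \<bullet> b) * fderiv (psi t0) (at x) b)" by (simp only: l.sum l.scale real_scaleR_def)
 finally have "emb w x * emb z x * (\<alpha> (x, t0) * fderiv (psi t0) (at x) (v (x, t0))) = (\<Sum>b\<in>Basis. F b x * fderiv (psi t0) (at x) b)"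
 by (simp add: F_def c_def sum_distrib_left mult_ac)
 thus ?thesis unfolding h by (simp add: algebra_simps) qed
 obtain K where K: "compact K" "K <= U t0" "{x. psi t0 x ~= 0} <= K" using facts(2)[OF t0] WU unfolding psi_def by blast
 have C1: "Ck (Suc 0) (psi t0)" unfolding psi_def by (rule facts(1)[OF t0])
 have dpsi0: "fderiv (psi t0) (at x) b = 0" if "x ~: K" for x b by (rule derivative_outside_support(2)[OF K(1) _ that]) (use K(3) in auto)
 have iF: "integrable (leb L) (F b)" if L: "compact L" "L <= U t0" for b L
 proof -
 have Lm: "L : sets lebesgue" by (rule compact_sets_leb[OF L(1)])
 have "integrable (leb L) (%x. emb w x * emb z x)" by (rule int_leb_subset[OF wz \<Omega>_sets(1) Lm]) (use L(2) u(2) in blast)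
 thus ?thesis unfolding F_def[abs_def] by (rule int_mult_csupp[OF Lm L(1) order_refl _ continuous_on_subset[OF c_continuous(1)[OF t0] L(2)]]) simp qed
 have iFs: "integrable (leb (U t0)) (%x. \<Sum>b\<in>Basis. F b x * fderiv (psi t0) (at x) b)"
 proof (rule bi_integrable_sum)
 fix b :: "real^'n" assume b: "b : Basis"
 show "integrable (leb (U t0)) (%x. F b x * fderiv (psi t0) (at x) b)" by (rule int_mult_csupp[OF u(4) K(1,2) iF[OF K(1,2)]])
 (use Ck_partial[OF C1 b] continuous_on_subset[OF _ subset_UNIV] dpsi0 in auto) qed
 \<comment> \<open>The cut-off is only C^1, so the extended divergence identity is used. Its compact
   support inside \<open>U t0\<close> leaves no interface term.\<close>
 have gr0: "(LINT x|leb (U t0). (\<Sum>b\<in>Basis. F b x * fderiv (psi t0) (at x) b)) = - (LINT x|leb (U t0). flux w z t0 x * psi t0 x)"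
 proof (rule weak_divergence_C1[OF u(1) order_refl iF _ _ C1 K(1,3,2)])
 fix L :: "(real^'n) set" assume "compact L" "L <= U t0"
 thus "integrable (leb L) (flux w z t0)" using flux_weak_divergence[OF t0, of w z, unfolded is_weak_divergence_def, THEN conjunct1, rule_format, of L] by simp
 next
 fix phi assume phi: "phi : test_functions (U t0)"
 have e: "((\<alpha> (x, t0) * emb w x * emb z x) *\<^sub>R v (x, t0)) \<bullet> grad phi x
 = (\<Sum>b\<in>Basis. F b x * fderiv phi (at x) b)" for x unfolding inner_grad by (intro sum.cong refl) (simp add: F_def c_def)
 show "(LINT x|leb (U t0). (\<Sum>b\<in>Basis. F b x * fderiv phi (at x) b)) = - (LINT x|leb (U t0). flux w z t0 x * phi x)"
 using flux_weak_divergence[OF t0, of w z, unfolded is_weak_divergence_def, THEN conjunct2, rule_format, OF phi] unfolding e . qed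
 have bm: "integrable \<L> (%x. f x * psi t0 x)" if f: "integrable \<L> f" for f
 proof (rule bi_integrable_bound[OF f])
 show "(%x. f x * psi t0 x) : bmeas \<L>" by (intro borel_measurable_times borel_measurable_integrable[OF f] psim t0)
 show "AE x in \<L>. norm (f x * psi t0 x) <= norm (f x)" by (rule AE_I2) (simp add: abs_mult mult_left_le psi1) qed
 have i1: "integrable (leb (U t0)) (%x. flux w z t0 x * psi t0 x)" "integrable (leb (U t0)) (%x. dens w z t0 x * psi t0 x)"
 unfolding restrict_U(2)[OF t0] by (intro bm dens_integrable t0)+
 have i2: "integrable (leb (U t0)) (%x. emb w x * emb z x * d\<alpha> (x, t0) (0, 1) * psi t0 x)" using bi_integrable_diff[OF i1(2,1)] by (simp add: dens_def algebra_simps)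
 have "(LINT x|\<L>. emb w x * emb z x * h' x t0) = (LINT x|leb (U t0). emb w x * emb z x * h' x t0)" by (rule restrict_U(3)[OF t0, symmetric])
 also have "... = (LINT x|leb (U t0). emb w x * emb z x * d\<alpha> (x, t0) (0, 1) * psi t0 x - (\<Sum>b\<in>Basis. F b x * fderiv (psi t0) (at x) b))"
 by (rule bi_integral_cong[OF refl]) (simp add: h'U space_restrict_space)
 also have "... = (LINT x|leb (U t0). emb w x * emb z x * d\<alpha> (x, t0) (0, 1) * psi t0 x) + (LINT x|leb (U t0). flux w z t0 x * psi t0 x)"
 unfolding bi_integral_diff[OF i2 iFs] gr0 by simp
 also have "... = (LINT x|leb (U t0). emb w x * emb z x * d\<alpha> (x, t0) (0, 1) * psi t0 x + flux w z t0 x * psi t0 x)" by (rule bi_integral_add[OF i2 i1(1), symmetric])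
 also have "... = (LINT x|\<L>. dens w z t0 x * psi t0 x)" unfolding restrict_U(3)[OF t0] by (simp add: dens_def distrib_right)
 finally show ?thesis using dN unfolding N_def[abs_def] psi_def by simp qed

text \<open>The derivative exists at every time, so the fundamental theorem for the gauge integral
  applies before measurability of the integrand in time is known.\<close>

lemma localized_reynolds:
 assumes W: "W = \<Omega>1 \<or> W = \<Omega>2" and eta: "eta : test_functions (W 0)" "!!x. 0 <= eta x" "!!x. eta x <= 1"
 and st: "0 < s" "s <= t" "t < T" shows "((%tau. LINT x|\<L>. dens w z tau x * transport eta tau x) has_integral
 (LINT x|\<L>. emb w x * emb z x * (\<alpha> (x, t) * transport eta t x))
 - (LINT x|\<L>. emb w x * emb z x * (\<alpha> (x, s) * transport eta s x))) {s..t}"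
proof (rule fundamental_theorem_of_calculus[OF st(2)])
 fix tau assume "tau : {s..t}"
 hence "tau : J" using st by auto
 from localized_reynolds_derivative[OF W eta this, of w z, unfolded has_real_derivative_iff_has_vector_derivative]
 show "((%t. LINT x|\<L>. emb w x * emb z x * (\<alpha> (x, t) * transport eta t x)) has_vector_derivative
 (LINT x|\<L>. dens w z tau x * transport eta tau x)) (at tau within {s..t})" by (rule has_vector_derivative_at_within) qed

lemma transport_measurable:
 assumes "W = \<Omega>1 \<or> W = \<Omega>2" "eta : test_functions (W 0)" "t : J" shows "transport eta t : bmeas \<L>"
 by (rule cont_measurable_leb(2)[OF Ck_continuous[OF transport_facts(1)[OF assms]]])

lemma integrable_mult_bounded:
 fixes f g :: "real^'n => real"
 assumes f: "integrable \<L> f" and g: "g : bmeas \<L>" "!!x. abs(g x) <= 1" shows "integrable \<L> (%x. f x * g x)" "abs(LINT x|\<L>. f x * g x) <= (LINT x|\<L>. abs(f x))"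
proof -
 show i: "integrable \<L> (%x. f x * g x)"
 proof (rule bi_integrable_bound[OF f])
 show "(%x. f x * g x) : bmeas \<L>" by (intro borel_measurable_times borel_measurable_integrable[OF f] g)
 show "AE x in \<L>. norm (f x * g x) <= norm (f x)" by (rule AE_I2) (simp add: abs_mult mult_left_le g(2)) qed
 have "abs(LINT x|\<L>. f x * g x) <= (LINT x|\<L>. abs(f x * g x))" by (rule integral_abs_bound)
 also have "... <= (LINT x|\<L>. abs(f x))" by (rule bi_integral_mono[OF integrable_abs[OF i] integrable_abs[OF f]]) (simp add: abs_mult mult_left_le g(2))
 finally show "abs(LINT x|\<L>. f x * g x) <= (LINT x|\<L>. abs(f x))" . qed

text \<open>Cut-offs exhausting the two initial phases are transported; their sum tends to 1 off the
  interface, a null set. Dominated convergence applies first in space at each time and then in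
  time.\<close>

lemma reynolds:
 assumes st: "0 < s" "s <= t" "t < T" shows "((%tau. a tau w z) has_integral (m t w z - m s w z)) {s..t}"
proof -
 have 0: "0 : {0..T}" using T_pos by simp
 obtain eta1 where eta1: "!!n. eta1 n : test_functions (\<Omega>1 0)" "!!n x. 0 <= eta1 n x" "!!n x. eta1 n x <= 1"
 "!!x. x : \<Omega>1 0 ==> \<forall>\<^sub>F n in sequentially. eta1 n x = 1" using cutoff_sequence[OF open_domains(2)[OF 0]] by blast
 obtain eta2 where eta2: "!!n. eta2 n : test_functions (\<Omega>2 0)" "!!n x. 0 <= eta2 n x" "!!n x. eta2 n x <= 1"
 "!!x. x : \<Omega>2 0 ==> \<forall>\<^sub>F n in sequentially. eta2 n x = 1" using cutoff_sequence[OF open_domains(3)[OF 0]] by blast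
 have W1: "\<Omega>1 = \<Omega>1 \<or> \<Omega>1 = \<Omega>2" and W2: "\<Omega>2 = \<Omega>1 \<or> \<Omega>2 = \<Omega>2" by simp_all
 have b1: "abs(transport (eta1 n) tau x) <= 1" for n tau x using eta1(2,3) by (simp add: transport_def)
 have b2: "abs(transport (eta2 n) tau x) <= 1" for n tau x using eta2(2,3) by (simp add: transport_def)
 note m1 = transport_measurable[OF W1 eta1(1)] and m2 = transport_measurable[OF W2 eta2(1)]
 have ptw: "(%n. transport (eta1 n) tau x + transport (eta2 n) tau x) ----> 1" if tau: "tau : J" and x: "x : U tau" for tau x
 proof -
 have xO: "x : Om" using x U(2)[OF tau] by blast
 have out1: "eta1 n y = 0" if "y : \<Omega>2 0" for n y using tf_bounds(6)[OF eta1(1)] tf_bounds(4)[OF eta1(1)] disjoint[OF 0] that by blast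
 have out2: "eta2 n y = 0" if "y : \<Omega>1 0" for n y using tf_bounds(6)[OF eta2(1)] tf_bounds(4)[OF eta2(1)] disjoint[OF 0] that by blast
 have "\<forall>\<^sub>F n in sequentially. eta1 n (inv\<Phi> tau x) + eta2 n (inv\<Phi> tau x) = 1"
 proof (cases "x : \<Omega>1 tau")
 case True
 hence y: "inv\<Phi> tau x : \<Omega>1 0" by (rule transport_facts(6)[OF W1 eta1(1) tau])
 show ?thesis using eta1(4)[OF y] by eventually_elim (simp add: out2[OF y])
 next
 case False
 hence "x : \<Omega>2 tau" using x by (simp add: U_def)
 hence y: "inv\<Phi> tau x : \<Omega>2 0" by (rule transport_facts(6)[OF W2 eta2(1) tau])
 show ?thesis using eta2(4)[OF y] by eventually_elim (simp add: out1[OF y]) qed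
 thus ?thesis using xO by (intro tendsto_eventually) (simp add: transport_def) qed
 have lim: "(%n. (LINT x|\<L>. f x * transport (eta1 n) tau x) + (LINT x|\<L>. f x * transport (eta2 n) tau x)) ----> (LINT x|\<L>. f x)"
 if tau: "tau : J" and f: "integrable \<L> f" for tau and f :: "real^'n => real"
 proof -
 have ae: "AE x in \<L>. x : U tau" using AE_U[OF tau] by (simp add: AE_restrict_space_iff \<Omega>_sets)
 have i: "integrable \<L> (%x. f x * transport (eta1 n) tau x)" "integrable \<L> (%x. f x * transport (eta2 n) tau x)" for n
 using integrable_mult_bounded(1)[OF f m1[OF tau] b1] integrable_mult_bounded(1)[OF f m2[OF tau] b2] .
 have "(%n. LINT x|\<L>. f x * transport (eta1 n) tau x + f x * transport (eta2 n) tau x) ----> (LINT x|\<L>. f x)"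
 proof (rule integral_dominated_convergence[where w="%x. 2 * abs(f x)"])
 show "f : bmeas \<L>" using f by simp
 show "integrable \<L> (%x. 2 * abs(f x))" using f by simp
 show "(%x. f x * transport (eta1 n) tau x + f x * transport (eta2 n) tau x) : bmeas \<L>" for n using i[of n] by simp
 show "AE x in \<L>. norm (f x * transport (eta1 n) tau x + f x * transport (eta2 n) tau x) <= 2 * abs(f x)" for n
 proof (rule AE_I2)
 fix x
 have "abs(f x * transport (eta1 n) tau x) <= abs(f x)" "abs(f x * transport (eta2 n) tau x) <= abs(f x)"
 using b1[of n tau x] b2[of n tau x] by (simp_all add: abs_mult mult_left_le)
 thus "norm (f x * transport (eta1 n) tau x + f x * transport (eta2 n) tau x) <= 2 * abs(f x)" unfolding real_norm_def by linarith qed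
 show "AE x in \<L>. (%n. f x * transport (eta1 n) tau x + f x * transport (eta2 n) tau x) ----> f x" using ae
 proof eventually_elim
 case (elim x)
 show ?case using tendsto_mult[OF tendsto_const[of "f x"] ptw[OF tau elim]] by (simp add: distrib_left) qed qed
 thus ?thesis using i by simp qed
 define f where "f n tau = (LINT x|\<L>. dens w z tau x * transport (eta1 n) tau x) + (LINT x|\<L>. dens w z tau x * transport (eta2 n) tau x)" for n tau
 define N where "N n tau = (LINT x|\<L>. emb w x * emb z x * (\<alpha> (x, tau) * transport (eta1 n) tau x)) + (LINT x|\<L>. emb w x * emb z x * (\<alpha> (x, tau) * transport (eta2 n) tau x))" for n tau
 have hi: "(f n has_integral (N n t - N n s)) {s..t}" for n
 proof -
 have e: "x + y - (x' + y') = (x - x') + (y - y')" for x y x' y' :: real by simp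
 show ?thesis unfolding f_def[abs_def] N_def e by (rule has_integral_add[OF localized_reynolds[OF W1 eta1(1,2,3) st] localized_reynolds[OF W2 eta2(1,2,3) st]]) qed
 have Nlim: "(%n. N n tau) ----> m tau w z" if tau: "tau : J" for tau
 proof -
 have e: "emb w x * emb z x * (\<alpha> (x, tau) * y) = \<alpha> (x, tau) * emb w x * emb z x * y" for x y by (simp add: mult_ac)
 show ?thesis using lim[OF tau m_integrable(1)[OF tau, of w z]] unfolding N_def m_def e . qed
 have flim: "(%n. f n tau) ----> a tau w z" if tau: "tau : J" for tau using lim[OF tau dens_integrable(2)[OF tau, of w z]] unfolding f_def a_integrand(3)[OF tau] .
 have fb: "norm (f n tau) <= 2 * (LINT x|\<L>. dom w z x)" if tau: "tau : J" for n tau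
 proof -
 have ae: "AE x in \<L>. x : U tau" using AE_U[OF tau] by (simp add: AE_restrict_space_iff \<Omega>_sets)
 have "(LINT x|\<L>. abs(dens w z tau x)) <= (LINT x|\<L>. dom w z x)"
 proof (rule integral_mono_AE[OF integrable_abs[OF dens_integrable(2)[OF tau]] dom_integrable])
 show "AE x in \<L>. abs(dens w z tau x) <= dom w z x" using ae by eventually_elim (rule dens_bound(1)[OF tau]) qed
 moreover have "abs(LINT x|\<L>. dens w z tau x * transport (eta1 n) tau x) <= (LINT x|\<L>. abs(dens w z tau x))"
 by (rule integrable_mult_bounded(2)[OF dens_integrable(2)[OF tau] m1[OF tau] b1])
 moreover have "abs(LINT x|\<L>. dens w z tau x * transport (eta2 n) tau x) <= (LINT x|\<L>. abs(dens w z tau x))"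
 by (rule integrable_mult_bounded(2)[OF dens_integrable(2)[OF tau] m2[OF tau] b2])
 ultimately show ?thesis unfolding f_def real_norm_def by linarith qed
 have J: "tau : J" if "tau : {s..t}" for tau using that st by auto
 have fi: "f n integrable_on {s..t}" for n using hi by (rule has_integral_integrable)
 have ci: "(%tau. 2 * (LINT x|\<L>. dom w z x)) integrable_on {s..t}" by (rule integrable_const_ivl)
 note dc = dominated_convergence[where f=f and g="%tau. a tau w z" and S="{s..t}", OF fi ci fb[OF J] flim[OF J]]
 have "(%n. integral {s..t} (f n)) ----> m t w z - m s w z" using tendsto_diff[OF Nlim[of t] Nlim[of s]] st by (simp add: integral_unique[OF hi])
 hence "integral {s..t} (%tau. a tau w z) = m t w z - m s w z" using LIMSEQ_unique[OF dc(2)] by blast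
 thus ?thesis using integrable_integral[OF dc(1)] by simp qed

text \<open>Measurability in time is not visible from the definition of \<open>a\<close>. It is read
  off from the gauge integrability in \<open>reynolds\<close>, and the uniform bound then gives
  Lebesgue integrability.\<close>

lemma a_integrable_Icc:
 assumes st: "0 < s" "s <= t" "t < T" shows "(%tau. indicator {s..t} tau * a tau w z) : bmeas lebesgue"
 "m t w z - m s w z = (LINT tau|leb {s..t}. a tau w z)"
proof -
 show me: "(%tau. indicator {s..t} tau * a tau w z) : bmeas lebesgue"
 using has_integral_implies_lebesgue_measurable_real[OF reynolds[OF st, of w z]] by (simp add: mult.commute)
 obtain C where C: "!!t w z. t : J ==> abs(a t w z) <= C * norm w * norm z" using forms_bound by blast
 have "integrable lebesgue (%tau. indicator {s..t} tau * a tau w z)"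
 proof (rule bi_integrable_bound[OF _ me])
 show "integrable lebesgue (%tau::real. indicator {s..t} tau * (C * norm w * norm z))"
 by (intro integrable_mult_left integrable_real_indicator) (auto simp: emeasure_lborel_Icc_eq)
 show "AE tau in lebesgue. norm (indicator {s..t} tau * a tau w z) <= norm (indicator {s..t} tau * (C * norm w * norm z))"
 proof (rule AE_I2)
 fix tau :: real
 show "norm (indicator {s..t} tau * a tau w z) <= norm (indicator {s..t} tau * (C * norm w * norm z))"
 proof (cases "tau : {s..t}")
 case True
 hence "abs(a tau w z) <= C * norm w * norm z" using st by (intro C) auto
 thus ?thesis using True by simp qed simp qed qed
 hence i: "integrable (leb {s..t}) (%tau. a tau w z)" by (simp add: integrable_leb_eq)
 show "m t w z - m s w z = (LINT tau|leb {s..t}. a tau w z)" unfolding lebesgue_integral_eq_integral[OF i, simplified] by (rule integral_unique[OF reynolds[OF st], symmetric])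
qed

lemma a_measurable: "(%t. a t w z) : bmeas (leb J)"
proof -
 \<comment> \<open>Compact intervals exhausting J; the offset 3 ensures l n <= r n already for n =
   0.\<close>
 define l r where "l n = T / (n + 3)" and "r n = T - T / (n + 3)" for n :: nat
 have lr: "0 < l n" "l n <= r n" "r n < T" for n using T_pos by (auto simp: l_def r_def field_simps)
 have "(%n. T * (1 / real (n + 3))) ----> T * 0" by (intro tendsto_mult tendsto_const LIMSEQ_ignore_initial_segment[OF lim_1_over_n])
 hence l0: "l ----> 0" by (simp add: l_def[abs_def] add.commute)
 hence rT: "r ----> T" unfolding r_def[abs_def] l_def[abs_def] using tendsto_diff[OF tendsto_const[of T], of _ 0] by fastforce
 show ?thesis
 proof (rule measurable_AE_limit[where f="%n tau. indicator {l n..r n} tau * a tau w z"])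
 show "(%tau. indicator {l n..r n} tau * a tau w z) : bmeas (leb J)" for n by (rule borel_measurable_lebesgue_onI[OF a_integrable_Icc(1)[OF lr]])
 show "AE tau in leb J. (%n. indicator {l n..r n} tau * a tau w z) ----> a tau w z"
 proof (rule AE_I2)
 fix tau assume "tau : space (leb J)"
 hence tau: "0 < tau" "tau < T" by (auto simp: space_restrict_space)
 have "\<forall>\<^sub>F n in sequentially. l n < tau" "\<forall>\<^sub>F n in sequentially. tau < r n" using order_tendstoD(2)[OF l0 tau(1)] order_tendstoD(1)[OF rT tau(2)] .
 hence "\<forall>\<^sub>F n in sequentially. indicator {l n..r n} tau * a tau w z = a tau w z" by eventually_elim simp
 thus "(%n. indicator {l n..r n} tau * a tau w z) ----> a tau w z" by (rule tendsto_eventually) qed qed simp qed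

text \<open>Almost every x stays in one phase near tau. The limit is the value of the continuous
  extension of alpha to the closed space-time phase, to which (x, tau) belongs at least as a limit
  point.\<close>

lemma sqrt_weight_tendsto:
 assumes tau: "tau : {0..T}" shows "AE x in lebesgue. x : Om --> (EX l. ALL R. (ALL n::nat. R n : J) --> R ----> tau --> (%n. sqrt (\<alpha> (x, R n))) ----> l)"
 using eventually_one_phase[OF tau]
proof (rule eventually_mono, intro impI)
 fix x assume x: "x : Om" and ph: "x : Om --> (EX d>0. (ALL t:J. abs(t - tau) < d --> x : \<Omega>1 t) \<or> (ALL t:J. abs(t - tau) < d --> x : \<Omega>2 t))"
 have "EX d>0. EX W. (W = \<Omega>1 \<or> W = \<Omega>2) & (ALL t:J. abs(t - tau) < d --> x : W t)" using ph x by metis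
 then obtain d W where d: "0 < d" and W: "W = \<Omega>1 \<or> W = \<Omega>2" and stay: "!!t. t : J ==> abs(t - tau) < d ==> x : W t" by blast
 obtain \<beta> where \<beta>: "continuous_on (closure (phase W)) \<beta>" "!!p. p : phase W ==> \<alpha> p = \<beta> p" using coefficient_phase[OF W] by blast
 show "EX l. ALL R. (ALL n::nat. R n : J) --> R ----> tau --> (%n. sqrt (\<alpha> (x, R n))) ----> l"
 proof (intro exI[of _ "sqrt (\<beta> (x, tau))"] allI impI)
 fix R :: "nat => real" assume R: "ALL n. R n : J" "R ----> tau"
 have "\<forall>\<^sub>F n in sequentially. abs(R n - tau) < d" using tendstoD[OF R(2) d] by (simp add: dist_real_def)
 hence ev: "\<forall>\<^sub>F n in sequentially. (x, R n) : phase W" by eventually_elim (use stay R(1) in "simp add: phase_def")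
 have Rx: "(%n. (x, R n)) ----> (x, tau)" by (intro tendsto_Pair tendsto_const R(2))
 have evc: "\<forall>\<^sub>F n in sequentially. (x, R n) : closure (phase W)" using ev by eventually_elim (rule subsetD[OF closure_subset])
 have cl: "(x, tau) : closure (phase W)" by (rule Lim_in_closed_set[OF closed_closure evc _ Rx]) simp
 have "(%n. \<beta> (x, R n)) ----> \<beta> (x, tau)" by (rule continuous_on_tendsto_compose[OF \<beta>(1) Rx cl evc])
 moreover have "\<forall>\<^sub>F n in sequentially. \<beta> (x, R n) = \<alpha> (x, R n)" using ev by eventually_elim (simp add: \<beta>(2))
 ultimately have "(%n. \<alpha> (x, R n)) ----> \<beta> (x, tau)" by (rule Lim_transform_eventually)
 thus "(%n. sqrt (\<alpha> (x, R n))) ----> sqrt (\<beta> (x, tau))" by (rule tendsto_real_sqrt) qed qed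

lemma sqrt_weight_sqint:
 assumes t: "t : J" shows "sqint \<L> (%x. sqrt (\<alpha> (x, t)) * emb w x)"
 "AE x in \<L>. abs(sqrt (\<alpha> (x, t))) <= sqrt M"
 "(%x. sqrt (\<alpha> (x, t))) : bmeas \<L>"
 "(LINT x|\<L>. (sqrt (\<alpha> (x, t)) * emb w x) * (sqrt (\<alpha> (x, t)) * emb z x)) = m t w z"
proof -
 have ae: "AE x in \<L>. x : U t" using AE_U[OF t] by (simp add: AE_restrict_space_iff \<Omega>_sets)
 show me: "(%x. sqrt (\<alpha> (x, t))) : bmeas \<L>" by (rule measurable_compose[OF dens_measurable(3)[OF t]]) (intro borel_measurable_continuous_onI continuous_intros)
 show b: "AE x in \<L>. abs(sqrt (\<alpha> (x, t))) <= sqrt M" using ae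
 proof eventually_elim
 case (elim x)
 have "0 <= \<alpha> (x, t)" using nonneg[of x t] elim U(2)[OF t] t by auto
 moreover have "\<alpha> (x, t) <= M" using regularU(3)[OF t elim] by simp
 ultimately show ?case by simp qed
 show "sqint \<L> (%x. sqrt (\<alpha> (x, t)) * emb w x)" by (rule sqint_bounded_mult[OF emb_sqint me b])
 show "(LINT x|\<L>. (sqrt (\<alpha> (x, t)) * emb w x) * (sqrt (\<alpha> (x, t)) * emb z x)) = m t w z" unfolding m_def
 proof (rule bi_integral_cong[OF refl])
 fix x assume "x : space \<L>"
 hence "0 <= \<alpha> (x, t)" using nonneg[of x t] t by (auto simp: space_restrict_space)
 hence "sqrt (\<alpha> (x, t)) * sqrt (\<alpha> (x, t)) = \<alpha> (x, t)" by simp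
 thus "(sqrt (\<alpha> (x, t)) * emb w x) * (sqrt (\<alpha> (x, t)) * emb z x) = \<alpha> (x, t) * emb w x * emb z x" by (metis mult.assoc mult.left_commute) qed qed

text \<open>A counterexample would give two sequences of times tending to tau. Along both the weight
  has the same pointwise limit almost everywhere, and 4 M w^2 is a majorant, so dominated
  convergence contradicts the lower bound eps.\<close>

lemma sqrt_weight_continuous:
 assumes tau: "tau : {0..T}" and eps: "0 < eps" shows "EX d>0. ALL s:J. ALL t:J. \<bar>s - tau\<bar> < d --> \<bar>t - tau\<bar> < d -->
 nrm2 \<L> (%x. sqrt (\<alpha> (x, t)) * emb w x - sqrt (\<alpha> (x, s)) * emb w x) < eps"
proof (rule ccontr)
 assume neg: "\<not> ?thesis"
 have "EX s t. s : J & t : J & \<bar>s - tau\<bar> < 1 / Suc n & \<bar>t - tau\<bar> < 1 / Suc n &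
 \<not> nrm2 \<L> (%x. sqrt (\<alpha> (x, t)) * emb w x - sqrt (\<alpha> (x, s)) * emb w x) < eps" for n :: nat
 proof -
 have "0 < 1 / real (Suc n)" by simp
 thus ?thesis using neg by blast qed
 note ex = this
 define P where "P n s t \<longleftrightarrow> s : J & t : J & \<bar>s - tau\<bar> < 1 / Suc n & \<bar>t - tau\<bar> < 1 / Suc n &
 \<not> nrm2 \<L> (%x. sqrt (\<alpha> (x, t)) * emb w x - sqrt (\<alpha> (x, s)) * emb w x) < eps" for n :: nat and s t
 have "ALL n. EX s. EX t. P n s t" unfolding P_def using ex by (rule allI)
 from choice[OF this] obtain S where "ALL n. EX t. P n (S n) t" ..
 from choice[OF this] obtain R where PR: "ALL n. P n (S n) (R n)" ..
 have SR: "S n : J" "R n : J" "abs(S n - tau) < 1 / Suc n" "abs(R n - tau) < 1 / Suc n"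
 "\<not> nrm2 \<L> (%x. sqrt (\<alpha> (x, R n)) * emb w x - sqrt (\<alpha> (x, S n)) * emb w x) < eps" for n using PR[rule_format, of n] unfolding P_def by simp_all
 define f where "f n x = (sqrt (\<alpha> (x, R n)) * emb w x - sqrt (\<alpha> (x, S n)) * emb w x)\<^sup>2" for n x
 have "(%n. LINT x|\<L>. f n x) ----> (LINT x|\<L>. 0)"
 proof (rule integral_dominated_convergence[where w="%x. 4 * M * (emb w x)\<^sup>2"])
 show "(%x. 0) : bmeas \<L>" by simp
 show "integrable \<L> (%x. 4 * M * (emb w x)\<^sup>2)" using emb_sqint[of w] by (simp add: sqint_def)
 show "f n : bmeas \<L>" for n unfolding f_def[abs_def] using sqrt_weight_sqint(1)[OF SR(2), of n w] sqrt_weight_sqint(1)[OF SR(1), of n w]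
 by (intro borel_measurable_power borel_measurable_diff) (simp_all add: sqint_def)
 show "AE x in \<L>. (%n. f n x) ----> 0"
 proof -
 have "AE x in \<L>. EX l. ALL R. (ALL n::nat. R n : J) --> R ----> tau --> (%n. sqrt (\<alpha> (x, R n))) ----> l"
 using sqrt_weight_tendsto[OF tau] by (simp add: AE_restrict_space_iff \<Omega>_sets)
 thus ?thesis
 proof eventually_elim
 case (elim x)
 then obtain l where l: "!!R. (ALL n::nat. R n : J) ==> R ----> tau ==> (%n. sqrt (\<alpha> (x, R n))) ----> l" by blast
 have "(%n. (sqrt (\<alpha> (x, R n)) * emb w x - sqrt (\<alpha> (x, S n)) * emb w x)\<^sup>2) ----> (l * emb w x - l * emb w x)\<^sup>2"
 by (intro tendsto_power tendsto_diff tendsto_mult tendsto_const l allI SR inverse_Suc_tendsto)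
 thus ?case by (simp add: f_def) qed qed
 show "AE x in \<L>. norm (f n x) <= 4 * M * (emb w x)\<^sup>2" for n using sqrt_weight_sqint(2)[OF SR(1)[of n]] sqrt_weight_sqint(2)[OF SR(2)[of n]]
 proof eventually_elim
 case (elim x)
 have "abs(sqrt (\<alpha> (x, R n)) - sqrt (\<alpha> (x, S n))) <= 2 * sqrt M" using elim by linarith
 from power_mono[OF this abs_ge_zero, of 2]
 have "(sqrt (\<alpha> (x, R n)) - sqrt (\<alpha> (x, S n)))\<^sup>2 <= (2 * sqrt M)\<^sup>2" by (simp only: power2_abs)
 also have "... = 4 * M" using M by (simp add: power_mult_distrib)
 finally have "(sqrt (\<alpha> (x, R n)) - sqrt (\<alpha> (x, S n)))\<^sup>2 * (emb w x)\<^sup>2 <= 4 * M * (emb w x)\<^sup>2" by (rule mult_right_mono) simp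
 thus ?case by (simp add: f_def left_diff_distrib[symmetric] power_mult_distrib) qed qed
 hence "(%n. LINT x|\<L>. f n x) ----> 0" by simp
 moreover have "0 < eps\<^sup>2" using eps by simp
 ultimately have "\<forall>\<^sub>F n in sequentially. (LINT x|\<L>. f n x) < eps\<^sup>2" by (rule order_tendstoD(2))
 then obtain n where n: "(LINT x|\<L>. f n x) < eps\<^sup>2" by (auto simp: eventually_sequentially)
 have "(nrm2 \<L> (%x. sqrt (\<alpha> (x, R n)) * emb w x - sqrt (\<alpha> (x, S n)) * emb w x))\<^sup>2 < eps\<^sup>2" unfolding nrm2_square using n by (simp add: f_def)
 from power2_less_imp_less[OF this less_imp_le[OF eps]] show False using SR(5)[of n] by simp qed

end

section \<open>The weighted evolution problem\<close>

text \<open>Riesz-Fischer for functions instead of classes: a fast subsequence converges almost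
  everywhere by Markov and Borel-Cantelli, and Fatou transfers the Cauchy estimate to the
  limit.\<close>

lemma sqint_complete:
 fixes f :: "nat => 'm => real"
 assumes f: "!!n. sqint M (f n)" and cauchy: "!!eps. 0 < eps ==> EX N. ALL n>=N. ALL k>=N. nrm2 M (%x. f n x - f k x) <= eps"
 shows "EX g. sqint M g & (ALL eps>0. EX N. ALL n>=N. nrm2 M (%x. f n x - g x) <= eps)"
proof -
 have "ALL k. EX N. ALL n>=N. ALL j>=N. nrm2 M (%x. f n x - f j x) <= (1/4)^k" using cauchy by simp
 from choice[OF this] obtain N where N: "!!k n j. N k <= n ==> N k <= j ==> nrm2 M (%x. f n x - f j x) <= (1/4)^k" by blast
 \<comment> \<open>The indices are monotone in k, at least N k for the fast Cauchy bound, and at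
   least k for the use of Fatou.\<close>
 define r where "r k = k + (\<Sum>i\<le>k. N i)" for k
 have rN: "N k <= r k" for k unfolding r_def by (rule trans_le_add2, rule member_le_sum) auto
 have rk: "k <= r k" and rS: "r k <= r (Suc k)" for k by (simp_all add: r_def)
 have fm: "f n : bmeas M" for n using f[of n] by (simp add: sqint_def)
 define \<Delta> where "\<Delta> k x = f (r (Suc k)) x - f (r k) x" for k x
 have \<Delta>: "sqint M (\<Delta> k)" "nrm2 M (\<Delta> k) <= (1/4)^k" for k
 unfolding \<Delta>_def[abs_def] using N[of k "r (Suc k)" "r k"] rN[of k] rS[of k] by (auto intro: sqint_diff f)
 \<comment> \<open>The squared norm of the k-th difference is at most 16^-k, so this set has measure
   at most 4^-k; off it the difference is below 2^-k. Both sequences are summable.\<close>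
 define A where "A k = {x : space M. (1/4)^k <= (\<Delta> k x)\<^sup>2}" for k
 have i\<Delta>: "integrable M (%x. (\<Delta> k x)\<^sup>2)" for k using \<Delta>(1)[of k] by (simp add: sqint_def)
 have mA: "A k : sets M" for k unfolding A_def using borel_measurable_integrable[OF i\<Delta>[of k]] by measurable
 have "(LINT x|M. (\<Delta> k x)\<^sup>2) <= (1/16)^k" for k
 proof -
 have "(nrm2 M (\<Delta> k))\<^sup>2 <= ((1/4)^k)\<^sup>2" by (rule power_mono[OF \<Delta>(2)]) simp
 also have "((1/4)^k)\<^sup>2 = ((1/16)^k :: real)" by (simp add: power2_eq_square power_mult_distrib[symmetric])
 finally show ?thesis by (simp only: nrm2_square) qed
 note ib = this
 have AE1: "emeasure M (A k) <= ennreal ((1/4)^k)" for k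
 proof -
 have "emeasure M (A k) <= ennreal ((1 / (1/4)^k) * (LINT x|M. (\<Delta> k x)\<^sup>2))" unfolding A_def by (rule integral_Markov_inequality[OF i\<Delta>]) auto
 also have "... <= ennreal ((1 / (1/4)^k) * (1/16)^k)" by (intro ennreal_leI mult_left_mono ib) simp
 also have "(1 / (1/4)^k) * (1/16)^k = ((1/4)^k :: real)" by (simp add: power_divide field_simps power_mult_distrib[symmetric])
 finally show ?thesis . qed
 have AE2: "emeasure M (A k) < \<infinity>" for k using le_less_trans[OF AE1 ennreal_less_top] by (simp add: top_ennreal_def)
 have mA': "measure M (A k) <= (1/4)^k" for k unfolding measure_def using AE1[of k] by (intro enn2real_leI) auto
 have "summable (%k. measure M (A k))" by (rule summable_comparison_test'[OF summable_geometric[of "1/4::real"]]) (use mA' in auto)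
 from borel_cantelli_AE1[OF mA AE2 this]
 have conv: "AE x in M. convergent (%k. f (r k) x)"
 proof (rule AE_mp, intro AE_I2 impI)
 fix x assume x: "x : space M" and evA: "\<forall>\<^sub>F k in sequentially. x : space M - A k"
 from evA have ev: "\<forall>\<^sub>F k in sequentially. norm (\<Delta> k x) <= (1/2)^k"
 proof (eventually_elim)
 case (elim k)
 hence "(\<Delta> k x)\<^sup>2 <= (1/4)^k" using x by (auto simp: A_def)
 also have "(1/4)^k = ((1/2)^k :: real)\<^sup>2" by (simp add: power2_eq_square power_mult_distrib[symmetric])
 finally have "abs(\<Delta> k x) <= abs((1/2)^k)" by (simp only: abs_le_square_iff)
 thus ?case by simp qed
 have s: "summable (%k. \<Delta> k x)" by (rule summable_comparison_test_ev[OF ev]) (rule summable_geometric, simp)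
 have tel: "f (r k) x = f (r 0) x + (\<Sum>i<k. \<Delta> i x)" for k by (induction k) (simp_all add: \<Delta>_def)
 have "convergent (%k. f (r 0) x + (\<Sum>i<k. \<Delta> i x))" by (rule convergentI[OF tendsto_add[OF tendsto_const summable_LIMSEQ[OF s]]])
 thus "convergent (%k. f (r k) x)" by (simp only: tel[symmetric]) qed
 define g where "g x = lim (%k. f (r k) x)" for x
 have gm: "g : bmeas M" unfolding g_def[abs_def] by (rule borel_measurable_lim_metric) (rule fm)
 have lim: "AE x in M. (%k. f (r k) x) ----> g x" using conv by eventually_elim (simp add: g_def convergent_LIMSEQ_iff)
 have main: "sqint M (%x. f n x - g x) & nrm2 M (%x. f n x - g x) <= eps"
 if eps: "0 < eps" and K: "!!k. K <= k ==> nrm2 M (%x. f n x - f k x) <= eps" for n K eps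
 proof -
 have me: "(%x. (f n x - g x)\<^sup>2) : bmeas M" by (intro borel_measurable_power borel_measurable_diff fm gm)
 have "(\<integral>\<^sup>+x. ennreal ((f n x - g x)\<^sup>2) \<partial>M) = (\<integral>\<^sup>+x. liminf (%k. ennreal ((f n x - f (r k) x)\<^sup>2)) \<partial>M)"
 proof (rule nn_integral_cong_AE)
 show "AE x in M. ennreal ((f n x - g x)\<^sup>2) = liminf (%k. ennreal ((f n x - f (r k) x)\<^sup>2))" using lim
 proof eventually_elim
 case (elim x)
 have "(%k. ennreal ((f n x - f (r k) x)\<^sup>2)) ----> ennreal ((f n x - g x)\<^sup>2)" by (intro tendsto_ennrealI tendsto_power tendsto_diff tendsto_const elim)
 thus ?case by (rule lim_imp_Liminf[OF sequentially_bot, symmetric]) qed qed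
 also have "... <= liminf (%k. \<integral>\<^sup>+x. ennreal ((f n x - f (r k) x)\<^sup>2) \<partial>M)"
 by (rule nn_integral_liminf) (intro measurable_compose[OF _ measurable_ennreal] borel_measurable_power borel_measurable_diff fm)
 also have "... <= ennreal (eps\<^sup>2)"
 proof (rule Liminf_le[OF sequentially_bot])
 have "(\<integral>\<^sup>+x. ennreal ((f n x - f (r k) x)\<^sup>2) \<partial>M) <= ennreal (eps\<^sup>2)" if "K <= k" for k
 proof -
 have i: "integrable M (%x. (f n x - f (r k) x)\<^sup>2)" using sqint_diff[OF f[of n] f[of "r k"]] by (simp add: sqint_def)
 have "nrm2 M (%x. f n x - f (r k) x) <= eps" by (rule K) (use that rk[of k] in linarith)
 hence "(nrm2 M (%x. f n x - f (r k) x))\<^sup>2 <= eps\<^sup>2" by (rule power_mono) simp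
 hence "(LINT x|M. (f n x - f (r k) x)\<^sup>2) <= eps\<^sup>2" by (simp only: nrm2_square)
 thus ?thesis using nn_integral_eq_integral[OF i] by (simp add: ennreal_leI) qed
 thus "\<forall>\<^sub>F k in sequentially. (\<integral>\<^sup>+x. ennreal ((f n x - f (r k) x)\<^sup>2) \<partial>M) <= ennreal (eps\<^sup>2)"
 unfolding eventually_sequentially by blast qed
 finally have le: "(\<integral>\<^sup>+x. ennreal ((f n x - g x)\<^sup>2) \<partial>M) <= ennreal (eps\<^sup>2)" .
 have i: "integrable M (%x. (f n x - g x)\<^sup>2)" by (rule integrableI_nonneg[OF me]) (use le_less_trans[OF le ennreal_less_top] in "simp_all add: top_ennreal_def")
 have "ennreal (LINT x|M. (f n x - g x)\<^sup>2) <= ennreal (eps\<^sup>2)" using le nn_integral_eq_integral[OF i] by simp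
 hence "(LINT x|M. (f n x - g x)\<^sup>2) <= eps\<^sup>2" by (simp add: ennreal_le_iff)
 hence "nrm2 M (%x. f n x - g x) <= eps" unfolding nrm2_def using eps by (simp add: real_sqrt_le_iff' real_le_lsqrt)
 moreover have "sqint M (%x. f n x - g x)" unfolding sqint_def using i by (intro conjI borel_measurable_diff fm gm)
 ultimately show ?thesis by blast qed
 obtain N0 where N0: "ALL n>=N0. ALL k>=N0. nrm2 M (%x. f n x - f k x) <= 1" using cauchy[of 1] by auto
 have "sqint M (%x. f N0 x - g x)" using main[of 1 N0 N0] N0 by simp
 from sqint_diff[OF f[of N0] this] have "sqint M g" by simp
 moreover have "EX N. ALL n>=N. nrm2 M (%x. f n x - g x) <= eps" if eps: "0 < eps" for eps
 proof -
 obtain N where N: "ALL n>=N. ALL k>=N. nrm2 M (%x. f n x - f k x) <= eps" using cauchy[OF eps] by blast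
 have "nrm2 M (%x. f n x - g x) <= eps" if n: "n >= N" for n using main[OF eps, of N n] N n by blast
 thus ?thesis by blast qed
 ultimately show ?thesis by blast qed

lemma full_measure_dense:
 assumes T: "0 < T" and S: "AE t in lebesgue. t : {0<..<T} --> t : S" and tau: "tau : {0..T}" and d: "0 < (d::real)" shows "EX t:S. t : {0<..<T} & abs(t - tau) < d"
proof (rule ccontr)
 assume neg: "\<not> ?thesis"
 define I where "I = {max 0 (tau - d)<..<min T (tau + d)}"
 have ne: "I ~= {}" using T tau d by (auto simp: I_def)
 have "AE t in lebesgue. t ~: I" using S by eventually_elim (use neg in "auto simp: I_def")
 hence "negligible I" by (simp add: negligible_iff_null_sets AE_iff_null_sets I_def)
 moreover have "open I" by (simp add: I_def)
 ultimately show False using ne open_not_negligible by blast qed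

text \<open>A difference of primitives handles both orientations of the oriented integral.\<close>

lemma interval_integral_eq:
 fixes f :: "real => real"
 assumes f: "integrable (leb {0..T}) f" and t: "t1 : {0..T}" "t2 : {0..T}"
 shows "(LINT t=ereal t1..ereal t2|lebesgue. f t) = (LINT t|leb {0..t2}. f t) - (LINT t|leb {0..t1}. f t)"
proof -
 have split: "(LINT x|leb {0..t}. f x) - (LINT x|leb {0..s}. f x) = (LINT x|leb {s..t}. f x)"
 if "0 <= s" "s <= t" "t <= T" for s t using integral_combine[OF sub_integrable[OF f order_refl that(3)] that(1,2)] by simp
 have ei: "(LINT x:{s<..<t}|lebesgue. f x) = (LINT x|leb {s..t}. f x)" for s t unfolding leb_Ioo_Icc(2)[symmetric] set_lebesgue_integral_def by (simp add: integral_leb_eq)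
 show ?thesis
 proof (cases "t1 <= t2")
 case True
 thus ?thesis using split[of t1 t2] t by (simp add: interval_lebesgue_integral_def ei)
 next
 case False
 thus ?thesis using split[of t2 t1] t by (simp add: interval_lebesgue_integral_def ei) qed qed

locale weighted_evolution = weighted_forms \<Omega> T \<Omega>1 \<Omega>2 \<Phi> v \<alpha> \<alpha>0 emb d\<alpha> dv M
 for \<Omega> :: "(real^'n) set" and T :: real
 and \<Omega>1 \<Omega>2 :: "real => (real^'n) set"
 and \<Phi> v :: "(real^'n) \<times> real => real^'n"
 and \<alpha> :: "(real^'n) \<times> real => real" and \<alpha>0 :: real
 and emb :: "'v::{real_inner, complete_space} => real^'n => real"
 and d\<alpha> dv M +
 fixes p q C :: real
 assumes p: "2 <= p" and q: "q = p / (p - 1)" and C: "0 <= C"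
 and C_bound: "!!t w z. t : {0<..<T} ==> abs(m t w z) <= C * norm w * norm z & abs(a t w z) <= C * norm w * norm z"
begin

sublocale ff: form_family T C m a p q
proof (rule form_family.intro)
 show "0 < T" by (rule T_pos)
 show "0 <= C" by (rule C)
 show "2 <= p" "q = p / (p - 1)" by (rule p, rule q)
 show "m t w z = m t z w" "a t w z = a t z w" for t w z by (rule forms_sym)+
 show "abs(m t w z) <= C * norm w * norm z" "abs(a t w z) <= C * norm w * norm z" if "t : J" for t w z using C_bound[OF that] by blast+
 show "bounded_bilinear (m t)" if t: "t : J" for t by (rule bounded_bilinear_symI[OF forms_linear(1)[OF t] forms_sym(1) C_bound[OF t, THEN conjunct1]])
 show "bounded_bilinear (a t)" if t: "t : J" for t by (rule bounded_bilinear_symI[OF forms_linear(2)[OF t] forms_sym(2) C_bound[OF t, THEN conjunct2]])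
 show "(%t. a t w z) : bmeas (leb J)" for w z by (rule a_measurable)
 show "m t w z - m s w z = (LINT x|leb {s..t}. a x w z)" if "0 < s" "s <= t" "t < T" for s t w z by (rule a_integrable_Icc(2)[OF that]) qed

section \<open>Continuous representatives and integration by parts\<close>

abbreviation "D \<equiv> alpha_dt Om T \<Omega>1 \<Omega>2 v \<alpha> emb q"
abbreviation "W \<equiv> W_space Om T \<Omega>1 \<Omega>2 v \<alpha> emb p q"

definition Y :: "(real => 'v) => real => real^'n => real" where
 "Y u t x = sqrt (\<alpha> (x, t)) * emb (u t) x"

text \<open>At fixed time the defining integrand splits into \<open>m\<close> and \<open>a\<close>,
  which makes members of the weighted space solutions in the abstract sense.\<close>

lemma distribution_eq:
 "alpha_dt_distribution Om T \<Omega>1 \<Omega>2 v \<alpha> emb u phi w = - (LINT t|leb J. m t (u t) w * deriv phi t + phi t * a t (u t) w)"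
proof -
 have "(LINT x|\<L>. \<alpha> (x, t) * emb (u t) x * emb w x * deriv phi t + emb (u t) x * phi t * emb w x * dt \<alpha> x t
 + phi t * flux_div \<Omega>1 \<Omega>2 v \<alpha> t (emb (u t)) (emb w) x) = m t (u t) w * deriv phi t + phi t * a t (u t) w"
 if t: "t : J" for t
 proof -
 have e: "\<alpha> (x, t) * emb (u t) x * emb w x * deriv phi t + emb (u t) x * phi t * emb w x * dt \<alpha> x t
 + phi t * flux_div \<Omega>1 \<Omega>2 v \<alpha> t (emb (u t)) (emb w) x
 = \<alpha> (x, t) * emb (u t) x * emb w x * deriv phi t + phi t * (emb (u t) x * emb w x * dt \<alpha> x t + flux_div \<Omega>1 \<Omega>2 v \<alpha> t (emb (u t)) (emb w) x)" for x
 by (simp add: algebra_simps)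
 show ?thesis unfolding e by (simp only: bi_integral_add[OF integrable_mult_left[OF m_integrable(1)[OF t]] integrable_mult_right[OF a_integrand(2)[OF t]]]
 integral_mult_left_zero integral_mult_right_zero m_def a_def) qed
 thus ?thesis unfolding alpha_dt_distribution_def by (intro arg_cong[where f=uminus] bi_integral_cong[OF refl]) (simp add: space_restrict_space) qed

lemma W_sol:
 assumes "u : W" shows "ff.sol u (D u)"
proof -
 have u: "u : Lp_space p J" and "EX g. is_alpha_dt Om T \<Omega>1 \<Omega>2 v \<alpha> emb q u g" using assms by (simp_all add: W_space_def)
 from someI_ex[OF this(2)] have "is_alpha_dt Om T \<Omega>1 \<Omega>2 v \<alpha> emb q u (D u)" unfolding alpha_dt_def .
 thus ?thesis using u unfolding is_alpha_dt_def ff.sol_def distribution_eq by (simp add: minus_equation_iff) qed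

lemma Y:
 assumes t: "t : J" shows "sqint \<L> (Y u t)" "(LINT x|\<L>. Y u t x * Y z t x) = m t (u t) (z t)"
 unfolding Y_def[abs_def] by (rule sqrt_weight_sqint(1)[OF t], rule sqrt_weight_sqint(4)[OF t])

lemma sqrt_weight_diff:
 assumes t: "t : J" shows "(nrm2 \<L> (%x. sqrt (\<alpha> (x, t)) * emb w x - sqrt (\<alpha> (x, t)) * emb w' x))\<^sup>2 = m t (w - w') (w - w')"
proof -
 have ae: "AE x in \<L>. emb (1 *\<^sub>R w + (-1) *\<^sub>R w') x = 1 * emb w x + (-1) * emb w' x" by (rule emb_linear)
 have e: "nrm2 \<L> (%x. sqrt (\<alpha> (x, t)) * emb w x - sqrt (\<alpha> (x, t)) * emb w' x) = nrm2 \<L> (%x. sqrt (\<alpha> (x, t)) * emb (w - w') x)"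
 proof (rule nrm2_cong_AE)
 show "(%x. sqrt (\<alpha> (x, t)) * emb w x - sqrt (\<alpha> (x, t)) * emb w' x) : bmeas \<L>"
 using sqint_diff[OF sqrt_weight_sqint(1)[OF t] sqrt_weight_sqint(1)[OF t], of w w'] by (simp add: sqint_def)
 show "(%x. sqrt (\<alpha> (x, t)) * emb (w - w') x) : bmeas \<L>" using sqrt_weight_sqint(1)[OF t, of "w - w'"] by (simp add: sqint_def)
 show "AE x in \<L>. sqrt (\<alpha> (x, t)) * emb w x - sqrt (\<alpha> (x, t)) * emb w' x = sqrt (\<alpha> (x, t)) * emb (w - w') x"
 using ae by eventually_elim (simp add: right_diff_distrib) qed
 show ?thesis unfolding e nrm2_square unfolding power2_eq_square by (rule sqrt_weight_sqint(4)[OF t]) qed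

text \<open>Cauchy property at tau: the times s and t are compared through the fixed element u r.
  Its weighted versions at s and t are close by \<open>sqrt_weight_continuous\<close>, and their
  distances to the values of u are energies of u - u r.\<close>

lemma Y_limit:
 assumes sol: "ff.sol u g" and S: "S <= J" "AE t in lebesgue. t : J --> t : S"
 and bal: "!!w s t. w : u ` S ==> s : S ==> t : S ==> s <= t ==> ff.bal u g w s t"
 and id: "!!s t. s : S ==> t : S ==> s <= t ==> m t (u t) (u t) - m s (u s) (u s)
 = (LINT x|leb {s..t}. bapp (g x) (u x) + bapp (g x) (u x) + a x (u x) (u x))"
 and tau: "tau : {0..T}" shows "EX y. sqint \<L> y & (ALL eps>0. EX d>0. ALL t:S. abs(t - tau) < d --> nrm2 \<L> (%x. Y u t x - y x) <= eps)"
proof -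
 have SJ: "t : J" if "t : S" for t using S(1) that by blast
 have cauchy: "EX d>0. ALL s:S. ALL t:S. abs(s - tau) < d --> abs(t - tau) < d --> nrm2 \<L> (%x. Y u s x - Y u t x) <= eps" if eps: "0 < eps" for eps
 proof -
 have e: "0 < (eps / 3)\<^sup>2" "0 < eps / 3" using eps by simp_all
 obtain d1 r where d1: "0 < d1" "r : S" "!!t. t : S ==> abs(t - tau) < d1 ==> m t (u t - u r) (u t - u r) <= (eps / 3)\<^sup>2"
 using ff.energy_cauchy[OF sol S bal id tau e(1)] by blast
 obtain d2 where d2: "0 < d2" "!!s t. s : J ==> t : J ==> \<bar>s - tau\<bar> < d2 ==> \<bar>t - tau\<bar> < d2 ==>
 nrm2 \<L> (%x. sqrt (\<alpha> (x, t)) * emb (u r) x - sqrt (\<alpha> (x, s)) * emb (u r) x) < eps / 3" using sqrt_weight_continuous[OF tau e(2), of "u r"] by blast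
 define Z where "Z t x = sqrt (\<alpha> (x, t)) * emb (u r) x" for t x
 have Z: "sqint \<L> (Z t)" if "t : S" for t unfolding Z_def[abs_def] by (rule sqrt_weight_sqint(1)[OF SJ[OF that]])
 have YZ: "nrm2 \<L> (%x. Y u t x - Z t x) <= eps / 3" if t: "t : S" "abs(t - tau) < d1" for t
 proof (rule power2_le_imp_le)
 show "(nrm2 \<L> (%x. Y u t x - Z t x))\<^sup>2 <= (eps / 3)\<^sup>2" unfolding Y_def Z_def sqrt_weight_diff[OF SJ[OF t(1)]] by (rule d1(3)[OF t]) qed (use eps in simp)
 show ?thesis
 proof (intro exI[of _ "min d1 d2"] conjI ballI impI)
 show "0 < min d1 d2" using d1 d2 by simp
 fix s t assume s: "s : S" "abs(s - tau) < min d1 d2" and t: "t : S" "abs(t - tau) < min d1 d2"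
 have 1: "nrm2 \<L> (%x. Y u s x - Z s x) <= eps / 3" using YZ s by simp
 have 2: "nrm2 \<L> (%x. Z t x - Y u t x) <= eps / 3" using YZ[of t] t nrm2_minus_commute[of \<L> "Z t" "Y u t"] by simp
 have 3: "nrm2 \<L> (%x. Z s x - Z t x) <= eps / 3" using d2(2)[of t s] s t SJ by (simp add: Z_def less_imp_le)
 have 4: "nrm2 \<L> (%x. Y u s x - Y u t x) <= nrm2 \<L> (%x. Y u s x - Z s x) + nrm2 \<L> (%x. Z s x - Y u t x)"
 by (rule nrm2_triangle_diff[OF Y(1)[OF SJ[OF s(1)]] Z[OF s(1)] Y(1)[OF SJ[OF t(1)]]])
 have 5: "nrm2 \<L> (%x. Z s x - Y u t x) <= nrm2 \<L> (%x. Z s x - Z t x) + nrm2 \<L> (%x. Z t x - Y u t x)"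
 by (rule nrm2_triangle_diff[OF Z[OF s(1)] Z[OF t(1)] Y(1)[OF SJ[OF t(1)]]])
 show "nrm2 \<L> (%x. Y u s x - Y u t x) <= eps" using 1 2 3 4 5 by linarith qed qed
 have "ALL n::nat. EX t. t : S & abs(t - tau) < 1 / Suc n"
 proof
 fix n :: nat
 have "0 < 1 / real (Suc n)" by simp
 from full_measure_dense[OF T_pos S(2) tau this] show "EX t. t : S & abs(t - tau) < 1 / Suc n" by blast qed
 from choice[OF this] obtain t where t: "!!n. t n : S" "!!n. abs(t n - tau) < 1 / Suc n" by blast
 have near: "EX N. ALL n>=N. abs(t n - tau) < d" if d: "0 < d" for d
 proof -
 obtain N where N: "1 / Suc N < d" using reals_Archimedean[OF d] by (auto simp: inverse_eq_divide)
 have "abs(t n - tau) < d" if "n >= N" for n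
 proof -
 have "1 / Suc n <= 1 / Suc N" using that by (simp add: frac_le)
 thus ?thesis using t(2)[of n] N by linarith qed
 thus ?thesis by blast qed
 have "EX N. ALL n>=N. ALL k>=N. nrm2 \<L> (%x. Y u (t n) x - Y u (t k) x) <= eps" if eps: "0 < eps" for eps
 proof -
 obtain d where d: "0 < d" "!!s t. s : S ==> t : S ==> abs(s - tau) < d ==> abs(t - tau) < d ==> nrm2 \<L> (%x. Y u s x - Y u t x) <= eps" using cauchy[OF eps] by blast
 obtain N where "ALL n>=N. abs(t n - tau) < d" using near[OF d(1)] by blast
 thus ?thesis using d(2) t(1) by blast qed
 from sqint_complete[of \<L> "%n. Y u (t n)", OF Y(1)[OF SJ[OF t(1)]] this]
 obtain y where y: "sqint \<L> y" "!!eps. 0 < eps ==> EX N. ALL n>=N. nrm2 \<L> (%x. Y u (t n) x - y x) <= eps" by blast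
 have "EX d>0. ALL t:S. abs(t - tau) < d --> nrm2 \<L> (%x. Y u t x - y x) <= eps" if eps: "0 < eps" for eps
 proof -
 have e2: "0 < eps / 2" using eps by simp
 obtain d where d: "0 < d" "!!s t. s : S ==> t : S ==> abs(s - tau) < d ==> abs(t - tau) < d ==> nrm2 \<L> (%x. Y u s x - Y u t x) <= eps / 2" using cauchy[OF e2] by blast
 obtain N1 where N1: "ALL n>=N1. abs(t n - tau) < d" using near[OF d(1)] by blast
 obtain N2 where N2: "ALL n>=N2. nrm2 \<L> (%x. Y u (t n) x - y x) <= eps / 2" using y(2)[OF e2] by blast
 define n where "n = max N1 N2"
 have n: "abs(t n - tau) < d" "nrm2 \<L> (%x. Y u (t n) x - y x) <= eps / 2" using N1 N2 by (simp_all add: n_def)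
 have "nrm2 \<L> (%x. Y u s x - y x) <= eps" if s: "s : S" "abs(s - tau) < d" for s
 using nrm2_triangle_diff[OF Y(1)[OF SJ[OF s(1)], of u] Y(1)[OF SJ[OF t(1)[of n]], of u] y(1)] d(2)[OF s(1) t(1)[of n] s(2) n(1)] n(2) by linarith
 thus ?thesis using d(1) by blast qed
 thus ?thesis using y(1) by blast qed

text \<open>y tau is the L^2 limit along the good times, for every tau in [0,T]. Continuity compares
  y at s and at tau through a good time close to s. At a good time t the time t itself enters the
  limit, which forces y t to agree with the weighted value almost everywhere.\<close>

lemma continuous_rep_exists:
 assumes u: "u : W" shows "EX y. is_continuous_rep Om T \<alpha> emb u y"
proof (rule ff.product_identity[OF W_sol[OF u] W_sol[OF u]])
 fix S assume S: "S <= J" "AE t in lebesgue. t : J --> t : S"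
 and bal: "!!w s t. w : u ` S \<union> u ` S ==> s : S ==> t : S ==> s <= t ==> ff.bal u (D u) w s t & ff.bal u (D u) w s t"
 and id: "!!s t. s : S ==> t : S ==> s <= t ==> m t (u t) (u t) - m s (u s) (u s)
 = (LINT x|leb {s..t}. bapp (D u x) (u x) + bapp (D u x) (u x) + a x (u x) (u x))"
 have SJ: "t : J" if "t : S" for t using S(1) that by blast
 have "ALL tau:{0..T}. EX y. sqint \<L> y & (ALL eps>0. EX d>0. ALL t:S. abs(t - tau) < d --> nrm2 \<L> (%x. Y u t x - y x) <= eps)"
 proof
 fix tau assume tau: "tau : {0..T}"
 have bal': "!!w s t. w : u ` S ==> s : S ==> t : S ==> s <= t ==> ff.bal u (D u) w s t" using bal by blast
 show "EX y. sqint \<L> y & (ALL eps>0. EX d>0. ALL t:S. abs(t - tau) < d --> nrm2 \<L> (%x. Y u t x - y x) <= eps)" by (rule Y_limit[OF W_sol[OF u] S bal' id tau]) qed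
 from bchoice[OF this] obtain y where y: "!!tau. tau : {0..T} ==> sqint \<L> (y tau)"
 "!!tau eps. tau : {0..T} ==> 0 < eps ==> EX d>0. ALL t:S. abs(t - tau) < d --> nrm2 \<L> (%x. Y u t x - y tau x) <= eps" by blast
 have "y : C_L2 T Om" unfolding C_L2_def mem_Collect_eq L2_sqint L2_norm_eq
 proof (intro ballI conjI)
 fix tau assume tau: "tau : {0..T}"
 show "sqint \<L> (y tau)" by (rule y(1)[OF tau])
 show "((%s. nrm2 \<L> (%x. y s x - y tau x)) \<longlongrightarrow> 0) (at tau within {0..T})"
 proof (rule tendstoI)
 fix eps :: real assume eps: "0 < eps"
 hence e3: "0 < eps / 3" by simp
 obtain d where d: "0 < d" "!!t. t : S ==> abs(t - tau) < d ==> nrm2 \<L> (%x. Y u t x - y tau x) <= eps / 3" using y(2)[OF tau e3] by blast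
 have "nrm2 \<L> (%x. y s x - y tau x) < eps" if s: "s : {0..T}" "abs(s - tau) < d" for s
 proof -
 obtain d' where d': "0 < d'" "!!t. t : S ==> abs(t - s) < d' ==> nrm2 \<L> (%x. Y u t x - y s x) <= eps / 3" using y(2)[OF s(1) e3] by blast
 have "0 < min d' (d - abs(s - tau))" using d'(1) s(2) by simp
 from full_measure_dense[OF T_pos S(2) s(1) this] obtain t where t: "t : S" "abs(t - s) < min d' (d - abs(s - tau))" by blast
 have "abs(t - tau) < d" using t(2) by linarith
 hence 1: "nrm2 \<L> (%x. Y u t x - y tau x) <= eps / 3" by (rule d(2)[OF t(1)])
 have 2: "nrm2 \<L> (%x. y s x - Y u t x) <= eps / 3" using d'(2)[OF t(1)] t(2) by (simp add: nrm2_minus_commute[of \<L> "y s"])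
 show ?thesis using nrm2_triangle_diff[OF y(1)[OF s(1)] Y(1)[OF SJ[OF t(1)], of u] y(1)[OF tau]] 1 2 eps by linarith qed
 thus "\<forall>\<^sub>F s in at tau within {0..T}. dist (nrm2 \<L> (%x. y s x - y tau x)) 0 < eps"
 unfolding eventually_at using d(1) by (intro exI[of _ d]) (simp add: dist_real_def) qed qed
 moreover have "AE x in \<L>. y t x = Y u t x" if t: "t : S" for t
 proof -
 have tT: "t : {0..T}" using SJ[OF t] by auto
 have le: "nrm2 \<L> (%x. Y u t x - y t x) <= eps" if eps: "0 < eps" for eps
 proof -
 obtain d where "0 < d" "ALL s:S. abs(s - t) < d --> nrm2 \<L> (%x. Y u s x - y t x) <= eps" using y(2)[OF tT eps] by blast
 thus ?thesis using t by force qed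
 have "nrm2 \<L> (%x. Y u t x - y t x) <= 0" by (rule field_le_epsilon) (use le in simp)
 hence "nrm2 \<L> (%x. Y u t x - y t x) = 0" using nrm2_nonneg[of \<L> "%x. Y u t x - y t x"] by linarith
 hence z: "(LINT x|\<L>. (Y u t x - y t x)\<^sup>2) = 0" by (simp add: nrm2_def)
 have i: "integrable \<L> (%x. (Y u t x - y t x)\<^sup>2)" using sqint_diff[OF Y(1)[OF SJ[OF t], of u] y(1)[OF tT]] by (simp add: sqint_def)
 have "AE x in \<L>. (Y u t x - y t x)\<^sup>2 = 0" using integral_nonneg_eq_0_iff_AE[OF i] z by simp
 thus ?thesis by eventually_elim simp qed
 hence "AE t in leb J. AE x in \<L>. y t x = sqrt (\<alpha> (x, t)) * emb (u t) x" using S(2) unfolding Y_def by (subst AE_restrict_space_iff) (auto elim: eventually_mono)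
 ultimately show ?thesis unfolding is_continuous_rep_def by blast qed

text \<open>Links the continuous inner product with the form \<open>m\<close>, which is tied to it
  at almost every time; continuity is bilinear expansion around t with Cauchy-Schwarz.\<close>

lemma continuous_rep_inner:
 assumes rep: "is_continuous_rep Om T \<alpha> emb u yu" "is_continuous_rep Om T \<alpha> emb z yz" shows "continuous_on {0..T} (%t. L2_inner Om (yu t) (yz t))"
 "AE t in lebesgue. t : J --> L2_inner Om (yu t) (yz t) = m t (u t) (z t)"
proof -
 have sq: "t : {0..T} ==> sqint \<L> (yu t)" "t : {0..T} ==> sqint \<L> (yz t)" for t using rep by (simp_all add: is_continuous_rep_def C_L2_def L2_sqint)
 have con: "t : {0..T} ==> ((%s. nrm2 \<L> (%x. yu s x - yu t x)) \<longlongrightarrow> 0) (at t within {0..T})"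
 "t : {0..T} ==> ((%s. nrm2 \<L> (%x. yz s x - yz t x)) \<longlongrightarrow> 0) (at t within {0..T})" for t
 using rep by (simp_all add: is_continuous_rep_def C_L2_def L2_norm_eq)
 show "continuous_on {0..T} (%t. L2_inner Om (yu t) (yz t))" unfolding continuous_on_def
 proof
 fix t assume t: "t : {0..T}"
 define E where "E s = nrm2 \<L> (%x. yu s x - yu t x) * nrm2 \<L> (%x. yz s x - yz t x)
 + nrm2 \<L> (%x. yu s x - yu t x) * nrm2 \<L> (yz t) + nrm2 \<L> (yu t) * nrm2 \<L> (%x. yz s x - yz t x)" for s
 have "(E \<longlongrightarrow> 0 * 0 + 0 * nrm2 \<L> (yz t) + nrm2 \<L> (yu t) * 0) (at t within {0..T})"
 unfolding E_def by (intro tendsto_add tendsto_mult tendsto_const con t)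
 hence E0: "(E \<longlongrightarrow> 0) (at t within {0..T})" by simp
 have bd: "norm (L2_inner Om (yu s) (yz s) - L2_inner Om (yu t) (yz t)) <= E s" if s: "s : {0..T}" for s
 proof -
 note du = sqint_diff[OF sq(1)[OF s] sq(1)[OF t]] and dz = sqint_diff[OF sq(2)[OF s] sq(2)[OF t]]
 have i1: "integrable \<L> (%x. (yu s x - yu t x) * (yz s x - yz t x))" "integrable \<L> (%x. (yu s x - yu t x) * yz t x)"
 "integrable \<L> (%x. yu t x * (yz s x - yz t x))" "integrable \<L> (%x. yu t x * yz t x)"
 by (rule sqint_mult[OF du dz], rule sqint_mult[OF du sq(2)[OF t]], rule sqint_mult[OF sq(1)[OF t] dz], rule sqint_mult[OF sq(1)[OF t] sq(2)[OF t]])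
 have "L2_inner Om (yu s) (yz s) = (LINT x|\<L>. (yu s x - yu t x) * (yz s x - yz t x) + (yu s x - yu t x) * yz t x + yu t x * (yz s x - yz t x) + yu t x * yz t x)"
 unfolding L2_inner_def by (rule bi_integral_cong[OF refl]) (simp add: algebra_simps)
 also have "... = (LINT x|\<L>. (yu s x - yu t x) * (yz s x - yz t x)) + (LINT x|\<L>. (yu s x - yu t x) * yz t x) + (LINT x|\<L>. yu t x * (yz s x - yz t x)) + (LINT x|\<L>. yu t x * yz t x)"
 using i1 by simp
 finally have e: "L2_inner Om (yu s) (yz s) - L2_inner Om (yu t) (yz t)
 = (LINT x|\<L>. (yu s x - yu t x) * (yz s x - yz t x)) + (LINT x|\<L>. (yu s x - yu t x) * yz t x) + (LINT x|\<L>. yu t x * (yz s x - yz t x))" by (simp add: L2_inner_def)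
 show ?thesis unfolding e E_def real_norm_def
 using sqint_cauchy_schwarz'[OF du dz] sqint_cauchy_schwarz'[OF du sq(2)[OF t]] sqint_cauchy_schwarz'[OF sq(1)[OF t] dz] by linarith qed
 have "((%s. L2_inner Om (yu s) (yz s) - L2_inner Om (yu t) (yz t)) \<longlongrightarrow> 0) (at t within {0..T})"
 by (rule Lim_null_comparison[OF _ E0]) (use bd in "auto simp: eventually_at intro: exI[of _ 1]")
 thus "((%t. L2_inner Om (yu t) (yz t)) \<longlongrightarrow> L2_inner Om (yu t) (yz t)) (at t within {0..T})" by (rule Lim_null[THEN iffD2]) qed
 have ae: "AE t in lebesgue. t : J --> (AE x in \<L>. yu t x = Y u t x)" "AE t in lebesgue. t : J --> (AE x in \<L>. yz t x = Y z t x)"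
 using rep unfolding is_continuous_rep_def Y_def by (simp_all add: AE_restrict_space_iff)
 show "AE t in lebesgue. t : J --> L2_inner Om (yu t) (yz t) = m t (u t) (z t)" using ae
 proof eventually_elim
 case (elim t)
 show ?case
 proof
 assume t: "t : J"
 hence tT: "t : {0..T}" by auto
 have "L2_inner Om (yu t) (yz t) = (LINT x|\<L>. Y u t x * Y z t x)" unfolding L2_inner_def
 proof (rule integral_cong_AE)
 show "(%x. yu t x * yz t x) : bmeas \<L>" using sqint_mult[OF sq(1)[OF tT] sq(2)[OF tT]] by simp
 show "(%x. Y u t x * Y z t x) : bmeas \<L>" using sqint_mult[OF Y(1)[OF t, of u] Y(1)[OF t, of z]] by simp
 have "AE x in \<L>. yu t x = Y u t x" "AE x in \<L>. yz t x = Y z t x" using elim t by blast+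
 thus "AE x in \<L>. yu t x * yz t x = Y u t x * Y z t x" by eventually_elim simp qed
 thus "L2_inner Om (yu t) (yz t) = m t (u t) (z t)" by (simp only: Y(2)[OF t]) qed qed qed

text \<open>Transfers bounds from a set of full measure to all of [0,T], the end points
  included.\<close>

lemma dense_le:
 assumes f: "continuous_on {0..T} f" and S: "AE t in lebesgue. t : J --> t : S" and le: "!!t. t : S ==> t : J ==> f t <= (B::real)" and t: "t : {0..T}" shows "f t <= B"
proof (rule field_le_epsilon)
 fix e :: real assume "0 < e"
 then obtain d where d: "0 < d" "!!s. s : {0..T} ==> dist s t < d ==> dist (f s) (f t) < e" using f t unfolding continuous_on_iff by blast
 obtain s where s: "s : S" "s : J" "abs(s - t) < d" using full_measure_dense[OF T_pos S t d(1)] by blast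
 have "dist (f s) (f t) < e" using d(2)[of s] s by (auto simp: dist_real_def)
 thus "f t <= B + e" using le[OF s(1,2)] by (auto simp: dist_real_def) qed

lemma continuous_rep_bound:
 assumes u: "u : W" and rep: "is_continuous_rep Om T \<alpha> emb u y"
 shows "C_L2_norm T Om y <= sqrt ((C * (T + 1) + T * (4 + C * (T + 1))) / T) * W_norm Om T \<Omega>1 \<Omega>2 v \<alpha> emb p q u"
proof (rule ff.product_identity[OF W_sol[OF u] W_sol[OF u]])
 fix S assume S: "S <= J" "AE t in lebesgue. t : J --> t : S"
 and id: "!!s t. s : S ==> t : S ==> s <= t ==> m t (u t) (u t) - m s (u s) (u s)
 = (LINT x|leb {s..t}. bapp (D u x) (u x) + bapp (D u x) (u x) + a x (u x) (u x))"
 define A where "A = C * (T + 1) + T * (4 + C * (T + 1))"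
 define W0 where "W0 = W_norm Om T \<Omega>1 \<Omega>2 v \<alpha> emb p q u"
 have A0: "0 <= A" unfolding A_def using C T_pos by simp
 have W00: "0 <= W0" unfolding W0_def W_norm_def Lp_norm_def by simp
 have pq: "0 < p" "0 < q" using p ff.q by simp_all
 \<comment> \<open>\<open>ff.energy_bound\<close> divides by N, and the norm W0 may be zero; hence
   every N above W0 is used and N tends to W0 afterwards.\<close>
 have bound: "L2_inner Om (y t) (y t) <= A / T * N\<^sup>2" if N: "W0 < N" and t: "t : {0..T}" for N t
 proof (rule dense_le[OF continuous_rep_inner(1)[OF rep rep] _ _ t, of "S \<inter> {t. L2_inner Om (y t) (y t) = m t (u t) (u t)}"])
 show "AE t in lebesgue. t : J --> t : S \<inter> {t. L2_inner Om (y t) (y t) = m t (u t) (u t)}" using S(2) continuous_rep_inner(2)[OF rep rep] by eventually_elim simp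
 have N0: "0 < N" using W00 N by linarith
 have pw: "I <= N powr r" if "I powr (1 / r) <= N" "0 <= I" "0 < r" for I r
 proof -
 have "(I powr (1 / r)) powr r <= N powr r" using that by (intro powr_mono2) auto
 thus ?thesis using that by (simp add: powr_powr) qed
 have Lp: "Lp_norm p J u <= N" "Lp_norm q J (D u) <= N" using N unfolding W0_def W_norm_def by (smt (verit) Lp_norm_def powr_ge_zero)+
 have 1: "(LINT t|leb {0..T}. norm (u t) powr p) <= N powr p" "(LINT t|leb {0..T}. norm (D u t) powr q) <= N powr q" using Lp pq unfolding Lp_norm_def leb_Ioo_Icc(2)
 by (auto intro!: pw bi_integral_nonneg)
 fix t assume "t : S \<inter> {t. L2_inner Om (y t) (y t) = m t (u t) (u t)}"
 hence t: "t : S" "L2_inner Om (y t) (y t) = m t (u t) (u t)" by auto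
 have "T * m t (u t) (u t) <= A * N\<^sup>2" unfolding A_def by (rule ff.energy_bound[OF W_sol[OF u] S id N0 1 t(1)])
 thus "L2_inner Om (y t) (y t) <= A / T * N\<^sup>2" unfolding t(2) using T_pos by (simp add: field_simps) qed
 have "L2_norm Om (y t) <= sqrt (A / T) * W0" if t: "t : {0..T}" for t
 proof -
 have "((%N. A / T * N\<^sup>2) \<longlongrightarrow> A / T * W0\<^sup>2) (at_right W0)" by (intro tendsto_intros)
 hence "L2_inner Om (y t) (y t) <= A / T * W0\<^sup>2"
 proof (rule tendsto_lowerbound)
 show "\<forall>\<^sub>F N in at_right W0. L2_inner Om (y t) (y t) <= A / T * N\<^sup>2"
 unfolding eventually_at_right_field by (intro exI[of _ "W0 + 1"] conjI allI impI bound[OF _ t]) simp_all qed simp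
 hence "L2_norm Om (y t) <= sqrt (A / T * W0\<^sup>2)" unfolding L2_norm_def by (rule real_sqrt_le_mono)
 also have "... = sqrt (A / T) * W0" unfolding real_sqrt_mult using W00 by simp
 finally show ?thesis . qed
 thus ?thesis unfolding C_L2_norm_def A_def[symmetric] W0_def[symmetric] by (intro cSUP_least) (use T_pos in auto) qed

text \<open>The function H below, inner product minus primitive, is continuous on [0,T] and constant
  on a set of full measure, hence constant everywhere. A difference of two of its values is the
  formula, for either order of t1 and t2.\<close>

lemma integration_by_parts:
 assumes u: "u : W" "is_continuous_rep Om T \<alpha> emb u yu" and z: "z : W" "is_continuous_rep Om T \<alpha> emb z yz"
 and t: "t1 : {0..T}" "t2 : {0..T}" shows "(LINT t=ereal t1..ereal t2|lebesgue. (bapp (D u t) (z t) + bapp (D z t) (u t)))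
 = L2_inner Om (yu t2) (yz t2) - L2_inner Om (yu t1) (yz t1)
 - (LINT t=ereal t1..ereal t2|lebesgue. (LINT x|\<L>. emb (u t) x * emb (z t) x * dt \<alpha> x t
 + flux_div \<Omega>1 \<Omega>2 v \<alpha> t (emb (u t)) (emb (z t)) x))"
proof (rule ff.product_identity[OF W_sol[OF u(1)] W_sol[OF z(1)]])
 fix S assume S: "S <= J" "AE t in lebesgue. t : J --> t : S"
 and id: "!!s t. s : S ==> t : S ==> s <= t ==> m t (u t) (z t) - m s (u s) (z s)
 = (LINT x|leb {s..t}. bapp (D u x) (z x) + bapp (D z x) (u x) + a x (u x) (z x))"
 note su = W_sol[OF u(1)] and sz = W_sol[OF z(1)]
 define f where "f t = bapp (D u t) (z t) + bapp (D z t) (u t)" for t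
 define g where "g t = a t (u t) (z t)" for t
 have f: "integrable (leb {0..T}) f" unfolding f_def by (intro bi_integrable_add ff.g_integrable[OF su sz] ff.g_integrable[OF sz su])
 have g: "integrable (leb {0..T}) g" unfolding g_def by (rule ff.a_integrable(1)[OF su sz])
 have fg: "integrable (leb {0..T}) (%t. f t + g t)" by (rule bi_integrable_add[OF f g])
 define H where "H t = L2_inner Om (yu t) (yz t) - (LINT x|leb {0..t}. f x + g x)" for t
 have cH: "continuous_on {0..T} H" unfolding H_def by (intro continuous_on_diff continuous_rep_inner(1)[OF u(2) z(2)] indefinite_integral_continuous_real[OF fg])
 define S' where "S' = S \<inter> {t. L2_inner Om (yu t) (yz t) = m t (u t) (z t)}"
 have S': "AE t in lebesgue. t : J --> t : S'" using S(2) continuous_rep_inner(2)[OF u(2) z(2)] unfolding S'_def by eventually_elim simp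
 have eq: "H t = H s" if st: "s : S'" "t : S'" "s <= t" for s t
 proof -
 have "0 <= s" "t <= T" using st S(1) by (auto simp: S'_def)
 from ff.Icc_integral_split[OF fg this(1) st(3) this(2)]
 show ?thesis using id[of s t] st by (simp add: H_def S'_def f_def g_def) qed
 have eq': "H t = H s" if st: "s : S'" "t : S'" for s t using eq[OF st] eq[OF st(2,1)] by (cases "s <= t") auto
 obtain s0 where s0: "s0 : S'" using full_measure_dense[OF T_pos S' t(1) zero_less_one] by blast
 have const: "H t = H s0" if t: "t : {0..T}" for t
 proof (rule antisym)
 show "H t <= H s0" by (rule dense_le[OF cH S' _ t]) (use eq'[OF s0] in simp)
 have "- H t <= - H s0" by (rule dense_le[OF continuous_on_minus[OF cH] S' _ t]) (use eq'[OF s0] in simp)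
 thus "H s0 <= H t" by simp qed
 have add: "(LINT x|leb {0..t}. f x + g x) = (LINT x|leb {0..t}. f x) + (LINT x|leb {0..t}. g x)" if "t : {0..T}" for t
 by (rule bi_integral_add) (rule sub_integrable[OF f], use that in simp_all, rule sub_integrable[OF g], use that in simp_all)
 have "(LINT t=ereal t1..ereal t2|lebesgue. f t) = L2_inner Om (yu t2) (yz t2) - L2_inner Om (yu t1) (yz t1) - (LINT t=ereal t1..ereal t2|lebesgue. g t)"
 unfolding interval_integral_eq[OF f t] interval_integral_eq[OF g t] using const[OF t(1)] const[OF t(2)] add[OF t(1)] add[OF t(2)] by (simp add: H_def)
 thus ?thesis unfolding f_def g_def a_def . qed

end

theorem lemma2p3:
  fixes \<Omega> :: "(real^'n) set" and T :: real
    and \<Omega>1 \<Omega>2 :: "real \<Rightarrow> (real^'n) set"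
    and \<Phi> v :: "(real^'n) \<times> real \<Rightarrow> real^'n"
    and \<alpha> :: "(real^'n) \<times> real \<Rightarrow> real" and \<alpha>0 :: real
    and emb :: "'v::{real_inner, complete_space} \<Rightarrow> real^'n \<Rightarrow> real"
    and p p' :: real
  assumes "moving_coefficient \<Omega> T \<Omega>1 \<Omega>2 \<Phi> v \<alpha> \<alpha>0"
    and "gelfand_embedding \<Omega> emb"
    and "2 \<le> p" and "p' = p / (p - 1)"
  shows "(\<forall>u \<in> W_space \<Omega> T \<Omega>1 \<Omega>2 v \<alpha> emb p p'. \<exists>y. is_continuous_rep \<Omega> T \<alpha> emb u y)
    \<and> (\<exists>C>0. \<forall>u \<in> W_space \<Omega> T \<Omega>1 \<Omega>2 v \<alpha> emb p p'. \<forall>y. is_continuous_rep \<Omega> T \<alpha> emb u y \<longrightarrow>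
          C_L2_norm T \<Omega> y \<le> C * W_norm \<Omega> T \<Omega>1 \<Omega>2 v \<alpha> emb p p' u)
    \<and> (\<forall>u \<in> W_space \<Omega> T \<Omega>1 \<Omega>2 v \<alpha> emb p p'. \<forall>z \<in> W_space \<Omega> T \<Omega>1 \<Omega>2 v \<alpha> emb p p'.
        \<forall>yu yz. is_continuous_rep \<Omega> T \<alpha> emb u yu \<longrightarrow> is_continuous_rep \<Omega> T \<alpha> emb z yz \<longrightarrow>
        (\<forall>t1\<in>{0..T}. \<forall>t2\<in>{0..T}.
          (LINT t=ereal t1..ereal t2|lebesgue.
             (blinfun_apply (alpha_dt \<Omega> T \<Omega>1 \<Omega>2 v \<alpha> emb p' u t) (z t)
             + blinfun_apply (alpha_dt \<Omega> T \<Omega>1 \<Omega>2 v \<alpha> emb p' z t) (u t)))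
          = L2_inner \<Omega> (yu t2) (yz t2) - L2_inner \<Omega> (yu t1) (yz t1)
            - (LINT t=ereal t1..ereal t2|lebesgue. (LINT x|lebesgue_on \<Omega>.
                 emb (u t) x * emb (z t) x * dt \<alpha> x t
                 + flux_div \<Omega>1 \<Omega>2 v \<alpha> t (emb (u t)) (emb (z t)) x))))"
proof -
 interpret mc: moving_coefficient \<Omega> T \<Omega>1 \<Omega>2 \<Phi> v \<alpha> \<alpha>0 by (rule assms(1))
 interpret ge: gelfand_embedding \<Omega> emb by (rule assms(2))
 obtain d\<alpha> dv M where reg: "0 <= M" "continuous_on (mc.phase \<Omega>1 \<union> mc.phase \<Omega>2) d\<alpha>" "continuous_on (mc.phase \<Omega>1 \<union> mc.phase \<Omega>2) dv"
 "ALL p:mc.phase \<Omega>1 \<union> mc.phase \<Omega>2. (\<alpha> has_derivative bapp (d\<alpha> p)) (at p) & (v has_derivative bapp (dv p)) (at p) &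
 \<bar>\<alpha> p\<bar> <= M & norm (v p) <= M & norm (d\<alpha> p) <= M & norm (dv p) <= M"
 using mc.regular_data by blast
 interpret wf: weighted_forms \<Omega> T \<Omega>1 \<Omega>2 \<Phi> v \<alpha> \<alpha>0 emb d\<alpha> dv M
 by unfold_locales (rule reg)+
 obtain C where C: "0 <= C" "ALL t:{0<..<T}. ALL w z. abs(wf.m t w z) <= C * norm w * norm z & abs(wf.a t w z) <= C * norm w * norm z"
 using wf.forms_bound by blast
 interpret we: weighted_evolution \<Omega> T \<Omega>1 \<Omega>2 \<Phi> v \<alpha> \<alpha>0 emb d\<alpha> dv M p p' C
 by unfold_locales (use assms(3,4) C in auto)
 \<comment> \<open>The constant of the energy bound, divided by T; it is positive even for C = 0
   because of the summand 4 T.\<close>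
 define K where "K = sqrt ((C * (T + 1) + T * (4 + C * (T + 1))) / T)"
 have K: "0 < K" unfolding K_def
 by (intro real_sqrt_gt_zero divide_pos_pos add_nonneg_pos mult_pos_pos add_pos_nonneg mult_nonneg_nonneg) (use C(1) mc.T_pos in simp_all)
 show ?thesis
 proof (intro conjI ballI allI impI exI[of _ K])
 show "EX y. is_continuous_rep \<Omega> T \<alpha> emb u y" if "u : W_space \<Omega> T \<Omega>1 \<Omega>2 v \<alpha> emb p p'" for u
 by (rule we.continuous_rep_exists[OF that])
 show "0 < K" by (rule K)
 show "C_L2_norm T \<Omega> y <= K * W_norm \<Omega> T \<Omega>1 \<Omega>2 v \<alpha> emb p p' u"
 if "u : W_space \<Omega> T \<Omega>1 \<Omega>2 v \<alpha> emb p p'" "is_continuous_rep \<Omega> T \<alpha> emb u y" for u y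
 unfolding K_def by (rule we.continuous_rep_bound[OF that])
 qed (rule we.integration_by_parts; assumption)
qed

end
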